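(* Let $\mathcal{D}=(G,\chi,g,0)$ be a group datum of nilpotent type with $n\ge 2$ the order of $\chi(g)$, let $H=H_{\mathcal D}$, let $r(H)$ be its Green ring, and let $M[i,j]$, $[V_i]$, $a=[V_{\chi^{-1}}]$ be the elements of $r(H)$ defined in the context. The following hold in $r(H)$: (1) $M[i,j]=[V_i]M[1,j]=M[1,j][V_i]$, for $1\le i\le m$ and $1\le j\le n$. (2) $M[1,2]M[1,j]=M[1,j]M[1,2]=M[1,j+1]+aM[1,j-1]$, for $2\le j\le n-1$. (3) $M[1,2]M[1,n]=M[1,n]M[1,2]=(1+a)M[1,n]$. (4) $r(H)$ is commutative and is generated by the elements $[V_i]$, $1\le i\le m$, and $M[1,2]$ over $\mathbb{Z}$.
   Context: $\mathbb{K}$ is an algebraically closed field of characteristic zero; modules are finite dimensional left modules; $\otimes=\otimes_{\mathbb K}$. Group datum: $G$ is a finite group, $g$ an element of the center of $G$, $\chi:G\to\mathbb{K}^\times$ a linear character, $q=\chi(g)$ has order $n\ge 2$. $H=H_{\mathcal D}$ is the $\mathbb K$-algebra generated by $y$ and the elements $h\in G$, containing $\mathbb{K}G$ as a subalgebra, with relations $y^n=0$ and $yh=\chi(h)hy$ for $h\in G$; it has basis $\{y^ih\mid h\in G,\ 0\le i\le n-1\}$. It is a Hopf algebra with $\Delta(y)=y\otimes g+1\otimes y$, $\varepsilon(y)=0$, $S(y)=-yg^{-1}$, and $\Delta(h)=h\otimes h$, $\varepsilon(h)=1$, $S(h)=h^{-1}$ for $h\in G$. $V_1,\dots,V_m$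 is a complete set of non-isomorphic simple $\mathbb{K}G$-modules, with $V_1$ the trivial module; each is regarded as a simple $H$-module with $y$ acting by $0$. $V_{\chi^{-1}}$ is the one-dimensional module with character $\chi^{-1}$. For $1\le i\le m$, $1\le j\le n$, $M(i,j)=V_i\oplus xV_i\oplus\cdots\oplus x^{j-1}V_i$ (formal copies $x^kV_i$ of the vector space $V_i$), with $h(x^kv)=\chi^{-k}(h)\,x^k(hv)$ for $h\in G$, and $y(x^kv)=x^{k+1}v$ if $0\le k\le j-2$, $y(x^{j-1}v)=0$, for $v\in V_i$. The $M(i,j)$ form a complete set of non-isomorphic indecomposable $H$-modules. The Green ring $r(H)$ is the free abelian group on isomorphism classes $[V]$ of finite dimensional $H$-modules modulo $[M\oplus N]=[M]+[N]$, with product $[M][N]=[M\otimes N]$. $M[i,j]=[M(i,j)]$, $1=[V_1]$, $a=[V_{\chi^{-1}}]$. *)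

theory Defs
  imports
    "HOL-Algebra.Free_Abelian_Groups"
    "HOL-Algebra.QuotRing"
    "HOL-Algebra.Generated_Rings"
    "HOL-Algebra.Multiplicative_Group"
    "Jordan_Normal_Form.VS_Connect"
begin

section \<open>Modules over an algebra\<close>

text \<open>
  The field is a type \<open>'k\<close>, turned into a ring record by \<^const>\<open>class_ring\<close>. An algebra is
  given by a record that carries both its ring operations and its scalar multiplication.
  The fields \<^const>\<open>mult\<close> and \<^const>\<open>one\<close> of a record that serves as a vector space
  carry no information.
\<close>

record ('k, 'a, 'v) amod = "('k, 'v) module" +
  act :: "'a \<Rightarrow> 'v \<Rightarrow> 'v"

definition with_act :: "('k, 'v, 'z) module_scheme \<Rightarrow> ('a \<Rightarrow> 'v \<Rightarrow> 'v) \<Rightarrow> ('k, 'a, 'v) amod" where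
  "with_act V f = module.extend (module.truncate V) (amod.fields f)"

text \<open>Finite-dimensional left modules.\<close>

definition amodule :: "('k :: field, 'a) module \<Rightarrow> ('k, 'a, 'v) amod \<Rightarrow> bool" where
  "amodule A V \<longleftrightarrow>
     vectorspace class_ring V \<and> vectorspace.fin_dim class_ring V \<and>
     (\<forall>a\<in>carrier A. act V a \<in> LinearCombinations.module_hom class_ring V V) \<and>
     (\<forall>a\<in>carrier A. \<forall>b\<in>carrier A. \<forall>v\<in>carrier V.
        act V (a \<oplus>\<^bsub>A\<^esub> b) v = act V a v \<oplus>\<^bsub>V\<^esub> act V b v) \<and>
     (\<forall>c. \<forall>a\<in>carrier A. \<forall>v\<in>carrier V. act V (c \<odot>\<^bsub>A\<^esub> a) v = c \<odot>\<^bsub>V\<^esub> act V a v) \<and>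
     (\<forall>a\<in>carrier A. \<forall>b\<in>carrier A. \<forall>v\<in>carrier V.
        act V (a \<otimes>\<^bsub>A\<^esub> b) v = act V a (act V b v)) \<and>
     (\<forall>v\<in>carrier V. act V \<one>\<^bsub>A\<^esub> v = v)"

definition amod_iso ::
  "('k :: field, 'a) module \<Rightarrow> ('k, 'a, 'v) amod \<Rightarrow> ('k, 'a, 'w) amod \<Rightarrow> bool" where
  "amod_iso A V W \<longleftrightarrow>
     (\<exists>f \<in> LinearCombinations.module_hom class_ring V W. bij_betw f (carrier V) (carrier W) \<and>
        (\<forall>a\<in>carrier A. \<forall>v\<in>carrier V. f (act V a v) = act W a (f v)))"

definition simple_amodule :: "('k :: field, 'a) module \<Rightarrow> ('k, 'a, 'v) amod \<Rightarrow> bool" where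
  "simple_amodule A V \<longleftrightarrow>
     amodule A V \<and> carrier V \<noteq> {\<zero>\<^bsub>V\<^esub>} \<and>
     (\<forall>W. VectorSpace.subspace class_ring W V \<and> (\<forall>a\<in>carrier A. \<forall>w\<in>W. act V a w \<in> W) \<longrightarrow>
        W = {\<zero>\<^bsub>V\<^esub>} \<or> W = carrier V)"

definition amod_sum ::
  "('k, 'a, 'v) amod \<Rightarrow> ('k, 'a, 'w) amod \<Rightarrow> ('k, 'a, 'v \<times> 'w) amod" where
  "amod_sum V W = with_act (direct_sum V W) (\<lambda>a (v, w). (act V a v, act W a w))"

text \<open>
  The family \<open>V 1, \<dots>, V m\<close> represents each isomorphism class of simple modules exactly once.
  Every finite-dimensional vector space is isomorphic to one whose carrier consists of
  elements of \<^typ>\<open>'k vec\<close> (such as \<^term>\<open>carrier_vec d\<close>), so it suffices to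
  let \<open>W\<close> range over modules of this type.
\<close>

definition complete_simples ::
  "('k :: field, 'a) module \<Rightarrow> nat \<Rightarrow> (nat \<Rightarrow> ('k, 'a, 'v) amod) \<Rightarrow> bool" where
  "complete_simples A m V \<longleftrightarrow>
     (\<forall>i\<in>{1..m}. simple_amodule A (V i)) \<and>
     (\<forall>i\<in>{1..m}. \<forall>j\<in>{1..m}. i \<noteq> j \<longrightarrow> \<not> amod_iso A (V i) (V j)) \<and>
     (\<forall>W :: ('k, 'a, 'k vec) amod. simple_amodule A W \<longrightarrow> (\<exists>i\<in>{1..m}. amod_iso A (V i) W))"


section \<open>The Hopf algebra of a group datum of nilpotent type\<close>

locale nilpotent_group_datum = group G for G (structure) +
  fixes \<chi> :: "'a \<Rightarrow> 'k :: field" and g :: 'a and n :: nat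
  assumes finite_G: "finite (carrier G)"
    and g_closed: "g \<in> carrier G"
    and g_central: "\<And>h. h \<in> carrier G \<Longrightarrow> g \<otimes> h = h \<otimes> g"
    and chi_character: "\<chi> \<in> hom G (mult_of class_ring)"
    and n_def: "n = group.ord (mult_of class_ring) (\<chi> g)"
    and n_ge_2: "2 \<le> n"

definition unit_fun :: "'b \<Rightarrow> 'b \<Rightarrow> 'k :: zero_neq_one" where
  "unit_fun b = (\<lambda>c. if c = b then 1 else 0)"

text \<open>
  The algebra with finite basis \<open>B\<close>, where \<open>\<mu> a b\<close> is the product of the basis elements
  \<open>a\<close> and \<open>b\<close>, and \<open>u\<close> is the unit. An element is its coefficient function, so the
  basis element \<open>b\<close> itself is \<^term>\<open>unit_fun b\<close>.
\<close>

definition basis_algebra ::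
  "'b set \<Rightarrow> ('b \<Rightarrow> 'b \<Rightarrow> 'b \<Rightarrow> 'k) \<Rightarrow> ('b \<Rightarrow> 'k) \<Rightarrow> ('k :: field, 'b \<Rightarrow> 'k) module" where
  "basis_algebra B \<mu> u =
     \<lparr>carrier = {f. \<forall>b. b \<notin> B \<longrightarrow> f b = 0},
      mult = (\<lambda>f f' c. \<Sum>a\<in>B. \<Sum>b\<in>B. f a * f' b * \<mu> a b c),
      one = u,
      zero = (\<lambda>_. 0),
      add = (\<lambda>f f' b. f b + f' b),
      smult = (\<lambda>c f b. c * f b)\<rparr>"

definition group_algebra :: "('g, 'x) monoid_scheme \<Rightarrow> ('k :: field, 'g \<Rightarrow> 'k) module" where
  "group_algebra G = basis_algebra (carrier G) (\<lambda>h k. unit_fun (h \<otimes>\<^bsub>G\<^esub> k)) (unit_fun \<one>\<^bsub>G\<^esub>)"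

text \<open>
  The pair \<open>(i, h)\<close> stands for the basis element \<open>y\<^sup>i h\<close> of \<open>H\<close>. From \<open>y h = \<chi>(h) h y\<close>
  and \<open>y\<^sup>n = 0\<close> one gets \<open>(y\<^sup>i h) (y\<^sup>j k) = \<chi>(h)\<^bsup>-j\<^esup> y\<^bsup>i+j\<^esup> h k\<close>, which vanishes for \<open>i + j \<ge> n\<close>.
\<close>

definition H_basis :: "('g, 'x) monoid_scheme \<Rightarrow> nat \<Rightarrow> (nat \<times> 'g) set" where
  "H_basis G n = {..<n} \<times> carrier G"

definition H_mult ::
  "('g, 'x) monoid_scheme \<Rightarrow> ('g \<Rightarrow> 'k :: field) \<Rightarrow> nat \<Rightarrow>
     nat \<times> 'g \<Rightarrow> nat \<times> 'g \<Rightarrow> nat \<times> 'g \<Rightarrow> 'k" where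
  "H_mult G \<chi> n = (\<lambda>(i, h) (j, k) b.
     if i + j < n then inverse (\<chi> h) ^ j * unit_fun (i + j, h \<otimes>\<^bsub>G\<^esub> k) b else 0)"

definition H_alg ::
  "('g, 'x) monoid_scheme \<Rightarrow> ('g \<Rightarrow> 'k :: field) \<Rightarrow> nat \<Rightarrow> ('k, nat \<times> 'g \<Rightarrow> 'k) module" where
  "H_alg G \<chi> n = basis_algebra (H_basis G n) (H_mult G \<chi> n) (unit_fun (0, \<one>\<^bsub>G\<^esub>))"

abbreviation H_grp :: "'g \<Rightarrow> nat \<times> 'g \<Rightarrow> 'k :: field" where
  "H_grp h \<equiv> unit_fun (0, h)"

abbreviation H_y :: "('g, 'x) monoid_scheme \<Rightarrow> nat \<times> 'g \<Rightarrow> 'k :: field" where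
  "H_y G \<equiv> unit_fun (1, \<one>\<^bsub>G\<^esub>)"

lemma basis_algebra_mult:
  assumes "finite B" "a \<in> B" "b \<in> B"
  shows "unit_fun a \<otimes>\<^bsub>basis_algebra B \<mu> u\<^esub> unit_fun b = \<mu> a b"
proof
  fix c
  have "(unit_fun a \<otimes>\<^bsub>basis_algebra B \<mu> u\<^esub> unit_fun b) c =
      (\<Sum>a'\<in>B. if a' = a then (\<Sum>b'\<in>B. if b' = b then \<mu> a' b' c else 0) else 0)"
    unfolding basis_algebra_def by (auto simp: unit_fun_def intro!: sum.cong)
  also have "\<dots> = \<mu> a b c"
    using assms by simp
  finally show "(unit_fun a \<otimes>\<^bsub>basis_algebra B \<mu> u\<^esub> unit_fun b) c = \<mu> a b c" .
qed

text \<open>The defining relations of \<open>H\<close> hold, and \<open>y\<^sup>i h\<close> is the basis element indexed by \<open>(i, h)\<close>.\<close>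

context nilpotent_group_datum
begin

lemma finite_H_basis: "finite (H_basis G n)"
  using finite_G by (simp add: H_basis_def)

lemma chi_nonzero: "h \<in> carrier G \<Longrightarrow> \<chi> h \<noteq> 0"
  using chi_character by (auto simp: hom_def Pi_iff)

lemma chi_one: "\<chi> \<one> = 1"
proof -
  have "\<chi> \<one> = \<chi> (\<one> \<otimes> \<one>)" by simp
  also have "\<dots> = \<chi> \<one> * \<chi> \<one>"
    using chi_character unfolding hom_def by (metis (mono_tags, lifting) mem_Collect_eq
        mult_mult_of one_closed monoid.simps(1))
  finally show ?thesis using chi_nonzero[of \<one>] by simp
qed

lemma H_mult_unit_fun:
  assumes "i < n" "j < n" "h \<in> carrier G" "k \<in> carrier G"
  shows "unit_fun (i, h) \<otimes>\<^bsub>H_alg G \<chi> n\<^esub> unit_fun (j, k) =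
    (if i + j < n then inverse (\<chi> h) ^ j \<odot>\<^bsub>H_alg G \<chi> n\<^esub> unit_fun (i + j, h \<otimes> k)
     else \<zero>\<^bsub>H_alg G \<chi> n\<^esub>)"
  using assms finite_H_basis
  by (simp add: H_alg_def basis_algebra_mult H_basis_def)
     (auto simp: H_mult_def basis_algebra_def fun_eq_iff)

lemma H_grp_mult:
  assumes "h \<in> carrier G" "k \<in> carrier G"
  shows "H_grp h \<otimes>\<^bsub>H_alg G \<chi> n\<^esub> H_grp k = H_grp (h \<otimes> k)"
  using n_ge_2 assms H_mult_unit_fun[of 0 0 h k] by (simp add: H_alg_def basis_algebra_def)

lemma H_y_grp:
  assumes "h \<in> carrier G"
  shows "H_y G \<otimes>\<^bsub>H_alg G \<chi> n\<^esub> H_grp h =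
    \<chi> h \<odot>\<^bsub>H_alg G \<chi> n\<^esub> (H_grp h \<otimes>\<^bsub>H_alg G \<chi> n\<^esub> H_y G)"
  using n_ge_2 assms H_mult_unit_fun[of 1 0 \<one> h] H_mult_unit_fun[of 0 1 h \<one>] chi_nonzero[of h]
  by (simp add: H_alg_def basis_algebra_def mult.assoc[symmetric])

lemma H_y_pow: "i < n \<Longrightarrow> H_y G [^]\<^bsub>H_alg G \<chi> n\<^esub> i = unit_fun (i, \<one>)"
proof (induction i)
  case 0
  show ?case by (simp add: nat_pow_def H_alg_def basis_algebra_def)
next
  case (Suc i)
  then show ?case
    using n_ge_2 H_mult_unit_fun[of i 1 \<one> \<one>] chi_one
    by (simp add: nat_pow_def H_alg_def basis_algebra_def)
qed

lemma H_y_pow_n: "H_y G [^]\<^bsub>H_alg G \<chi> n\<^esub> n = \<zero>\<^bsub>H_alg G \<chi> n\<^esub>"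
proof -
  obtain k where k: "n = Suc k" using n_ge_2 by (cases n) auto
  then have "H_y G [^]\<^bsub>H_alg G \<chi> n\<^esub> n = unit_fun (k, \<one>) \<otimes>\<^bsub>H_alg G \<chi> n\<^esub> H_y G"
    using H_y_pow[of k] by (simp add: nat_pow_def)
  then show ?thesis
    using n_ge_2 k H_mult_unit_fun[of k 1 \<one> \<one>] by simp
qed

lemma H_y_pow_grp:
  assumes "i < n" "h \<in> carrier G"
  shows "(H_y G [^]\<^bsub>H_alg G \<chi> n\<^esub> i) \<otimes>\<^bsub>H_alg G \<chi> n\<^esub> H_grp h = unit_fun (i, h)"
proof -
  have "1 \<odot>\<^bsub>H_alg G \<chi> n\<^esub> unit_fun (i, h) = unit_fun (i, h)"
    by (simp add: H_alg_def basis_algebra_def)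
  then show ?thesis
    using assms H_mult_unit_fun[of i 0 \<one> h] unfolding H_y_pow[OF assms(1)] by simp
qed

end

text \<open>The tensor product algebra of \<open>H\<close> with itself, on the basis of all pairs of basis elements.\<close>

definition HH_alg ::
  "('g, 'x) monoid_scheme \<Rightarrow> ('g \<Rightarrow> 'k :: field) \<Rightarrow> nat \<Rightarrow>
     ('k, (nat \<times> 'g) \<times> (nat \<times> 'g) \<Rightarrow> 'k) module" where
  "HH_alg G \<chi> n = basis_algebra (H_basis G n \<times> H_basis G n)
     (\<lambda>(a, b) (c, d) (e, f). H_mult G \<chi> n a c e * H_mult G \<chi> n b d f)
     (unit_fun ((0, \<one>\<^bsub>G\<^esub>), (0, \<one>\<^bsub>G\<^esub>)))"

definition HH_tensor :: "('b \<Rightarrow> 'k :: field) \<Rightarrow> ('b \<Rightarrow> 'k) \<Rightarrow> 'b \<times> 'b \<Rightarrow> 'k" where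
  "HH_tensor x x' = (\<lambda>(a, b). x a * x' b)"

text \<open>
  The algebra homomorphism \<open>\<Delta>\<close> with \<open>\<Delta>(y) = y \<otimes> g + 1 \<otimes> y\<close> and \<open>\<Delta>(h) = h \<otimes> h\<close>; on the
  basis it is \<open>\<Delta>(y\<^sup>i h) = \<Delta>(y)\<^sup>i \<Delta>(h)\<close>.
\<close>

definition H_comult ::
  "('g, 'x) monoid_scheme \<Rightarrow> ('g \<Rightarrow> 'k :: field) \<Rightarrow> 'g \<Rightarrow> nat \<Rightarrow>
     (nat \<times> 'g \<Rightarrow> 'k) \<Rightarrow> (nat \<times> 'g) \<times> (nat \<times> 'g) \<Rightarrow> 'k" where
  "H_comult G \<chi> g n x = (\<lambda>p. \<Sum>(i, h)\<in>H_basis G n. x (i, h) *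
     (((HH_tensor (H_y G) (H_grp g) \<oplus>\<^bsub>HH_alg G \<chi> n\<^esub> HH_tensor (H_grp \<one>\<^bsub>G\<^esub>) (H_y G))
         [^]\<^bsub>HH_alg G \<chi> n\<^esub> i)
       \<otimes>\<^bsub>HH_alg G \<chi> n\<^esub> HH_tensor (H_grp h) (H_grp h)) p)"


section \<open>Tensor products of modules\<close>

definition free_space :: "'s set \<Rightarrow> ('k :: field, 's \<Rightarrow> 'k) module" where
  "free_space S =
     \<lparr>carrier = {f. finite {s. f s \<noteq> 0} \<and> {s. f s \<noteq> 0} \<subseteq> S},
      mult = (\<lambda>_ _ _. 0), one = (\<lambda>_. 0),
      zero = (\<lambda>_. 0),
      add = (\<lambda>f f' s. f s + f' s),
      smult = (\<lambda>c f s. c * f s)\<rparr>"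

definition bilinear_rels ::
  "('k :: field, 'v, 'y) module_scheme \<Rightarrow> ('k, 'w, 'z) module_scheme \<Rightarrow> ('v \<times> 'w \<Rightarrow> 'k) set" where
  "bilinear_rels V W =
     {\<lambda>p. unit_fun (v \<oplus>\<^bsub>V\<^esub> v', w) p - unit_fun (v, w) p - unit_fun (v', w) p | v v' w.
        v \<in> carrier V \<and> v' \<in> carrier V \<and> w \<in> carrier W} \<union>
     {\<lambda>p. unit_fun (v, w \<oplus>\<^bsub>W\<^esub> w') p - unit_fun (v, w) p - unit_fun (v, w') p | v w w'.
        v \<in> carrier V \<and> w \<in> carrier W \<and> w' \<in> carrier W} \<union>
     {\<lambda>p. unit_fun (c \<odot>\<^bsub>V\<^esub> v, w) p - c * unit_fun (v, w) p | c v w.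
        v \<in> carrier V \<and> w \<in> carrier W} \<union>
     {\<lambda>p. unit_fun (v, c \<odot>\<^bsub>W\<^esub> w) p - c * unit_fun (v, w) p | c v w.
        v \<in> carrier V \<and> w \<in> carrier W}"

text \<open>
  \<open>V \<otimes> W\<close> is the free vector space on \<open>V \<times> W\<close> modulo the span of the bilinearity relations;
  \<open>x \<in> H\<close> acts by \<open>x (v \<otimes> w) = \<Sum> x\<^sub>1 v \<otimes> x\<^sub>2 w\<close> where \<open>\<Delta>(x) = \<Sum> x\<^sub>1 \<otimes> x\<^sub>2\<close>. Operations on cosets
  are defined as for \<^const>\<open>FactRing\<close>, by taking the union over all representatives.
\<close>

definition H_diag ::
  "('g, 'x) monoid_scheme \<Rightarrow> ('g \<Rightarrow> 'k :: field) \<Rightarrow> 'g \<Rightarrow> nat \<Rightarrow>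
     ('k, nat \<times> 'g \<Rightarrow> 'k, 'v) amod \<Rightarrow> ('k, nat \<times> 'g \<Rightarrow> 'k, 'w) amod \<Rightarrow>
     (nat \<times> 'g \<Rightarrow> 'k) \<Rightarrow> ('v \<times> 'w \<Rightarrow> 'k) \<Rightarrow> 'v \<times> 'w \<Rightarrow> 'k" where
  "H_diag G \<chi> g n V W x f = (\<lambda>p.
     \<Sum>(v, w) | f (v, w) \<noteq> 0. \<Sum>(b, c)\<in>H_basis G n \<times> H_basis G n.
       f (v, w) * H_comult G \<chi> g n x (b, c) *
       unit_fun (act V (unit_fun b) v, act W (unit_fun c) w) p)"

definition H_tensor ::
  "('g, 'x) monoid_scheme \<Rightarrow> ('g \<Rightarrow> 'k :: field) \<Rightarrow> 'g \<Rightarrow> nat \<Rightarrow>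
     ('k, nat \<times> 'g \<Rightarrow> 'k, 'v) amod \<Rightarrow> ('k, nat \<times> 'g \<Rightarrow> 'k, 'w) amod \<Rightarrow>
     ('k, nat \<times> 'g \<Rightarrow> 'k, ('v \<times> 'w \<Rightarrow> 'k) set) amod" where
  "H_tensor G \<chi> g n V W =
     (let F = free_space (carrier V \<times> carrier W);
          N = LinearCombinations.module.span class_ring F (bilinear_rels V W)
      in \<lparr>carrier = a_rcosets\<^bsub>F\<^esub> N,
          mult = (\<lambda>_ _. N), one = N,
          zero = N,
          add = set_add F,
          smult = (\<lambda>c A. \<Union>f\<in>A. N +>\<^bsub>F\<^esub> (c \<odot>\<^bsub>F\<^esub> f)),
          act = (\<lambda>x A. \<Union>f\<in>A. N +>\<^bsub>F\<^esub> H_diag G \<chi> g n V W x f)\<rparr>)"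


section \<open>The modules \<open>M(i, j)\<close>\<close>

text \<open>
  The action of \<open>H\<close> on \<open>V\<close> for which \<open>h \<in> G\<close> acts by \<open>\<rho> h\<close> and \<open>y\<close> acts by \<open>Y\<close>.
\<close>

definition H_act ::
  "('g, 'x) monoid_scheme \<Rightarrow> nat \<Rightarrow> ('k :: field, 'v, 'z) module_scheme \<Rightarrow>
     ('g \<Rightarrow> 'v \<Rightarrow> 'v) \<Rightarrow> ('v \<Rightarrow> 'v) \<Rightarrow> (nat \<times> 'g \<Rightarrow> 'k) \<Rightarrow> 'v \<Rightarrow> 'v" where
  "H_act G n V \<rho> Y x v = finsum V (\<lambda>(i, h). x (i, h) \<odot>\<^bsub>V\<^esub> (Y ^^ i) (\<rho> h v)) (H_basis G n)"

text \<open>A \<open>K[G]\<close>-module, regarded as an \<open>H\<close>-module on which \<open>y\<close> acts by zero.\<close>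

definition inflate ::
  "('g, 'x) monoid_scheme \<Rightarrow> nat \<Rightarrow> ('k :: field, 'g \<Rightarrow> 'k, 'v) amod \<Rightarrow>
     ('k, nat \<times> 'g \<Rightarrow> 'k, 'v) amod" where
  "inflate G n V = with_act V (H_act G n V (\<lambda>h. act V (unit_fun h)) (\<lambda>_. \<zero>\<^bsub>V\<^esub>))"

text \<open>The one-dimensional \<open>K[G]\<close>-module with character \<open>\<psi>\<close>.\<close>

definition char_module ::
  "('g, 'x) monoid_scheme \<Rightarrow> ('g \<Rightarrow> 'k :: field) \<Rightarrow> ('k, 'g \<Rightarrow> 'k, 'k) amod" where
  "char_module G \<psi> =
     \<lparr>carrier = UNIV, mult = (*), one = 1, zero = 0, add = (+), smult = (*),
      act = (\<lambda>x v. (\<Sum>h\<in>carrier G. x h * \<psi> h) * v)\<rparr>"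

text \<open>
  \<open>V \<oplus> x V \<oplus> \<dots> \<oplus> x\<^bsup>j-1\<^esup> V\<close>: the element \<open>\<Sum> x\<^sup>k v\<^sub>k\<close> is the function \<open>k \<mapsto> v\<^sub>k\<close>,
  extended by zero to \<open>k \<ge> j\<close>.
\<close>

definition copies :: "('k, 'v, 'z) module_scheme \<Rightarrow> nat \<Rightarrow> ('k, nat \<Rightarrow> 'v) module" where
  "copies V j =
     \<lparr>carrier = {f. (\<forall>k<j. f k \<in> carrier V) \<and> (\<forall>k\<ge>j. f k = \<zero>\<^bsub>V\<^esub>)},
      mult = (\<lambda>_ _ _. \<zero>\<^bsub>V\<^esub>), one = (\<lambda>_. \<zero>\<^bsub>V\<^esub>),
      zero = (\<lambda>_. \<zero>\<^bsub>V\<^esub>),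
      add = (\<lambda>f f' k. f k \<oplus>\<^bsub>V\<^esub> f' k),
      smult = (\<lambda>c f k. c \<odot>\<^bsub>V\<^esub> f k)\<rparr>"

definition M_module ::
  "('g, 'x) monoid_scheme \<Rightarrow> ('g \<Rightarrow> 'k :: field) \<Rightarrow> nat \<Rightarrow> ('k, 'g \<Rightarrow> 'k, 'v) amod \<Rightarrow> nat \<Rightarrow>
     ('k, nat \<times> 'g \<Rightarrow> 'k, nat \<Rightarrow> 'v) amod" where
  "M_module G \<chi> n V j = with_act (copies V j)
     (H_act G n (copies V j)
        (\<lambda>h f k. inverse (\<chi> h) ^ k \<odot>\<^bsub>V\<^esub> act V (unit_fun h) (f k))
        (\<lambda>f k. if 0 < k \<and> k < j then f (k - 1) else \<zero>\<^bsub>V\<^esub>))"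


section \<open>The Green ring\<close>

text \<open>
  The isomorphism class of a finite-dimensional module, whatever the type of its carrier,
  is represented by the modules in it whose carrier consists of elements of \<^typ>\<open>'k vec\<close>;
  it contains such modules by finite-dimensionality.
\<close>

definition iso_class ::
  "('k :: field, 'a) module \<Rightarrow> ('k, 'a, 'v) amod \<Rightarrow> ('k, 'a, 'k vec) amod set" where
  "iso_class A M = {N. amodule A N \<and> amod_iso A N M}"

definition iso_classes :: "('k :: field, 'a) module \<Rightarrow> ('k, 'a, 'k vec) amod set set" where
  "iso_classes A = iso_class A ` {M :: ('k, 'a, 'k vec) amod. amodule A M}"

definition class_tensor ::
  "('g, 'x) monoid_scheme \<Rightarrow> ('g \<Rightarrow> 'k :: field) \<Rightarrow> 'g \<Rightarrow> nat \<Rightarrow>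
     ('k, nat \<times> 'g \<Rightarrow> 'k, 'k vec) amod set \<Rightarrow> ('k, nat \<times> 'g \<Rightarrow> 'k, 'k vec) amod set \<Rightarrow>
     ('k, nat \<times> 'g \<Rightarrow> 'k, 'k vec) amod set" where
  "class_tensor G \<chi> g n C D = (\<Union>M\<in>C. \<Union>N\<in>D. iso_class (H_alg G \<chi> n) (H_tensor G \<chi> g n M N))"

text \<open>
  The free abelian group on the isomorphism classes, with the biadditive extension of the
  tensor product of classes.
\<close>

definition green_free ::
  "('g, 'x) monoid_scheme \<Rightarrow> ('g \<Rightarrow> 'k :: field) \<Rightarrow> 'g \<Rightarrow> nat \<Rightarrow>
     (('k, nat \<times> 'g \<Rightarrow> 'k, 'k vec) amod set \<Rightarrow>\<^sub>0 int) ring" where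
  "green_free G \<chi> g n =
     \<lparr>carrier = carrier (free_Abelian_group (iso_classes (H_alg G \<chi> n))),
      mult = (\<lambda>p p'. frag_extend (\<lambda>C. frag_extend (\<lambda>D. frag_of (class_tensor G \<chi> g n C D)) p') p),
      one = frag_of (iso_class (H_alg G \<chi> n) (inflate G n (char_module G (\<lambda>_. 1)))),
      zero = 0,
      add = (+)\<rparr>"

definition green_relations ::
  "('k :: field, 'a) module \<Rightarrow> (('k, 'a, 'k vec) amod set \<Rightarrow>\<^sub>0 int) set" where
  "green_relations A = generate (free_Abelian_group (iso_classes A))
     {frag_of (iso_class A (amod_sum M N)) - frag_of (iso_class A M) - frag_of (iso_class A N)
        | (M :: ('k, 'a, 'k vec) amod) (N :: ('k, 'a, 'k vec) amod). amodule A M \<and> amodule A N}"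

definition green_ring ::
  "('g, 'x) monoid_scheme \<Rightarrow> ('g \<Rightarrow> 'k :: field) \<Rightarrow> 'g \<Rightarrow> nat \<Rightarrow>
     (('k, nat \<times> 'g \<Rightarrow> 'k, 'k vec) amod set \<Rightarrow>\<^sub>0 int) set ring" where
  "green_ring G \<chi> g n = green_free G \<chi> g n Quot green_relations (H_alg G \<chi> n)"

text \<open>The element \<open>[M]\<close> of the Green ring.\<close>

definition green_class ::
  "('g, 'x) monoid_scheme \<Rightarrow> ('g \<Rightarrow> 'k :: field) \<Rightarrow> 'g \<Rightarrow> nat \<Rightarrow>
     ('k, nat \<times> 'g \<Rightarrow> 'k, 'v) amod \<Rightarrow> (('k, nat \<times> 'g \<Rightarrow> 'k, 'k vec) amod set \<Rightarrow>\<^sub>0 int) set" where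
  "green_class G \<chi> g n M =
     green_relations (H_alg G \<chi> n) +>\<^bsub>green_free G \<chi> g n\<^esub> frag_of (iso_class (H_alg G \<chi> n) M)"

end

theory Submission
  imports Defs "HOL-Library.Function_Algebras"
begin

text \<open>
  Write \<open>q = \<chi>(g)\<close>, let \<open>C(j) = M(1,j)\<close> be the chain \<open>x\<^sup>0, \<dots>, x\<^bsup>j-1\<^esup>\<close>, and let
  \<open>A = V\<^bsub>\<chi>\<^sup>-\<^sup>1\<^esub>\<close>. Three facts about modules carry the result.

  The module \<open>M(i,j)\<close> is \<open>V\<^sub>i \<otimes> C(j)\<close>: on \<open>v \<otimes> x\<^sup>k\<close> the summand \<open>y \<otimes> g\<close> of \<open>\<Delta>(y)\<close> vanishes,
  because \<open>y\<close> kills \<open>V\<^sub>i\<close>, and \<open>1 \<otimes> y\<close> shifts \<open>x\<^sup>k\<close>. Moreover \<open>v \<otimes> x\<^sup>k \<mapsto> x\<^sup>k \<otimes> g\<^sup>k v\<close> is an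
  isomorphism \<open>V\<^sub>i \<otimes> C(j) \<cong> C(j) \<otimes> V\<^sub>i\<close>, since \<open>g\<close> is central
  (\<open>has_rep_M_module\<close>, \<open>rtensor_chain_commute\<close>).

  In \<open>C(2) \<otimes> C(j)\<close> the vector \<open>x\<^sup>0 \<otimes> x\<^sup>0\<close> satisfies
  \<open>y\<^sup>l (x\<^sup>0 \<otimes> x\<^sup>0) = x\<^sup>0 \<otimes> x\<^sup>l + [l] x\<^sup>1 \<otimes> x\<^bsup>l-1\<^esup>\<close> with \<open>[l] = 1 + q\<^bsup>-1\<^esup> + \<dots> + q\<^bsup>-(l-1)\<^esup>\<close>.
  For \<open>j < n\<close> the number \<open>[j]\<close> is nonzero, so this vector generates a chain of length \<open>j + 1\<close>, which
  has the complement \<open>A \<otimes> C(j-1)\<close>. For \<open>j = n\<close> one has \<open>[n] = 0\<close>, so the chain has length \<open>n\<close>, with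
  complement \<open>A \<otimes> C(n)\<close> (\<open>chain_product\<close>, \<open>top_chain_product\<close>). These are the product formulas
  with \<open>M[1,2]\<close> as left factor.

  Every module is a direct sum of modules \<open>U \<otimes> C(j)\<close> with \<open>j \<le> n\<close> and \<open>y U = 0\<close>
  (\<open>split_off_chain\<close>), and such a \<open>U\<close> is a direct sum of simple modules (\<open>maschke\<close>). Solved for
  \<open>[C(j+1)]\<close>, the product formula expresses all \<open>[C(j)]\<close> in terms of \<open>[C(2)]\<close> and \<open>[A]\<close>. Hence the
  \<open>[V\<^sub>i]\<close> and \<open>M[1,2]\<close> generate the Green ring (\<open>rep_in_subring\<close>). The \<open>[V\<^sub>i]\<close> commute with each
  other, because \<open>y\<close> acts by zero on the products and the action of \<open>G\<close> is diagonal, and with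
  \<open>M[1,2]\<close> by the isomorphism above. A ring with commuting generators is commutative, and
  commutativity gives the formulas with \<open>M[1,2]\<close> or \<open>[V\<^sub>i]\<close> as right factor.

  Modules enter these arguments through coordinates. A representation consists of a finite index
  set \<open>B\<close>, operators on the functions supported on \<open>B\<close> for the elements of \<open>G\<close>, and an operator for
  \<open>y\<close>; every finite-dimensional module is described by one, and its isomorphism class depends only on
  it (\<open>amodule_has_rep\<close>, \<open>iso_class_has_rep\<close>). This allows modules whose carriers have different types
  to be compared. The link with the quotient construction of the tensor product is
  \<open>has_rep_H_tensor\<close>: the tensor product of two modules is described by the tensor product of their
  representations.
\<close>

section \<open>Coordinate spaces\<close>

definition fsp :: "'b set \<Rightarrow> ('b \<Rightarrow> 'k :: field) set" where
  "fsp B = {f. \<forall>b. b \<notin> B \<longrightarrow> f b = 0}"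

text \<open>
  Linearity is required on the coordinate space only: operators are total functions, and their values
  outside \<open>fsp B\<close> carry no meaning.
\<close>

definition lin_on :: "'b set \<Rightarrow> 'c set \<Rightarrow> (('b \<Rightarrow> 'k :: field) \<Rightarrow> 'c \<Rightarrow> 'k) \<Rightarrow> bool" where
  "lin_on B C T \<longleftrightarrow> (\<forall>f\<in>fsp B. T f \<in> fsp C) \<and>
     (\<forall>f\<in>fsp B. \<forall>f'\<in>fsp B. T (\<lambda>b. f b + f' b) = (\<lambda>c. T f c + T f' c)) \<and>
     (\<forall>a. \<forall>f\<in>fsp B. T (\<lambda>b. a * f b) = (\<lambda>c. a * T f c))"

lemma fspD: "f \<in> fsp B \<Longrightarrow> b \<notin> B \<Longrightarrow> f b = 0"
  by (simp add: fsp_def)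

lemma fspI: "(\<And>b. b \<notin> B \<Longrightarrow> f b = 0) \<Longrightarrow> f \<in> fsp B"
  by (simp add: fsp_def)

lemma fsp_zero [simp]: "(\<lambda>_. 0) \<in> fsp B"
  and fsp_add [intro]: "f \<in> fsp B \<Longrightarrow> f' \<in> fsp B \<Longrightarrow> (\<lambda>b. f b + f' b) \<in> fsp B"
  and fsp_scale [intro]: "f \<in> fsp B \<Longrightarrow> (\<lambda>b. a * f b) \<in> fsp B"
  and fsp_unit [intro]: "b \<in> B \<Longrightarrow> unit_fun b \<in> fsp B"
  by (auto simp: fsp_def unit_fun_def)

lemma fsp_sum [intro]: "(\<And>i. i \<in> I \<Longrightarrow> F i \<in> fsp B) \<Longrightarrow> (\<lambda>b. \<Sum>i\<in>I. a i * F i b) \<in> fsp B"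
  by (auto simp: fsp_def intro!: sum.neutral)

lemma lin_onI:
  assumes "\<And>f. f \<in> fsp B \<Longrightarrow> T f \<in> fsp C"
    and "\<And>f f'. f \<in> fsp B \<Longrightarrow> f' \<in> fsp B \<Longrightarrow> T (\<lambda>b. f b + f' b) = (\<lambda>c. T f c + T f' c)"
    and "\<And>a f. f \<in> fsp B \<Longrightarrow> T (\<lambda>b. a * f b) = (\<lambda>c. a * T f c)"
  shows "lin_on B C T"
  using assms by (simp add: lin_on_def)

lemma lin_on_fsp: "lin_on B C T \<Longrightarrow> f \<in> fsp B \<Longrightarrow> T f \<in> fsp C"
  and lin_on_add: "lin_on B C T \<Longrightarrow> f \<in> fsp B \<Longrightarrow> f' \<in> fsp B \<Longrightarrow>
     T (\<lambda>b. f b + f' b) = (\<lambda>c. T f c + T f' c)"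
  and lin_on_scale: "lin_on B C T \<Longrightarrow> f \<in> fsp B \<Longrightarrow> T (\<lambda>b. a * f b) = (\<lambda>c. a * T f c)"
  by (simp_all add: lin_on_def)

lemma lin_on_zero:
  assumes "lin_on B C T" shows "T (\<lambda>_. 0) = (\<lambda>_. 0)"
  using lin_on_scale[OF assms fsp_zero, of 0] by simp

lemma lin_on_sum:
  assumes T: "lin_on B C T" and F: "\<And>i. i \<in> I \<Longrightarrow> F i \<in> fsp B"
  shows "T (\<lambda>b. \<Sum>i\<in>I. a i * F i b) = (\<lambda>c. \<Sum>i\<in>I. a i * T (F i) c)"
  using F
proof (induction I rule: infinite_finite_induct)
  case (insert i I)
  have "T (\<lambda>b. a i * F i b + (\<Sum>i\<in>I. a i * F i b))
      = (\<lambda>c. T (\<lambda>b. a i * F i b) c + T (\<lambda>b. \<Sum>i\<in>I. a i * F i b) c)"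
    using insert.prems by (intro lin_on_add[OF T]) auto
  then show ?case
    using insert lin_on_scale[OF T, of "F i" "a i"] by simp
qed (simp_all add: lin_on_zero[OF T])

lemma fsp_expand:
  assumes "finite B" "f \<in> fsp B"
  shows "f = (\<lambda>b. \<Sum>c\<in>B. f c * unit_fun c b)"
proof
  fix b
  have "(\<Sum>c\<in>B. f c * unit_fun c b) = (\<Sum>c\<in>B. if c = b then f c else 0)"
    by (intro sum.cong) (auto simp: unit_fun_def)
  also have "\<dots> = f b" using assms by (auto simp: fsp_def)
  finally show "f b = (\<Sum>c\<in>B. f c * unit_fun c b)" by simp
qed

lemma lin_on_expand:
  assumes T: "lin_on B C T" and "finite B" "f \<in> fsp B"
  shows "T f = (\<lambda>c. \<Sum>b\<in>B. f b * T (unit_fun b) c)"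
  using lin_on_sum[OF T, of B unit_fun f] fsp_expand[OF assms(2,3)] by (metis fsp_unit)

lemma lin_on_comp:
  assumes "lin_on B C T" "lin_on C D T'"
  shows "lin_on B D (\<lambda>f. T' (T f))"
  using assms by (simp add: lin_on_def)

lemma lin_on_plus:
  assumes "lin_on B C T" "lin_on B C T'"
  shows "lin_on B C (\<lambda>f c. T f c + T' f c)"
  using assms by (auto simp: lin_on_def fun_eq_iff algebra_simps)

lemma lin_on_setsum:
  fixes T :: "'i \<Rightarrow> ('b \<Rightarrow> 'k :: field) \<Rightarrow> 'c \<Rightarrow> 'k"
  assumes "\<And>i. i \<in> I \<Longrightarrow> lin_on B C (T i)"
  shows "lin_on B C (\<lambda>f c. \<Sum>i\<in>I. a i * T i f c)"
proof (rule lin_onI)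
  fix f :: "'b \<Rightarrow> 'k" assume f: "f \<in> fsp B"
  show "(\<lambda>c. \<Sum>i\<in>I. a i * T i f c) \<in> fsp C"
    by (rule fsp_sum) (rule lin_on_fsp[OF assms f])
  fix f' :: "'b \<Rightarrow> 'k" assume f': "f' \<in> fsp B"
  show "(\<lambda>c. \<Sum>i\<in>I. a i * T i (\<lambda>b. f b + f' b) c) =
      (\<lambda>c. (\<Sum>i\<in>I. a i * T i f c) + (\<Sum>i\<in>I. a i * T i f' c))"
    unfolding sum.distrib[symmetric]
    by (intro ext sum.cong refl) (simp add: lin_on_add[OF assms f f'] distrib_left)
next
  fix a' :: 'k and f :: "'b \<Rightarrow> 'k" assume f: "f \<in> fsp B"
  show "(\<lambda>c. \<Sum>i\<in>I. a i * T i (\<lambda>b. a' * f b) c) = (\<lambda>c. a' * (\<Sum>i\<in>I. a i * T i f c))"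
    unfolding sum_distrib_left
    by (intro ext sum.cong refl) (simp add: lin_on_scale[OF assms f] mult.left_commute)
qed

lemma lin_on_null: "lin_on B C (\<lambda>_ _. 0)"
  by (simp add: lin_on_def)

lemma lin_on_funpow:
  assumes "lin_on B B T" shows "lin_on B B (T ^^ i)"
proof (induction i)
  case (Suc i)
  show ?case using lin_on_comp[OF Suc assms] by simp
qed (simp add: lin_on_def)

text \<open>
  On functions of two variables, \<open>T \<otimes> 1\<close> and \<open>1 \<otimes> T\<close>.
\<close>

definition tens1 :: "(('b \<Rightarrow> 'k) \<Rightarrow> 'b' \<Rightarrow> 'k) \<Rightarrow> ('b \<times> 'c \<Rightarrow> 'k) \<Rightarrow> 'b' \<times> 'c \<Rightarrow> 'k" where
  "tens1 T f = (\<lambda>(b, c). T (\<lambda>b'. f (b', c)) b)"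

definition tens2 :: "(('c \<Rightarrow> 'k) \<Rightarrow> 'c' \<Rightarrow> 'k) \<Rightarrow> ('b \<times> 'c \<Rightarrow> 'k) \<Rightarrow> 'b \<times> 'c' \<Rightarrow> 'k" where
  "tens2 T f = (\<lambda>(b, c). T (\<lambda>c'. f (b, c')) c)"

lemma slice1: "f \<in> fsp (B \<times> C) \<Longrightarrow> (\<lambda>b. f (b, c)) \<in> fsp B"
  and slice2: "f \<in> fsp (B \<times> C) \<Longrightarrow> (\<lambda>c. f (b, c)) \<in> fsp C"
  by (auto simp: fsp_def)

lemma lin_on_tens1:
  fixes T :: "('b \<Rightarrow> 'k :: field) \<Rightarrow> 'b' \<Rightarrow> 'k" and C :: "'c set"
  assumes T: "lin_on B B' T" shows "lin_on (B \<times> C) (B' \<times> C) (tens1 T)"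
proof (rule lin_onI)
  fix f :: "'b \<times> 'c \<Rightarrow> 'k" assume f: "f \<in> fsp (B \<times> C)"
  show "tens1 T f \<in> fsp (B' \<times> C)"
  proof (rule fspI)
    fix p assume p: "p \<notin> B' \<times> C"
    obtain b c where [simp]: "p = (b, c)" by (cases p)
    show "tens1 T f p = 0"
    proof (cases "c \<in> C")
      case True
      then show ?thesis
        using p lin_on_fsp[OF T slice1[OF f, of c]] by (auto simp: tens1_def dest: fspD)
    next
      case False
      then have "(\<lambda>b. f (b, c)) = (\<lambda>_. 0)" using f by (auto simp: fsp_def)
      then show ?thesis by (simp add: tens1_def lin_on_zero[OF T])
    qed
  qed
qed (auto simp: tens1_def fun_eq_iff lin_on_add[OF T slice1 slice1] lin_on_scale[OF T slice1])

lemma lin_on_tens2: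
  fixes T :: "('c \<Rightarrow> 'k :: field) \<Rightarrow> 'c' \<Rightarrow> 'k" and B :: "'b set"
  assumes T: "lin_on C C' T" shows "lin_on (B \<times> C) (B \<times> C') (tens2 T)"
proof (rule lin_onI)
  fix f :: "'b \<times> 'c \<Rightarrow> 'k" assume f: "f \<in> fsp (B \<times> C)"
  show "tens2 T f \<in> fsp (B \<times> C')"
  proof (rule fspI)
    fix p assume p: "p \<notin> B \<times> C'"
    obtain b c where [simp]: "p = (b, c)" by (cases p)
    show "tens2 T f p = 0"
    proof (cases "b \<in> B")
      case True
      then show ?thesis
        using p lin_on_fsp[OF T slice2[OF f, of b]] by (auto simp: tens2_def dest: fspD)
    next
      case False
      then have "(\<lambda>c. f (b, c)) = (\<lambda>_. 0)" using f by (auto simp: fsp_def)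
      then show ?thesis by (simp add: tens2_def lin_on_zero[OF T])
    qed
  qed
qed (auto simp: tens2_def fun_eq_iff lin_on_add[OF T slice2 slice2] lin_on_scale[OF T slice2])

text \<open>
  \<open>(T \<otimes> 1)(1 \<otimes> T') = (1 \<otimes> T')(T \<otimes> 1)\<close>. As \<open>T'\<close> is an arbitrary linear operator, it is first
  expanded in the matrix entries \<open>T' (unit_fun c') c\<close>, after which linearity of \<open>T\<close> applies.
\<close>

lemma tens_commute:
  fixes T :: "('b \<Rightarrow> 'k :: field) \<Rightarrow> 'b' \<Rightarrow> 'k" and T' :: "('c \<Rightarrow> 'k) \<Rightarrow> 'c' \<Rightarrow> 'k"
  assumes T: "lin_on B B' T" and T': "lin_on C C' T'" and fin: "finite C"
    and f: "f \<in> fsp (B \<times> C)"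
  shows "tens1 T (tens2 T' f) = tens2 T' (tens1 T f)"
proof
  fix p :: "'b' \<times> 'c'"
  obtain b c where [simp]: "p = (b, c)" by (cases p)
  have 1: "T' (\<lambda>c'. f (b', c')) c = (\<Sum>c'\<in>C. T' (unit_fun c') c * f (b', c'))" for b'
    using fun_cong[OF lin_on_expand[OF T' fin slice2[OF f, of b']], of c] by (simp add: mult.commute)
  have 2: "(\<lambda>c'. T (\<lambda>b'. f (b', c')) b) \<in> fsp C"
    using slice2[OF lin_on_fsp[OF lin_on_tens1[OF T] f], of b] by (simp add: tens1_def)
  have "tens1 T (tens2 T' f) p = T (\<lambda>b'. \<Sum>c'\<in>C. T' (unit_fun c') c * f (b', c')) b"
    by (simp add: tens1_def tens2_def 1)
  also have "\<dots> = (\<Sum>c'\<in>C. T' (unit_fun c') c * T (\<lambda>b'. f (b', c')) b)"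
    using fun_cong[OF lin_on_sum[OF T, of C "\<lambda>c' b'. f (b', c')" "\<lambda>c'. T' (unit_fun c') c"], of b]
      slice1[OF f] by simp
  also have "\<dots> = T' (\<lambda>c'. T (\<lambda>b'. f (b', c')) b) c"
    using fun_cong[OF lin_on_expand[OF T' fin 2], of c] by (simp add: mult.commute)
  finally show "tens1 T (tens2 T' f) p = tens2 T' (tens1 T f) p"
    by (simp add: tens1_def tens2_def)
qed

lemma tens2_funpow:
  fixes T :: "('c \<Rightarrow> 'k) \<Rightarrow> 'c \<Rightarrow> 'k"
  shows "(tens2 T ^^ i) f = tens2 (T ^^ i) f"
proof (induction i arbitrary: f)
  case (Suc i)
  have "(tens2 T ^^ Suc i) f = tens2 T (tens2 (T ^^ i) f)" using Suc by simp
  also have "\<dots> = tens2 (T ^^ Suc i) f" by (simp add: tens2_def)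
  finally show ?case .
qed (simp add: tens2_def)

section \<open>Nilpotency of a sum of q-commuting operators\<close>

text \<open>
  The Gaussian binomial coefficients, by the recursion that one more factor in \<open>(A + B)\<^sup>m\<close> produces
  when \<open>B A = q A B\<close>. No division occurs, so roots of unity are admissible values of \<open>q\<close>.
\<close>

fun qbinom :: "'k :: field \<Rightarrow> nat \<Rightarrow> nat \<Rightarrow> 'k" where
  "qbinom q 0 0 = 1"
| "qbinom q 0 (Suc k) = 0"
| "qbinom q (Suc m) 0 = 1"
| "qbinom q (Suc m) (Suc k) = qbinom q m k + q ^ Suc k * qbinom q m (Suc k)"

lemma qbinom_0 [simp]: "qbinom q m 0 = 1"
  by (cases m) auto

lemma qbinom_above: "m < k \<Longrightarrow> qbinom q m k = 0"
  by (induction q m k rule: qbinom.induct) auto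

text \<open>
  The quotient of consecutive Gaussian binomials is \<open>(1 - q\<^bsup>m-k\<^esup>) / (1 - q\<^bsup>k+1\<^esup>)\<close>; here the
  denominator is cleared and both sides are multiplied by \<open>q\<^sup>k\<close>, which avoids the exponent \<open>m - k\<close>.
\<close>

lemma qbinom_step:
  "q ^ k * (1 - q ^ Suc k) * qbinom q m (Suc k) = (q ^ k - q ^ m) * qbinom q m k"
proof (induction m arbitrary: k)
  case 0
  show ?case by (cases k) auto
next
  case (Suc m)
  have 1: "q ^ k * (1 - q ^ Suc k) * (q ^ Suc k * qbinom q m (Suc k))
      = q ^ Suc k * ((q ^ k - q ^ m) * qbinom q m k)"
    unfolding Suc[symmetric] by (simp add: algebra_simps)
  show ?case
  proof (cases k)
    case 0
    with 1 show ?thesis by (simp add: algebra_simps)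
  next
    case (Suc l)
    have 2: "q ^ k * (1 - q ^ k) * qbinom q m k = (q ^ k - q ^ Suc m) * qbinom q m l"
      using arg_cong[OF Suc.IH[of l], of "\<lambda>x. q * x"] Suc by (simp add: algebra_simps)
    have "q ^ k * (1 - q ^ Suc k) * qbinom q (Suc m) (Suc k)
       = q ^ k * (1 - q ^ Suc k) * qbinom q m k + q ^ Suc k * ((q ^ k - q ^ m) * qbinom q m k)"
      unfolding 1[symmetric] by (simp add: algebra_simps)
    also have "\<dots> = q ^ k * (1 - q ^ k) * qbinom q m k + (q ^ k - q ^ Suc m) * (q ^ k * qbinom q m k)"
      by (simp add: algebra_simps)
    also have "\<dots> = (q ^ k - q ^ Suc m) * qbinom q (Suc m) k"
      unfolding 2 using Suc by (simp add: algebra_simps)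
    finally show ?thesis .
  qed
qed

text \<open>
  For \<open>q\<^sup>n = 1\<close> the step from \<open>k = 0\<close> to \<open>k = 1\<close> has the factor \<open>1 - q\<^sup>n = 0\<close>, and later steps
  preserve the value zero as long as \<open>q\<^bsup>k+1\<^esup> \<noteq> 1\<close>.
\<close>

lemma qbinom_root_of_unity:
  assumes "q ^ n = 1" "\<And>k. 0 < k \<Longrightarrow> k < n \<Longrightarrow> q ^ k \<noteq> 1" "0 < k" "k < n"
  shows "qbinom q n k = 0"
  using assms(3,4)
proof (induction k)
  case (Suc k)
  have q: "q \<noteq> 0" using assms(1) Suc.prems by (metis not_less_zero power_0_left zero_neq_one gr_zeroI)
  have "(q ^ k - q ^ n) * qbinom q n k = 0"
    using Suc assms(1) by (cases "k = 0") auto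
  then have "q ^ k * (1 - q ^ Suc k) * qbinom q n (Suc k) = 0"
    by (simp only: qbinom_step)
  then show ?case using q assms(2)[of "Suc k"] Suc.prems by auto
qed simp

lemma q_commute_funpow:
  assumes A: "lin_on D D A" and B: "lin_on D D B"
    and comm: "\<And>f. f \<in> fsp D \<Longrightarrow> B (A f) = (\<lambda>d. q * A (B f) d)"
    and f: "f \<in> fsp D"
  shows "B ((A ^^ k) f) = (\<lambda>d. q ^ k * (A ^^ k) (B f) d)"
proof (induction k)
  case (Suc k)
  have Ak: "(A ^^ k) f \<in> fsp D" "(A ^^ k) (B f) \<in> fsp D"
    using lin_on_fsp[OF lin_on_funpow[OF A]] lin_on_fsp[OF B f] f by auto
  have "B ((A ^^ Suc k) f) = (\<lambda>d. q * A (B ((A ^^ k) f)) d)"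
    using comm[OF Ak(1)] by simp
  also have "\<dots> = (\<lambda>d. q ^ Suc k * (A ^^ Suc k) (B f) d)"
    unfolding Suc lin_on_scale[OF A Ak(2)] by (simp add: mult.assoc)
  finally show ?case .
qed simp

lemma q_binomial_theorem:
  assumes A: "lin_on D D A" and B: "lin_on D D B"
    and comm: "\<And>f. f \<in> fsp D \<Longrightarrow> B (A f) = (\<lambda>d. q * A (B f) d)"
    and f: "f \<in> fsp D"
  shows "((\<lambda>f d. A f d + B f d) ^^ m) f =
    (\<lambda>d. \<Sum>k\<le>m. qbinom q m k * (A ^^ k) ((B ^^ (m - k)) f) d)"
proof (induction m)
  case (Suc m)
  define t where "t k l = (A ^^ k) ((B ^^ l) f)" for k l
  have t: "t k l \<in> fsp D" for k l
    unfolding t_def using lin_on_fsp[OF lin_on_funpow[OF A]] lin_on_fsp[OF lin_on_funpow[OF B]] f by auto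
  have At: "A (t k l) = t (Suc k) l" for k l by (simp add: t_def)
  have Bt: "B (t k l) = (\<lambda>d. q ^ k * t k (Suc l) d)" for k l
    using q_commute_funpow[OF A B comm, of "(B ^^ l) f" k] lin_on_fsp[OF lin_on_funpow[OF B] f]
    by (simp add: t_def)
  let ?b = "qbinom q m"
  have "((\<lambda>f d. A f d + B f d) ^^ Suc m) f =
      (\<lambda>d. A (\<lambda>d. \<Sum>k\<le>m. ?b k * t k (m - k) d) d + B (\<lambda>d. \<Sum>k\<le>m. ?b k * t k (m - k) d) d)"
    using Suc by (simp add: t_def)
  also have "\<dots> = (\<lambda>d. (\<Sum>k\<le>m. ?b k * t (Suc k) (m - k) d) +
       (\<Sum>k\<le>m. ?b k * (q ^ k * t k (Suc (m - k)) d)))"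
    by (simp add: lin_on_sum[OF A t] lin_on_sum[OF B t] At Bt)
  also have "\<dots> = (\<lambda>d. \<Sum>k\<le>Suc m. qbinom q (Suc m) k * t k (Suc m - k) d)"
  proof
    fix d
    have "(\<Sum>k\<le>m. ?b k * (q ^ k * t k (Suc (m - k)) d))
        = (\<Sum>k\<le>Suc m. ?b k * (q ^ k * t k (Suc m - k) d))"
      by (simp add: qbinom_above Suc_diff_le)
    also have "\<dots> = t 0 (Suc m) d + (\<Sum>k\<le>m. ?b (Suc k) * (q ^ Suc k * t (Suc k) (m - k) d))"
      by (subst sum.atMost_Suc_shift) simp
    finally show "(\<Sum>k\<le>m. ?b k * t (Suc k) (m - k) d) + (\<Sum>k\<le>m. ?b k * (q ^ k * t k (Suc (m - k)) d))
        = (\<Sum>k\<le>Suc m. qbinom q (Suc m) k * t k (Suc m - k) d)"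
      by (subst sum.atMost_Suc_shift) (simp add: sum.distrib algebra_simps)
  qed
  finally show ?case by (simp add: t_def)
qed simp

text \<open>
  All mixed terms of the \<open>q\<close>-binomial expansion of \<open>(A + B)\<^sup>n\<close> vanish at a primitive \<open>n\<close>-th root of
  unity, which leaves \<open>A\<^sup>n + B\<^sup>n\<close>. With \<open>A = y \<otimes> g\<close> and \<open>B = 1 \<otimes> y\<close> this shows that
  \<open>\<Delta>(y)\<^sup>n\<close> acts by zero.
\<close>

lemma q_commuting_sum_nilpotent:
  assumes A: "lin_on D D A" and B: "lin_on D D B"
    and comm: "\<And>f. f \<in> fsp D \<Longrightarrow> B (A f) = (\<lambda>d. q * A (B f) d)"
    and An: "\<And>f. f \<in> fsp D \<Longrightarrow> (A ^^ n) f = (\<lambda>_. 0)"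
    and Bn: "\<And>f. f \<in> fsp D \<Longrightarrow> (B ^^ n) f = (\<lambda>_. 0)"
    and q: "q ^ n = 1" "\<And>k. 0 < k \<Longrightarrow> k < n \<Longrightarrow> q ^ k \<noteq> 1" and f: "f \<in> fsp D"
  shows "((\<lambda>f d. A f d + B f d) ^^ n) f = (\<lambda>_. 0)"
proof -
  have "qbinom q n k * (A ^^ k) ((B ^^ (n - k)) f) d = 0" if "k \<le> n" for k d
  proof -
    have "k = 0 \<or> k = n \<or> 0 < k \<and> k < n" using that by linarith
    then show ?thesis
      using An Bn f qbinom_root_of_unity[OF q] by (elim disjE) auto
  qed
  then have "(\<lambda>d. \<Sum>k\<le>n. qbinom q n k * (A ^^ k) ((B ^^ (n - k)) f) d) = (\<lambda>_. 0)"
    by (auto intro!: ext sum.neutral)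
  with q_binomial_theorem[OF A B comm f, of n] show ?thesis by simp
qed

section \<open>Representations of the group datum in coordinates\<close>

text \<open>
  The operators of a module in coordinates: \<open>gact h\<close> is the action of \<open>h \<in> G\<close>, and \<open>yact\<close> that
  of \<open>y\<close>.
\<close>

record ('g, 'b, 'k) crep =
  idx :: "'b set"
  gact :: "'g \<Rightarrow> ('b \<Rightarrow> 'k) \<Rightarrow> 'b \<Rightarrow> 'k"
  yact :: "('b \<Rightarrow> 'k) \<Rightarrow> 'b \<Rightarrow> 'k"

context nilpotent_group_datum
begin

lemma chi_mult: "h \<in> carrier G \<Longrightarrow> k \<in> carrier G \<Longrightarrow> \<chi> (h \<otimes> k) = \<chi> h * \<chi> k"
  using chi_character unfolding hom_def
  by (metis (mono_tags, lifting) mem_Collect_eq mult_mult_of monoid.simps(1))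

lemma chi_inv: "h \<in> carrier G \<Longrightarrow> \<chi> (inv h) = inverse (\<chi> h)"
  using chi_mult[of h "inv h"] chi_one by (simp add: inverse_unique)

lemma q_pow_eq_1_iff: "\<chi> g ^ k = 1 \<longleftrightarrow> n dvd k"
proof -
  interpret K: group "mult_of (class_ring :: 'k ring)"
    by (rule field.field_mult_group[OF class_field])
  have "\<chi> g [^]\<^bsub>mult_of class_ring\<^esub> k = \<chi> g ^ k"
    unfolding nat_pow_mult_of by (simp add: class_ring_simps)
  moreover have "\<chi> g \<in> carrier (mult_of class_ring)"
    using chi_character g_closed by (auto simp: hom_def)
  ultimately show ?thesis
    using K.pow_eq_id[of "\<chi> g" k] n_def by simp
qed

lemma q_pow_n: "\<chi> g ^ n = 1"
  and q_pow_neq_1: "0 < k \<Longrightarrow> k < n \<Longrightarrow> \<chi> g ^ k \<noteq> 1"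
  using nat_dvd_not_less by (auto simp: q_pow_eq_1_iff)

definition is_rep :: "('a, 'i, 'k) crep \<Rightarrow> bool" where
  "is_rep R \<longleftrightarrow> finite (idx R) \<and>
     (\<forall>h\<in>carrier G. lin_on (idx R) (idx R) (gact R h)) \<and>
     lin_on (idx R) (idx R) (yact R) \<and>
     (\<forall>f\<in>fsp (idx R). gact R \<one> f = f) \<and>
     (\<forall>h\<in>carrier G. \<forall>k\<in>carrier G. \<forall>f\<in>fsp (idx R). gact R h (gact R k f) = gact R (h \<otimes> k) f) \<and>
     (\<forall>h\<in>carrier G. \<forall>f\<in>fsp (idx R). yact R (gact R h f) = (\<lambda>b. \<chi> h * gact R h (yact R f) b)) \<and>
     (\<forall>f\<in>fsp (idx R). (yact R ^^ n) f = (\<lambda>_. 0))"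

lemma is_repD:
  assumes "is_rep R"
  shows "finite (idx R)"
    and "h \<in> carrier G \<Longrightarrow> lin_on (idx R) (idx R) (gact R h)"
    and "lin_on (idx R) (idx R) (yact R)"
    and "f \<in> fsp (idx R) \<Longrightarrow> gact R \<one> f = f"
    and "h \<in> carrier G \<Longrightarrow> k \<in> carrier G \<Longrightarrow> f \<in> fsp (idx R) \<Longrightarrow>
      gact R h (gact R k f) = gact R (h \<otimes> k) f"
    and "h \<in> carrier G \<Longrightarrow> f \<in> fsp (idx R) \<Longrightarrow>
      yact R (gact R h f) = (\<lambda>b. \<chi> h * gact R h (yact R f) b)"
    and "f \<in> fsp (idx R) \<Longrightarrow> (yact R ^^ n) f = (\<lambda>_. 0)"
  using assms by (auto simp: is_rep_def)

lemma is_rep_closed: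
  assumes "is_rep R" "f \<in> fsp (idx R)"
  shows "h \<in> carrier G \<Longrightarrow> gact R h f \<in> fsp (idx R)" "yact R f \<in> fsp (idx R)"
    "(yact R ^^ i) f \<in> fsp (idx R)"
  using lin_on_fsp is_repD(2,3)[OF assms(1)] lin_on_funpow assms(2) by blast+

definition rep_iso :: "('a, 'i, 'k) crep \<Rightarrow> ('a, 'j, 'k) crep \<Rightarrow> bool" where
  "rep_iso R R' \<longleftrightarrow> (\<exists>F. lin_on (idx R) (idx R') F \<and> bij_betw F (fsp (idx R)) (fsp (idx R')) \<and>
     (\<forall>h\<in>carrier G. \<forall>f\<in>fsp (idx R). F (gact R h f) = gact R' h (F f)) \<and>
     (\<forall>f\<in>fsp (idx R). F (yact R f) = yact R' (F f)))"

lemma rep_isoI: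
  assumes "lin_on (idx R) (idx R') F" "\<And>f. f \<in> fsp (idx R') \<Longrightarrow> E f \<in> fsp (idx R)"
    and "\<And>f. f \<in> fsp (idx R) \<Longrightarrow> E (F f) = f" "\<And>f. f \<in> fsp (idx R') \<Longrightarrow> F (E f) = f"
    and "\<And>h f. h \<in> carrier G \<Longrightarrow> f \<in> fsp (idx R) \<Longrightarrow> F (gact R h f) = gact R' h (F f)"
    and "\<And>f. f \<in> fsp (idx R) \<Longrightarrow> F (yact R f) = yact R' (F f)"
  shows "rep_iso R R'"
proof -
  have "bij_betw F (fsp (idx R)) (fsp (idx R'))"
    by (rule bij_betw_byWitness[of _ E]) (use assms(2-4) lin_on_fsp[OF assms(1)] in auto)
  then show ?thesis using assms(1,5,6) unfolding rep_iso_def by blast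
qed

text \<open>
  Isomorphisms that only rename basis vectors; the associativity, distributivity and unit laws of the
  tensor product are of this kind.
\<close>

lemma rep_iso_relabel:
  assumes b: "bij \<beta>" and idx: "\<And>c. \<beta> c \<in> idx R \<longleftrightarrow> c \<in> idx R'"
    and g: "\<And>h f. h \<in> carrier G \<Longrightarrow> f \<in> fsp (idx R) \<Longrightarrow>
      gact R' h (\<lambda>c. f (\<beta> c)) = (\<lambda>c. gact R h f (\<beta> c))"
    and y: "\<And>f. f \<in> fsp (idx R) \<Longrightarrow> yact R' (\<lambda>c. f (\<beta> c)) = (\<lambda>c. yact R f (\<beta> c))"
  shows "rep_iso R R'"
proof (rule rep_isoI)
  show "lin_on (idx R) (idx R') (\<lambda>f c. f (\<beta> c))"
    using idx by (auto simp: lin_on_def fsp_def)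
  show "f \<in> fsp (idx R') \<Longrightarrow> (\<lambda>d. f (inv_into UNIV \<beta> d)) \<in> fsp (idx R)" for f
    using idx b by (auto simp: fsp_def bij_is_surj surj_f_inv_f) (metis b bij_is_surj surj_f_inv_f)
qed (use b g y in \<open>auto simp: bij_is_surj surj_f_inv_f bij_is_inj\<close>)

lemma rep_iso_sym:
  assumes R: "is_rep R" and iso: "rep_iso R R'"
  shows "rep_iso R' R"
proof -
  from iso obtain F where F: "lin_on (idx R) (idx R') F" "bij_betw F (fsp (idx R)) (fsp (idx R'))"
    "\<And>h f. h \<in> carrier G \<Longrightarrow> f \<in> fsp (idx R) \<Longrightarrow> F (gact R h f) = gact R' h (F f)"
    "\<And>f. f \<in> fsp (idx R) \<Longrightarrow> F (yact R f) = yact R' (F f)"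
    unfolding rep_iso_def by blast
  define E where "E = inv_into (fsp (idx R)) F"
  have E: "E f \<in> fsp (idx R)" "F (E f) = f" if "f \<in> fsp (idx R')" for f
    using F(2) that unfolding E_def
    by (auto simp: bij_betw_def inv_into_into f_inv_into_f)
  have EF: "E (F f) = f" if "f \<in> fsp (idx R)" for f
    using F(2) that unfolding E_def by (simp add: bij_betw_inv_into_left)
  have eqI: "E f = f'" if "f = F f'" "f' \<in> fsp (idx R)" for f f'
    using EF that by simp
  show ?thesis
  proof (rule rep_isoI)
    show "lin_on (idx R') (idx R) E"
    proof (rule lin_onI)
      show "E (\<lambda>b. f b + f' b) = (\<lambda>c. E f c + E f' c)" if "f \<in> fsp (idx R')" "f' \<in> fsp (idx R')" for f f'
        by (rule eqI) (use lin_on_add[OF F(1) E(1) E(1)] E that in auto)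
      show "E (\<lambda>b. a * f b) = (\<lambda>c. a * E f c)" if "f \<in> fsp (idx R')" for a f
        by (rule eqI) (use lin_on_scale[OF F(1) E(1)] E that in auto)
    qed (use E in auto)
    show "E (gact R' h f) = gact R h (E f)" if "h \<in> carrier G" "f \<in> fsp (idx R')" for h f
      by (rule eqI) (use F(3) E is_rep_closed[OF R] that in auto)
    show "E (yact R' f) = yact R (E f)" if "f \<in> fsp (idx R')" for f
      by (rule eqI) (use F(4) E is_rep_closed[OF R] that in auto)
    show "F f \<in> fsp (idx R')" if "f \<in> fsp (idx R)" for f by (rule lin_on_fsp[OF F(1) that])
  qed (use E EF in simp_all)
qed

subsection \<open>Tensor products\<close>

text \<open>
  The action through \<open>\<Delta>(h) = h \<otimes> h\<close> and \<open>\<Delta>(y) = y \<otimes> g + 1 \<otimes> y\<close>.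
\<close>

definition rtensor :: "('a, 'i, 'k) crep \<Rightarrow> ('a, 'j, 'k) crep \<Rightarrow> ('a, 'i \<times> 'j, 'k) crep" where
  "rtensor R R' = \<lparr>idx = idx R \<times> idx R',
     gact = (\<lambda>h f. tens1 (gact R h) (tens2 (gact R' h) f)),
     yact = (\<lambda>f p. tens1 (yact R) (tens2 (gact R' g) f) p + tens2 (yact R') f p)\<rparr>"

lemma tens1_cong:
  assumes "\<And>f. f \<in> fsp B \<Longrightarrow> T f = S f" "f \<in> fsp (B \<times> C)"
  shows "tens1 T f = tens1 S f"
  using assms(1)[OF slice1[OF assms(2)]] by (simp add: tens1_def)

lemma tens2_cong:
  assumes "\<And>f. f \<in> fsp C \<Longrightarrow> T f = S f" "f \<in> fsp (B \<times> C)"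
  shows "tens2 T f = tens2 S f"
  using assms(1)[OF slice2[OF assms(2)]] by (simp add: tens2_def)

lemma tens1_comp: "tens1 T (tens1 S f) = tens1 (\<lambda>f. T (S f)) f"
  by (auto simp: tens1_def)

lemma tens2_comp: "tens2 T (tens2 S f) = tens2 (\<lambda>f. T (S f)) f"
  by (auto simp: tens2_def)

lemma tens1_scale: "tens1 (\<lambda>f b. (a :: 'k) * S f b) f = (\<lambda>p. a * tens1 S f p)"
  by (auto simp: tens1_def)

lemma tens2_scale: "tens2 (\<lambda>f b. (a :: 'k) * S f b) f = (\<lambda>p. a * tens2 S f p)"
  by (auto simp: tens2_def)

text \<open>
  With \<open>A = y \<otimes> g\<close> and \<open>B = 1 \<otimes> y\<close> one has \<open>B A = y \<otimes> y g = q (y \<otimes> g y) = q A B\<close>, so the relation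
  \<open>y\<^sup>n = 0\<close> is an instance of the nilpotency of a sum of \<open>q\<close>-commuting operators. The relation
  \<open>y h = \<chi>(h) h y\<close> holds for \<open>A\<close> because \<open>g\<close> is central.
\<close>

lemma is_rep_rtensor:
  fixes R :: "('a, 'i, 'k) crep" and R' :: "('a, 'j, 'k) crep"
  assumes R: "is_rep R" and R': "is_rep R'"
  shows "is_rep (rtensor R R')"
proof -
  let ?D = "idx R \<times> idx R'"
  note fin = is_repD(1)[OF R] is_repD(1)[OF R']
  note gl = is_repD(2)[OF R] and gl' = is_repD(2)[OF R']
  note yl = is_repD(3)[OF R] and yl' = is_repD(3)[OF R']
  note L1 = lin_on_tens1[where C = "idx R'"] and L2 = lin_on_tens2[where B = "idx R"]
  define A where "A f = tens1 (yact R) (tens2 (gact R' g) f)" for f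
  define B :: "('i \<times> 'j \<Rightarrow> 'k) \<Rightarrow> 'i \<times> 'j \<Rightarrow> 'k" where "B = tens2 (yact R')"
  have A: "lin_on ?D ?D A" unfolding A_def
    by (rule lin_on_comp[OF L2[OF gl'[OF g_closed]] L1[OF yl]])
  have B: "lin_on ?D ?D B" unfolding B_def by (rule L2[OF yl'])
  have gt: "lin_on ?D ?D (gact (rtensor R R') h)" if "h \<in> carrier G" for h
    unfolding rtensor_def using lin_on_comp[OF L2[OF gl'[OF that]] L1[OF gl[OF that]]] by simp
  have y_eq: "yact (rtensor R R') = (\<lambda>f p. A f p + B f p)"
    unfolding rtensor_def A_def B_def by simp
  have BA: "B (A f) = (\<lambda>p. \<chi> g * A (B f) p)" if f: "f \<in> fsp ?D" for f
  proof -
    have "B (A f) = tens1 (yact R) (tens2 (yact R') (tens2 (gact R' g) f))"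
      unfolding A_def B_def
      using tens_commute[OF yl yl' fin(2) lin_on_fsp[OF L2[OF gl'[OF g_closed]] f]] by simp
    also have "tens2 (yact R') (tens2 (gact R' g) f) =
        (\<lambda>p. \<chi> g * tens2 (gact R' g) (tens2 (yact R') f) p)"
      unfolding tens2_comp tens2_scale[symmetric]
      by (rule tens2_cong[OF _ f]) (simp add: is_repD(6)[OF R' g_closed])
    also have "tens1 (yact R) \<dots> = (\<lambda>p. \<chi> g * tens1 (yact R) (tens2 (gact R' g) (tens2 (yact R') f)) p)"
      by (rule lin_on_scale[OF L1[OF yl]])
        (rule lin_on_fsp[OF L2[OF gl'[OF g_closed]] lin_on_fsp[OF L2[OF yl'] f]])
    finally show ?thesis unfolding A_def B_def .
  qed
  have An: "(A ^^ n) f = (\<lambda>_. 0)" if f: "f \<in> fsp ?D" for f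
  proof -
    define S where "S i = (gact R' g ^^ i)" for i
    have S: "lin_on (idx R') (idx R') (S i)" for i
      unfolding S_def by (rule lin_on_funpow[OF gl'[OF g_closed]])
    have "(A ^^ i) f = tens1 (yact R ^^ i) (tens2 (S i) f)" for i
    proof (induction i)
      case 0
      show ?case by (simp add: S_def tens1_def tens2_def)
    next
      case (Suc i)
      have "(A ^^ Suc i) f = A (tens1 (yact R ^^ i) (tens2 (S i) f))"
        using Suc by simp
      also have "\<dots> = tens1 (yact R) (tens2 (gact R' g) (tens1 (yact R ^^ i) (tens2 (S i) f)))"
        by (simp add: A_def)
      also have "tens2 (gact R' g) (tens1 (yact R ^^ i) (tens2 (S i) f)) =
          tens1 (yact R ^^ i) (tens2 (gact R' g) (tens2 (S i) f))"
        by (rule tens_commute[OF lin_on_funpow[OF yl] gl'[OF g_closed] fin(2), symmetric])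
          (rule lin_on_fsp[OF L2[OF S] f])
      finally show ?case by (simp add: tens1_comp tens2_comp S_def o_def)
    qed
    moreover have "tens1 (yact R ^^ n) (tens2 (S n) f) = tens1 (\<lambda>_ _. 0) (tens2 (S n) f)"
      by (rule tens1_cong[OF _ lin_on_fsp[OF L2[OF S] f]]) (simp add: is_repD(7)[OF R])
    ultimately show ?thesis by (simp add: tens1_def case_prod_unfold)
  qed
  have Bn: "(B ^^ n) f = (\<lambda>_. 0)" if f: "f \<in> fsp ?D" for f
  proof -
    have "tens2 (yact R' ^^ n) f = tens2 (\<lambda>_ _. 0) f"
      by (rule tens2_cong[OF _ f]) (simp add: is_repD(7)[OF R'])
    then show ?thesis by (simp add: B_def tens2_funpow) (simp add: tens2_def case_prod_unfold)
  qed
  have g_one: "gact (rtensor R R') \<one> f = f" if f: "f \<in> fsp ?D" for f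
  proof -
    have "tens2 (gact R' \<one>) f = tens2 (\<lambda>f. f) f"
      by (rule tens2_cong[OF _ f]) (simp add: is_repD(4)[OF R'])
    moreover have "tens1 (gact R \<one>) f = tens1 (\<lambda>f. f) f"
      by (rule tens1_cong[OF _ f]) (simp add: is_repD(4)[OF R])
    ultimately show ?thesis
      by (simp add: rtensor_def tens1_def[of "\<lambda>f. f"] tens2_def[of "\<lambda>f. f"])
  qed
  have g_mult: "gact (rtensor R R') h (gact (rtensor R R') k f) = gact (rtensor R R') (h \<otimes> k) f"
    if h: "h \<in> carrier G" and k: "k \<in> carrier G" and f: "f \<in> fsp ?D" for h k f
  proof -
    have f1: "tens2 (gact R' k) f \<in> fsp ?D" and f2: "tens2 (gact R' (h \<otimes> k)) f \<in> fsp ?D"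
      using lin_on_fsp[OF L2[OF gl'] f] h k by auto
    have "gact (rtensor R R') h (gact (rtensor R R') k f) =
        tens1 (gact R h) (tens1 (gact R k) (tens2 (gact R' h) (tens2 (gact R' k) f)))"
      unfolding rtensor_def
      using tens_commute[OF gl[OF k] gl'[OF h] fin(2) f1] by simp
    also have "tens2 (gact R' h) (tens2 (gact R' k) f) = tens2 (gact R' (h \<otimes> k)) f"
      unfolding tens2_comp by (rule tens2_cong[OF _ f]) (simp add: is_repD(5)[OF R' h k])
    also have "tens1 (gact R h) (tens1 (gact R k) \<dots>) = tens1 (gact R (h \<otimes> k)) \<dots>"
      unfolding tens1_comp by (rule tens1_cong[OF _ f2]) (simp add: is_repD(5)[OF R h k])
    finally show ?thesis by (simp add: rtensor_def)
  qed
  have y_g: "yact (rtensor R R') (gact (rtensor R R') h f) =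
      (\<lambda>p. \<chi> h * gact (rtensor R R') h (yact (rtensor R R') f) p)"
    if h: "h \<in> carrier G" and f: "f \<in> fsp ?D" for h f
  proof -
    let ?gt = "gact (rtensor R R') h"
    have gt_eq: "?gt f = tens1 (gact R h) (tens2 (gact R' h) f)" for f by (simp add: rtensor_def)
    have f1: "tens2 (gact R' h) f \<in> fsp ?D" and f2: "tens2 (gact R' g) f \<in> fsp ?D"
      and f3: "tens2 (gact R' (g \<otimes> h)) f \<in> fsp ?D" and f4: "tens2 (yact R') f \<in> fsp ?D"
      using lin_on_fsp[OF L2[OF gl'] f] lin_on_fsp[OF L2[OF yl'] f] h g_closed by auto
    have "A (?gt f) = tens1 (yact R) (tens1 (gact R h) (tens2 (gact R' g) (tens2 (gact R' h) f)))"
      unfolding A_def gt_eq using tens_commute[OF gl[OF h] gl'[OF g_closed] fin(2) f1] by simp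
    also have "tens2 (gact R' g) (tens2 (gact R' h) f) = tens2 (gact R' (g \<otimes> h)) f"
      unfolding tens2_comp by (rule tens2_cong[OF _ f]) (simp add: is_repD(5)[OF R' g_closed h])
    also have "tens1 (yact R) (tens1 (gact R h) \<dots>) =
        (\<lambda>p. \<chi> h * tens1 (gact R h) (tens1 (yact R) (tens2 (gact R' (g \<otimes> h)) f)) p)"
      unfolding tens1_comp tens1_scale[symmetric]
      by (rule tens1_cong[OF _ f3]) (simp add: is_repD(6)[OF R h])
    also have "tens2 (gact R' (g \<otimes> h)) f = tens2 (gact R' h) (tens2 (gact R' g) f)"
      unfolding tens2_comp
      by (rule tens2_cong[OF _ f]) (simp add: is_repD(5)[OF R' h g_closed] g_central[OF h])
    also have "tens1 (yact R) \<dots> = tens2 (gact R' h) (A f)"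
      unfolding A_def by (rule tens_commute[OF yl gl'[OF h] fin(2) f2])
    finally have 1: "A (?gt f) = (\<lambda>p. \<chi> h * ?gt (A f) p)" unfolding gt_eq .
    have "B (?gt f) = tens1 (gact R h) (tens2 (yact R') (tens2 (gact R' h) f))"
      unfolding B_def gt_eq using tens_commute[OF gl[OF h] yl' fin(2) f1] by simp
    also have "tens2 (yact R') (tens2 (gact R' h) f) =
        (\<lambda>p. \<chi> h * tens2 (gact R' h) (tens2 (yact R') f) p)"
      unfolding tens2_comp tens2_scale[symmetric]
      by (rule tens2_cong[OF _ f]) (simp add: is_repD(6)[OF R' h])
    also have "tens1 (gact R h) \<dots> = (\<lambda>p. \<chi> h * ?gt (B f) p)"
      unfolding gt_eq B_def
      by (rule lin_on_scale[OF L1[OF gl[OF h]] lin_on_fsp[OF L2[OF gl'[OF h]] f4]])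
    finally have 2: "B (?gt f) = (\<lambda>p. \<chi> h * ?gt (B f) p)" .
    show ?thesis
      unfolding y_eq lin_on_add[OF gt[OF h] lin_on_fsp[OF A f] lin_on_fsp[OF B f]] 1 2
      by (simp add: distrib_left)
  qed
  have idx: "idx (rtensor R R') = ?D" by (simp add: rtensor_def)
  show ?thesis
    unfolding is_rep_def idx
  proof (intro conjI ballI)
    show "finite ?D" using fin by simp
    show "lin_on ?D ?D (yact (rtensor R R'))" unfolding y_eq by (rule lin_on_plus[OF A B])
    show "(yact (rtensor R R') ^^ n) f = (\<lambda>_. 0)" if "f \<in> fsp ?D" for f
      unfolding y_eq
      by (rule q_commuting_sum_nilpotent[OF A B BA An Bn q_pow_n q_pow_neq_1 that])
  qed (use gt g_one g_mult y_g in auto)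
qed

subsection \<open>Direct sums, characters and chains\<close>

definition rsum :: "('a, 'i, 'k) crep \<Rightarrow> ('a, 'j, 'k) crep \<Rightarrow> ('a, 'i + 'j, 'k) crep" where
  "rsum R R' = \<lparr>idx = idx R <+> idx R',
     gact = (\<lambda>h f. case_sum (gact R h (\<lambda>b. f (Inl b))) (gact R' h (\<lambda>c. f (Inr c)))),
     yact = (\<lambda>f. case_sum (yact R (\<lambda>b. f (Inl b))) (yact R' (\<lambda>c. f (Inr c))))\<rparr>"

lemma fsp_Plus: "f \<in> fsp (B <+> C) \<longleftrightarrow> (\<lambda>b. f (Inl b)) \<in> fsp B \<and> (\<lambda>c. f (Inr c)) \<in> fsp C"
  by (auto simp: fsp_def split_sum_all)

lemma lin_on_case_sum:
  fixes T :: "('i \<Rightarrow> 'k) \<Rightarrow> 'i' \<Rightarrow> 'k" and S :: "('j \<Rightarrow> 'k) \<Rightarrow> 'j' \<Rightarrow> 'k"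
  assumes T: "lin_on B B' T" and S: "lin_on C C' S"
  shows "lin_on (B <+> C) (B' <+> C') (\<lambda>f. case_sum (T (\<lambda>b. f (Inl b))) (S (\<lambda>c. f (Inr c))))"
proof (rule lin_onI)
  fix f :: "'i + 'j \<Rightarrow> 'k" assume "f \<in> fsp (B <+> C)"
  then have f: "(\<lambda>b. f (Inl b)) \<in> fsp B" "(\<lambda>c. f (Inr c)) \<in> fsp C" by (simp_all add: fsp_Plus)
  show "case_sum (T (\<lambda>b. f (Inl b))) (S (\<lambda>c. f (Inr c))) \<in> fsp (B' <+> C')"
    using lin_on_fsp[OF T f(1)] lin_on_fsp[OF S f(2)] by (simp add: fsp_Plus)
  show "case_sum (T (\<lambda>b. a * f (Inl b))) (S (\<lambda>c. a * f (Inr c))) =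
      (\<lambda>c. a * case_sum (T (\<lambda>b. f (Inl b))) (S (\<lambda>c. f (Inr c))) c)" for a
    by (simp add: fun_eq_iff split_sum_all lin_on_scale[OF T f(1)] lin_on_scale[OF S f(2)])
  fix f' :: "'i + 'j \<Rightarrow> 'k" assume "f' \<in> fsp (B <+> C)"
  then have f': "(\<lambda>b. f' (Inl b)) \<in> fsp B" "(\<lambda>c. f' (Inr c)) \<in> fsp C" by (simp_all add: fsp_Plus)
  show "case_sum (T (\<lambda>b. f (Inl b) + f' (Inl b))) (S (\<lambda>c. f (Inr c) + f' (Inr c))) =
      (\<lambda>c. case_sum (T (\<lambda>b. f (Inl b))) (S (\<lambda>c. f (Inr c))) c +
        case_sum (T (\<lambda>b. f' (Inl b))) (S (\<lambda>c. f' (Inr c))) c)"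
    by (simp add: fun_eq_iff split_sum_all lin_on_add[OF T f(1) f'(1)] lin_on_add[OF S f(2) f'(2)])
qed

lemma rsum_yact_funpow:
  "(yact (rsum R R') ^^ i) f =
    case_sum ((yact R ^^ i) (\<lambda>b. f (Inl b))) ((yact R' ^^ i) (\<lambda>c. f (Inr c)))"
proof (induction i)
  case 0
  show ?case by (simp add: fun_eq_iff split_sum_all)
qed (simp add: rsum_def fun_eq_iff split_sum_all)

lemma is_rep_rsum:
  fixes R :: "('a, 'i, 'k) crep" and R' :: "('a, 'j, 'k) crep"
  assumes R: "is_rep R" and R': "is_rep R'"
  shows "is_rep (rsum R R')"
proof -
  have idx: "idx (rsum R R') = idx R <+> idx R'"
    and ga: "gact (rsum R R') h f =
      case_sum (gact R h (\<lambda>b. f (Inl b))) (gact R' h (\<lambda>c. f (Inr c)))"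
    and ya: "yact (rsum R R') f = case_sum (yact R (\<lambda>b. f (Inl b))) (yact R' (\<lambda>c. f (Inr c)))"
    for h f by (simp_all add: rsum_def)
  show ?thesis
    unfolding is_rep_def idx
  proof (intro conjI ballI)
    show "finite (idx R <+> idx R')" using is_repD(1)[OF R] is_repD(1)[OF R'] by simp
    show "lin_on (idx R <+> idx R') (idx R <+> idx R') (yact (rsum R R'))"
      using lin_on_case_sum[OF is_repD(3)[OF R] is_repD(3)[OF R']] by (simp add: rsum_def)
    show "lin_on (idx R <+> idx R') (idx R <+> idx R') (gact (rsum R R') h)"
      if "h \<in> carrier G" for h
      using lin_on_case_sum[OF is_repD(2)[OF R that] is_repD(2)[OF R' that]] by (simp add: rsum_def)
    fix f :: "'i + 'j \<Rightarrow> 'k" assume "f \<in> fsp (idx R <+> idx R')"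
    then have f: "(\<lambda>b. f (Inl b)) \<in> fsp (idx R)" "(\<lambda>c. f (Inr c)) \<in> fsp (idx R')"
      by (simp_all add: fsp_Plus)
    show "(yact (rsum R R') ^^ n) f = (\<lambda>_. 0)"
      unfolding rsum_yact_funpow using is_repD(7)[OF R f(1)] is_repD(7)[OF R' f(2)]
      by (simp add: fun_eq_iff split_sum_all)
    show "gact (rsum R R') \<one> f = f"
      using is_repD(4)[OF R f(1)] is_repD(4)[OF R' f(2)]
      by (simp add: ga fun_eq_iff split_sum_all)
    fix h assume h: "h \<in> carrier G"
    show "yact (rsum R R') (gact (rsum R R') h f) =
        (\<lambda>b. \<chi> h * gact (rsum R R') h (yact (rsum R R') f) b)"
      using is_repD(6)[OF R h f(1)] is_repD(6)[OF R' h f(2)]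
      by (simp add: ga ya fun_eq_iff split_sum_all)
    fix k assume k: "k \<in> carrier G"
    show "gact (rsum R R') h (gact (rsum R R') k f) = gact (rsum R R') (h \<otimes> k) f"
      using is_repD(5)[OF R h k f(1)] is_repD(5)[OF R' h k f(2)]
      by (simp add: ga fun_eq_iff split_sum_all)
  qed
qed

definition rchar :: "('a \<Rightarrow> 'k) \<Rightarrow> ('a, unit, 'k) crep" where
  "rchar \<psi> = \<lparr>idx = {()}, gact = (\<lambda>h f u. \<psi> h * f u), yact = (\<lambda>_ _. 0)\<rparr>"

lemma is_rep_rchar:
  assumes "\<psi> \<one> = 1" "\<And>h k. h \<in> carrier G \<Longrightarrow> k \<in> carrier G \<Longrightarrow> \<psi> (h \<otimes> k) = \<psi> h * \<psi> k"
  shows "is_rep (rchar \<psi>)"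
proof -
  have "((\<lambda>_ _. 0) ^^ n) f = (\<lambda>_ :: unit. 0 :: 'k)" for f :: "unit \<Rightarrow> 'k"
    using n_ge_2 by (cases n) auto
  then show ?thesis
    using assms by (auto simp: is_rep_def rchar_def lin_on_def fun_eq_iff fsp_def algebra_simps)
qed

text \<open>
  The module \<open>M(1,j)\<close>; coordinate \<open>k\<close> is the coefficient of \<open>x\<^sup>k\<close>. It is defined for all \<open>j\<close>, but
  satisfies \<open>y\<^sup>n = 0\<close> only for \<open>j \<le> n\<close>; for \<open>j = 0\<close> it is the zero module.
\<close>

definition rchain :: "nat \<Rightarrow> ('a, nat, 'k) crep" where
  "rchain j = \<lparr>idx = {..<j}, gact = (\<lambda>h f k. inverse (\<chi> h) ^ k * f k),
     yact = (\<lambda>f k. if 0 < k \<and> k < j then f (k - 1) else 0)\<rparr>"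

lemma rchain_yact_funpow:
  assumes "f \<in> fsp {..<j}"
  shows "(yact (rchain j) ^^ i) f = (\<lambda>k. if i \<le> k \<and> k < j then f (k - i) else 0)"
proof (induction i)
  case 0
  show ?case using assms by (auto simp: fsp_def)
next
  case (Suc i)
  then show ?case by (auto simp: rchain_def fun_eq_iff)
qed

lemma is_rep_rchain:
  assumes "j \<le> n" shows "is_rep (rchain j)"
proof -
  have "(yact (rchain j) ^^ n) f = (\<lambda>_. 0)" if "f \<in> fsp {..<j}" for f
    unfolding rchain_yact_funpow[OF that] by (intro ext) (use assms in auto)
  moreover have "idx (rchain j) = {..<j}" by (simp add: rchain_def)
  moreover have "inverse (\<chi> h) ^ (k - Suc 0) = \<chi> h * inverse (\<chi> h) ^ k"
    if "h \<in> carrier G" "0 < k" for h k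
    using chi_nonzero[OF that(1)] that(2) by (cases k) auto
  ultimately show ?thesis
    unfolding is_rep_def
    by (auto simp: rchain_def lin_on_def fun_eq_iff fsp_def algebra_simps chi_one chi_mult
        power_mult_distrib inverse_mult_distrib)
qed

subsection \<open>Tensor identities\<close>

lemma rtensor_assoc: "rep_iso (rtensor (rtensor R1 R2) R3) (rtensor R1 (rtensor R2 R3))"
proof (rule rep_iso_relabel[of "\<lambda>(b, (c, d)). ((b, c), d)"])
  show "bij (\<lambda>(b, (c, d)). ((b, c), d))"
    by (rule o_bij[of "\<lambda>((b, c), d). (b, (c, d))"]) auto
qed (auto simp: rtensor_def tens1_def tens2_def fun_eq_iff)

lemma rtensor_rsum_distrib_right:
  "rep_iso (rtensor (rsum R1 R2) R3) (rsum (rtensor R1 R3) (rtensor R2 R3))"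
proof (rule rep_iso_relabel[of "case_sum (\<lambda>(b, c). (Inl b, c)) (\<lambda>(b, c). (Inr b, c))"])
  show "bij (case_sum (\<lambda>(b, c). (Inl b, c)) (\<lambda>(b, c). (Inr b, c)))"
    by (rule o_bij[of "\<lambda>(s, c). case s of Inl b \<Rightarrow> Inl (b, c) | Inr b \<Rightarrow> Inr (b, c)"])
      (auto simp: fun_eq_iff split: sum.split)
qed (auto simp: rtensor_def rsum_def tens1_def tens2_def fun_eq_iff split: sum.split)

lemma rtensor_rsum_distrib_left:
  "rep_iso (rtensor R3 (rsum R1 R2)) (rsum (rtensor R3 R1) (rtensor R3 R2))"
proof (rule rep_iso_relabel[of "case_sum (\<lambda>(b, c). (b, Inl c)) (\<lambda>(b, c). (b, Inr c))"])
  show "bij (case_sum (\<lambda>(b, c). (b, Inl c)) (\<lambda>(b, c). (b, Inr c)))"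
    by (rule o_bij[of "\<lambda>(c, s). case s of Inl b \<Rightarrow> Inl (c, b) | Inr b \<Rightarrow> Inr (c, b)"])
      (auto simp: fun_eq_iff split: sum.split)
qed (auto simp: rtensor_def rsum_def tens1_def tens2_def fun_eq_iff split: sum.split)

lemma rtensor_unit_left: "rep_iso (rtensor (rchar (\<lambda>_. 1)) R) R"
proof (rule rep_iso_relabel[of "\<lambda>b. ((), b)"])
  show "bij (\<lambda>b. ((), b))" by (rule o_bij[of snd]) auto
qed (auto simp: rtensor_def rchar_def tens1_def tens2_def fun_eq_iff)

lemma rtensor_unit_right: "rep_iso (rtensor R (rchar (\<lambda>_. 1))) R"
proof (rule rep_iso_relabel[of "\<lambda>b. (b, ())"])
  show "bij (\<lambda>b. (b, ()))" by (rule o_bij[of fst]) auto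
qed (auto simp: rtensor_def rchar_def tens1_def tens2_def fun_eq_iff)

lemma rchain_1: "rep_iso (rchain 1) (rchar (\<lambda>_. 1))"
proof (rule rep_isoI)
  show "lin_on (idx (rchain 1)) (idx (rchar (\<lambda>_. 1))) (\<lambda>f _. f 0)"
    by (auto simp: lin_on_def fsp_def rchar_def)
  show "(\<lambda>k. if k = 0 then f () else 0) \<in> fsp (idx (rchain 1))" for f
    by (auto simp: fsp_def rchain_def)
qed (auto simp: fsp_def rchain_def rchar_def)

end

section \<open>Coordinates on modules\<close>

text \<open>
  Only the operations of \<open>V\<close> and a linear bijection onto a coordinate space are mentioned: the axioms of
  a vector space then follow by transport, which is how the quotient spaces below are seen to be
  vector spaces.
\<close>

definition coord :: "('k :: field, 'v, 'z) module_scheme \<Rightarrow> 'i set \<Rightarrow> ('v \<Rightarrow> 'i \<Rightarrow> 'k) \<Rightarrow> bool" where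
  "coord V B \<phi> \<longleftrightarrow> finite B \<and> \<zero>\<^bsub>V\<^esub> \<in> carrier V \<and>
     (\<forall>u\<in>carrier V. \<forall>v\<in>carrier V. u \<oplus>\<^bsub>V\<^esub> v \<in> carrier V) \<and>
     (\<forall>u\<in>carrier V. \<forall>v\<in>carrier V. \<phi> (u \<oplus>\<^bsub>V\<^esub> v) = (\<lambda>b. \<phi> u b + \<phi> v b)) \<and>
     (\<forall>v\<in>carrier V. \<forall>c. c \<odot>\<^bsub>V\<^esub> v \<in> carrier V) \<and>
     (\<forall>v\<in>carrier V. \<forall>c. \<phi> (c \<odot>\<^bsub>V\<^esub> v) = (\<lambda>b. c * \<phi> v b)) \<and>
     \<phi> \<zero>\<^bsub>V\<^esub> = (\<lambda>_. 0) \<and> bij_betw \<phi> (carrier V) (fsp B)"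

lemma coordI:
  assumes "finite B" "\<zero>\<^bsub>V\<^esub> \<in> carrier V"
    and "\<And>u v. u \<in> carrier V \<Longrightarrow> v \<in> carrier V \<Longrightarrow> u \<oplus>\<^bsub>V\<^esub> v \<in> carrier V"
    and "\<And>u v. u \<in> carrier V \<Longrightarrow> v \<in> carrier V \<Longrightarrow> \<phi> (u \<oplus>\<^bsub>V\<^esub> v) = (\<lambda>b. \<phi> u b + \<phi> v b)"
    and "\<And>c v. v \<in> carrier V \<Longrightarrow> c \<odot>\<^bsub>V\<^esub> v \<in> carrier V"
    and "\<And>c v. v \<in> carrier V \<Longrightarrow> \<phi> (c \<odot>\<^bsub>V\<^esub> v) = (\<lambda>b. c * \<phi> v b)"
    and "\<phi> \<zero>\<^bsub>V\<^esub> = (\<lambda>_. 0)" "bij_betw \<phi> (carrier V) (fsp B)"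
  shows "coord V B \<phi>"
  unfolding coord_def by (intro conjI ballI allI assms; assumption)

lemma coordD:
  assumes "coord V B \<phi>"
  shows "finite B" "\<zero>\<^bsub>V\<^esub> \<in> carrier V"
    and "u \<in> carrier V \<Longrightarrow> v \<in> carrier V \<Longrightarrow> u \<oplus>\<^bsub>V\<^esub> v \<in> carrier V"
    and "u \<in> carrier V \<Longrightarrow> v \<in> carrier V \<Longrightarrow> \<phi> (u \<oplus>\<^bsub>V\<^esub> v) = (\<lambda>b. \<phi> u b + \<phi> v b)"
    and "v \<in> carrier V \<Longrightarrow> c \<odot>\<^bsub>V\<^esub> v \<in> carrier V"
    and "v \<in> carrier V \<Longrightarrow> \<phi> (c \<odot>\<^bsub>V\<^esub> v) = (\<lambda>b. c * \<phi> v b)"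
    and "\<phi> \<zero>\<^bsub>V\<^esub> = (\<lambda>_. 0)" "bij_betw \<phi> (carrier V) (fsp B)"
proof -
  note D = assms[unfolded coord_def]
  show "finite B" by (rule D[THEN conjunct1])
  show "\<zero>\<^bsub>V\<^esub> \<in> carrier V" by (rule D[THEN conjunct2, THEN conjunct1])
  show "u \<in> carrier V \<Longrightarrow> v \<in> carrier V \<Longrightarrow> u \<oplus>\<^bsub>V\<^esub> v \<in> carrier V"
    by (rule D[THEN conjunct2, THEN conjunct2, THEN conjunct1, THEN bspec, THEN bspec])
  show "u \<in> carrier V \<Longrightarrow> v \<in> carrier V \<Longrightarrow> \<phi> (u \<oplus>\<^bsub>V\<^esub> v) = (\<lambda>b. \<phi> u b + \<phi> v b)"
    by (rule D[THEN conjunct2, THEN conjunct2, THEN conjunct2, THEN conjunct1, THEN bspec, THEN bspec])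
  show "v \<in> carrier V \<Longrightarrow> c \<odot>\<^bsub>V\<^esub> v \<in> carrier V"
    by (rule D[THEN conjunct2, THEN conjunct2, THEN conjunct2, THEN conjunct2, THEN conjunct1, THEN bspec, THEN spec])
  show "v \<in> carrier V \<Longrightarrow> \<phi> (c \<odot>\<^bsub>V\<^esub> v) = (\<lambda>b. c * \<phi> v b)"
    by (rule D[THEN conjunct2, THEN conjunct2, THEN conjunct2, THEN conjunct2, THEN conjunct2, THEN conjunct1, THEN bspec, THEN spec])
  show "\<phi> \<zero>\<^bsub>V\<^esub> = (\<lambda>_. 0)" by (rule D[THEN conjunct2, THEN conjunct2, THEN conjunct2, THEN conjunct2, THEN conjunct2, THEN conjunct2, THEN conjunct1])
  show "bij_betw \<phi> (carrier V) (fsp B)" by (rule D[THEN conjunct2, THEN conjunct2, THEN conjunct2, THEN conjunct2, THEN conjunct2, THEN conjunct2, THEN conjunct2])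
qed

lemma coord_fsp: "coord V B \<phi> \<Longrightarrow> v \<in> carrier V \<Longrightarrow> \<phi> v \<in> fsp B"
  using bij_betwE[OF coordD(8)] by blast

lemma coord_inj: "coord V B \<phi> \<Longrightarrow> u \<in> carrier V \<Longrightarrow> v \<in> carrier V \<Longrightarrow> \<phi> u = \<phi> v \<Longrightarrow> u = v"
  using bij_betw_imp_inj_on[OF coordD(8)] by (rule inj_onD)

lemma coord_surj:
  assumes "coord V B \<phi>" "f \<in> fsp B" shows "\<exists>v\<in>carrier V. \<phi> v = f"
proof -
  have "f \<in> \<phi> ` carrier V"
    using bij_betw_imp_surj_on[OF coordD(8)[OF assms(1)]] assms(2) by simp
  then obtain v where "f = \<phi> v" "v \<in> carrier V" by (rule imageE)
  then show ?thesis by (intro bexI[of _ v]) simp_all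
qed

lemma coord_inv:
  assumes "coord V B \<phi>"
  shows "f \<in> fsp B \<Longrightarrow> inv_into (carrier V) \<phi> f \<in> carrier V"
    and "f \<in> fsp B \<Longrightarrow> \<phi> (inv_into (carrier V) \<phi> f) = f"
    and "v \<in> carrier V \<Longrightarrow> inv_into (carrier V) \<phi> (\<phi> v) = v"
  using coordD(8)[OF assms]
  by (auto simp: bij_betw_def inv_into_into f_inv_into_f intro: inv_into_f_f)

lemma coord_vectorspace:
  fixes V :: "('k :: field, 'v, 'z) module_scheme"
  assumes V: "coord V B \<phi>"
  shows "vectorspace class_ring V"
proof (rule vs_criteria)
  note D = coordD(2,3,5)[OF V] and L = coordD(4,6,7)[OF V] and eqI = coord_inj[OF V]
  show "\<forall>v\<in>carrier V. \<exists>w\<in>carrier V. v \<oplus>\<^bsub>V\<^esub> w = \<zero>\<^bsub>V\<^esub>"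
  proof
    fix v assume v: "v \<in> carrier V"
    have "v \<oplus>\<^bsub>V\<^esub> ((-1) \<odot>\<^bsub>V\<^esub> v) = \<zero>\<^bsub>V\<^esub>" by (rule eqI) (simp_all add: v D L)
    then show "\<exists>w\<in>carrier V. v \<oplus>\<^bsub>V\<^esub> w = \<zero>\<^bsub>V\<^esub>" using D v by blast
  qed
  show "\<forall>v w. v \<in> carrier V \<and> w \<in> carrier V \<longrightarrow> v \<oplus>\<^bsub>V\<^esub> w = w \<oplus>\<^bsub>V\<^esub> v"
    by (intro allI impI eqI) (simp_all add: D L add.commute)
  show "\<forall>v w x. v \<in> carrier V \<and> w \<in> carrier V \<and> x \<in> carrier V \<longrightarrow>
      v \<oplus>\<^bsub>V\<^esub> w \<oplus>\<^bsub>V\<^esub> x = v \<oplus>\<^bsub>V\<^esub> (w \<oplus>\<^bsub>V\<^esub> x)"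
    by (intro allI impI eqI) (simp_all add: D L add.assoc)
  show "\<forall>v\<in>carrier V. v \<oplus>\<^bsub>V\<^esub> \<zero>\<^bsub>V\<^esub> = v"
    by (intro ballI eqI) (simp_all add: D L)
  show "\<forall>a b v. a \<in> carrier class_ring \<and> b \<in> carrier class_ring \<and> v \<in> carrier V \<longrightarrow>
      (a \<otimes>\<^bsub>class_ring\<^esub> b) \<odot>\<^bsub>V\<^esub> v = a \<odot>\<^bsub>V\<^esub> (b \<odot>\<^bsub>V\<^esub> v)"
    by (intro allI impI eqI) (simp_all add: D L mult.assoc)
  show "\<forall>v\<in>carrier V. \<one>\<^bsub>class_ring\<^esub> \<odot>\<^bsub>V\<^esub> v = v"
    by (intro ballI eqI) (simp_all add: D L)
  show "\<forall>a b v. a \<in> carrier class_ring \<and> b \<in> carrier class_ring \<and> v \<in> carrier V \<longrightarrow>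
      (a \<oplus>\<^bsub>class_ring\<^esub> b) \<odot>\<^bsub>V\<^esub> v = a \<odot>\<^bsub>V\<^esub> v \<oplus>\<^bsub>V\<^esub> b \<odot>\<^bsub>V\<^esub> v"
    by (intro allI impI eqI) (simp_all add: D L distrib_right)
  show "\<forall>a v w. a \<in> carrier class_ring \<and> v \<in> carrier V \<and> w \<in> carrier V \<longrightarrow>
      a \<odot>\<^bsub>V\<^esub> (v \<oplus>\<^bsub>V\<^esub> w) = a \<odot>\<^bsub>V\<^esub> v \<oplus>\<^bsub>V\<^esub> a \<odot>\<^bsub>V\<^esub> w"
    by (intro allI impI eqI) (simp_all add: D L distrib_left)
qed (use class_field coordD(2,3,5)[OF V] in auto)

lemma coord_induct:
  assumes V: "coord V B \<phi>" and v: "v \<in> carrier V"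
    and zero: "P \<zero>\<^bsub>V\<^esub>"
    and add: "\<And>u v. u \<in> carrier V \<Longrightarrow> v \<in> carrier V \<Longrightarrow> P u \<Longrightarrow> P v \<Longrightarrow> P (u \<oplus>\<^bsub>V\<^esub> v)"
    and scale: "\<And>c v. v \<in> carrier V \<Longrightarrow> P v \<Longrightarrow> P (c \<odot>\<^bsub>V\<^esub> v)"
    and unit: "\<And>b v. b \<in> B \<Longrightarrow> v \<in> carrier V \<Longrightarrow> \<phi> v = unit_fun b \<Longrightarrow> P v"
  shows "P v"
proof -
  have "\<forall>v\<in>carrier V. \<phi> v \<in> fsp S \<longrightarrow> P v" if "S \<subseteq> B" "finite S" for S
    using that(2,1)
  proof (induction S rule: finite_induct)
    case empty
    show ?case
    proof (intro ballI impI)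
      fix v assume "v \<in> carrier V" "\<phi> v \<in> fsp {}"
      then have "v = \<zero>\<^bsub>V\<^esub>"
        using coord_inj[OF V] coordD[OF V] by (metis fspD empty_iff ext)
      then show "P v" using zero by simp
    qed
  next
    case (insert b S)
    show ?case
    proof (intro ballI impI)
      fix v assume v: "v \<in> carrier V" "\<phi> v \<in> fsp (insert b S)"
      obtain e where e: "e \<in> carrier V" "\<phi> e = unit_fun b"
        using coord_surj[OF V, of "unit_fun b"] insert.prems fsp_unit[of b B] by auto
      have "(\<phi> v)(b := 0) \<in> fsp B"
        using coord_fsp[OF V v(1)] by (auto simp: fsp_def)
      then obtain u where u: "u \<in> carrier V" "\<phi> u = (\<phi> v)(b := 0)"
        using coord_surj[OF V] by blast
      have "\<phi> u \<in> fsp S" using u v by (auto simp: fsp_def)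
      then have Pu: "P u" using insert u by blast
      have "v = u \<oplus>\<^bsub>V\<^esub> (\<phi> v b \<odot>\<^bsub>V\<^esub> e)"
        by (rule coord_inj[OF V])
          (use v e u coordD[OF V] in \<open>auto simp: unit_fun_def fun_eq_iff\<close>)
      then show "P v"
        using add[OF u(1) _ Pu scale[OF e(1)]] unit[OF _ e] coordD(5)[OF V e(1)] insert.prems
        by (metis insertI1 insert_subset)
    qed
  qed
  then show ?thesis using coord_fsp[OF V v] coordD(1)[OF V] v by blast
qed

lemma coord_fin_dim:
  fixes V :: "('k :: field, 'v, 'z) module_scheme"
  assumes V: "coord V B \<phi>"
  shows "vectorspace.fin_dim class_ring V"
proof -
  interpret vectorspace class_ring V by (rule coord_vectorspace[OF V])
  define A where "A = (\<lambda>b. inv_into (carrier V) \<phi> (unit_fun b)) ` B"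
  have A: "finite A" "A \<subseteq> carrier V"
    using coordD(1)[OF V] coord_inv(1)[OF V] by (auto simp: A_def fsp_unit)
  have sub: "submodule class_ring (span A) V" by (rule span_is_submodule[OF A(2)])
  have "v \<in> span A" if "v \<in> carrier V" for v
    using V that
  proof (rule coord_induct)
    show "u \<oplus>\<^bsub>V\<^esub> v \<in> span A" if "u \<in> span A" "v \<in> span A" for u v
      using submodule.m_closed[OF sub] that by blast
    show "c \<odot>\<^bsub>V\<^esub> v \<in> span A" if "v \<in> span A" for c v
      using submodule.smult_closed[OF sub] that by simp
    show "v \<in> span A" if "b \<in> B" "v \<in> carrier V" "\<phi> v = unit_fun b" for b v
      using in_own_span[OF A(2)] that coord_inv(3)[OF V that(2)] by (auto simp: A_def)
  qed (use submodule.zero_closed[OF sub] in auto)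
  then have "span A = carrier V" using span_is_subset2[OF A(2)] by blast
  then show ?thesis unfolding fin_dim_def using A by blast
qed

lemma coord_finsum:
  fixes V :: "('k :: field, 'v, 'z) module_scheme"
  assumes V: "coord V B \<phi>" and "finite S" "\<And>s. s \<in> S \<Longrightarrow> F s \<in> carrier V"
  shows "finsum V F S \<in> carrier V" "\<phi> (finsum V F S) = (\<lambda>b. \<Sum>s\<in>S. \<phi> (F s) b)"
proof -
  interpret vectorspace class_ring V by (rule coord_vectorspace[OF V])
  have "finsum V F S \<in> carrier V \<and> \<phi> (finsum V F S) = (\<lambda>b. \<Sum>s\<in>S. \<phi> (F s) b)"
    using assms(2,3)
  proof (induction S rule: finite_induct)
    case (insert s S)
    then have "F \<in> S \<rightarrow> carrier V" "F s \<in> carrier V" by auto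
    then have "finsum V F (insert s S) = F s \<oplus>\<^bsub>V\<^esub> finsum V F S"
      using insert.hyps by (simp add: finsum_insert)
    then show ?case using insert coordD(3,4)[OF V] by simp
  qed (use coordD[OF V] in auto)
  then show "finsum V F S \<in> carrier V" "\<phi> (finsum V F S) = (\<lambda>b. \<Sum>s\<in>S. \<phi> (F s) b)" by auto
qed

lemma coord_exists:
  fixes V :: "('k :: field, 'v, 'z) module_scheme"
  assumes V: "vectorspace class_ring V" and fd: "vectorspace.fin_dim class_ring V"
  shows "\<exists>(B :: 'v set) \<phi>. coord V B \<phi>"
proof -
  interpret vectorspace class_ring V by fact
  obtain B where B: "finite B" "basis B" using finite_basis_exists[OF fd] by blast
  then have BV: "B \<subseteq> carrier V" by (simp add: basis_def)
  have ex1: "\<exists>!a. a \<in> B \<rightarrow>\<^sub>E carrier class_ring \<and> lincomb a B = v" if "v \<in> carrier V" for v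
    using basis_criterion[OF B(1) BV] B(2) that by blast
  have restr: "lincomb (restrict a B) B = lincomb a B" for a
    by (rule lincomb_cong[OF refl BV]) auto
  define \<psi> where "\<psi> f = lincomb f B" for f
  have \<psi>: "bij_betw \<psi> (fsp B) (carrier V)"
    unfolding bij_betw_def
  proof (intro conjI inj_onI equalityI subsetI)
    fix f f' assume f: "f \<in> fsp B" "f' \<in> fsp B" "\<psi> f = \<psi> f'"
    have "\<psi> f \<in> carrier V" unfolding \<psi>_def by (rule lincomb_closed[OF BV]) simp
    from ex1[OF this] obtain a where
      a: "\<forall>a'. a' \<in> B \<rightarrow>\<^sub>E carrier class_ring \<and> lincomb a' B = \<psi> f \<longrightarrow> a' = a"
      by - (erule ex1E, rule that)
    have "restrict f B = a" by (rule a[rule_format]) (simp add: restr \<psi>_def)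
    moreover have "restrict f' B = a" by (rule a[rule_format]) (simp add: restr f(3) \<psi>_def[of f'])
    ultimately have "restrict f B = restrict f' B" by simp
    then have "f b = f' b" if "b \<in> B" for b
      using that by (metis restrict_apply')
    then show "f = f'" using fspD[OF f(1)] fspD[OF f(2)] by (intro ext) metis
  next
    fix v assume "v \<in> \<psi> ` fsp B"
    then show "v \<in> carrier V" unfolding \<psi>_def by (elim imageE) (simp add: lincomb_closed[OF BV])
  next
    fix v assume "v \<in> carrier V"
    then obtain a where a: "lincomb a B = v" using ex1 by blast
    have "lincomb (\<lambda>b. if b \<in> B then a b else 0) B = lincomb a B"
      by (rule lincomb_cong[OF refl BV]) auto
    then have "\<psi> (\<lambda>b. if b \<in> B then a b else 0) = v" using a by (simp add: \<psi>_def)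
    moreover have "(\<lambda>b. if b \<in> B then a b else 0) \<in> fsp B" by (simp add: fsp_def)
    ultimately show "v \<in> \<psi> ` fsp B" by (metis imageI)
  qed
  have \<psi>_add: "\<psi> (\<lambda>b. f b + f' b) = \<psi> f \<oplus>\<^bsub>V\<^esub> \<psi> f'" for f f'
    using lincomb_sum[OF B(1) BV, of f f'] by (simp add: \<psi>_def)
  have \<psi>_scale: "\<psi> (\<lambda>b. c * f b) = c \<odot>\<^bsub>V\<^esub> \<psi> f" for c f
    using lincomb_smult[OF BV, of f c] by (simp add: \<psi>_def)
  define \<phi> where "\<phi> = inv_into (fsp B) \<psi>"
  have \<phi>: "bij_betw \<phi> (carrier V) (fsp B)" unfolding \<phi>_def by (rule bij_betw_inv_into[OF \<psi>])
  have \<phi>_fsp: "\<phi> v \<in> fsp B" and \<psi>\<phi>: "\<psi> (\<phi> v) = v" if "v \<in> carrier V" for v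
    using \<phi> bij_betwE that bij_betw_inv_into_right[OF \<psi> that] by (auto simp: \<phi>_def)
  have \<phi>I: "\<phi> v = f" if "f \<in> fsp B" "\<psi> f = v" for f v
    using bij_betw_inv_into_left[OF \<psi> that(1)] that(2) by (simp add: \<phi>_def)
  have "coord V B \<phi>"
  proof (rule coordI)
    show "\<phi> (u \<oplus>\<^bsub>V\<^esub> v) = (\<lambda>b. \<phi> u b + \<phi> v b)" if "u \<in> carrier V" "v \<in> carrier V" for u v
      by (rule \<phi>I) (use that \<phi>_fsp \<psi>\<phi> \<psi>_add in auto)
    show "\<phi> (c \<odot>\<^bsub>V\<^esub> v) = (\<lambda>b. c * \<phi> v b)" if "v \<in> carrier V" for c v
      by (rule \<phi>I) (use that \<phi>_fsp \<psi>\<phi> \<psi>_scale in auto)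
    show "\<phi> \<zero>\<^bsub>V\<^esub> = (\<lambda>_. 0)"
    proof (rule \<phi>I)
      have "\<psi> (\<lambda>_. 0) \<in> carrier V" unfolding \<psi>_def by (rule lincomb_closed[OF BV]) simp
      then show "\<psi> (\<lambda>_. 0) = \<zero>\<^bsub>V\<^esub>"
        using \<psi>_scale[of 0 "\<lambda>_. 0"] lmult_0[of "\<psi> (\<lambda>_. 0)"] by simp
    qed simp
  qed (use B \<phi> in auto)
  then show ?thesis by blast
qed

section \<open>Modules over an algebra with a basis\<close>

text \<open>
  If the operators \<open>E a\<close> multiply like the basis elements of an algebra, then
  \<open>x \<mapsto> \<Sum> x\<^sub>a E a\<close> is multiplicative.
\<close>

lemma basis_algebra_act_mult:
  fixes E :: "'b \<Rightarrow> ('i \<Rightarrow> 'k :: field) \<Rightarrow> 'i \<Rightarrow> 'k"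
  assumes fin: "finite Bs"
    and lin: "\<And>a. a \<in> Bs \<Longrightarrow> lin_on B B (E a)"
    and mul: "\<And>a b f. a \<in> Bs \<Longrightarrow> b \<in> Bs \<Longrightarrow> f \<in> fsp B \<Longrightarrow>
      E a (E b f) = (\<lambda>i. \<Sum>c\<in>Bs. \<mu> a b c * E c f i)"
    and f: "f \<in> fsp B"
  shows "(\<lambda>i. \<Sum>c\<in>Bs. (x \<otimes>\<^bsub>basis_algebra Bs \<mu> u\<^esub> x') c * E c f i) =
    (\<lambda>i. \<Sum>a\<in>Bs. x a * E a (\<lambda>j. \<Sum>b\<in>Bs. x' b * E b f j) i)"
proof
  fix i
  have "(\<Sum>a\<in>Bs. x a * E a (\<lambda>j. \<Sum>b\<in>Bs. x' b * E b f j) i)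
      = (\<Sum>a\<in>Bs. x a * (\<Sum>b\<in>Bs. x' b * E a (E b f) i))"
    by (intro sum.cong refl) (simp add: lin_on_sum[OF lin lin_on_fsp[OF lin f]])
  also have "\<dots> = (\<Sum>a\<in>Bs. x a * (\<Sum>b\<in>Bs. x' b * (\<Sum>c\<in>Bs. \<mu> a b c * E c f i)))"
    by (intro sum.cong refl) (simp add: mul f)
  also have "\<dots> = (\<Sum>a\<in>Bs. \<Sum>b\<in>Bs. \<Sum>c\<in>Bs. x a * x' b * \<mu> a b c * E c f i)"
    by (simp add: sum_distrib_left mult.assoc)
  also have "\<dots> = (\<Sum>a\<in>Bs. \<Sum>c\<in>Bs. \<Sum>b\<in>Bs. x a * x' b * \<mu> a b c * E c f i)"
    by (intro sum.cong refl sum.swap)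
  also have "\<dots> = (\<Sum>c\<in>Bs. \<Sum>a\<in>Bs. \<Sum>b\<in>Bs. x a * x' b * \<mu> a b c * E c f i)"
    by (rule sum.swap)
  also have "\<dots> = (\<Sum>c\<in>Bs. (x \<otimes>\<^bsub>basis_algebra Bs \<mu> u\<^esub> x') c * E c f i)"
    by (simp add: basis_algebra_def sum_distrib_right)
  finally show "(\<Sum>c\<in>Bs. (x \<otimes>\<^bsub>basis_algebra Bs \<mu> u\<^esub> x') c * E c f i) =
    (\<Sum>a\<in>Bs. x a * E a (\<lambda>j. \<Sum>b\<in>Bs. x' b * E b f j) i)" ..
qed

lemma amodule_basis_algebraI:
  fixes E :: "'b \<Rightarrow> ('i \<Rightarrow> 'k :: field) \<Rightarrow> 'i \<Rightarrow> 'k" and V :: "('k, 'b \<Rightarrow> 'k, 'v) amod"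
  assumes fin: "finite Bs" and V: "coord V B \<phi>"
    and closed: "\<And>a b c. a \<in> Bs \<Longrightarrow> b \<in> Bs \<Longrightarrow> c \<notin> Bs \<Longrightarrow> \<mu> a b c = 0" "\<And>c. c \<notin> Bs \<Longrightarrow> u c = 0"
    and lin: "\<And>a. a \<in> Bs \<Longrightarrow> lin_on B B (E a)"
    and mul: "\<And>a b f. a \<in> Bs \<Longrightarrow> b \<in> Bs \<Longrightarrow> f \<in> fsp B \<Longrightarrow>
      E a (E b f) = (\<lambda>i. \<Sum>c\<in>Bs. \<mu> a b c * E c f i)"
    and unit: "\<And>f. f \<in> fsp B \<Longrightarrow> (\<lambda>i. \<Sum>c\<in>Bs. u c * E c f i) = f"
    and act: "\<And>x v. x \<in> carrier (basis_algebra Bs \<mu> u) \<Longrightarrow> v \<in> carrier V \<Longrightarrow>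
       act V x v \<in> carrier V \<and> \<phi> (act V x v) = (\<lambda>i. \<Sum>c\<in>Bs. x c * E c (\<phi> v) i)"
  shows "amodule (basis_algebra Bs \<mu> u) V"
proof -
  let ?A = "basis_algebra Bs \<mu> u"
  note D = coordD[OF V] and eqI = coord_inj[OF V] and fsp = coord_fsp[OF V]
  have A: "x \<oplus>\<^bsub>?A\<^esub> x' \<in> carrier ?A" "c \<odot>\<^bsub>?A\<^esub> x \<in> carrier ?A" "x \<otimes>\<^bsub>?A\<^esub> x' \<in> carrier ?A"
    if "x \<in> carrier ?A" "x' \<in> carrier ?A" for x x' c
    using that closed by (auto simp: basis_algebra_def intro!: sum.neutral)
  have opl: "lin_on B B (\<lambda>f i. \<Sum>c\<in>Bs. x c * E c f i)" for x
    by (rule lin_on_setsum[OF lin])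
  have actc: "act V x v \<in> carrier V"
    and acte: "\<phi> (act V x v) = (\<lambda>i. \<Sum>c\<in>Bs. x c * E c (\<phi> v) i)"
    if "x \<in> carrier ?A" "v \<in> carrier V" for x v
    using act[OF that] by blast+
  have hom: "act V x \<in> LinearCombinations.module_hom class_ring V V" if x: "x \<in> carrier ?A" for x
    unfolding LinearCombinations.module_hom_def
  proof (intro CollectI conjI allI impI funcsetI)
    show "act V x v \<in> carrier V" if "v \<in> carrier V" for v by (rule actc[OF x that])
    show "act V x (v \<oplus>\<^bsub>V\<^esub> w) = act V x v \<oplus>\<^bsub>V\<^esub> act V x w"
      if "v \<in> carrier V \<and> w \<in> carrier V" for v w
    proof (rule eqI)
      show "\<phi> (act V x (v \<oplus>\<^bsub>V\<^esub> w)) = \<phi> (act V x v \<oplus>\<^bsub>V\<^esub> act V x w)"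
        using that x lin_on_add[OF opl fsp fsp, of v w x] by (simp add: acte actc D(3,4))
    qed (use that x in \<open>simp_all add: actc D(3)\<close>)
    show "act V x (c \<odot>\<^bsub>V\<^esub> v) = c \<odot>\<^bsub>V\<^esub> act V x v"
      if "c \<in> carrier class_ring \<and> v \<in> carrier V" for c v
    proof (rule eqI)
      show "\<phi> (act V x (c \<odot>\<^bsub>V\<^esub> v)) = \<phi> (c \<odot>\<^bsub>V\<^esub> act V x v)"
        using that x lin_on_scale[OF opl fsp, of v x c] by (simp add: acte actc D(5,6))
    qed (use that x in \<open>simp_all add: actc D(5)\<close>)
  qed
  have add: "act V (x \<oplus>\<^bsub>?A\<^esub> x') v = act V x v \<oplus>\<^bsub>V\<^esub> act V x' v"
    if x: "x \<in> carrier ?A" "x' \<in> carrier ?A" and v: "v \<in> carrier V" for x x' v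
  proof (rule eqI)
    have "(x \<oplus>\<^bsub>?A\<^esub> x') c = x c + x' c" for c by (simp add: basis_algebra_def)
    then show "\<phi> (act V (x \<oplus>\<^bsub>?A\<^esub> x') v) = \<phi> (act V x v \<oplus>\<^bsub>V\<^esub> act V x' v)"
      using x v A(1)[OF x] by (simp add: acte actc D(4) sum.distrib distrib_right)
  qed (use x v A(1)[OF x] in \<open>simp_all add: actc D(3)\<close>)
  have scale: "act V (c \<odot>\<^bsub>?A\<^esub> x) v = c \<odot>\<^bsub>V\<^esub> act V x v"
    if x: "x \<in> carrier ?A" and v: "v \<in> carrier V" for c x v
  proof (rule eqI)
    have "(c \<odot>\<^bsub>?A\<^esub> x) d = c * x d" for d by (simp add: basis_algebra_def)
    then show "\<phi> (act V (c \<odot>\<^bsub>?A\<^esub> x) v) = \<phi> (c \<odot>\<^bsub>V\<^esub> act V x v)"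
      using x v A(2)[OF x x] by (simp add: acte actc D(6) sum_distrib_left mult.assoc)
  qed (use x v A(2)[OF x x] in \<open>simp_all add: actc D(5)\<close>)
  have mult: "act V (x \<otimes>\<^bsub>?A\<^esub> x') v = act V x (act V x' v)"
    if x: "x \<in> carrier ?A" "x' \<in> carrier ?A" and v: "v \<in> carrier V" for x x' v
  proof (rule eqI)
    show "\<phi> (act V (x \<otimes>\<^bsub>?A\<^esub> x') v) = \<phi> (act V x (act V x' v))"
      unfolding acte[OF A(3)[OF x] v] acte[OF x(1) actc[OF x(2) v]] acte[OF x(2) v]
      by (rule basis_algebra_act_mult[OF fin lin mul fsp[OF v]])
  qed (use x v A(3)[OF x] in \<open>simp_all add: actc\<close>)
  have one: "act V \<one>\<^bsub>?A\<^esub> v = v" if v: "v \<in> carrier V" for v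
  proof (rule eqI)
    have 1: "\<one>\<^bsub>?A\<^esub> \<in> carrier ?A" using closed(2) by (auto simp: basis_algebra_def)
    have "\<one>\<^bsub>?A\<^esub> = u" by (simp add: basis_algebra_def)
    then show "\<phi> (act V \<one>\<^bsub>?A\<^esub> v) = \<phi> v"
      unfolding acte[OF 1 v] using unit[OF fsp[OF v]] by simp
    show "act V \<one>\<^bsub>?A\<^esub> v \<in> carrier V" by (rule actc[OF 1 v])
  qed (use v in auto)
  show ?thesis
    unfolding amodule_def
    by (intro conjI ballI allI coord_vectorspace[OF V] coord_fin_dim[OF V] hom add scale mult one)
qed

lemma amoduleD:
  assumes "amodule A V"
  shows "vectorspace class_ring V" "vectorspace.fin_dim class_ring V"
    and "a \<in> carrier A \<Longrightarrow> v \<in> carrier V \<Longrightarrow> act V a v \<in> carrier V"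
    and "a \<in> carrier A \<Longrightarrow> v \<in> carrier V \<Longrightarrow> w \<in> carrier V \<Longrightarrow>
      act V a (v \<oplus>\<^bsub>V\<^esub> w) = act V a v \<oplus>\<^bsub>V\<^esub> act V a w"
    and "a \<in> carrier A \<Longrightarrow> v \<in> carrier V \<Longrightarrow> act V a (c \<odot>\<^bsub>V\<^esub> v) = c \<odot>\<^bsub>V\<^esub> act V a v"
    and "a \<in> carrier A \<Longrightarrow> b \<in> carrier A \<Longrightarrow> v \<in> carrier V \<Longrightarrow>
      act V (a \<oplus>\<^bsub>A\<^esub> b) v = act V a v \<oplus>\<^bsub>V\<^esub> act V b v"
    and "a \<in> carrier A \<Longrightarrow> v \<in> carrier V \<Longrightarrow> act V (c \<odot>\<^bsub>A\<^esub> a) v = c \<odot>\<^bsub>V\<^esub> act V a v"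
    and "a \<in> carrier A \<Longrightarrow> b \<in> carrier A \<Longrightarrow> v \<in> carrier V \<Longrightarrow>
      act V (a \<otimes>\<^bsub>A\<^esub> b) v = act V a (act V b v)"
    and "v \<in> carrier V \<Longrightarrow> act V \<one>\<^bsub>A\<^esub> v = v"
proof -
  note D = assms[unfolded amodule_def]
  have hom: "a \<in> carrier A \<Longrightarrow> act V a \<in> LinearCombinations.module_hom class_ring V V"
    by (rule D[THEN conjunct2, THEN conjunct2, THEN conjunct1, THEN bspec])
  show "vectorspace class_ring V" by (rule D[THEN conjunct1])
  show "vectorspace.fin_dim class_ring V" by (rule D[THEN conjunct2, THEN conjunct1])
  show "a \<in> carrier A \<Longrightarrow> v \<in> carrier V \<Longrightarrow> act V a v \<in> carrier V"
    using funcset_mem[OF module_hom_closed[OF hom]] .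
  show "a \<in> carrier A \<Longrightarrow> v \<in> carrier V \<Longrightarrow> w \<in> carrier V \<Longrightarrow>
      act V a (v \<oplus>\<^bsub>V\<^esub> w) = act V a v \<oplus>\<^bsub>V\<^esub> act V a w"
    using module_hom_add[OF hom] .
  show "a \<in> carrier A \<Longrightarrow> v \<in> carrier V \<Longrightarrow> act V a (c \<odot>\<^bsub>V\<^esub> v) = c \<odot>\<^bsub>V\<^esub> act V a v"
    using module_hom_smult[OF hom, of c v] by simp
  show "a \<in> carrier A \<Longrightarrow> b \<in> carrier A \<Longrightarrow> v \<in> carrier V \<Longrightarrow>
      act V (a \<oplus>\<^bsub>A\<^esub> b) v = act V a v \<oplus>\<^bsub>V\<^esub> act V b v"
    by (rule D[THEN conjunct2, THEN conjunct2, THEN conjunct2, THEN conjunct1,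
          THEN bspec, THEN bspec, THEN bspec])
  show "a \<in> carrier A \<Longrightarrow> v \<in> carrier V \<Longrightarrow> act V (c \<odot>\<^bsub>A\<^esub> a) v = c \<odot>\<^bsub>V\<^esub> act V a v"
    by (rule D[THEN conjunct2, THEN conjunct2, THEN conjunct2, THEN conjunct2, THEN conjunct1,
          THEN spec, THEN bspec, THEN bspec])
  show "a \<in> carrier A \<Longrightarrow> b \<in> carrier A \<Longrightarrow> v \<in> carrier V \<Longrightarrow>
      act V (a \<otimes>\<^bsub>A\<^esub> b) v = act V a (act V b v)"
    by (rule D[THEN conjunct2, THEN conjunct2, THEN conjunct2, THEN conjunct2, THEN conjunct2,
          THEN conjunct1, THEN bspec, THEN bspec, THEN bspec])
  show "v \<in> carrier V \<Longrightarrow> act V \<one>\<^bsub>A\<^esub> v = v"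
    by (rule D[THEN conjunct2, THEN conjunct2, THEN conjunct2, THEN conjunct2, THEN conjunct2,
          THEN conjunct2, THEN bspec])
qed

text \<open>
  The action of an algebra element is determined by the basis elements. The proof removes one basis
  element at a time from the support of \<open>x\<close>.
\<close>

lemma amodule_coord_act:
  fixes V :: "('k :: field, 'b \<Rightarrow> 'k, 'v) amod"
  assumes fin: "finite Bs" and M: "amodule (basis_algebra Bs \<mu> u) V" and V: "coord V B \<phi>"
    and x: "x \<in> carrier (basis_algebra Bs \<mu> u)" and v: "v \<in> carrier V"
  shows "\<phi> (act V x v) = (\<lambda>i. \<Sum>b\<in>Bs. x b * \<phi> (act V (unit_fun b) v) i)"
proof -
  let ?A = "basis_algebra Bs \<mu> u"
  have unitA: "unit_fun b \<in> carrier ?A" if "b \<in> Bs" for b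
    using that by (auto simp: basis_algebra_def unit_fun_def)
  have "\<phi> (act V x v) = (\<lambda>i. \<Sum>b\<in>S. x b * \<phi> (act V (unit_fun b) v) i)"
    if "finite S" "S \<subseteq> Bs" "x \<in> fsp S" for S x
    using that
  proof (induction S arbitrary: x rule: finite_induct)
    case empty
    then have x0: "x = 0 \<odot>\<^bsub>?A\<^esub> x" and xA: "x \<in> carrier ?A"
      by (auto simp: basis_algebra_def fsp_def fun_eq_iff)
    have "act V x v = 0 \<odot>\<^bsub>V\<^esub> act V x v"
      using amoduleD(7)[OF M xA v, of 0] x0 by simp
    moreover have "\<phi> (0 \<odot>\<^bsub>V\<^esub> act V x v) = (\<lambda>i. 0 * \<phi> (act V x v) i)"
      by (rule coordD(6)[OF V amoduleD(3)[OF M xA v]])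
    ultimately show ?case by simp
  next
    case (insert b S)
    let ?y = "x(b := 0)"
    have y: "?y \<in> fsp S" "?y \<in> carrier ?A" using insert.prems by (auto simp: fsp_def basis_algebra_def)
    have b: "unit_fun b \<in> carrier ?A" using insert.prems unitA by auto
    have bA: "x b \<odot>\<^bsub>?A\<^esub> unit_fun b \<in> carrier ?A"
      using b by (auto simp: basis_algebra_def)
    have xeq: "x = ?y \<oplus>\<^bsub>?A\<^esub> (x b \<odot>\<^bsub>?A\<^esub> unit_fun b)"
      by (auto simp: basis_algebra_def unit_fun_def fun_eq_iff)
    have "act V x v = act V ?y v \<oplus>\<^bsub>V\<^esub> x b \<odot>\<^bsub>V\<^esub> act V (unit_fun b) v"
      by (subst xeq) (simp add: amoduleD(6)[OF M y(2) bA v] amoduleD(7)[OF M b v])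
    then have "\<phi> (act V x v) = (\<lambda>i. \<phi> (act V ?y v) i + x b * \<phi> (act V (unit_fun b) v) i)"
      using coordD(4-6)[OF V] amoduleD(3)[OF M _ v] y(2) b by simp
    also have "\<phi> (act V ?y v) = (\<lambda>i. \<Sum>b\<in>S. x b * \<phi> (act V (unit_fun b) v) i)"
    proof -
      have "\<phi> (act V ?y v) = (\<lambda>i. \<Sum>b\<in>S. ?y b * \<phi> (act V (unit_fun b) v) i)"
        using insert.prems by (intro insert.IH y(1)) simp
      also have "\<dots> = (\<lambda>i. \<Sum>b\<in>S. x b * \<phi> (act V (unit_fun b) v) i)"
        by (intro ext sum.cong) (use insert.hyps in auto)
      finally show ?thesis .
    qed
    finally show ?case using insert.hyps by (simp add: add.commute)
  qed
  from this[OF fin order_refl, of x] x show ?thesis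
    by (auto simp: basis_algebra_def fsp_def)
qed

lemma with_act_simps [simp]:
  "carrier (with_act V f) = carrier V" "zero (with_act V f) = zero V" "add (with_act V f) = add V"
  "module.smult (with_act V f) = module.smult V" "act (with_act V f) = f"
  by (simp_all add: with_act_def module.defs amod.defs)

lemma coord_with_act [simp]: "coord (with_act V f) B \<phi> \<longleftrightarrow> coord V B \<phi>"
  by (simp add: coord_def)

section \<open>Modules over \<open>H\<close> as representations\<close>

lemma sum_unit_fun:
  fixes F :: "'s \<Rightarrow> 'k :: field"
  assumes "finite S" "s \<in> S"
  shows "(\<Sum>c\<in>S. unit_fun s c * F c) = F s"
proof -
  have "(\<Sum>c\<in>S. unit_fun s c * F c) = (\<Sum>c\<in>S. if c = s then F c else 0)"
    by (intro sum.cong) (auto simp: unit_fun_def)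
  then show ?thesis using assms by simp
qed

text \<open>
  Coordinate spaces with an arbitrary finite index set are realised on vectors of the corresponding
  length, so that each representation is described by a module whose carrier consists of such
  vectors, as the classes of the Green ring require.
\<close>

lemma vec_coord:
  assumes "finite B"
  shows "\<exists>\<phi>. coord (module_vec TYPE('k :: field) (card B)) B \<phi>"
proof -
  obtain e where e: "bij_betw e {0..<card B} B" using ex_bij_betw_nat_finite[OF assms] by blast
  define e' where "e' = inv_into {0..<card B} e"
  have e'1: "e' b < card B" "e (e' b) = b" if "b \<in> B" for b
    using bij_betw_inv_into_right[OF e that] bij_betwE[OF bij_betw_inv_into[OF e]] that
    by (auto simp: e'_def)
  have e'2: "e' (e i) = i" "e i \<in> B" if "i < card B" for i
    using bij_betw_inv_into_left[OF e] bij_betwE[OF e] that by (auto simp: e'_def)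
  define \<phi> where "\<phi> v = (\<lambda>b. if b \<in> B then v $ e' b else 0)" for v :: "'k vec"
  have bij: "bij_betw \<phi> (carrier_vec (card B)) (fsp B)"
  proof (rule bij_betw_byWitness[of _ "\<lambda>f. vec (card B) (\<lambda>i. f (e i))"])
    show "\<forall>v\<in>carrier_vec (card B). vec (card B) (\<lambda>i. \<phi> v (e i)) = v"
      using e'2 by (auto simp: \<phi>_def intro!: eq_vecI)
    show "\<forall>f\<in>fsp B. \<phi> (vec (card B) (\<lambda>i. f (e i))) = f"
      using e'1 by (auto simp: \<phi>_def fun_eq_iff fspD)
  qed (auto simp: \<phi>_def fsp_def)
  have "coord (module_vec TYPE('k) (card B)) B \<phi>"
    by (rule coordI) (use assms bij e'1 in \<open>auto simp: module_vec_simps \<phi>_def fun_eq_iff\<close>)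
  then show ?thesis by blast
qed

context nilpotent_group_datum
begin

abbreviation H :: "('k, nat \<times> 'a \<Rightarrow> 'k) module" where
  "H \<equiv> H_alg G \<chi> n"

definition basis_act :: "('a, 'i, 'k) crep \<Rightarrow> nat \<times> 'a \<Rightarrow> ('i \<Rightarrow> 'k) \<Rightarrow> 'i \<Rightarrow> 'k" where
  "basis_act R p f = (yact R ^^ fst p) (gact R (snd p) f)"

definition hact :: "('a, 'i, 'k) crep \<Rightarrow> (nat \<times> 'a \<Rightarrow> 'k) \<Rightarrow> ('i \<Rightarrow> 'k) \<Rightarrow> 'i \<Rightarrow> 'k" where
  "hact R x f = (\<lambda>b. \<Sum>p\<in>H_basis G n. x p * basis_act R p f b)"

lemma lin_on_basis_act:
  assumes R: "is_rep R" and p: "p \<in> H_basis G n"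
  shows "lin_on (idx R) (idx R) (basis_act R p)"
  unfolding basis_act_def[abs_def]
  using lin_on_comp[OF is_repD(2)[OF R] lin_on_funpow[OF is_repD(3)[OF R]]] p
  by (auto simp: H_basis_def)

lemma lin_on_hact:
  assumes R: "is_rep R"
  shows "lin_on (idx R) (idx R) (hact R x)"
  unfolding hact_def[abs_def] by (rule lin_on_setsum[OF lin_on_basis_act[OF R]])

lemma yact_pow_gact:
  assumes R: "is_rep R" and h: "h \<in> carrier G" and f: "f \<in> fsp (idx R)"
  shows "(yact R ^^ j) (gact R h f) = (\<lambda>b. \<chi> h ^ j * gact R h ((yact R ^^ j) f) b)"
proof (induction j)
  case (Suc j)
  have fj: "(yact R ^^ j) f \<in> fsp (idx R)" by (rule is_rep_closed(3)[OF R f])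
  have "(yact R ^^ Suc j) (gact R h f) = yact R (\<lambda>b. \<chi> h ^ j * gact R h ((yact R ^^ j) f) b)"
    using Suc by simp
  also have "\<dots> = (\<lambda>b. \<chi> h ^ j * yact R (gact R h ((yact R ^^ j) f)) b)"
    by (rule lin_on_scale[OF is_repD(3)[OF R] is_rep_closed(1)[OF R fj h]])
  also have "\<dots> = (\<lambda>b. \<chi> h ^ Suc j * gact R h ((yact R ^^ Suc j) f) b)"
    unfolding is_repD(6)[OF R h fj] by (simp add: fun_eq_iff)
  finally show ?case .
qed simp

lemma gact_yact_pow:
  assumes R: "is_rep R" and h: "h \<in> carrier G" and f: "f \<in> fsp (idx R)"
  shows "gact R h ((yact R ^^ j) f) = (\<lambda>b. inverse (\<chi> h) ^ j * (yact R ^^ j) (gact R h f) b)"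
  unfolding yact_pow_gact[OF assms]
  using chi_nonzero[OF h] by (simp add: fun_eq_iff mult.assoc[symmetric] power_mult_distrib[symmetric])

lemma yact_pow_zero:
  assumes R: "is_rep R" and f: "f \<in> fsp (idx R)" and "n \<le> j"
  shows "(yact R ^^ j) f = (\<lambda>_. 0)"
proof -
  obtain m where "j = n + m" using \<open>n \<le> j\<close> le_Suc_ex by blast
  then have "(yact R ^^ j) f = (yact R ^^ n) ((yact R ^^ m) f)" by (simp add: funpow_add)
  then show ?thesis using is_repD(7)[OF R is_rep_closed(3)[OF R f]] by simp
qed

text \<open>
  \<open>y\<^sup>i h y\<^sup>j k = \<chi>(h)\<^bsup>-j\<^esup> y\<^bsup>i+j\<^esup> h k\<close>, by moving \<open>h\<close> past \<open>y\<^sup>j\<close>. The case \<open>i + j \<ge> n\<close>, in which the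
  structure constants are zero, is the relation \<open>y\<^sup>n = 0\<close>.
\<close>

lemma basis_act_mult:
  assumes R: "is_rep R" and p: "p \<in> H_basis G n" and p': "p' \<in> H_basis G n"
    and f: "f \<in> fsp (idx R)"
  shows "basis_act R p (basis_act R p' f) =
    (\<lambda>b. \<Sum>c\<in>H_basis G n. H_mult G \<chi> n p p' c * basis_act R c f b)"
proof -
  obtain i h j k where [simp]: "p = (i, h)" "p' = (j, k)" by (cases p, cases p')
  have h: "h \<in> carrier G" and k: "k \<in> carrier G" using p p' by (auto simp: H_basis_def)
  have fk: "gact R k f \<in> fsp (idx R)" by (rule is_rep_closed(1)[OF R f k])
  have fhk: "gact R (h \<otimes> k) f \<in> fsp (idx R)" by (rule is_rep_closed(1)[OF R f]) (use h k in simp)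
  have "basis_act R p (basis_act R p' f) =
      (yact R ^^ i) (\<lambda>b. inverse (\<chi> h) ^ j * (yact R ^^ j) (gact R (h \<otimes> k) f) b)"
    unfolding basis_act_def using gact_yact_pow[OF R h fk] is_repD(5)[OF R h k f] by simp
  also have "\<dots> = (\<lambda>b. inverse (\<chi> h) ^ j * (yact R ^^ (i + j)) (gact R (h \<otimes> k) f) b)"
    using lin_on_scale[OF lin_on_funpow[OF is_repD(3)[OF R]] is_rep_closed(3)[OF R fhk]]
    by (simp add: funpow_add)
  also have "\<dots> = (\<lambda>b. \<Sum>c\<in>H_basis G n. H_mult G \<chi> n p p' c * basis_act R c f b)"
  proof (cases "i + j < n")
    case True
    then have "(i + j, h \<otimes> k) \<in> H_basis G n" using h k by (simp add: H_basis_def)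
    then show ?thesis
      using True sum_unit_fun[OF finite_H_basis, of "(i + j, h \<otimes> k)" "\<lambda>c. basis_act R c f b" for b]
      by (simp add: H_mult_def mult.assoc sum_distrib_left[symmetric]) (simp add: basis_act_def)
  next
    case False
    then show ?thesis using yact_pow_zero[OF R fhk, of "i + j"] by (simp add: H_mult_def)
  qed
  finally show ?thesis .
qed

definition rep_map :: "('k, nat \<times> 'a \<Rightarrow> 'k, 'v) amod \<Rightarrow> ('a, 'i, 'k) crep \<Rightarrow> ('v \<Rightarrow> 'i \<Rightarrow> 'k) \<Rightarrow> bool" where
  "rep_map M R \<phi> \<longleftrightarrow> coord M (idx R) \<phi> \<and>
     (\<forall>x\<in>carrier H. \<forall>v\<in>carrier M. act M x v \<in> carrier M) \<and>
     (\<forall>x\<in>carrier H. \<forall>v\<in>carrier M. \<phi> (act M x v) = hact R x (\<phi> v))"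

lemma rep_mapD:
  assumes "rep_map M R \<phi>"
  shows "coord M (idx R) \<phi>"
    and "x \<in> carrier H \<Longrightarrow> v \<in> carrier M \<Longrightarrow> act M x v \<in> carrier M"
    and "x \<in> carrier H \<Longrightarrow> v \<in> carrier M \<Longrightarrow> \<phi> (act M x v) = hact R x (\<phi> v)"
proof -
  note D = assms[unfolded rep_map_def]
  show "coord M (idx R) \<phi>" by (rule D[THEN conjunct1])
  show "x \<in> carrier H \<Longrightarrow> v \<in> carrier M \<Longrightarrow> act M x v \<in> carrier M"
    by (rule D[THEN conjunct2, THEN conjunct1, THEN bspec, THEN bspec])
  show "x \<in> carrier H \<Longrightarrow> v \<in> carrier M \<Longrightarrow> \<phi> (act M x v) = hact R x (\<phi> v)"
    by (rule D[THEN conjunct2, THEN conjunct2, THEN bspec, THEN bspec])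
qed

text \<open>
  The module \<open>M\<close> has \<open>R\<close> as its family of operators in suitable coordinates.
\<close>

definition has_rep :: "('k, nat \<times> 'a \<Rightarrow> 'k, 'v) amod \<Rightarrow> ('a, 'i, 'k) crep \<Rightarrow> bool" where
  "has_rep M R \<longleftrightarrow> is_rep R \<and> (\<exists>\<phi>. rep_map M R \<phi>)"

lemma has_repI:
  assumes "is_rep R" "coord M (idx R) \<phi>"
    and "\<And>x v. x \<in> carrier H \<Longrightarrow> v \<in> carrier M \<Longrightarrow> act M x v \<in> carrier M"
    and "\<And>x v. x \<in> carrier H \<Longrightarrow> v \<in> carrier M \<Longrightarrow> \<phi> (act M x v) = hact R x (\<phi> v)"
  shows "has_rep M R"
  unfolding has_rep_def rep_map_def
  by (intro conjI exI[of _ \<phi>] ballI assms; assumption)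

lemma has_rep_is_rep: "has_rep M R \<Longrightarrow> is_rep R"
  by (simp add: has_rep_def)

lemma has_rep_amodule:
  assumes "has_rep M R" shows "amodule H M"
proof -
  from assms obtain \<phi> where a_map: "rep_map M R \<phi>"
    unfolding has_rep_def by blast
  note \<phi> = rep_mapD(1)[OF a_map] and c = rep_mapD(2)[OF a_map] and a = rep_mapD(3)[OF a_map]
  note R = has_rep_is_rep[OF assms]
  show ?thesis
    unfolding H_alg_def
  proof (rule amodule_basis_algebraI[OF finite_H_basis \<phi>])
    show "H_mult G \<chi> n p p' c = 0" if "p \<in> H_basis G n" "p' \<in> H_basis G n" "c \<notin> H_basis G n" for p p' c
      using that by (auto simp: H_mult_def H_basis_def unit_fun_def)
    show "unit_fun (0, \<one>) c = 0" if "c \<notin> H_basis G n" for c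
      using that n_ge_2 by (auto simp: H_basis_def unit_fun_def)
    show "lin_on (idx R) (idx R) (basis_act R p)" if "p \<in> H_basis G n" for p
      by (rule lin_on_basis_act[OF R that])
    show "basis_act R p (basis_act R p' f) =
        (\<lambda>i. \<Sum>c\<in>H_basis G n. H_mult G \<chi> n p p' c * basis_act R c f i)"
      if "p \<in> H_basis G n" "p' \<in> H_basis G n" "f \<in> fsp (idx R)" for p p' f
      by (rule basis_act_mult[OF R that])
    have "(0, \<one>) \<in> H_basis G n" using n_ge_2 by (simp add: H_basis_def)
    then show "(\<lambda>i. \<Sum>c\<in>H_basis G n. unit_fun (0, \<one>) c * basis_act R c f i) = f"
      if "f \<in> fsp (idx R)" for f
      using sum_unit_fun[OF finite_H_basis, of "(0, \<one>)" "\<lambda>c. basis_act R c f i" for i]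
        is_repD(4)[OF R that] by (simp add: basis_act_def[of R "(0, \<one>)"])
    show "act M x v \<in> carrier M \<and> \<phi> (act M x v) = (\<lambda>i. \<Sum>c\<in>H_basis G n. x c * basis_act R c (\<phi> v) i)"
      if "x \<in> carrier (basis_algebra (H_basis G n) (H_mult G \<chi> n) (unit_fun (0, \<one>)))"
        "v \<in> carrier M" for x v
      using c[of x v] a[of x v] that unfolding H_alg_def hact_def by blast
  qed
qed

lemma H_unit_fun_closed: "p \<in> H_basis G n \<Longrightarrow> unit_fun p \<in> carrier H"
  by (auto simp: H_alg_def basis_algebra_def unit_fun_def)

lemma H_grp_closed: "h \<in> carrier G \<Longrightarrow> H_grp h \<in> carrier H"
  and H_y_closed: "H_y G \<in> carrier H"
  using n_ge_2 by (auto intro!: H_unit_fun_closed simp: H_basis_def)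

lemma amodule_act_basis:
  assumes M: "amodule H M" and i: "i < n" and h: "h \<in> carrier G" and v: "v \<in> carrier M"
  shows "act M (unit_fun (i, h)) v = (act M (H_y G) ^^ i) (act M (H_grp h) v)"
  using i
proof (induction i)
  case (Suc i)
  have "H_y G \<otimes>\<^bsub>H\<^esub> unit_fun (i, h) = unit_fun (Suc i, h)"
    using H_mult_unit_fun[of 1 i \<one> h] Suc.prems h n_ge_2 chi_one
    by (simp add: H_alg_def basis_algebra_def)
  moreover have "unit_fun (i, h) \<in> carrier H"
    using Suc.prems h by (intro H_unit_fun_closed) (simp add: H_basis_def)
  ultimately show ?case
    using amoduleD(8)[OF M H_y_closed _ v, of "unit_fun (i, h)"] Suc by simp
qed simp

text \<open>
  Coordinates exist by finite dimension, and the operators of \<open>h\<close> and \<open>y\<close> are transported along them.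
  They satisfy the relations because the basis elements of \<open>H\<close> do, and they determine the action of
  all of \<open>H\<close> because the basis elements \<open>y\<^sup>i h\<close> are products of these generators.
\<close>

lemma amodule_has_rep:
  fixes M :: "('k, nat \<times> 'a \<Rightarrow> 'k, 'v) amod"
  assumes M: "amodule H M"
  shows "\<exists>R :: ('a, 'v, 'k) crep. has_rep M R"
proof -
  obtain B :: "'v set" and \<phi> where \<phi>: "coord M B \<phi>"
    using coord_exists[OF amoduleD(1,2)[OF M]] by blast
  define \<psi> where "\<psi> = inv_into (carrier M) \<phi>"
  have \<psi>: "\<psi> f \<in> carrier M" "\<phi> (\<psi> f) = f" if "f \<in> fsp B" for f
    using coord_inv(1,2)[OF \<phi> that] by (simp_all add: \<psi>_def)
  have \<psi>\<phi>: "\<psi> (\<phi> v) = v" if "v \<in> carrier M" for v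
    using coord_inv(3)[OF \<phi> that] by (simp add: \<psi>_def)
  have \<psi>_add: "\<psi> (\<lambda>b. f b + f' b) = \<psi> f \<oplus>\<^bsub>M\<^esub> \<psi> f'" if "f \<in> fsp B" "f' \<in> fsp B" for f f'
    using \<psi>\<phi>[of "\<psi> f \<oplus>\<^bsub>M\<^esub> \<psi> f'"] \<psi> that coordD(3,4)[OF \<phi>] by simp
  have \<psi>_scale: "\<psi> (\<lambda>b. c * f b) = c \<odot>\<^bsub>M\<^esub> \<psi> f" if "f \<in> fsp B" for c f
    using \<psi>\<phi>[of "c \<odot>\<^bsub>M\<^esub> \<psi> f"] \<psi> that coordD(5,6)[OF \<phi>] by simp
  define R where "R = \<lparr>idx = B, gact = (\<lambda>h f. \<phi> (act M (H_grp h) (\<psi> f))),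
    yact = (\<lambda>f. \<phi> (act M (H_y G) (\<psi> f)))\<rparr>"
  have lin: "lin_on B B (\<lambda>f. \<phi> (act M x (\<psi> f)))" if x: "x \<in> carrier H" for x
  proof (rule lin_onI)
    fix f :: "'v \<Rightarrow> 'k" assume f: "f \<in> fsp B"
    show "\<phi> (act M x (\<psi> f)) \<in> fsp B"
      by (rule coord_fsp[OF \<phi> amoduleD(3)[OF M x \<psi>(1)[OF f]]])
    show "\<phi> (act M x (\<psi> (\<lambda>b. c * f b))) = (\<lambda>b. c * \<phi> (act M x (\<psi> f)) b)" for c
      using coordD(6)[OF \<phi>] by (simp add: \<psi>_scale[OF f] amoduleD(3,5)[OF M x \<psi>(1)[OF f]])
    fix f' :: "'v \<Rightarrow> 'k" assume f': "f' \<in> fsp B"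
    show "\<phi> (act M x (\<psi> (\<lambda>b. f b + f' b))) = (\<lambda>b. \<phi> (act M x (\<psi> f)) b + \<phi> (act M x (\<psi> f')) b)"
      using coordD(4)[OF \<phi>]
      by (simp add: \<psi>_add[OF f f'] amoduleD(4)[OF M x \<psi>(1)[OF f] \<psi>(1)[OF f']]
          amoduleD(3)[OF M x \<psi>(1)[OF f]] amoduleD(3)[OF M x \<psi>(1)[OF f']])
  qed
  have ac: "act M x v \<in> carrier M" if "x \<in> carrier H" "v \<in> carrier M" for x v
    by (rule amoduleD(3)[OF M that])
  have comp: "\<phi> (act M x (\<psi> (\<phi> (act M x' v)))) = \<phi> (act M (x \<otimes>\<^bsub>H\<^esub> x') v)"
    if "x \<in> carrier H" "x' \<in> carrier H" "v \<in> carrier M" for x x' v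
    using amoduleD(8)[OF M that] \<psi>\<phi>[OF ac[OF that(2,3)]] by simp
  have ypow: "(yact R ^^ i) (\<phi> v) = \<phi> ((act M (H_y G) ^^ i) v) \<and>
      (act M (H_y G) ^^ i) v \<in> carrier M" if "v \<in> carrier M" for i v
    by (induction i) (use that \<psi>\<phi> ac H_y_closed in \<open>auto simp: R_def\<close>)
  have ypow_n: "(act M (H_y G) ^^ n) v = \<zero>\<^bsub>M\<^esub>" if v: "v \<in> carrier M" for v
  proof -
    obtain k where k: "n = Suc k" using n_ge_2 by (cases n) auto
    have u: "unit_fun (k, \<one>) \<in> carrier H"
      by (rule H_unit_fun_closed) (simp add: H_basis_def k)
    have one: "act M (H_grp \<one>) v = v"
      using amoduleD(9)[OF M v] by (simp add: H_alg_def basis_algebra_def)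
    have z: "H_y G \<otimes>\<^bsub>H\<^esub> unit_fun (k, \<one>) = 0 \<odot>\<^bsub>H\<^esub> H_y G"
      using H_mult_unit_fun[of 1 k \<one> \<one>] n_ge_2 k by (simp add: H_alg_def basis_algebra_def)
    have "(act M (H_y G) ^^ n) v = act M (H_y G) (act M (unit_fun (k, \<one>)) v)"
      using amodule_act_basis[OF M _ one_closed v, of k] k one by simp
    also have "\<dots> = 0 \<odot>\<^bsub>M\<^esub> act M (H_y G) v"
      using amoduleD(8)[OF M H_y_closed u v] amoduleD(7)[OF M H_y_closed v] z by simp
    also have "\<dots> = \<zero>\<^bsub>M\<^esub>"
    proof -
      interpret vectorspace class_ring M by (rule amoduleD(1)[OF M])
      show ?thesis using lmult_0[OF ac[OF H_y_closed v]] by simp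
    qed
    finally show ?thesis .
  qed
  have R: "is_rep R"
    unfolding is_rep_def
  proof (intro conjI ballI)
    show "finite (idx R)" using coordD(1)[OF \<phi>] by (simp add: R_def)
    show "lin_on (idx R) (idx R) (yact R)" using lin[OF H_y_closed] by (simp add: R_def)
    show "lin_on (idx R) (idx R) (gact R h)" if "h \<in> carrier G" for h
      using lin[OF H_grp_closed[OF that]] by (simp add: R_def)
    fix f :: "'v \<Rightarrow> 'k" assume "f \<in> fsp (idx R)"
    then have f: "f \<in> fsp B" by (simp add: R_def)
    obtain v where v: "v \<in> carrier M" and fv: "f = \<phi> v" using \<psi>[OF f] by metis
    show "gact R \<one> f = f"
      using amoduleD(9)[OF M v] \<psi>\<phi>[OF v] by (simp add: R_def fv H_alg_def basis_algebra_def)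
    show "(yact R ^^ n) f = (\<lambda>_. 0)"
      using ypow[OF v, of n] ypow_n[OF v] coordD(7)[OF \<phi>] by (simp add: fv)
    fix h assume h: "h \<in> carrier G"
    note hc = H_grp_closed[OF h]
    have "yact R (gact R h f) = \<phi> (act M (H_y G \<otimes>\<^bsub>H\<^esub> H_grp h) v)"
      using comp[OF H_y_closed hc v] \<psi>\<phi>[OF v] by (simp add: R_def fv)
    also have "act M (H_y G \<otimes>\<^bsub>H\<^esub> H_grp h) v = \<chi> h \<odot>\<^bsub>M\<^esub> act M (H_grp h) (act M (H_y G) v)"
    proof -
      have "H_grp h \<otimes>\<^bsub>H\<^esub> H_y G \<in> carrier H"
        using H_mult_unit_fun[of 0 1 h \<one>] n_ge_2 h
        by (auto simp: H_alg_def basis_algebra_def H_basis_def unit_fun_def)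
      then show ?thesis
        using amoduleD(7)[OF M _ v] amoduleD(8)[OF M hc H_y_closed v] H_y_grp[OF h] by simp
    qed
    also have "\<phi> \<dots> = (\<lambda>b. \<chi> h * gact R h (yact R f) b)"
      using coordD(6)[OF \<phi> ac[OF hc ac[OF H_y_closed v]]] \<psi>\<phi>[OF v] \<psi>\<phi>[OF ac[OF H_y_closed v]]
      by (simp add: R_def fv)
    finally show "yact R (gact R h f) = (\<lambda>b. \<chi> h * gact R h (yact R f) b)" .
    fix k assume k: "k \<in> carrier G"
    show "gact R h (gact R k f) = gact R (h \<otimes> k) f"
      using comp[OF hc H_grp_closed[OF k] v] \<psi>\<phi>[OF v] H_grp_mult[OF h k] by (simp add: R_def fv)
  qed
  have "has_rep M R"
  proof (rule has_repI[OF R])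
    show "coord M (idx R) \<phi>" using \<phi> by (simp add: R_def)
    fix x v assume x: "x \<in> carrier H" and v: "v \<in> carrier M"
    show "act M x v \<in> carrier M" by (rule ac[OF x v])
    have "\<phi> (act M x v) = (\<lambda>i. \<Sum>p\<in>H_basis G n. x p * \<phi> (act M (unit_fun p) v) i)"
      using amodule_coord_act[OF finite_H_basis M[unfolded H_alg_def] \<phi> x[unfolded H_alg_def] v] .
    also have "\<dots> = hact R x (\<phi> v)"
      unfolding hact_def
    proof (intro ext sum.cong refl)
      fix i p assume "p \<in> H_basis G n"
      then obtain j h where p: "p = (j, h)" "j < n" "h \<in> carrier G" by (auto simp: H_basis_def)
      have "basis_act R p (\<phi> v) = (yact R ^^ j) (\<phi> (act M (H_grp h) v))"
        using \<psi>\<phi>[OF v] by (simp add: basis_act_def p(1) R_def)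
      also have "\<dots> = \<phi> (act M (unit_fun p) v)"
        using ypow[OF ac[OF H_grp_closed[OF p(3)] v]] amodule_act_basis[OF M p(2,3) v] p(1) by simp
      finally show "x p * \<phi> (act M (unit_fun p) v) i = x p * basis_act R p (\<phi> v) i" by simp
    qed
    finally show "\<phi> (act M x v) = hact R x (\<phi> v)" .
  qed
  then show ?thesis by blast
qed

lemma has_rep_amod_iso:
  assumes M: "has_rep M R" and N: "has_rep N R"
  shows "amod_iso H M N"
proof -
  from M obtain \<phi> where Ma_map: "rep_map M R \<phi>"
    unfolding has_rep_def by blast
  note \<phi> = rep_mapD(1)[OF Ma_map] and Mc = rep_mapD(2)[OF Ma_map] and Ma = rep_mapD(3)[OF Ma_map]
  from N obtain \<psi> where Na_map: "rep_map N R \<psi>"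
    unfolding has_rep_def by blast
  note \<psi> = rep_mapD(1)[OF Na_map] and Nc = rep_mapD(2)[OF Na_map] and Na = rep_mapD(3)[OF Na_map]
  define f where "f v = inv_into (carrier N) \<psi> (\<phi> v)" for v
  have f: "f v \<in> carrier N" "\<psi> (f v) = \<phi> v" if "v \<in> carrier M" for v
    using coord_inv(1,2)[OF \<psi> coord_fsp[OF \<phi> that]] by (simp_all add: f_def)
  show ?thesis
    unfolding amod_iso_def
  proof (intro bexI[of _ f] conjI ballI)
    have "bij_betw (inv_into (carrier N) \<psi> \<circ> \<phi>) (carrier M) (carrier N)"
      by (rule bij_betw_trans[OF coordD(8)[OF \<phi>] bij_betw_inv_into[OF coordD(8)[OF \<psi>]]])
    then show "bij_betw f (carrier M) (carrier N)" by (simp add: f_def[abs_def] o_def)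
    show "f (act M x v) = act N x (f v)" if "x \<in> carrier H" "v \<in> carrier M" for x v
      by (rule coord_inj[OF \<psi>]) (simp_all add: f Mc Nc Ma Na that)
    show "f \<in> LinearCombinations.module_hom class_ring M N"
      unfolding LinearCombinations.module_hom_def
    proof (intro CollectI conjI allI impI funcsetI)
      show "f (v \<oplus>\<^bsub>M\<^esub> w) = f v \<oplus>\<^bsub>N\<^esub> f w" if "v \<in> carrier M \<and> w \<in> carrier M" for v w
        by (rule coord_inj[OF \<psi>]) (use that in \<open>simp_all add: f coordD(3,4)[OF \<phi>] coordD(3,4)[OF \<psi>]\<close>)
      show "f (c \<odot>\<^bsub>M\<^esub> v) = c \<odot>\<^bsub>N\<^esub> f v" if "c \<in> carrier class_ring \<and> v \<in> carrier M" for c v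
        by (rule coord_inj[OF \<psi>]) (use that in \<open>simp_all add: f coordD(5,6)[OF \<phi>] coordD(5,6)[OF \<psi>]\<close>)
    qed (rule f)
  qed
qed

lemma coord_amod_iso:
  assumes f: "f \<in> LinearCombinations.module_hom class_ring N M" "bij_betw f (carrier N) (carrier M)"
    and N: "vectorspace class_ring N" and \<phi>: "coord M B \<phi>"
  shows "coord N B (\<lambda>v. \<phi> (f v))"
proof -
  interpret vectorspace class_ring N by (rule N)
  have fc: "f v \<in> carrier M" if "v \<in> carrier N" for v
    using f(1) that by (auto simp: LinearCombinations.module_hom_def)
  have fa: "f (u \<oplus>\<^bsub>N\<^esub> v) = f u \<oplus>\<^bsub>M\<^esub> f v" if "u \<in> carrier N" "v \<in> carrier N" for u v
    using f(1) that by (auto simp: LinearCombinations.module_hom_def)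
  have fs: "f (c \<odot>\<^bsub>N\<^esub> v) = c \<odot>\<^bsub>M\<^esub> f v" if "v \<in> carrier N" for c v
    using f(1) that by (auto simp: LinearCombinations.module_hom_def)
  have z: "f \<zero>\<^bsub>N\<^esub> = 0 \<odot>\<^bsub>M\<^esub> f \<zero>\<^bsub>N\<^esub>" using fs[of "\<zero>\<^bsub>N\<^esub>" 0] lmult_0[of "\<zero>\<^bsub>N\<^esub>"] by simp
  show ?thesis
  proof (rule coordI)
    show "bij_betw (\<lambda>v. \<phi> (f v)) (carrier N) (fsp B)"
      using bij_betw_trans[OF f(2) coordD(8)[OF \<phi>]] by (simp add: o_def)
    have "\<phi> (f \<zero>\<^bsub>N\<^esub>) = (\<lambda>b. 0 * \<phi> (f \<zero>\<^bsub>N\<^esub>) b)"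
      using arg_cong[OF z, of \<phi>] coordD(6)[OF \<phi> fc[of "\<zero>\<^bsub>N\<^esub>"], of 0] by simp
    then show "\<phi> (f \<zero>\<^bsub>N\<^esub>) = (\<lambda>_. 0)" by simp
  qed (use coordD(1)[OF \<phi>] coordD(4,6)[OF \<phi>] fc fa fs in simp_all)
qed

lemma amod_iso_has_rep:
  assumes N: "amodule H N" and iso: "amod_iso H N M" and M: "has_rep M R"
  shows "has_rep N R"
proof -
  from M obtain \<phi> where Ma_map: "rep_map M R \<phi>"
    unfolding has_rep_def by blast
  note \<phi> = rep_mapD(1)[OF Ma_map] and Mc = rep_mapD(2)[OF Ma_map] and Ma = rep_mapD(3)[OF Ma_map]
  note R = has_rep_is_rep[OF M]
  from iso obtain f where f: "f \<in> LinearCombinations.module_hom class_ring N M"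
    "bij_betw f (carrier N) (carrier M)"
    and fact: "\<forall>x\<in>carrier H. \<forall>v\<in>carrier N. f (act N x v) = act M x (f v)"
    unfolding amod_iso_def by blast
  have fc: "f v \<in> carrier M" if "v \<in> carrier N" for v
    using f(1) that by (auto simp: LinearCombinations.module_hom_def)
  show ?thesis
    by (rule has_repI[OF R coord_amod_iso[OF f amoduleD(1)[OF N] \<phi>]])
      (simp_all add: amoduleD(3)[OF N] fact fc Ma)
qed

lemma has_rep_rep_iso:
  assumes M: "has_rep M R" and iso: "rep_iso R R'" and R': "is_rep R'"
  shows "has_rep M R'"
proof -
  from M obtain \<phi> where Ma_map: "rep_map M R \<phi>"
    unfolding has_rep_def by blast
  note \<phi> = rep_mapD(1)[OF Ma_map] and Mc = rep_mapD(2)[OF Ma_map] and Ma = rep_mapD(3)[OF Ma_map]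
  note R = has_rep_is_rep[OF M]
  from iso obtain F where F: "lin_on (idx R) (idx R') F" "bij_betw F (fsp (idx R)) (fsp (idx R'))"
    and Fg: "\<forall>h\<in>carrier G. \<forall>f\<in>fsp (idx R). F (gact R h f) = gact R' h (F f)"
    and Fy: "\<forall>f\<in>fsp (idx R). F (yact R f) = yact R' (F f)"
    unfolding rep_iso_def by blast
  have Fyi: "F ((yact R ^^ i) f) = (yact R' ^^ i) (F f)" if "f \<in> fsp (idx R)" for i f
    by (induction i) (use that Fy is_rep_closed(3)[OF R that] in auto)
  have Fb: "F (basis_act R p f) = basis_act R' p (F f)" if "p \<in> H_basis G n" "f \<in> fsp (idx R)" for p f
    using that Fyi[OF is_rep_closed(1)[OF R that(2)]] Fg by (auto simp: basis_act_def H_basis_def)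
  have Fh: "F (hact R x f) = hact R' x (F f)" if f: "f \<in> fsp (idx R)" for x f
    unfolding hact_def
    using lin_on_sum[OF F(1), of "H_basis G n" "\<lambda>p. basis_act R p f" x] Fb[OF _ f]
      lin_on_fsp[OF lin_on_basis_act[OF R] f] by simp
  show ?thesis
  proof (rule has_repI[OF R'])
    show "coord M (idx R') (\<lambda>v. F (\<phi> v))"
    proof (rule coordI)
      show "bij_betw (\<lambda>v. F (\<phi> v)) (carrier M) (fsp (idx R'))"
        using bij_betw_trans[OF coordD(8)[OF \<phi>] F(2)] by (simp add: o_def)
    qed (use is_repD(1)[OF R'] coordD(2-7)[OF \<phi>] coord_fsp[OF \<phi>] lin_on_add[OF F(1)]
        lin_on_scale[OF F(1)] lin_on_zero[OF F(1)] in simp_all)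
  qed (use Mc Ma Fh coord_fsp[OF \<phi>] in simp_all)
qed

lemma rep_realizable:
  assumes R: "is_rep R"
  shows "\<exists>N :: ('k, nat \<times> 'a \<Rightarrow> 'k, 'k vec) amod. has_rep N R"
proof -
  obtain \<phi> where \<phi>: "coord (module_vec TYPE('k) (card (idx R))) (idx R) \<phi>"
    using vec_coord[OF is_repD(1)[OF R]] by blast
  let ?V = "module_vec TYPE('k) (card (idx R))"
  have "has_rep (with_act ?V (\<lambda>x v. inv_into (carrier ?V) \<phi> (hact R x (\<phi> v)))) R"
    by (rule has_repI[OF R, of _ \<phi>])
      (simp_all add: \<phi> coord_inv[OF \<phi>] lin_on_fsp[OF lin_on_hact[OF R]] coord_fsp[OF \<phi>])
  then show ?thesis by blast
qed

lemma has_rep_amod_sum: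
  assumes M: "has_rep M R" and N: "has_rep N R'"
  shows "has_rep (amod_sum M N) (rsum R R')"
proof -
  from M obtain \<phi> where Ma_map: "rep_map M R \<phi>"
    unfolding has_rep_def by blast
  note \<phi> = rep_mapD(1)[OF Ma_map] and Mc = rep_mapD(2)[OF Ma_map] and Ma = rep_mapD(3)[OF Ma_map]
  note R = has_rep_is_rep[OF M]
  from N obtain \<psi> where Na_map: "rep_map N R' \<psi>"
    unfolding has_rep_def by blast
  note \<psi> = rep_mapD(1)[OF Na_map] and Nc = rep_mapD(2)[OF Na_map] and Na = rep_mapD(3)[OF Na_map]
  note R' = has_rep_is_rep[OF N]
  define \<theta> where "\<theta> p = case_sum (\<phi> (fst p)) (\<psi> (snd p))" for p
  have \<theta>: "coord (direct_sum M N) (idx R <+> idx R') \<theta>"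
  proof (rule coordI)
    show "finite (idx R <+> idx R')" using is_repD(1)[OF R] is_repD(1)[OF R'] by simp
    show "bij_betw \<theta> (carrier (direct_sum M N)) (fsp (idx R <+> idx R'))"
    proof (rule bij_betw_byWitness[of _ "\<lambda>f. (inv_into (carrier M) \<phi> (\<lambda>b. f (Inl b)),
        inv_into (carrier N) \<psi> (\<lambda>b. f (Inr b)))"])
      show "\<forall>f\<in>fsp (idx R <+> idx R'). \<theta> (inv_into (carrier M) \<phi> (\<lambda>b. f (Inl b)),
        inv_into (carrier N) \<psi> (\<lambda>b. f (Inr b))) = f"
        by (simp add: \<theta>_def fsp_Plus fun_eq_iff split_sum_all coord_inv[OF \<phi>] coord_inv[OF \<psi>])
    qed (auto simp: direct_sum_def \<theta>_def fsp_Plus coord_inv[OF \<phi>] coord_inv[OF \<psi>]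
        coord_fsp[OF \<phi>] coord_fsp[OF \<psi>])
  qed (auto simp: direct_sum_def \<theta>_def fun_eq_iff split_sum_all coordD(2-7)[OF \<phi>] coordD(2-7)[OF \<psi>])
  have hs: "hact (rsum R R') x (case_sum f f') = case_sum (hact R x f) (hact R' x f')" for x f f'
    by (simp add: hact_def basis_act_def rsum_yact_funpow fun_eq_iff split_sum_all) (simp add: rsum_def)
  have idx: "idx (rsum R R') = idx R <+> idx R'" by (simp add: rsum_def)
  have \<theta>': "coord (amod_sum M N) (idx R <+> idx R') \<theta>"
    using \<theta> unfolding amod_sum_def coord_with_act .
  show ?thesis
  proof (rule has_repI[OF is_rep_rsum[OF R R']])
    show "coord (amod_sum M N) (idx (rsum R R')) \<theta>" using \<theta>' idx by simp
  qed (auto simp: amod_sum_def hs direct_sum_def Mc Nc Ma Na \<theta>_def)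
qed

text \<open>
  Modules given by an action of \<open>G\<close> and an operator for \<open>y\<close>, such as inflations and the \<open>M(i,j)\<close>: it
  is enough to compare these generators with the representation.
\<close>

lemma has_rep_H_act:
  fixes V :: "('k, 'v, 'z) module_scheme"
  assumes R: "is_rep R" and \<phi>: "coord V (idx R) \<phi>"
    and \<rho>: "\<And>h v. h \<in> carrier G \<Longrightarrow> v \<in> carrier V \<Longrightarrow> \<rho> h v \<in> carrier V \<and> \<phi> (\<rho> h v) = gact R h (\<phi> v)"
    and Y: "\<And>v. v \<in> carrier V \<Longrightarrow> Y v \<in> carrier V \<and> \<phi> (Y v) = yact R (\<phi> v)"
  shows "has_rep (with_act V (H_act G n V \<rho> Y)) R"
proof -
  have Yi: "(Y ^^ i) v \<in> carrier V \<and> \<phi> ((Y ^^ i) v) = (yact R ^^ i) (\<phi> v)" if "v \<in> carrier V" for i v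
    by (induction i) (use that Y in auto)
  have summand: "(case p of (i, h) \<Rightarrow> x (i, h) \<odot>\<^bsub>V\<^esub> (Y ^^ i) (\<rho> h v)) \<in> carrier V \<and>
      \<phi> (case p of (i, h) \<Rightarrow> x (i, h) \<odot>\<^bsub>V\<^esub> (Y ^^ i) (\<rho> h v)) = (\<lambda>b. x p * basis_act R p (\<phi> v) b)"
    if "p \<in> H_basis G n" "v \<in> carrier V" for p x v
    using that \<rho> Yi coordD(5,6)[OF \<phi>] by (auto simp: H_basis_def basis_act_def)
  show ?thesis
  proof (rule has_repI[OF R, of _ \<phi>])
    fix x v assume "v \<in> carrier (with_act V (H_act G n V \<rho> Y))"
    then have v: "v \<in> carrier V" by simp
    show "act (with_act V (H_act G n V \<rho> Y)) x v \<in> carrier (with_act V (H_act G n V \<rho> Y))"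
      using coord_finsum(1)[OF \<phi> finite_H_basis, of "\<lambda>(i, h). x (i, h) \<odot>\<^bsub>V\<^esub> (Y ^^ i) (\<rho> h v)"]
        summand[OF _ v] by (simp add: H_act_def)
    show "\<phi> (act (with_act V (H_act G n V \<rho> Y)) x v) = hact R x (\<phi> v)"
      using coord_finsum(2)[OF \<phi> finite_H_basis, of "\<lambda>(i, h). x (i, h) \<odot>\<^bsub>V\<^esub> (Y ^^ i) (\<rho> h v)"]
        summand[OF _ v] by (simp add: H_act_def hact_def)
  qed (use \<phi> in simp)
qed

text \<open>
  The isomorphism class attached to a representation, independent of any module that realises it.
\<close>

definition rep_class :: "('a, 'i, 'k) crep \<Rightarrow> ('k, nat \<times> 'a \<Rightarrow> 'k, 'k vec) amod set" where
  "rep_class R = {N. has_rep N R}"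

lemma iso_class_has_rep:
  assumes "has_rep M R" shows "iso_class H M = rep_class R"
  unfolding iso_class_def rep_class_def
  using amod_iso_has_rep[OF _ _ assms] has_rep_amod_iso[OF _ assms] has_rep_amodule by blast

lemma rep_class_iso:
  assumes "is_rep R" "is_rep R'" "rep_iso R R'"
  shows "rep_class R = rep_class R'"
  unfolding rep_class_def
proof (intro Collect_cong iffI)
  show "has_rep N R'" if "has_rep N R" for N
    by (rule has_rep_rep_iso[OF that assms(3,2)])
  show "has_rep N R" if "has_rep N R'" for N
    by (rule has_rep_rep_iso[OF that rep_iso_sym[OF assms(1,3)] assms(1)])
qed

lemma rep_class_nonempty: "is_rep R \<Longrightarrow> \<exists>N. N \<in> rep_class R"
  using rep_realizable unfolding rep_class_def by blast

end

section \<open>Tensor products of vector spaces in coordinates\<close>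

text \<open>
  The linear extension of \<open>\<theta>\<close> from the basis of a free space. The sum runs over the support of \<open>f\<close>,
  which is finite for elements of the free space.
\<close>

definition lin_ext :: "('s \<Rightarrow> 'i \<Rightarrow> 'k :: field) \<Rightarrow> ('s \<Rightarrow> 'k) \<Rightarrow> 'i \<Rightarrow> 'k" where
  "lin_ext \<theta> f = (\<lambda>i. \<Sum>s | f s \<noteq> 0. f s * \<theta> s i)"

lemma lin_ext_superset:
  assumes "finite S" "{s. f s \<noteq> 0} \<subseteq> S"
  shows "lin_ext \<theta> f = (\<lambda>i. \<Sum>s\<in>S. f s * \<theta> s i)"
  unfolding lin_ext_def by (intro ext sum.mono_neutral_left) (use assms in auto)

lemma lin_ext_add:
  assumes f: "finite {s. f s \<noteq> 0}" "finite {s. f' s \<noteq> 0}"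
  shows "lin_ext \<theta> (\<lambda>s. f s + f' s) = (\<lambda>i. lin_ext \<theta> f i + lin_ext \<theta> f' i)"
proof -
  let ?S = "{s. f s \<noteq> 0} \<union> {s. f' s \<noteq> 0}"
  have S: "finite ?S" using f by simp
  have "lin_ext \<theta> (\<lambda>s. f s + f' s) = (\<lambda>i. \<Sum>s\<in>?S. (f s + f' s) * \<theta> s i)"
    by (rule lin_ext_superset[OF S]) auto
  moreover have "lin_ext \<theta> f = (\<lambda>i. \<Sum>s\<in>?S. f s * \<theta> s i)"
    by (rule lin_ext_superset[OF S]) auto
  moreover have "lin_ext \<theta> f' = (\<lambda>i. \<Sum>s\<in>?S. f' s * \<theta> s i)"
    by (rule lin_ext_superset[OF S]) auto
  ultimately show ?thesis by (simp add: distrib_right sum.distrib)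
qed

lemma lin_ext_scale:
  assumes f: "finite {s. f s \<noteq> 0}"
  shows "lin_ext \<theta> (\<lambda>s. c * f s) = (\<lambda>i. c * lin_ext \<theta> f i)"
proof -
  have "lin_ext \<theta> (\<lambda>s. c * f s) = (\<lambda>i. \<Sum>s | f s \<noteq> 0. (c * f s) * \<theta> s i)"
    by (rule lin_ext_superset[OF f]) auto
  then show ?thesis by (simp add: lin_ext_def sum_distrib_left mult.assoc)
qed

lemma lin_ext_unit: "lin_ext \<theta> (unit_fun s) = \<theta> s"
proof -
  have "lin_ext \<theta> (unit_fun s) = (\<lambda>i. \<Sum>t\<in>{s}. unit_fun s t * \<theta> t i)"
    by (rule lin_ext_superset) (auto simp: unit_fun_def)
  then show ?thesis by (simp add: unit_fun_def)
qed

lemma finite_support_sum: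
  assumes "finite I"
  shows "finite {s. (\<Sum>i\<in>I. a i * unit_fun (P i) s) \<noteq> (0 :: 'k :: field)}"
proof (rule finite_subset)
  show "{s. (\<Sum>i\<in>I. a i * unit_fun (P i) s) \<noteq> 0} \<subseteq> P ` I"
  proof
    fix s assume "s \<in> {s. (\<Sum>i\<in>I. a i * unit_fun (P i) s) \<noteq> 0}"
    then obtain i where "i \<in> I" "a i * unit_fun (P i) s \<noteq> 0"
      by (auto elim: sum.not_neutral_contains_not_neutral)
    then show "s \<in> P ` I" by (auto simp: unit_fun_def split: if_splits)
  qed
qed (use assms in simp)

lemma lin_ext_sum:
  fixes \<theta> :: "'s \<Rightarrow> 'i \<Rightarrow> 'k :: field"
  assumes I: "finite I"
  shows "lin_ext \<theta> (\<lambda>s. \<Sum>i\<in>I. a i * unit_fun (P i) s) = (\<lambda>j. \<Sum>i\<in>I. a i * \<theta> (P i) j)"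
  using I
proof (induction I rule: finite_induct)
  case empty
  show ?case by (simp add: lin_ext_def)
next
  case (insert i I)
  have u: "finite {s. unit_fun (P i) s \<noteq> (0 :: 'k)}"
    by (rule finite_subset[of _ "{P i}"]) (auto simp: unit_fun_def)
  have "finite {s. a i * unit_fun (P i) s \<noteq> 0}"
    by (rule finite_subset[OF _ u]) auto
  from lin_ext_add[OF this finite_support_sum[OF insert.hyps(1)], of \<theta> a P]
  show ?case using insert lin_ext_scale[OF u, of \<theta> "a i"] by (simp add: lin_ext_unit)
qed

lemma free_space_carrier: "f \<in> carrier (free_space S) \<longleftrightarrow> finite {s. f s \<noteq> 0} \<and> {s. f s \<noteq> 0} \<subseteq> S"
  and free_space_add: "f \<oplus>\<^bsub>free_space S\<^esub> f' = (\<lambda>s. f s + f' s)"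
  and free_space_smult: "c \<odot>\<^bsub>free_space S\<^esub> f = (\<lambda>s. c * f s)"
  and free_space_zero: "\<zero>\<^bsub>free_space S\<^esub> = (\<lambda>_. 0)"
  by (simp_all add: free_space_def)

lemma free_space_closed:
  fixes f :: "'s \<Rightarrow> 'k :: field"
  assumes "f \<in> carrier (free_space S)"
  shows "f' \<in> carrier (free_space S) \<Longrightarrow> (\<lambda>s. f s + f' s) \<in> carrier (free_space S)"
    and "(\<lambda>s. c * f s) \<in> carrier (free_space S)"
proof -
  show "(\<lambda>s. c * f s) \<in> carrier (free_space S)"
    using assms unfolding free_space_carrier by (auto elim: finite_subset[rotated])
  show "(\<lambda>s. f s + f' s) \<in> carrier (free_space S)" if "f' \<in> carrier (free_space S)"
  proof -
    have "{s. f s + f' s \<noteq> 0} \<subseteq> {s. f s \<noteq> 0} \<union> {s. f' s \<noteq> 0}" by auto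
    moreover have "finite ({s. f s \<noteq> 0} \<union> {s. f' s \<noteq> 0})"
      using assms that unfolding free_space_carrier by blast
    ultimately show ?thesis
      using assms that unfolding free_space_carrier by (meson finite_subset order_trans Un_least)
  qed
qed

lemma free_space_unit: "s \<in> S \<Longrightarrow> unit_fun s \<in> carrier (free_space S)"
  by (auto simp: free_space_carrier unit_fun_def)

lemma free_space_module: "module class_ring (free_space S :: ('k :: field, 's \<Rightarrow> 'k) module)"
proof (rule module_criteria)
  let ?F = "free_space S :: ('k, 's \<Rightarrow> 'k) module"
  show "cring (class_ring :: 'k ring)" by (rule class_cring.is_cring)
  show "\<forall>v\<in>carrier ?F. \<exists>w\<in>carrier ?F. v \<oplus>\<^bsub>?F\<^esub> w = \<zero>\<^bsub>?F\<^esub>"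
  proof
    fix v :: "'s \<Rightarrow> 'k" assume "v \<in> carrier ?F"
    then show "\<exists>w\<in>carrier ?F. v \<oplus>\<^bsub>?F\<^esub> w = \<zero>\<^bsub>?F\<^esub>"
      by (intro bexI[OF _ free_space_closed(2)[of v S "-1"]]) (simp_all add: free_space_add free_space_zero)
  qed
  show "\<forall>v w. v \<in> carrier ?F \<and> w \<in> carrier ?F \<longrightarrow> v \<oplus>\<^bsub>?F\<^esub> w \<in> carrier ?F"
    by (simp add: free_space_add free_space_closed)
  show "\<forall>c v. c \<in> carrier class_ring \<and> v \<in> carrier ?F \<longrightarrow> c \<odot>\<^bsub>?F\<^esub> v \<in> carrier ?F"
    by (simp add: free_space_smult free_space_closed)
  show "\<zero>\<^bsub>?F\<^esub> \<in> carrier ?F" by (simp add: free_space_zero free_space_carrier)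
qed (simp_all add: free_space_add free_space_smult free_space_zero algebra_simps)

lemma span_minimal:
  assumes "module class_ring F" "X \<subseteq> Q" "submodule class_ring Q F"
  shows "LinearCombinations.module.span class_ring F X \<subseteq> Q"
  using LinearCombinations.module.span_is_subset[OF assms(1,2,3)] .

lemma finite_support_induct:
  fixes f :: "'s \<Rightarrow> 'k :: field"
  assumes f: "f \<in> carrier (free_space S)"
    and zero: "P (\<lambda>_. 0)"
    and step: "\<And>f c s. f \<in> carrier (free_space S) \<Longrightarrow> s \<in> S \<Longrightarrow> P f \<Longrightarrow> P (\<lambda>t. f t + c * unit_fun s t)"
  shows "P f"
proof -
  have "\<forall>f. {s. f s \<noteq> 0} \<subseteq> A \<longrightarrow> P f" if "finite A" "A \<subseteq> S" for A
    using that
  proof (induction A rule: finite_induct)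
    case empty
    show ?case
    proof (intro allI impI)
      fix f :: "'s \<Rightarrow> 'k" assume "{s. f s \<noteq> 0} \<subseteq> {}"
      then have "f = (\<lambda>_. 0)" by auto
      then show "P f" using zero by simp
    qed
  next
    case (insert s A)
    show ?case
    proof (intro allI impI)
      fix f :: "'s \<Rightarrow> 'k" assume f: "{t. f t \<noteq> 0} \<subseteq> insert s A"
      let ?f = "f(s := 0)"
      have A: "{t. ?f t \<noteq> 0} \<subseteq> A" using f by auto
      then have "P ?f" using insert by blast
      moreover have "?f \<in> carrier (free_space S)"
        using A insert unfolding free_space_carrier by (meson finite_subset insert_subset order_trans)
      moreover have "s \<in> S" using insert.prems by simp
      ultimately have "P (\<lambda>t. ?f t + f s * unit_fun s t)" by (intro step)
      moreover have "(\<lambda>t. ?f t + f s * unit_fun s t) = f" by (auto simp: unit_fun_def)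
      ultimately show "P f" by simp
    qed
  qed
  then show ?thesis using f unfolding free_space_carrier by blast
qed

text \<open>
  The map \<open>v \<otimes> w \<mapsto> (b, c) \<mapsto> \<phi>(v)\<^sub>b \<psi>(w)\<^sub>c\<close> identifies the quotient of the free space by the bilinear
  relations with the functions on \<open>B \<times> C\<close>. It kills the relations, and sending a basis function to the
  pair of basis vectors defines a section \<open>\<sigma>\<close>. Its kernel is no larger than the span of the relations,
  because modulo these each \<open>f\<close> equals \<open>\<sigma> (\<Phi> f)\<close>: this holds for pairs of basis vectors, and
  bilinearity extends it first in the second argument, then in the first, then to all \<open>f\<close>.
\<close>

lemma tensor_kernel:
  fixes V :: "('k :: field, 'v, 'y) module_scheme" and W :: "('k, 'w, 'z) module_scheme"
    and \<phi> :: "'v \<Rightarrow> 'i \<Rightarrow> 'k" and \<psi> :: "'w \<Rightarrow> 'j \<Rightarrow> 'k"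
  assumes V: "coord V B \<phi>" and W: "coord W C \<psi>"
  defines "F \<equiv> free_space (carrier V \<times> carrier W) :: ('k, 'v \<times> 'w \<Rightarrow> 'k) module"
  defines "\<Phi> \<equiv> lin_ext (\<lambda>(v, w) (b, c). \<phi> v b * \<psi> w c)"
  shows "LinearCombinations.module.span class_ring F (bilinear_rels V W) =
      {f \<in> carrier F. \<Phi> f = (\<lambda>_. 0)}" (is "?N = ?K")
    and "\<And>f. f \<in> carrier F \<Longrightarrow> \<Phi> f \<in> fsp (B \<times> C)"
    and "\<And>t. t \<in> fsp (B \<times> C) \<Longrightarrow> \<exists>f\<in>carrier F. \<Phi> f = t"
proof -
  interpret M: Module.module class_ring F unfolding F_def by (rule free_space_module)
  note FS = free_space_carrier free_space_add free_space_smult free_space_zero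
  have fin: "finite {s. f s \<noteq> 0}" if "f \<in> carrier F" for f
    using that by (simp add: F_def FS)
  have Fadd: "(\<lambda>p. f p + f' p) \<in> carrier F" if "f \<in> carrier F" "f' \<in> carrier F" for f f'
    using free_space_closed(1)[OF that[unfolded F_def]] by (simp add: F_def)
  have Fscale: "(\<lambda>p. c * f p) \<in> carrier F" if "f \<in> carrier F" for f c
    using free_space_closed(2)[OF that[unfolded F_def]] by (simp add: F_def)
  have Fdiff: "(\<lambda>p. f p - f' p) \<in> carrier F" if "f \<in> carrier F" "f' \<in> carrier F" for f f'
    using Fadd[OF that(1) Fscale[OF that(2), of "-1"]] by simp
  have Funit: "unit_fun (v, w) \<in> carrier F" if "v \<in> carrier V" "w \<in> carrier W" for v w
    unfolding F_def by (rule free_space_unit) (use that in simp)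
  have Fsum: "(\<lambda>p. \<Sum>i\<in>I. a i * unit_fun (P i) p) \<in> carrier F"
    if "finite I" "P ` I \<subseteq> carrier V \<times> carrier W" for I :: "'x set" and a and P
    using that
  proof (induction I rule: finite_induct)
    case (insert i I)
    have "(\<lambda>p. a i * unit_fun (P i) p) \<in> carrier F"
      using Fscale[OF Funit, of "fst (P i)" "snd (P i)"] insert.prems by (simp add: mem_Times_iff)
    from Fadd[OF this] insert show ?case by simp
  qed (simp add: F_def FS)
  have \<Phi>_add: "\<Phi> (\<lambda>p. f p + f' p) = (\<lambda>q. \<Phi> f q + \<Phi> f' q)" if "f \<in> carrier F" "f' \<in> carrier F" for f f'
    unfolding \<Phi>_def by (rule lin_ext_add[OF fin[OF that(1)] fin[OF that(2)]])
  have \<Phi>_scale: "\<Phi> (\<lambda>p. c * f p) = (\<lambda>q. c * \<Phi> f q)" if "f \<in> carrier F" for f c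
    unfolding \<Phi>_def by (rule lin_ext_scale[OF fin[OF that]])
  have \<Phi>_diff: "\<Phi> (\<lambda>p. f p - f' p) = (\<lambda>q. \<Phi> f q - \<Phi> f' q)" if "f \<in> carrier F" "f' \<in> carrier F" for f f'
    using \<Phi>_add[OF that(1) Fscale[OF that(2), of "-1"]] \<Phi>_scale[OF that(2), of "-1"] by simp
  have \<Phi>_unit: "\<Phi> (unit_fun (v, w)) = (\<lambda>(b, c). \<phi> v b * \<psi> w c)" for v w
    by (simp add: \<Phi>_def lin_ext_unit)
  have \<Phi>_zero: "\<Phi> (\<lambda>_. 0) = (\<lambda>_. 0)" by (simp add: \<Phi>_def lin_ext_def)
  note opV = coordD(3,5)[OF V] and opW = coordD(3,5)[OF W]
  note linV = coordD(4,6)[OF V] and linW = coordD(4,6)[OF W]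
  have rels: "f \<in> carrier F \<and> \<Phi> f = (\<lambda>_. 0)" if "f \<in> bilinear_rels V W" for f
    using that unfolding bilinear_rels_def
  proof (elim UnE CollectE exE conjE)
    fix v v' w assume *: "f = (\<lambda>p. unit_fun (v \<oplus>\<^bsub>V\<^esub> v', w) p - unit_fun (v, w) p - unit_fun (v', w) p)"
      "v \<in> carrier V" "v' \<in> carrier V" "w \<in> carrier W"
    show ?thesis
      unfolding *(1) using *(2-)
      by (simp add: Fdiff Funit opV \<Phi>_diff \<Phi>_unit linV) (simp add: fun_eq_iff algebra_simps)
  next
    fix v w w' assume *: "f = (\<lambda>p. unit_fun (v, w \<oplus>\<^bsub>W\<^esub> w') p - unit_fun (v, w) p - unit_fun (v, w') p)"
      "v \<in> carrier V" "w \<in> carrier W" "w' \<in> carrier W"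
    show ?thesis
      unfolding *(1) using *(2-)
      by (simp add: Fdiff Funit opW \<Phi>_diff \<Phi>_unit linW) (simp add: fun_eq_iff algebra_simps)
  next
    fix c v w assume *: "f = (\<lambda>p. unit_fun (c \<odot>\<^bsub>V\<^esub> v, w) p - c * unit_fun (v, w) p)"
      "v \<in> carrier V" "w \<in> carrier W"
    show ?thesis
      unfolding *(1) using *(2-)
      by (simp add: Fdiff Fscale Funit opV \<Phi>_diff \<Phi>_scale \<Phi>_unit linV) (simp add: fun_eq_iff algebra_simps)
  next
    fix c v w assume *: "f = (\<lambda>p. unit_fun (v, c \<odot>\<^bsub>W\<^esub> w) p - c * unit_fun (v, w) p)"
      "v \<in> carrier V" "w \<in> carrier W"
    show ?thesis
      unfolding *(1) using *(2-)
      by (simp add: Fdiff Fscale Funit opW \<Phi>_diff \<Phi>_scale \<Phi>_unit linW) (simp add: fun_eq_iff algebra_simps)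
  qed
  have relsF: "bilinear_rels V W \<subseteq> carrier F" using rels by blast
  have subN: "submodule class_ring ?N F" by (rule M.span_is_submodule[OF relsF])
  have relsN: "bilinear_rels V W \<subseteq> ?N" by (rule M.in_own_span[OF relsF])
  have NF: "?N \<subseteq> carrier F" by (rule M.span_is_subset2[OF relsF])
  have Nadd: "(\<lambda>p. f p + f' p) \<in> ?N" if "f \<in> ?N" "f' \<in> ?N" for f f'
    using submodule.m_closed[OF subN that] by (simp add: F_def FS)
  have Nscale: "(\<lambda>p. c * f p) \<in> ?N" if "f \<in> ?N" for f c
    using submodule.smult_closed[OF subN _ that, of c] by (simp add: F_def FS)
  have Nzero: "(\<lambda>_. 0) \<in> ?N" using submodule.zero_closed[OF subN] by (simp add: F_def FS)
  have subK: "submodule class_ring ?K F"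
  proof (rule submodule.intro[OF M.module_axioms])
    show "\<zero>\<^bsub>F\<^esub> \<in> ?K" using \<Phi>_zero by (simp add: F_def FS)
    show "v \<oplus>\<^bsub>F\<^esub> w \<in> ?K" if "v \<in> ?K" "w \<in> ?K" for v w
      using that Fadd \<Phi>_add unfolding F_def FS by simp
    show "c \<odot>\<^bsub>F\<^esub> v \<in> ?K" if "v \<in> ?K" for c v
      using that Fscale \<Phi>_scale unfolding F_def FS by simp
  qed auto
  have NK: "?N \<subseteq> ?K"
    by (rule span_minimal[OF M.module_axioms _ subK]) (use rels in blast)
  have V0: "0 \<odot>\<^bsub>V\<^esub> \<zero>\<^bsub>V\<^esub> = \<zero>\<^bsub>V\<^esub>"
    by (rule coord_inj[OF V]) (use coordD(2,5,6,7)[OF V] in simp_all)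
  have W0: "0 \<odot>\<^bsub>W\<^esub> \<zero>\<^bsub>W\<^esub> = \<zero>\<^bsub>W\<^esub>"
    by (rule coord_inj[OF W]) (use coordD(2,5,6,7)[OF W] in simp_all)
  define e where "e b = inv_into (carrier V) \<phi> (unit_fun b)" for b
  define e' where "e' c = inv_into (carrier W) \<psi> (unit_fun c)" for c
  have e: "e b \<in> carrier V" "\<phi> (e b) = unit_fun b" if "b \<in> B" for b
    using coord_inv(1,2)[OF V fsp_unit[OF that]] by (simp_all add: e_def)
  have e': "e' c \<in> carrier W" "\<psi> (e' c) = unit_fun c" if "c \<in> C" for c
    using coord_inv(1,2)[OF W fsp_unit[OF that]] by (simp_all add: e'_def)
  have finBC: "finite (B \<times> C)" using coordD(1)[OF V] coordD(1)[OF W] by simp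
  define \<sigma> :: "('i \<times> 'j \<Rightarrow> 'k) \<Rightarrow> 'v \<times> 'w \<Rightarrow> 'k" where "\<sigma> t = (\<lambda>p. \<Sum>q\<in>B \<times> C. t q * unit_fun (e (fst q), e' (snd q)) p)" for t
  have \<sigma>F: "\<sigma> t \<in> carrier F" for t
    unfolding \<sigma>_def by (rule Fsum[OF finBC]) (use e e' in auto)
  have \<Phi>\<sigma>: "\<Phi> (\<sigma> t) = t" if t: "t \<in> fsp (B \<times> C)" for t
  proof -
    have "\<Phi> (\<sigma> t) = (\<lambda>p. \<Sum>q\<in>B \<times> C. t q * (case p of (b, c) \<Rightarrow> \<phi> (e (fst q)) b * \<psi> (e' (snd q)) c))"
      unfolding \<Phi>_def \<sigma>_def lin_ext_sum[OF finBC] by simp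
    also have "\<dots> = (\<lambda>p. \<Sum>q\<in>B \<times> C. t q * unit_fun q p)"
      by (intro ext sum.cong refl) (auto simp: e e' unit_fun_def split: if_splits)
    also have "\<dots> = t" by (rule fsp_expand[OF finBC t, symmetric])
    finally show ?thesis .
  qed
  then show "\<And>t. t \<in> fsp (B \<times> C) \<Longrightarrow> \<exists>f\<in>carrier F. \<Phi> f = t" using \<sigma>F by blast
  show \<Phi>_fsp: "\<Phi> f \<in> fsp (B \<times> C)" if f: "f \<in> carrier F" for f
  proof (rule fspI)
    fix q assume "q \<notin> B \<times> C"
    then have "(case s of (v, w) \<Rightarrow> \<lambda>(b, c). \<phi> v b * \<psi> w c) q = 0" if "s \<in> carrier V \<times> carrier W" for s
      using that fspD[OF coord_fsp[OF V]] fspD[OF coord_fsp[OF W]] by (cases q) auto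
    then show "\<Phi> f q = 0"
      using f unfolding \<Phi>_def lin_ext_def F_def FS by (intro sum.neutral) auto
  qed
  have \<sigma>_add: "\<sigma> (\<lambda>q. t q + t' q) = (\<lambda>p. \<sigma> t p + \<sigma> t' p)" for t t'
    by (simp add: \<sigma>_def sum.distrib distrib_right)
  have \<sigma>_scale: "\<sigma> (\<lambda>q. c * t q) = (\<lambda>p. c * \<sigma> t p)" for t c
    by (simp add: \<sigma>_def sum_distrib_left mult.assoc)
  have \<sigma>_zero: "\<sigma> (\<lambda>_. 0) = (\<lambda>_. 0)" by (simp add: \<sigma>_def)
  \<comment> \<open>The elements that are congruent to their image under \<open>\<sigma> \<circ> \<Phi>\<close> modulo the relations.\<close>
  define good where "good f \<longleftrightarrow> f \<in> carrier F \<and> (\<lambda>p. f p - \<sigma> (\<Phi> f) p) \<in> ?N" for f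
  have good_add: "good (\<lambda>p. f p + f' p)" if "good f" "good f'" for f f'
  proof -
    from that have f: "f \<in> carrier F" "f' \<in> carrier F" by (simp_all add: good_def)
    have "(\<lambda>p. (f p - \<sigma> (\<Phi> f) p) + (f' p - \<sigma> (\<Phi> f') p)) \<in> ?N"
      by (rule Nadd) (use that in \<open>simp_all add: good_def\<close>)
    then show ?thesis
      unfolding good_def \<Phi>_add[OF f] \<sigma>_add using Fadd[OF f] by (simp add: algebra_simps)
  qed
  have good_scale: "good (\<lambda>p. c * f p)" if "good f" for f c
  proof -
    from that have f: "f \<in> carrier F" by (simp add: good_def)
    have "(\<lambda>p. c * (f p - \<sigma> (\<Phi> f) p)) \<in> ?N"
      by (rule Nscale) (use that in \<open>simp add: good_def\<close>)
    then show ?thesis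
      unfolding good_def \<Phi>_scale[OF f] \<sigma>_scale using Fscale[OF f] by (simp add: algebra_simps)
  qed
  have good_rel: "good f" if "f \<in> bilinear_rels V W" for f
  proof -
    have "f \<in> carrier F" "\<Phi> f = (\<lambda>_. 0)" "f \<in> ?N" using rels[OF that] relsN that by auto
    then show ?thesis by (simp add: good_def \<sigma>_zero)
  qed
  have good_zero: "good (\<lambda>_. 0)"
    unfolding good_def \<Phi>_zero \<sigma>_zero using Nzero NF by auto
  have good_diag: "good (unit_fun (e b, e' c))" if "b \<in> B" "c \<in> C" for b c
  proof -
    have "\<Phi> (unit_fun (e b, e' c)) = unit_fun (b, c)"
      unfolding \<Phi>_unit e(2)[OF that(1)] e'(2)[OF that(2)] by (auto simp: unit_fun_def fun_eq_iff)
    moreover have "\<sigma> (unit_fun (b, c)) = unit_fun (e b, e' c)"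
      unfolding \<sigma>_def using sum_unit_fun[OF finBC, of "(b, c)" "\<lambda>q. unit_fun (e (fst q), e' (snd q)) p :: 'k" for p]
        that by simp
    ultimately show ?thesis using Nzero Funit[OF e(1) e'(1)] that by (simp add: good_def)
  qed
  have good_right: "good (unit_fun (e b, w))" if b: "b \<in> B" and w: "w \<in> carrier W" for b w
    using W w
  proof (rule coord_induct)
    \<comment> \<open>The zero vector is the case \<open>0 \<odot> \<zero> = \<zero>\<close> of homogeneity.\<close>
    have "(\<lambda>p. unit_fun (e b, 0 \<odot>\<^bsub>W\<^esub> \<zero>\<^bsub>W\<^esub>) p - 0 * unit_fun (e b, \<zero>\<^bsub>W\<^esub>) p) \<in> bilinear_rels V W"
      unfolding bilinear_rels_def using e(1)[OF b] coordD(2)[OF W] by blast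
    from good_rel[OF this] show "good (unit_fun (e b, \<zero>\<^bsub>W\<^esub>))" by (simp add: W0)
  next
    fix u w assume *: "u \<in> carrier W" "w \<in> carrier W" "good (unit_fun (e b, u))" "good (unit_fun (e b, w))"
    have "(\<lambda>p. unit_fun (e b, u \<oplus>\<^bsub>W\<^esub> w) p - unit_fun (e b, u) p - unit_fun (e b, w) p) \<in> bilinear_rels V W"
      unfolding bilinear_rels_def using e(1)[OF b] * by blast
    from good_add[OF good_add[OF good_rel[OF this] *(3)] *(4)]
    show "good (unit_fun (e b, u \<oplus>\<^bsub>W\<^esub> w))" by simp
  next
    fix c w assume *: "w \<in> carrier W" "good (unit_fun (e b, w))"
    have "(\<lambda>p. unit_fun (e b, c \<odot>\<^bsub>W\<^esub> w) p - c * unit_fun (e b, w) p) \<in> bilinear_rels V W"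
      unfolding bilinear_rels_def using e(1)[OF b] * by blast
    from good_add[OF good_rel[OF this] good_scale[OF *(2), of c]]
    show "good (unit_fun (e b, c \<odot>\<^bsub>W\<^esub> w))" by simp
  next
    fix c w assume "c \<in> C" "w \<in> carrier W" "\<psi> w = unit_fun c"
    moreover from this have "w = e' c" using coord_inv(3)[OF W] by (metis e'_def)
    ultimately show "good (unit_fun (e b, w))" using good_diag[OF b] by simp
  qed
  have good_unit: "good (unit_fun (v, w))" if v: "v \<in> carrier V" and w: "w \<in> carrier W" for v w
    using V v
  proof (rule coord_induct)
    have "(\<lambda>p. unit_fun (0 \<odot>\<^bsub>V\<^esub> \<zero>\<^bsub>V\<^esub>, w) p - 0 * unit_fun (\<zero>\<^bsub>V\<^esub>, w) p) \<in> bilinear_rels V W"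
      unfolding bilinear_rels_def using w coordD(2)[OF V] by blast
    from good_rel[OF this] show "good (unit_fun (\<zero>\<^bsub>V\<^esub>, w))" by (simp add: V0)
  next
    fix u v assume *: "u \<in> carrier V" "v \<in> carrier V" "good (unit_fun (u, w))" "good (unit_fun (v, w))"
    have "(\<lambda>p. unit_fun (u \<oplus>\<^bsub>V\<^esub> v, w) p - unit_fun (u, w) p - unit_fun (v, w) p) \<in> bilinear_rels V W"
      unfolding bilinear_rels_def using w * by blast
    from good_add[OF good_add[OF good_rel[OF this] *(3)] *(4)]
    show "good (unit_fun (u \<oplus>\<^bsub>V\<^esub> v, w))" by simp
  next
    fix c v assume *: "v \<in> carrier V" "good (unit_fun (v, w))"
    have "(\<lambda>p. unit_fun (c \<odot>\<^bsub>V\<^esub> v, w) p - c * unit_fun (v, w) p) \<in> bilinear_rels V W"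
      unfolding bilinear_rels_def using w * by blast
    from good_add[OF good_rel[OF this] good_scale[OF *(2), of c]]
    show "good (unit_fun (c \<odot>\<^bsub>V\<^esub> v, w))" by simp
  next
    fix b v assume "b \<in> B" "v \<in> carrier V" "\<phi> v = unit_fun b"
    moreover from this have "v = e b" using coord_inv(3)[OF V] by (metis e_def)
    ultimately show "good (unit_fun (v, w))" using good_right[OF _ w] by simp
  qed
  have good_all: "good f" if "f \<in> carrier F" for f
    using that unfolding F_def
  proof (rule finite_support_induct)
    fix f c s assume *: "good f" "s \<in> carrier V \<times> carrier W"
    then have "good (\<lambda>t. c * unit_fun s t)" using good_scale[OF good_unit] by auto
    from good_add[OF *(1) this] show "good (\<lambda>t. f t + c * unit_fun s t)" .
  qed (rule good_zero)
  have "f \<in> ?N" if "f \<in> ?K" for f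
    using good_all[of f] that by (simp add: good_def \<sigma>_zero)
  with NK show "?N = ?K" by blast
qed

section \<open>The diagonal action in coordinates\<close>

context nilpotent_group_datum
begin

text \<open>
  The action of \<open>H \<otimes> H\<close> on the tensor product of two coordinate spaces.
\<close>

definition HH_act :: "('a, 'i, 'k) crep \<Rightarrow> ('a, 'j, 'k) crep \<Rightarrow>
    ((nat \<times> 'a) \<times> (nat \<times> 'a) \<Rightarrow> 'k) \<Rightarrow> ('i \<times> 'j \<Rightarrow> 'k) \<Rightarrow> 'i \<times> 'j \<Rightarrow> 'k" where
  "HH_act R R' z f = (\<lambda>p. \<Sum>q\<in>H_basis G n \<times> H_basis G n.
     z q * tens1 (basis_act R (fst q)) (tens2 (basis_act R' (snd q)) f) p)"

lemma finite_HH_basis: "finite (H_basis G n \<times> H_basis G n)"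
  using finite_H_basis by simp

lemma HH_act_unit:
  assumes "p \<in> H_basis G n" "p' \<in> H_basis G n"
  shows "HH_act R R' (unit_fun (p, p')) f = tens1 (basis_act R p) (tens2 (basis_act R' p') f)"
proof
  fix i
  show "HH_act R R' (unit_fun (p, p')) f i = tens1 (basis_act R p) (tens2 (basis_act R' p') f) i"
    unfolding HH_act_def
    using sum_unit_fun[OF finite_HH_basis, of "(p, p')"
        "\<lambda>q. tens1 (basis_act R (fst q)) (tens2 (basis_act R' (snd q)) f) i"] assms by simp
qed

lemma lin_on_HH_basis_act:
  assumes R: "is_rep R" and R': "is_rep R'" and q: "q \<in> H_basis G n \<times> H_basis G n"
  shows "lin_on (idx R \<times> idx R') (idx R \<times> idx R')
    (\<lambda>f. tens1 (basis_act R (fst q)) (tens2 (basis_act R' (snd q)) f))"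
proof (rule lin_on_comp[OF lin_on_tens2 lin_on_tens1])
  show "lin_on (idx R') (idx R') (basis_act R' (snd q))" using lin_on_basis_act[OF R'] q by auto
  show "lin_on (idx R) (idx R) (basis_act R (fst q))" using lin_on_basis_act[OF R] q by auto
qed

lemma lin_on_HH_act:
  assumes R: "is_rep R" and R': "is_rep R'"
  shows "lin_on (idx R \<times> idx R') (idx R \<times> idx R') (HH_act R R' z)"
  unfolding HH_act_def[abs_def]
  by (rule lin_on_setsum[of "H_basis G n \<times> H_basis G n"]) (rule lin_on_HH_basis_act[OF R R'])

text \<open>
  Operators on different factors commute, so the products of basis operators have the structure
  constants of the tensor product algebra.
\<close>

lemma HH_act_mult:
  fixes R :: "('a, 'i, 'k) crep" and R' :: "('a, 'j, 'k) crep"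
  assumes R: "is_rep R" and R': "is_rep R'" and f: "f \<in> fsp (idx R \<times> idx R')"
  shows "HH_act R R' (z \<otimes>\<^bsub>HH_alg G \<chi> n\<^esub> z') f = HH_act R R' z (HH_act R R' z' f)"
  unfolding HH_act_def HH_alg_def
proof (rule basis_algebra_act_mult[OF finite_HH_basis lin_on_HH_basis_act[OF R R'] _ f])
  fix q q' and f :: "'i \<times> 'j \<Rightarrow> 'k" assume q: "q \<in> H_basis G n \<times> H_basis G n" and q': "q' \<in> H_basis G n \<times> H_basis G n"
    and f: "f \<in> fsp (idx R \<times> idx R')"
  obtain a b c d where [simp]: "q = (a, b)" "q' = (c, d)" by (cases q, cases q')
  have abcd: "a \<in> H_basis G n" "b \<in> H_basis G n" "c \<in> H_basis G n" "d \<in> H_basis G n"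
    using q q' by auto
  note lin = lin_on_basis_act[OF R] and lin' = lin_on_basis_act[OF R']
  define X where "X e = tens2 (basis_act R' e) f" for e
  have X: "X e \<in> fsp (idx R \<times> idx R')" if "e \<in> H_basis G n" for e
    unfolding X_def by (rule lin_on_fsp[OF lin_on_tens2[OF lin'[OF that]] f])
  let ?m = "H_mult G \<chi> n" and ?B = "H_basis G n"
  have "tens1 (basis_act R a) (tens2 (basis_act R' b) (tens1 (basis_act R c) (X d)))
      = tens1 (basis_act R a) (tens1 (basis_act R c) (tens2 (basis_act R' b) (X d)))"
    using tens_commute[OF lin[OF abcd(3)] lin'[OF abcd(2)] is_repD(1)[OF R'] X[OF abcd(4)]] by simp
  also have "tens2 (basis_act R' b) (X d) = tens2 (\<lambda>f i. \<Sum>e\<in>?B. ?m b d e * basis_act R' e f i) f"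
    unfolding X_def tens2_comp
    by (rule tens2_cong[OF _ f]) (rule basis_act_mult[OF R' abcd(2,4)])
  also have "\<dots> = (\<lambda>p. \<Sum>e\<in>?B. ?m b d e * X e p)"
    by (simp add: X_def tens2_def fun_eq_iff)
  also have "tens1 (basis_act R a) (tens1 (basis_act R c) \<dots>) =
      tens1 (\<lambda>f i. \<Sum>e'\<in>?B. ?m a c e' * basis_act R e' f i) (\<lambda>p. \<Sum>e\<in>?B. ?m b d e * X e p)"
    unfolding tens1_comp
    by (rule tens1_cong[OF _ fsp_sum[OF X]]) (rule basis_act_mult[OF R abcd(1,3)])
  also have "\<dots> = (\<lambda>p. \<Sum>e'\<in>?B. ?m a c e' * tens1 (basis_act R e') (\<lambda>p. \<Sum>e\<in>?B. ?m b d e * X e p) p)"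
    by (simp add: tens1_def fun_eq_iff)
  also have "\<dots> = (\<lambda>p. \<Sum>e'\<in>?B. \<Sum>e\<in>?B. ?m a c e' * ?m b d e * tens1 (basis_act R e') (X e) p)"
    by (intro ext sum.cong refl)
      (simp add: lin_on_sum[OF lin_on_tens1[OF lin] X] sum_distrib_left mult.assoc)
  also have "\<dots> = (\<lambda>p. \<Sum>s\<in>?B \<times> ?B. (case q of (a, b) \<Rightarrow> \<lambda>(c, d) (e, f). ?m a c e * ?m b d f) q' s *
        tens1 (basis_act R (fst s)) (tens2 (basis_act R' (snd s)) f) p)"
    by (simp add: sum.cartesian_product X_def case_prod_unfold)
  finally show "tens1 (basis_act R (fst q)) (tens2 (basis_act R' (snd q))
        (tens1 (basis_act R (fst q')) (tens2 (basis_act R' (snd q')) f))) =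
      (\<lambda>p. \<Sum>s\<in>?B \<times> ?B. (case q of (a, b) \<Rightarrow> \<lambda>(c, d) (e, f). ?m a c e * ?m b d f) q' s *
        tens1 (basis_act R (fst s)) (tens2 (basis_act R' (snd s)) f) p)"
    by (simp add: X_def)
qed

lemma HH_tensor_unit: "HH_tensor (unit_fun p) (unit_fun p') = unit_fun (p, p')"
  by (auto simp: HH_tensor_def unit_fun_def fun_eq_iff)

abbreviation Delta_y :: "(nat \<times> 'a) \<times> (nat \<times> 'a) \<Rightarrow> 'k" where
  "Delta_y \<equiv> HH_tensor (H_y G) (H_grp g) \<oplus>\<^bsub>HH_alg G \<chi> n\<^esub> HH_tensor (H_grp \<one>) (H_y G)"

lemma basis_act_simps: "basis_act R (0, h) f = gact R h f"
  "is_rep R \<Longrightarrow> f \<in> fsp (idx R) \<Longrightarrow> basis_act R (1, \<one>) f = yact R f"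
  by (simp_all add: basis_act_def is_repD(4))

lemma HH_act_Delta_y:
  fixes R :: "('a, 'i, 'k) crep" and R' :: "('a, 'j, 'k) crep"
  assumes R: "is_rep R" and R': "is_rep R'" and f: "f \<in> fsp (idx R \<times> idx R')"
  shows "HH_act R R' Delta_y f = yact (rtensor R R') f"
proof -
  have b: "(1, \<one>) \<in> H_basis G n" "(0, g) \<in> H_basis G n" "(0, \<one>) \<in> H_basis G n"
    using n_ge_2 g_closed by (simp_all add: H_basis_def)
  have f1: "tens2 (gact R' g) f \<in> fsp (idx R \<times> idx R')" "tens2 (yact R') f \<in> fsp (idx R \<times> idx R')"
    using lin_on_fsp[OF lin_on_tens2 f] is_repD(2,3)[OF R'] g_closed by auto
  have "HH_act R R' Delta_y f =
      (\<lambda>p. HH_act R R' (unit_fun ((1, \<one>), (0, g))) f p + HH_act R R' (unit_fun ((0, \<one>), (1, \<one>))) f p)"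
    by (simp add: HH_tensor_unit HH_alg_def basis_algebra_def HH_act_def distrib_right sum.distrib)
  also have "HH_act R R' (unit_fun ((1, \<one>), (0, g))) f = tens1 (yact R) (tens2 (gact R' g) f)"
    unfolding HH_act_unit[OF b(1,2)]
    using tens1_cong[OF basis_act_simps(2)[OF R] f1(1)]
    by (simp add: basis_act_simps(1)[abs_def])
  also have "HH_act R R' (unit_fun ((0, \<one>), (1, \<one>))) f = tens1 (gact R \<one>) (tens2 (yact R') f)"
    unfolding HH_act_unit[OF b(3,1)]
    using tens2_cong[OF basis_act_simps(2)[OF R'] f] by (simp add: basis_act_simps(1)[abs_def])
  also have "\<dots> = tens1 (\<lambda>f. f) (tens2 (yact R') f)"
    by (rule tens1_cong[OF _ f1(2)]) (rule is_repD(4)[OF R])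
  finally show ?thesis by (simp add: rtensor_def tens1_def[of "\<lambda>f. f"])
qed

lemma HH_act_Delta_y_pow:
  fixes R :: "('a, 'i, 'k) crep" and R' :: "('a, 'j, 'k) crep"
  assumes R: "is_rep R" and R': "is_rep R'" and f: "f \<in> fsp (idx R \<times> idx R')"
  shows "HH_act R R' (Delta_y [^]\<^bsub>HH_alg G \<chi> n\<^esub> i) f = (yact (rtensor R R') ^^ i) f"
  using f
proof (induction i arbitrary: f)
  case 0
  have b: "(0, \<one>) \<in> H_basis G n" using n_ge_2 by (simp add: H_basis_def)
  have "HH_act R R' (Delta_y [^]\<^bsub>HH_alg G \<chi> n\<^esub> (0 :: nat)) f = HH_act R R' (unit_fun ((0, \<one>), (0, \<one>))) f"
    by (simp add: nat_pow_def HH_alg_def basis_algebra_def)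
  also have "\<dots> = gact (rtensor R R') \<one> f"
    unfolding HH_act_unit[OF b b] by (simp add: basis_act_simps(1)[abs_def] rtensor_def)
  also have "\<dots> = f"
    using is_repD(4)[OF is_rep_rtensor[OF R R']] 0 by (simp add: rtensor_def)
  finally show ?case by simp
next
  case (Suc i)
  have y: "yact (rtensor R R') f \<in> fsp (idx R \<times> idx R')"
    using is_rep_closed(2)[OF is_rep_rtensor[OF R R']] Suc.prems by (simp add: rtensor_def)
  have "HH_act R R' (Delta_y [^]\<^bsub>HH_alg G \<chi> n\<^esub> Suc i) f =
      HH_act R R' (Delta_y [^]\<^bsub>HH_alg G \<chi> n\<^esub> i) (HH_act R R' Delta_y f)"
    using HH_act_mult[OF R R' Suc.prems] by (simp add: nat_pow_def)
  also have "\<dots> = (yact (rtensor R R') ^^ Suc i) f"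
    using Suc.IH[OF y] HH_act_Delta_y[OF R R' Suc.prems] by (simp add: funpow_swap1)
  finally show ?case .
qed

text \<open>
  Multiplicativity of the action of \<open>H \<otimes> H\<close> reduces the claim for \<open>\<Delta>(y\<^sup>i h) = \<Delta>(y)\<^sup>i \<Delta>(h)\<close> to the
  two generators.
\<close>

lemma HH_act_comult:
  fixes R :: "('a, 'i, 'k) crep" and R' :: "('a, 'j, 'k) crep"
  assumes R: "is_rep R" and R': "is_rep R'" and f: "f \<in> fsp (idx R \<times> idx R')"
  shows "HH_act R R' (H_comult G \<chi> g n x) f = hact (rtensor R R') x f"
proof
  fix p
  define z where "z q = (Delta_y [^]\<^bsub>HH_alg G \<chi> n\<^esub> fst q)
       \<otimes>\<^bsub>HH_alg G \<chi> n\<^esub> HH_tensor (H_grp (snd q)) (H_grp (snd q))" for q :: "nat \<times> 'a"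
  let ?t = "\<lambda>r. tens1 (basis_act R (fst r)) (tens2 (basis_act R' (snd r)) f) p"
  have "HH_act R R' (H_comult G \<chi> g n x) f p =
      (\<Sum>r\<in>H_basis G n \<times> H_basis G n. (\<Sum>q\<in>H_basis G n. x q * z q r) * ?t r)"
    by (simp add: HH_act_def H_comult_def z_def case_prod_unfold)
  also have "\<dots> = (\<Sum>q\<in>H_basis G n. x q * HH_act R R' (z q) f p)"
    unfolding HH_act_def sum_distrib_left sum_distrib_right mult.assoc by (rule sum.swap)
  also have "\<dots> = (\<Sum>q\<in>H_basis G n. x q * basis_act (rtensor R R') q f p)"
  proof (intro sum.cong refl)
    fix q assume q: "q \<in> H_basis G n"
    then have h: "snd q \<in> carrier G" and b: "(0, snd q) \<in> H_basis G n"
      using n_ge_2 by (auto simp: H_basis_def)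
    have gf: "gact (rtensor R R') (snd q) f \<in> fsp (idx R \<times> idx R')"
      using is_rep_closed(1)[OF is_rep_rtensor[OF R R'] _ h] f by (simp add: rtensor_def)
    have "HH_act R R' (z q) f = HH_act R R' (Delta_y [^]\<^bsub>HH_alg G \<chi> n\<^esub> fst q)
        (HH_act R R' (unit_fun ((0, snd q), (0, snd q))) f)"
      unfolding z_def HH_tensor_unit by (rule HH_act_mult[OF R R' f])
    also have "HH_act R R' (unit_fun ((0, snd q), (0, snd q))) f = gact (rtensor R R') (snd q) f"
      unfolding HH_act_unit[OF b b] by (simp add: basis_act_simps(1)[abs_def] rtensor_def)
    finally show "x q * HH_act R R' (z q) f p = x q * basis_act (rtensor R R') q f p"
      using HH_act_Delta_y_pow[OF R R' gf] by (simp add: basis_act_def)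
  qed
  finally show "HH_act R R' (H_comult G \<chi> g n x) f p = hact (rtensor R R') x f p"
    by (simp add: hact_def)
qed

lemma hact_unit: "p \<in> H_basis G n \<Longrightarrow> hact R (unit_fun p) f = basis_act R p f"
  unfolding hact_def using sum_unit_fun[OF finite_H_basis, of p "\<lambda>p. basis_act R p f b" for b] by simp

text \<open>
  The coset of \<open>f\<close> modulo the bilinear relations is the fibre of the coordinate map \<open>\<Phi>\<close> over
  \<open>\<Phi> f\<close>, by the description of the kernel of \<open>\<Phi>\<close>. All operations of the quotient are unions over
  representatives; since \<open>\<Phi>\<close> intertwines them with operations on the coordinate space, such a union
  is again a single fibre.
\<close>

lemma has_rep_H_tensor:
  fixes M :: "('k, nat \<times> 'a \<Rightarrow> 'k, 'v) amod" and N :: "('k, nat \<times> 'a \<Rightarrow> 'k, 'w) amod"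
    and R :: "('a, 'i, 'k) crep" and R' :: "('a, 'j, 'k) crep"
  assumes M: "has_rep M R" and N: "has_rep N R'"
  shows "has_rep (H_tensor G \<chi> g n M N) (rtensor R R')"
proof -
  from M obtain \<phi> where M_map: "rep_map M R \<phi>" unfolding has_rep_def by blast
  from N obtain \<psi> where N_map: "rep_map N R' \<psi>" unfolding has_rep_def by blast
  note R = has_rep_is_rep[OF M] and R' = has_rep_is_rep[OF N]
  note \<phi> = rep_mapD(1)[OF M_map] and \<psi> = rep_mapD(1)[OF N_map]
  let ?D = "idx R \<times> idx R'" and ?S = "carrier M \<times> carrier N" and ?B = "H_basis G n"
  define F where "F = (free_space ?S :: ('k, 'v \<times> 'w \<Rightarrow> 'k) module)"
  define \<theta> where "\<theta> = (\<lambda>(v, w) (b, c). \<phi> v b * \<psi> w c)"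
  define \<Phi> where "\<Phi> = lin_ext \<theta>"
  define K where "K = LinearCombinations.module.span class_ring F (bilinear_rels M N)"
  have K: "K = {f \<in> carrier F. \<Phi> f = (\<lambda>_. 0)}"
    unfolding K_def F_def \<Phi>_def \<theta>_def by (rule tensor_kernel(1)[OF \<phi> \<psi>])
  have \<Phi>_fsp: "\<Phi> f \<in> fsp ?D" if "f \<in> carrier F" for f
    using tensor_kernel(2)[OF \<phi> \<psi>] that unfolding F_def \<Phi>_def \<theta>_def .
  have \<Phi>_surj: "\<exists>f\<in>carrier F. \<Phi> f = t" if "t \<in> fsp ?D" for t
    using tensor_kernel(3)[OF \<phi> \<psi> that] unfolding F_def \<Phi>_def \<theta>_def .
  have fin: "finite {s. f s \<noteq> 0}" if "f \<in> carrier F" for f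
    using that by (simp add: F_def free_space_carrier)
  have Fops: "f \<oplus>\<^bsub>F\<^esub> f' = (\<lambda>s. f s + f' s)" "c \<odot>\<^bsub>F\<^esub> f = (\<lambda>s. c * f s)" for f f' c
    by (simp_all add: F_def free_space_add free_space_smult)
  have Fadd: "(\<lambda>p. f p + f' p) \<in> carrier F" if "f \<in> carrier F" "f' \<in> carrier F" for f f'
    using free_space_closed(1)[OF that[unfolded F_def]] by (simp add: F_def)
  have Fscale: "(\<lambda>p. c * f p) \<in> carrier F" if "f \<in> carrier F" for f c
    using free_space_closed(2)[OF that[unfolded F_def]] by (simp add: F_def)
  have \<Phi>_add: "\<Phi> (\<lambda>p. f p + f' p) = (\<lambda>q. \<Phi> f q + \<Phi> f' q)" if "f \<in> carrier F" "f' \<in> carrier F" for f f'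
    unfolding \<Phi>_def by (rule lin_ext_add[OF fin[OF that(1)] fin[OF that(2)]])
  have \<Phi>_scale: "\<Phi> (\<lambda>p. c * f p) = (\<lambda>q. c * \<Phi> f q)" if "f \<in> carrier F" for f c
    unfolding \<Phi>_def by (rule lin_ext_scale[OF fin[OF that]])
  \<comment> \<open>The fibre over \<open>t\<close>, which is the coset with coordinates \<open>t\<close>.\<close>
  define C where "C t = {f \<in> carrier F. \<Phi> f = t}" for t
  have C_ne: "\<exists>f. f \<in> C t" if "t \<in> fsp ?D" for t using \<Phi>_surj[OF that] by (auto simp: C_def)
  have diff: "(\<lambda>p. f p - f' p) \<in> carrier F \<and> \<Phi> (\<lambda>p. f p - f' p) = (\<lambda>q. \<Phi> f q - \<Phi> f' q)"
    if "f \<in> carrier F" "f' \<in> carrier F" for f f'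
    using Fadd[OF that(1) Fscale[OF that(2), of "-1"]] \<Phi>_add[OF that(1) Fscale[OF that(2), of "-1"]]
      \<Phi>_scale[OF that(2), of "-1"] by simp
  have coset: "K +>\<^bsub>F\<^esub> f = C (\<Phi> f)" if f: "f \<in> carrier F" for f
  proof (intro equalityI subsetI)
    fix f' assume "f' \<in> K +>\<^bsub>F\<^esub> f"
    then obtain k where "k \<in> K" "f' = (\<lambda>p. k p + f p)"
      by (auto simp: a_r_coset_def' Fops)
    then show "f' \<in> C (\<Phi> f)" using Fadd \<Phi>_add f by (simp add: C_def K)
  next
    fix f' assume f': "f' \<in> C (\<Phi> f)"
    then have "(\<lambda>p. f' p - f p) \<in> K" using diff[of f' f] f by (simp add: C_def K)
    moreover have "f' = (\<lambda>p. (f' p - f p) + f p)" by simp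
    ultimately show "f' \<in> K +>\<^bsub>F\<^esub> f" unfolding a_r_coset_def' Fops by blast
  qed
  define T where "T = H_tensor G \<chi> g n M N"
  have T_carrier: "carrier T = C ` fsp ?D"
  proof -
    have "carrier T = (\<Union>f\<in>carrier F. {K +>\<^bsub>F\<^esub> f})"
      by (simp add: T_def H_tensor_def Let_def A_RCOSETS_def' F_def[symmetric] K_def[symmetric])
    also have "\<dots> = (\<lambda>f. K +>\<^bsub>F\<^esub> f) ` carrier F" by blast
    also have "\<dots> = (\<lambda>f. C (\<Phi> f)) ` carrier F" by (rule image_cong[OF refl coset])
    also have "\<dots> = C ` (\<Phi> ` carrier F)" by (simp add: image_image)
    also have "\<Phi> ` carrier F = fsp ?D"
    proof (intro equalityI subsetI)
      show "t \<in> fsp ?D" if "t \<in> \<Phi> ` carrier F" for t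
        using that \<Phi>_fsp by (elim imageE) simp
      show "t \<in> \<Phi> ` carrier F" if "t \<in> fsp ?D" for t
        using \<Phi>_surj[OF that] by (metis imageI)
    qed
    finally show ?thesis .
  qed
  have T_zero: "\<zero>\<^bsub>T\<^esub> = C (\<lambda>_. 0)"
    by (simp add: T_def H_tensor_def Let_def F_def[symmetric] K_def[symmetric] C_def K)
  have T_add: "C t \<oplus>\<^bsub>T\<^esub> C t' = C (\<lambda>p. t p + t' p)" if "t \<in> fsp ?D" "t' \<in> fsp ?D" for t t'
  proof -
    have "C t \<oplus>\<^bsub>T\<^esub> C t' = (\<Union>f\<in>C t. \<Union>f'\<in>C t'. {\<lambda>p. f p + f' p})"
      by (simp add: T_def H_tensor_def Let_def F_def[symmetric] set_add_def' Fops)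
    also have "\<dots> = C (\<lambda>p. t p + t' p)"
    proof (intro equalityI subsetI)
      fix u assume "u \<in> (\<Union>f\<in>C t. \<Union>f'\<in>C t'. {\<lambda>p. f p + f' p})"
      then show "u \<in> C (\<lambda>p. t p + t' p)" using Fadd \<Phi>_add by (auto simp: C_def)
    next
      fix u assume u: "u \<in> C (\<lambda>p. t p + t' p)"
      obtain f where f: "f \<in> C t" using C_ne \<open>t \<in> fsp ?D\<close> by blast
      have "(\<lambda>p. u p - f p) \<in> C t'" using diff[of u f] u f by (simp add: C_def)
      moreover have "u = (\<lambda>p. f p + (u p - f p))" by simp
      ultimately show "u \<in> (\<Union>f\<in>C t. \<Union>f'\<in>C t'. {\<lambda>p. f p + f' p})" using f by blast
    qed
    finally show ?thesis .
  qed
  have union: "(\<Union>f\<in>C t. K +>\<^bsub>F\<^esub> u f) = C t'" if "t \<in> fsp ?D"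
    and "\<And>f. f \<in> C t \<Longrightarrow> u f \<in> carrier F" "\<And>f. f \<in> C t \<Longrightarrow> \<Phi> (u f) = t'" for t t' u
  proof -
    have "(\<Union>f\<in>C t. K +>\<^bsub>F\<^esub> u f) = (\<Union>f\<in>C t. C t')"
      by (intro SUP_cong refl) (simp add: that(2,3) coset)
    then show ?thesis using C_ne[OF that(1)] by auto
  qed
  have T_smult: "c \<odot>\<^bsub>T\<^esub> C t = C (\<lambda>p. c * t p)" if "t \<in> fsp ?D" for c t
  proof -
    have "c \<odot>\<^bsub>T\<^esub> C t = (\<Union>f\<in>C t. K +>\<^bsub>F\<^esub> (\<lambda>p. c * f p))"
      by (simp add: T_def H_tensor_def Let_def F_def[symmetric] K_def[symmetric] Fops)
    also have "\<dots> = C (\<lambda>p. c * t p)"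
      by (rule union[OF that]) (auto simp: C_def Fscale \<Phi>_scale)
    finally show ?thesis .
  qed
  \<comment> \<open>The lift of the diagonal action to the free space covers the action on coordinates.\<close>
  have diag: "H_diag G \<chi> g n M N x f \<in> carrier F \<and> \<Phi> (H_diag G \<chi> g n M N x f) = hact (rtensor R R') x (\<Phi> f)"
    if x: "x \<in> carrier H" and f: "f \<in> carrier F" for x f
  proof
    let ?I = "{s. f s \<noteq> 0} \<times> (?B \<times> ?B)"
    define P where "P = (\<lambda>(s, q). (act M (unit_fun (fst q)) (fst s), act N (unit_fun (snd q)) (snd s)) :: 'v \<times> 'w)"
    define \<alpha> where "\<alpha> = (\<lambda>(s, q). f s * H_comult G \<chi> g n x q)"
    have I: "finite ?I" using fin[OF f] finite_HH_basis by blast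
    have eq: "H_diag G \<chi> g n M N x f = (\<lambda>p. \<Sum>i\<in>?I. \<alpha> i * unit_fun (P i) p)"
      unfolding H_diag_def \<alpha>_def P_def
      by (simp add: sum.cartesian_product case_prod_unfold)
    have supp: "s \<in> ?S" if "f s \<noteq> 0" for s
      using f that by (auto simp: F_def free_space_carrier)
    have PS: "P i \<in> ?S" if "i \<in> ?I" for i
    proof -
      obtain s q where [simp]: "i = (s, q)" by (cases i)
      have "s \<in> ?S" "fst q \<in> ?B" "snd q \<in> ?B" using that supp[of s] by auto
      then show ?thesis
        using rep_mapD(2)[OF M_map H_unit_fun_closed, of "fst q" "fst s"]
          rep_mapD(2)[OF N_map H_unit_fun_closed, of "snd q" "snd s"] by (simp add: P_def mem_Times_iff)
    qed
    show "H_diag G \<chi> g n M N x f \<in> carrier F"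
      unfolding eq F_def free_space_carrier
    proof
      show "{s. (\<Sum>i\<in>?I. \<alpha> i * unit_fun (P i) s) \<noteq> 0} \<subseteq> ?S"
      proof
        fix s assume "s \<in> {s. (\<Sum>i\<in>?I. \<alpha> i * unit_fun (P i) s) \<noteq> 0}"
        then obtain i where "i \<in> ?I" "\<alpha> i * unit_fun (P i) s \<noteq> 0"
          by (auto elim: sum.not_neutral_contains_not_neutral)
        then show "s \<in> ?S" using PS[of i] by (auto simp: unit_fun_def split: if_splits)
      qed
    qed (rule finite_support_sum[OF I])
    have \<theta>P: "\<theta> (P (s, q)) = tens1 (basis_act R (fst q)) (tens2 (basis_act R' (snd q)) (\<theta> s))"
      if "f s \<noteq> 0" "q \<in> ?B \<times> ?B" for s q
    proof -
      obtain v w where s: "s = (v, w)" by (cases s)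
      have vw: "v \<in> carrier M" "w \<in> carrier N" using supp[OF that(1)] s by auto
      have q: "fst q \<in> ?B" "snd q \<in> ?B" using that(2) by auto
      have 1: "\<phi> (act M (unit_fun (fst q)) v) = basis_act R (fst q) (\<phi> v)"
        using rep_mapD(3)[OF M_map H_unit_fun_closed[OF q(1)] vw(1)] hact_unit[OF q(1)] by simp
      have 2: "\<psi> (act N (unit_fun (snd q)) w) = basis_act R' (snd q) (\<psi> w)"
        using rep_mapD(3)[OF N_map H_unit_fun_closed[OF q(2)] vw(2)] hact_unit[OF q(2)] by simp
      have "tens2 (basis_act R' (snd q)) (\<theta> s) = (\<lambda>(b, c). basis_act R' (snd q) (\<psi> w) c * \<phi> v b)"
        using lin_on_scale[OF lin_on_basis_act[OF R' q(2)] coord_fsp[OF \<psi> vw(2)]]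
        by (simp add: \<theta>_def s tens2_def fun_eq_iff)
      then have "tens1 (basis_act R (fst q)) (tens2 (basis_act R' (snd q)) (\<theta> s)) =
          (\<lambda>(b, c). basis_act R' (snd q) (\<psi> w) c * basis_act R (fst q) (\<phi> v) b)"
        using lin_on_scale[OF lin_on_basis_act[OF R q(1)] coord_fsp[OF \<phi> vw(1)]]
        by (simp add: tens1_def fun_eq_iff)
      then show ?thesis by (simp add: P_def s \<theta>_def 1 2 mult.commute fun_eq_iff)
    qed
    have \<theta>_fsp: "\<theta> s \<in> fsp ?D" if "f s \<noteq> 0" for s
      using supp[OF that] coord_fsp[OF \<phi>] coord_fsp[OF \<psi>]
      by (cases s) (auto simp: \<theta>_def fsp_def)
    have "\<Phi> (H_diag G \<chi> g n M N x f) = (\<lambda>p. \<Sum>i\<in>?I. \<alpha> i * \<theta> (P i) p)"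
      unfolding eq \<Phi>_def by (rule lin_ext_sum[OF I])
    also have "\<dots> = (\<lambda>p. \<Sum>s | f s \<noteq> 0. \<Sum>q\<in>?B \<times> ?B. f s * H_comult G \<chi> g n x q *
        tens1 (basis_act R (fst q)) (tens2 (basis_act R' (snd q)) (\<theta> s)) p)"
      unfolding sum.cartesian_product
      by (intro ext sum.cong refl) (auto simp: \<alpha>_def \<theta>P)
    also have "\<dots> = (\<lambda>p. \<Sum>s | f s \<noteq> 0. f s * HH_act R R' (H_comult G \<chi> g n x) (\<theta> s) p)"
      by (simp add: HH_act_def sum_distrib_left mult.assoc)
    also have "\<dots> = HH_act R R' (H_comult G \<chi> g n x) (\<Phi> f)"
      unfolding \<Phi>_def lin_ext_def
      by (rule lin_on_sum[OF lin_on_HH_act[OF R R'], symmetric]) (simp add: \<theta>_fsp)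
    also have "\<dots> = hact (rtensor R R') x (\<Phi> f)" by (rule HH_act_comult[OF R R' \<Phi>_fsp[OF f]])
    finally show "\<Phi> (H_diag G \<chi> g n M N x f) = hact (rtensor R R') x (\<Phi> f)" .
  qed
  have T_act: "act T x (C t) = C (hact (rtensor R R') x t)" if x: "x \<in> carrier H" and t: "t \<in> fsp ?D" for x t
  proof -
    have "act T x (C t) = (\<Union>f\<in>C t. K +>\<^bsub>F\<^esub> H_diag G \<chi> g n M N x f)"
      by (simp add: T_def H_tensor_def Let_def F_def[symmetric] K_def[symmetric])
    also have "\<dots> = C (hact (rtensor R R') x t)"
      by (rule union[OF t]) (auto simp: C_def diag[OF x])
    finally show ?thesis .
  qed
  \<comment> \<open>The coordinates of a coset, read off from any of its elements.\<close>
  define \<eta> where "\<eta> A = \<Phi> (SOME f. f \<in> A)" for A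
  have \<eta>: "\<eta> (C t) = t" if "t \<in> fsp ?D" for t
  proof -
    have "(SOME f. f \<in> C t) \<in> C t" using C_ne[OF that] by (rule someI_ex)
    then show ?thesis by (simp add: \<eta>_def C_def)
  qed
  have RT: "is_rep (rtensor R R')" by (rule is_rep_rtensor[OF R R'])
  have idx: "idx (rtensor R R') = ?D" by (simp add: rtensor_def)
  have hc: "hact (rtensor R R') x t \<in> fsp ?D" if "t \<in> fsp ?D" for x t
    using lin_on_fsp[OF lin_on_hact[OF RT]] that unfolding idx .
  have add_c: "(\<lambda>p. t p + t' p) \<in> fsp ?D" if "t \<in> fsp ?D" "t' \<in> fsp ?D" for t t' :: "'i \<times> 'j \<Rightarrow> 'k"
    using that by (rule fsp_add)
  have scale_c: "(\<lambda>p. c * t p) \<in> fsp ?D" if "t \<in> fsp ?D" for c and t :: "'i \<times> 'j \<Rightarrow> 'k"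
    using that by (rule fsp_scale)
  have "coord T ?D \<eta>"
  proof (rule coordI)
    show "finite ?D" using is_repD(1)[OF RT] unfolding idx .
    show "bij_betw \<eta> (carrier T) (fsp ?D)"
      unfolding T_carrier by (rule bij_betw_byWitness[of _ C]) (use \<eta> in auto)
  qed (auto simp: T_carrier T_zero T_add T_smult \<eta> add_c scale_c)
  moreover have "act T x v \<in> carrier T \<and> \<eta> (act T x v) = hact (rtensor R R') x (\<eta> v)"
    if "x \<in> carrier H" "v \<in> carrier T" for x v
    using that(2) unfolding T_carrier by (auto simp: T_act[OF that(1)] \<eta> hc)
  ultimately show ?thesis
    unfolding T_def[symmetric] by (intro has_repI[OF RT, of _ \<eta>]) (simp_all add: idx)
qed

end

section \<open>Products of chains\<close>

context nilpotent_group_datum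
begin

text \<open>
  The \<open>q\<^bsup>-1\<^esup>\<close>-integer \<open>[k]\<close>. Among \<open>1, \<dots>, n\<close> only \<open>[n]\<close> vanishes, which separates the two product
  formulas.
\<close>

definition qint :: "nat \<Rightarrow> 'k" where
  "qint k = (\<Sum>i<k. inverse (\<chi> g) ^ i)"

lemma qint_0 [simp]: "qint 0 = 0"
  and qint_Suc [simp]: "qint (Suc k) = qint k + inverse (\<chi> g) ^ k"
  by (simp_all add: qint_def)

lemma qint_geometric: "(1 - inverse (\<chi> g)) * qint k = 1 - inverse (\<chi> g) ^ k"
  by (induction k) (simp_all add: distrib_left left_diff_distrib)

lemma qint_nonzero: "0 < k \<Longrightarrow> k < n \<Longrightarrow> qint k \<noteq> 0"
  using qint_geometric[of k] q_pow_neq_1[of k]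
  by (auto simp: power_inverse)

lemma qint_n: "qint n = 0"
proof -
  have "inverse (\<chi> g) ^ n = 1" "inverse (\<chi> g) \<noteq> 1"
    using q_pow_n q_pow_neq_1[of 1] n_ge_2 by (auto simp: power_inverse)
  then show ?thesis using qint_geometric[of n] by simp
qed

abbreviation rchi_inv :: "('a, unit, 'k) crep" where
  "rchi_inv \<equiv> rchar (\<lambda>h. inverse (\<chi> h))"

lemma is_rep_rchi_inv: "is_rep rchi_inv"
  by (rule is_rep_rchar) (simp_all add: chi_one chi_mult)

lemma is_rep_runit: "is_rep (rchar (\<lambda>_. 1))"
  by (rule is_rep_rchar) simp_all

lemma rchain_simps:
  "idx (rchain j) = {..<j}" "gact (rchain j) h f k = inverse (\<chi> h) ^ k * f k"
  "yact (rchain j) f k = (if 0 < k \<and> k < j then f (k - 1) else 0)"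
  by (simp_all add: rchain_def)

lemma rtensor_simps:
  "idx (rtensor R R') = idx R \<times> idx R'"
  "gact (rtensor R R') h f (b, c) = gact R h (\<lambda>b'. gact R' h (\<lambda>c'. f (b', c')) c) b"
  "yact (rtensor R R') f (b, c) =
    yact R (\<lambda>b'. gact R' g (\<lambda>c'. f (b', c')) c) b + yact R' (\<lambda>c'. f (b, c')) c"
  by (simp_all add: rtensor_def tens1_def tens2_def)

lemma rsum_simps:
  "idx (rsum R R') = idx R <+> idx R'"
  "gact (rsum R R') h f (Inl b) = gact R h (\<lambda>b. f (Inl b)) b"
  "gact (rsum R R') h f (Inr c) = gact R' h (\<lambda>c. f (Inr c)) c"
  "yact (rsum R R') f (Inl b) = yact R (\<lambda>b. f (Inl b)) b"
  "yact (rsum R R') f (Inr c) = yact R' (\<lambda>c. f (Inr c)) c"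
  by (simp_all add: rsum_def)

lemma rchar_simps: "idx (rchar \<psi>) = {()}" "gact (rchar \<psi>) h f u = \<psi> h * f u" "yact (rchar \<psi>) f u = 0"
  by (simp_all add: rchar_def)

lemmas crep_simps = rchain_simps rtensor_simps rsum_simps rchar_simps

lemma nat_pair_eqI:
  assumes "\<And>l. u (0, l) = v (0, l)" "\<And>l. u (Suc 0, l) = v (Suc 0, l)"
    and "\<And>a l. u (Suc (Suc a), l) = v (Suc (Suc a), l)"
  shows "u = v"
proof
  fix p :: "nat \<times> 'c"
  obtain a l where p: "p = (a, l)" by (cases p)
  consider "a = 0" | "a = Suc 0" | a' where "a = Suc (Suc a')" by (metis not0_implies_Suc)
  then show "u p = v p" using assms p by cases simp_all
qed

text \<open>
  The summands are generated by \<open>u = x\<^sup>0 \<otimes> x\<^sup>0\<close> and \<open>v = x\<^sup>0 \<otimes> x\<^sup>1 + (1 - [j]) x\<^sup>1 \<otimes> x\<^sup>0\<close>. Indeed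
  \<open>y\<^sup>l u = x\<^sup>0 \<otimes> x\<^sup>l + [l] x\<^sup>1 \<otimes> x\<^bsup>l-1\<^esup>\<close>, where \<open>x\<^sup>j = 0\<close>, and
  \<open>y\<^sup>l v = x\<^sup>0 \<otimes> x\<^bsup>l+1\<^esup> + ([l+1] - [j]) x\<^sup>1 \<otimes> x\<^sup>l\<close>, which vanishes for \<open>l = j - 1\<close>. The coefficient of
  \<open>x\<^sup>1 \<otimes> x\<^sup>0\<close> in \<open>v\<close> is chosen for this purpose. The group acts on \<open>v\<close> by \<open>\<chi>\<^bsup>-1\<^esup>\<close>.
\<close>

lemma chain_product:
  assumes j: "0 < j" "j < n"
  shows "rep_iso (rsum (rchain (Suc j)) (rtensor rchi_inv (rchain (j - 1))))
    (rtensor (rchain 2) (rchain j))"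
    (is "rep_iso ?A ?B")
proof -
  define F :: "(nat + unit \<times> nat \<Rightarrow> 'k) \<Rightarrow> nat \<times> nat \<Rightarrow> 'k" where
    "F f = (\<lambda>(a, l). if l < j \<and> a = 0 then f (Inl l) + (if 0 < l then f (Inr ((), l - 1)) else 0)
      else if l < j \<and> a = 1 then qint (Suc l) * f (Inl (Suc l)) + (qint (Suc l) - qint j) * f (Inr ((), l))
      else 0)" for f
  \<comment> \<open>The coefficient of \<open>y\<^sup>l v\<close>: the vectors \<open>y\<^bsup>l+1\<^esup> u\<close> and \<open>y\<^sup>l v\<close> lie in the plane of
    \<open>x\<^sup>0 \<otimes> x\<^bsup>l+1\<^esup>\<close> and \<open>x\<^sup>1 \<otimes> x\<^sup>l\<close>, and their determinant is \<open>-[j]\<close>.\<close>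
  define s :: "(nat \<times> nat \<Rightarrow> 'k) \<Rightarrow> nat \<Rightarrow> 'k" where
    "s t l = (if l < j - 1 then (qint (Suc l) * t (0, Suc l) - t (1, l)) / qint j else 0)" for t l
  define E :: "(nat \<times> nat \<Rightarrow> 'k) \<Rightarrow> nat + unit \<times> nat \<Rightarrow> 'k" where
    "E t = case_sum (\<lambda>l. if l = 0 then t (0, 0) else if l < j then t (0, l) - s t (l - 1)
        else if l = j then t (1, j - 1) / qint j else 0) (\<lambda>(_, l). s t l)" for t
  have c: "qint j \<noteq> 0" by (rule qint_nonzero[OF j])
  have idx: "idx ?A = {..<Suc j} <+> {()} \<times> {..<j - 1}" "idx ?B = {..<2} \<times> {..<j}"
    by (simp_all add: crep_simps)
  have f0: "f (Inl l) = 0" "f (Inr ((), l')) = 0"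
    if "f \<in> fsp (idx ?A)" "\<not> l < Suc j" "\<not> l' < j - 1" for f :: "nat + unit \<times> nat \<Rightarrow> 'k" and l l'
    using that unfolding idx by (auto simp: fsp_def)
  have t0: "t (a, l) = 0" if "t \<in> fsp (idx ?B)" "\<not> (a < 2 \<and> l < j)" for t :: "nat \<times> nat \<Rightarrow> 'k" and a l
    using that unfolding idx by (auto simp: fsp_def)
  show ?thesis
  proof (rule rep_isoI)
    show "lin_on (idx ?A) (idx ?B) F"
      by (rule lin_onI) (auto simp: F_def idx fsp_def fun_eq_iff algebra_simps)
    show "E t \<in> fsp (idx ?A)" for t
    proof -
      have "E t (Inl l) = 0" if "\<not> l < Suc j" for l using j that by (simp add: E_def)
      moreover have "E t (Inr (u, l)) = 0" if "\<not> l < j - 1" for u l using that by (simp add: E_def s_def)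
      ultimately show ?thesis unfolding fsp_def idx by (auto simp: split_sum_all)
    qed
    show "E (F f) = f" if f: "f \<in> fsp (idx ?A)" for f
    proof -
      have s: "s (F f) l = f (Inr ((), l))" for l
      proof (cases "l < j - 1")
        case True
        then have "Suc l < j" "l < j" by auto
        then have "s (F f) l = (qint j * f (Inr ((), l))) / qint j"
          using True by (simp add: s_def F_def algebra_simps)
        then show ?thesis using c by simp
      next
        case False
        then show ?thesis using f0(2)[OF f _ False, of "Suc j"] by (simp add: s_def)
      qed
      have "E (F f) (Inl l) = f (Inl l)" for l
      proof -
        consider "l = 0" | "0 < l" "l < j" | "l = j" | "j < l" by linarith
        then show ?thesis
        proof cases
          case 3
          then obtain l' where "j = Suc l'" using j by (cases j) auto
          then show ?thesis using 3 c by (simp add: E_def F_def del: qint_Suc)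
        next
          case 1
          then show ?thesis using j by (simp add: E_def F_def)
        next
          case 2
          then have "E (F f) (Inl l) = F f (0, l) - s (F f) (l - 1)" by (simp add: E_def)
          then show ?thesis using 2 unfolding s by (simp add: F_def)
        next
          case 4
          then show ?thesis using f0(1)[OF f, of l j] by (simp add: E_def)
        qed
      qed
      then show ?thesis by (auto simp: fun_eq_iff split_sum_all E_def s)
    qed
    show "F (E t) = t" if t: "t \<in> fsp (idx ?B)" for t
    proof -
      have "F (E t) (0, l) = t (0, l)" for l
        using t0[OF t, of 0 l] j by (auto simp: F_def E_def)
      moreover have "F (E t) (Suc 0, l) = t (Suc 0, l)" for l
      proof -
        consider "Suc l < j" | "j = Suc l" | "j \<le> l" by linarith
        then show ?thesis
        proof cases
          case 1
          then have "F (E t) (Suc 0, l) = qint (Suc l) * (t (0, Suc l) - s t l) + (qint (Suc l) - qint j) * s t l"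
            by (simp add: F_def E_def del: qint_Suc)
          also have "\<dots> = qint (Suc l) * t (0, Suc l) - qint j * s t l"
            by (simp add: algebra_simps)
          also have "qint j * s t l = qint (Suc l) * t (0, Suc l) - t (1, l)"
            using less_diff_conv[of l j 1] 1 c by (simp add: s_def del: qint_Suc)
          finally show ?thesis by simp
        next
          case 2
          then show ?thesis using c by (simp add: F_def E_def s_def del: qint_Suc)
        next
          case 3
          then show ?thesis using t0[OF t, of 1 l] by (simp add: F_def)
        qed
      qed
      moreover have "F (E t) (Suc (Suc a), l) = t (Suc (Suc a), l)" for a l
        using t0[OF t, of "Suc (Suc a)" l] by (simp add: F_def)
      ultimately show ?thesis by (rule nat_pair_eqI)
    qed
    show "F (gact ?A h f) = gact ?B h (F f)" if "h \<in> carrier G" for h f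
    proof -
      have "inverse (\<chi> h) * inverse (\<chi> h) ^ (l - Suc 0) = inverse (\<chi> h) ^ l" if "0 < l" for l
        using that by (cases l) auto
      then show ?thesis
        by (auto simp: fun_eq_iff F_def crep_simps algebra_simps)
    qed
    show "F (yact ?A f) = yact ?B (F f)" if f: "f \<in> fsp (idx ?A)" for f
    proof -
      have "F (yact ?A f) (0, l) = yact ?B (F f) (0, l)" for l
        by (cases l) (auto simp: F_def crep_simps)
      moreover have "F (yact ?A f) (Suc 0, l) = yact ?B (F f) (Suc 0, l)" for l
      proof (cases l)
        case 0
        then show ?thesis using j by (simp add: F_def crep_simps)
      next
        case (Suc l')
        have last: "qint (Suc l) = qint j" if "Suc l = j" using that by simp
        show ?thesis
          using Suc j last
          by (cases "Suc l = j"; cases "l < j") (auto simp: F_def crep_simps algebra_simps)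
      qed
      moreover have "F (yact ?A f) (Suc (Suc a), l) = yact ?B (F f) (Suc (Suc a), l)" for a l
        by (simp add: F_def crep_simps)
      ultimately show ?thesis by (rule nat_pair_eqI)
    qed
  qed
qed

text \<open>
  As \<open>[n] = 0\<close>, the chain generated by \<open>x\<^sup>0 \<otimes> x\<^sup>0\<close> ends after \<open>n\<close> steps. A complement is the chain
  \<open>x\<^sup>1 \<otimes> x\<^sup>l\<close>.
\<close>

lemma top_chain_product:
  "rep_iso (rsum (rchain n) (rtensor rchi_inv (rchain n))) (rtensor (rchain 2) (rchain n))"
    (is "rep_iso ?A ?B")
proof -
  define F :: "(nat + unit \<times> nat \<Rightarrow> 'k) \<Rightarrow> nat \<times> nat \<Rightarrow> 'k" where
    "F f = (\<lambda>(a, l). if l < n \<and> a = 0 then f (Inl l)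
      else if l < n \<and> a = 1 then qint (Suc l) * f (Inl (Suc l)) + f (Inr ((), l)) else 0)" for f
  define E :: "(nat \<times> nat \<Rightarrow> 'k) \<Rightarrow> nat + unit \<times> nat \<Rightarrow> 'k" where
    "E t = case_sum (\<lambda>l. t (0, l)) (\<lambda>(_, l). if l < n then t (1, l) - qint (Suc l) * t (0, Suc l) else 0)" for t
  have idx: "idx ?A = {..<n} <+> {()} \<times> {..<n}" "idx ?B = {..<2} \<times> {..<n}"
    by (simp_all add: crep_simps)
  have f0: "f (Inl l) = 0" "f (Inr ((), l)) = 0"
    if "f \<in> fsp (idx ?A)" "\<not> l < n" for f :: "nat + unit \<times> nat \<Rightarrow> 'k" and l
    using that unfolding idx by (auto simp: fsp_def)
  have t0: "t (a, l) = 0" if "t \<in> fsp (idx ?B)" "\<not> (a < 2 \<and> l < n)" for t :: "nat \<times> nat \<Rightarrow> 'k" and a l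
    using that unfolding idx by (auto simp: fsp_def)
  show ?thesis
  proof (rule rep_isoI)
    show "lin_on (idx ?A) (idx ?B) F"
      by (rule lin_onI) (auto simp: F_def idx fsp_def fun_eq_iff algebra_simps)
    show "E t \<in> fsp (idx ?A)" if "t \<in> fsp (idx ?B)" for t
    proof -
      have "E t (Inl l) = 0" if "\<not> l < n" for l using t0[OF \<open>t \<in> fsp (idx ?B)\<close>, of 0 l] that by (simp add: E_def)
      moreover have "E t (Inr (u, l)) = 0" if "\<not> l < n" for u l using that by (simp add: E_def)
      ultimately show ?thesis unfolding fsp_def idx by (auto simp: split_sum_all)
    qed
    show "E (F f) = f" if f: "f \<in> fsp (idx ?A)" for f
    proof -
      have "E (F f) (Inl l) = f (Inl l)" for l
        using f0(1)[OF f, of l] by (cases "l < n") (simp_all add: E_def F_def)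
      moreover have "E (F f) (Inr (u, l)) = f (Inr (u, l))" for u l
        using f0(1)[OF f, of "Suc l"] f0(2)[OF f, of l]
        by (cases "Suc l < n"; cases "l < n") (simp_all add: E_def F_def)
      ultimately show ?thesis by (simp add: fun_eq_iff split_sum_all)
    qed
    show "F (E t) = t" if t: "t \<in> fsp (idx ?B)" for t
    proof -
      have "F (E t) (0, l) = t (0, l)" for l
        using t0[OF t, of 0 l] by (cases "l < n") (simp_all add: F_def E_def)
      moreover have "F (E t) (Suc 0, l) = t (Suc 0, l)" for l
        using t0[OF t, of "Suc 0" l] by (cases "l < n") (simp_all add: F_def E_def del: qint_Suc)
      moreover have "F (E t) (Suc (Suc a), l) = t (Suc (Suc a), l)" for a l
        using t0[OF t, of "Suc (Suc a)" l] by (simp add: F_def)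
      ultimately show ?thesis by (rule nat_pair_eqI)
    qed
    show "F (gact ?A h f) = gact ?B h (F f)" for h f
    proof -
      have "F (gact ?A h f) (0, l) = gact ?B h (F f) (0, l)" for l
        by (simp add: F_def crep_simps)
      moreover have "F (gact ?A h f) (Suc 0, l) = gact ?B h (F f) (Suc 0, l)" for l
        by (simp add: F_def crep_simps distrib_left mult.left_commute mult.assoc del: qint_Suc)
      moreover have "F (gact ?A h f) (Suc (Suc a), l) = gact ?B h (F f) (Suc (Suc a), l)" for a l
        by (simp add: F_def crep_simps)
      ultimately show ?thesis by (rule nat_pair_eqI)
    qed
    show "F (yact ?A f) = yact ?B (F f)" if f: "f \<in> fsp (idx ?A)" for f
    proof -
      have "F (yact ?A f) (0, l) = yact ?B (F f) (0, l)" for l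
        by (cases l) (auto simp: F_def crep_simps)
      moreover have "F (yact ?A f) (Suc 0, l) = yact ?B (F f) (Suc 0, l)" for l
      proof -
        consider "Suc l < n" | "Suc l = n" | "\<not> l < n" by linarith
        then show ?thesis
        proof cases
          case 1
          then show ?thesis by (cases l) (simp_all add: F_def crep_simps distrib_right)
        next
          case 2
          have "qint (Suc l) = 0" using qint_n unfolding 2 .
          then have "(qint l + inverse (\<chi> g) ^ l) * f (Inl l) = 0" by simp
          then have "inverse (\<chi> g) ^ l * f (Inl l) + qint l * f (Inl l) = 0"
            by (simp add: distrib_right add.commute)
          moreover obtain l' where "l = Suc l'" using 2 n_ge_2 by (cases l) auto
          ultimately show ?thesis using 2 by (simp add: F_def crep_simps add.assoc[symmetric])
        next
          case 3
          then show ?thesis by (simp add: F_def crep_simps)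
        qed
      qed
      moreover have "F (yact ?A f) (Suc (Suc a), l) = yact ?B (F f) (Suc (Suc a), l)" for a l
        by (simp add: F_def crep_simps)
      ultimately show ?thesis by (rule nat_pair_eqI)
    qed
  qed
qed

section \<open>Tensor factors that commute\<close>

text \<open>
  These representations are the inflations of representations of \<open>G\<close>.
\<close>

definition yact_trivial :: "('a, 'i, 'k) crep \<Rightarrow> bool" where
  "yact_trivial U \<longleftrightarrow> (\<forall>f\<in>fsp (idx U). yact U f = (\<lambda>_. 0))"

lemma g_pow_central: "h \<in> carrier G \<Longrightarrow> g [^] (k :: nat) \<otimes> h = h \<otimes> g [^] k"
proof (induction k)
  case (Suc k)
  have gk: "g [^] k \<in> carrier G" using g_closed by simp
  have "g [^] Suc k \<otimes> h = g [^] k \<otimes> (h \<otimes> g)"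
    using gk g_closed Suc.prems g_central by (simp add: m_assoc)
  also have "\<dots> = h \<otimes> (g [^] k \<otimes> g)"
    using gk g_closed Suc by (simp add: m_assoc[symmetric])
  finally show ?case by simp
qed simp

text \<open>
  The isomorphism is \<open>v \<otimes> x\<^sup>k \<mapsto> x\<^sup>k \<otimes> g\<^sup>k v\<close>. On \<open>x\<^sup>k \<otimes> w\<close> the element \<open>y\<close> acts by \<open>y \<otimes> g\<close>, and the
  power of \<open>g\<close> absorbs this extra factor. It is \<open>G\<close>-linear because \<open>g\<close> is central.
\<close>

lemma rtensor_chain_commute:
  fixes U :: "('a, 'i, 'k) crep"
  assumes U: "is_rep U" and triv: "yact_trivial U"
  shows "rep_iso (rtensor U (rchain j)) (rtensor (rchain j) U)" (is "rep_iso ?A ?B")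
proof -
  let ?g = "\<lambda>k :: nat. g [^] k"
  have gk: "?g k \<in> carrier G" for k using g_closed by simp
  define F :: "('i \<times> nat \<Rightarrow> 'k) \<Rightarrow> nat \<times> 'i \<Rightarrow> 'k" where
    "F f = (\<lambda>(k, b). gact U (?g k) (\<lambda>b'. f (b', k)) b)" for f
  define E :: "(nat \<times> 'i \<Rightarrow> 'k) \<Rightarrow> 'i \<times> nat \<Rightarrow> 'k" where
    "E f = (\<lambda>(b, k). gact U (inv (?g k)) (\<lambda>b'. f (k, b')) b)" for f
  have idx: "idx ?A = idx U \<times> {..<j}" "idx ?B = {..<j} \<times> idx U" by (simp_all add: crep_simps)
  note lin = is_repD(2)[OF U]
  have closed: "(\<lambda>b. gact U h v b) \<in> fsp (idx U)" if "h \<in> carrier G" "v \<in> fsp (idx U)" for h v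
    using lin_on_fsp[OF lin that(2)] that(1) by simp
  have sl: "(\<lambda>b. f (b, k)) \<in> fsp (idx U)" if "f \<in> fsp (idx ?A)" for f :: "'i \<times> nat \<Rightarrow> 'k" and k
    using slice1 that unfolding idx .
  have sl': "(\<lambda>b. f (k, b)) \<in> fsp (idx U)" if "f \<in> fsp (idx ?B)" for f :: "nat \<times> 'i \<Rightarrow> 'k" and k
    using slice2 that unfolding idx .
  have out: "(\<lambda>b. f (b, k)) = (\<lambda>_. 0)" if "f \<in> fsp (idx ?A)" "\<not> k < j" for f :: "'i \<times> nat \<Rightarrow> 'k" and k
    using that unfolding idx by (auto simp: fsp_def)
  have out': "(\<lambda>b. f (k, b)) = (\<lambda>_. 0)" if "f \<in> fsp (idx ?B)" "\<not> k < j" for f :: "nat \<times> 'i \<Rightarrow> 'k" and k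
    using that unfolding idx by (auto simp: fsp_def)
  have z: "gact U h (\<lambda>_. 0) = (\<lambda>_. 0)" if "h \<in> carrier G" for h
    by (rule lin_on_zero[OF lin[OF that]])
  have F_fsp: "F f \<in> fsp (idx ?B)" if f: "f \<in> fsp (idx ?A)" for f
  proof (rule fspI)
    fix p assume p: "p \<notin> idx ?B"
    obtain k b where [simp]: "p = (k, b)" by (cases p)
    show "F f p = 0"
      using p fspD[OF closed[OF gk sl[OF f]]] out[OF f] z[OF gk]
      by (cases "k < j") (auto simp: F_def idx)
  qed
  show ?thesis
  proof (rule rep_isoI)
    show "lin_on (idx ?A) (idx ?B) F"
      by (rule lin_onI[OF F_fsp])
        (simp_all add: F_def fun_eq_iff lin_on_add[OF lin[OF gk] sl sl] lin_on_scale[OF lin[OF gk] sl])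
    show "E f \<in> fsp (idx ?A)" if f: "f \<in> fsp (idx ?B)" for f
    proof (rule fspI)
      fix p assume p: "p \<notin> idx ?A"
      obtain b k where [simp]: "p = (b, k)" by (cases p)
      show "E f p = 0"
        using p fspD[OF closed[OF inv_closed[OF gk] sl'[OF f]]] out'[OF f] z[OF inv_closed[OF gk]]
        by (cases "k < j") (auto simp: E_def idx)
    qed
    show "E (F f) = f" if f: "f \<in> fsp (idx ?A)" for f
      using is_repD(5)[OF U inv_closed[OF gk] gk sl[OF f]] is_repD(4)[OF U sl[OF f]] gk
      by (auto simp: E_def F_def fun_eq_iff l_inv)
    show "F (E f) = f" if f: "f \<in> fsp (idx ?B)" for f
      using is_repD(5)[OF U gk inv_closed[OF gk] sl'[OF f]] is_repD(4)[OF U sl'[OF f]] gk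
      by (auto simp: E_def F_def fun_eq_iff r_inv)
    show "F (gact ?A h f) = gact ?B h (F f)" if h: "h \<in> carrier G" and f: "f \<in> fsp (idx ?A)" for h f
    proof -
      have "F (gact ?A h f) (k, b) = gact ?B h (F f) (k, b)" for k b
      proof -
        let ?s = "\<lambda>b. f (b, k)"
        have "F (gact ?A h f) (k, b) = gact U (?g k) (\<lambda>b. inverse (\<chi> h) ^ k * gact U h ?s b) b"
          by (simp add: F_def crep_simps lin_on_scale[OF lin[OF h] sl[OF f]])
        also have "\<dots> = inverse (\<chi> h) ^ k * gact U (?g k) (gact U h ?s) b"
          by (simp add: lin_on_scale[OF lin[OF gk] closed[OF h sl[OF f]]])
        also have "gact U (?g k) (gact U h ?s) = gact U h (gact U (?g k) ?s)"
          using is_repD(5)[OF U gk h sl[OF f]] is_repD(5)[OF U h gk sl[OF f]] g_pow_central[OF h] by simp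
        finally show ?thesis by (simp add: F_def crep_simps)
      qed
      then show ?thesis by (simp add: fun_eq_iff)
    qed
    show "F (yact ?A f) = yact ?B (F f)" if f: "f \<in> fsp (idx ?A)" for f
    proof -
      have 1: "yact U (\<lambda>b. c * f (b, k)) = (\<lambda>_. 0)" for c k
        using triv fsp_scale[OF sl[OF f]] unfolding yact_trivial_def by blast
      have 2: "yact U (\<lambda>b. F f (k, b)) = (\<lambda>_. 0)" for k
        using triv sl'[OF F_fsp[OF f]] unfolding yact_trivial_def by blast
      have "F (yact ?A f) (k, b) = yact ?B (F f) (k, b)" for k b
      proof (cases "0 < k \<and> k < j")
        case True
        then obtain l where k: "k = Suc l" by (cases k) auto
        have "F (yact ?A f) (k, b) = gact U (?g (Suc l)) (\<lambda>b. f (b, l)) b"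
          using True k by (simp add: F_def crep_simps 1 del: nat_pow_Suc)
        also have "?g (Suc l) = g \<otimes> ?g l" using g_pow_central[OF g_closed, of l] by simp
        also have "gact U (g \<otimes> ?g l) (\<lambda>b. f (b, l)) b = gact U g (gact U (?g l) (\<lambda>b. f (b, l))) b"
          using is_repD(5)[OF U g_closed gk sl[OF f]] by simp
        also have "\<dots> = yact ?B (F f) (k, b)"
          using True k 2[of k] by (simp add: crep_simps) (simp add: F_def)
        finally show ?thesis .
      next
        case False
        then show ?thesis using z[OF gk, of k] 2[of k] by (auto simp: F_def crep_simps 1)
      qed
      then show ?thesis by (simp add: fun_eq_iff)
    qed
  qed
qed

lemma rtensor_commute_trivial:
  fixes U :: "('a, 'i, 'k) crep" and U' :: "('a, 'j, 'k) crep"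
  assumes U: "is_rep U" "yact_trivial U" and U': "is_rep U'" "yact_trivial U'"
  shows "rep_iso (rtensor U U') (rtensor U' U)"
proof (rule rep_iso_relabel[of prod.swap])
  show "bij (prod.swap :: 'j \<times> 'i \<Rightarrow> 'i \<times> 'j)" by (rule bij_swap)
  show "prod.swap p \<in> idx (rtensor U U') \<longleftrightarrow> p \<in> idx (rtensor U' U)" for p
    by (cases p) (auto simp: crep_simps)
  fix f :: "'i \<times> 'j \<Rightarrow> 'k" assume "f \<in> fsp (idx (rtensor U U'))"
  then have f: "f \<in> fsp (idx U \<times> idx U')" by (simp add: crep_simps)
  show "gact (rtensor U' U) h (\<lambda>c. f (prod.swap c)) = (\<lambda>c. gact (rtensor U U') h f (prod.swap c))"
    if h: "h \<in> carrier G" for h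
    using tens_commute[OF is_repD(2)[OF U(1) h] is_repD(2)[OF U'(1) h] is_repD(1)[OF U'(1)] f]
    by (auto simp: fun_eq_iff crep_simps tens1_def tens2_def)
  have 1: "yact U' (\<lambda>c. f (b, c)) = (\<lambda>_. 0)" for b
    using U'(2) slice2[OF f] unfolding yact_trivial_def by blast
  have 2: "yact U (\<lambda>b. f (b, c)) = (\<lambda>_. 0)" for c
    using U(2) slice1[OF f] unfolding yact_trivial_def by blast
  have 3: "yact U (\<lambda>b. gact U' g (\<lambda>c. f (b, c)) c) = (\<lambda>_. 0)" for c
    using U(2) slice1[OF lin_on_fsp[OF lin_on_tens2[OF is_repD(2)[OF U'(1) g_closed]] f], of c]
    unfolding yact_trivial_def by (simp add: tens2_def)
  have 4: "yact U' (\<lambda>c. gact U g (\<lambda>b. f (b, c)) b) = (\<lambda>_. 0)" for b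
    using U'(2) slice2[OF lin_on_fsp[OF lin_on_tens1[OF is_repD(2)[OF U(1) g_closed]] f], of b]
    unfolding yact_trivial_def by (simp add: tens1_def)
  show "yact (rtensor U' U) (\<lambda>c. f (prod.swap c)) = (\<lambda>c. yact (rtensor U U') f (prod.swap c))"
    by (auto simp: fun_eq_iff crep_simps 1 2 3 4)
qed

end

section \<open>Modules over the group algebra\<close>

context nilpotent_group_datum
begin

definition group_map :: "('k, 'a \<Rightarrow> 'k, 'v) amod \<Rightarrow> ('a, 'i, 'k) crep \<Rightarrow> ('v \<Rightarrow> 'i \<Rightarrow> 'k) \<Rightarrow> bool" where
  "group_map V U \<phi> \<longleftrightarrow> coord V (idx U) \<phi> \<and>
     (\<forall>h\<in>carrier G. \<forall>v\<in>carrier V. act V (unit_fun h) v \<in> carrier V) \<and>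
     (\<forall>h\<in>carrier G. \<forall>v\<in>carrier V. \<phi> (act V (unit_fun h) v) = gact U h (\<phi> v))"

lemma group_mapD:
  assumes "group_map V U \<phi>"
  shows "coord V (idx U) \<phi>"
    and "h \<in> carrier G \<Longrightarrow> v \<in> carrier V \<Longrightarrow> act V (unit_fun h) v \<in> carrier V"
    and "h \<in> carrier G \<Longrightarrow> v \<in> carrier V \<Longrightarrow> \<phi> (act V (unit_fun h) v) = gact U h (\<phi> v)"
proof -
  note D = assms[unfolded group_map_def]
  show "coord V (idx U) \<phi>" by (rule D[THEN conjunct1])
  show "h \<in> carrier G \<Longrightarrow> v \<in> carrier V \<Longrightarrow> act V (unit_fun h) v \<in> carrier V"
    by (rule D[THEN conjunct2, THEN conjunct1, THEN bspec, THEN bspec])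
  show "h \<in> carrier G \<Longrightarrow> v \<in> carrier V \<Longrightarrow> \<phi> (act V (unit_fun h) v) = gact U h (\<phi> v)"
    by (rule D[THEN conjunct2, THEN conjunct2, THEN bspec, THEN bspec])
qed

definition has_group_rep :: "('k, 'a \<Rightarrow> 'k, 'v) amod \<Rightarrow> ('a, 'i, 'k) crep \<Rightarrow> bool" where
  "has_group_rep V U \<longleftrightarrow> is_rep U \<and> yact_trivial U \<and> (\<exists>\<phi>. group_map V U \<phi>)"

lemma has_group_repI:
  assumes "is_rep U" "yact_trivial U" "coord V (idx U) \<phi>"
    and "\<And>h v. h \<in> carrier G \<Longrightarrow> v \<in> carrier V \<Longrightarrow> act V (unit_fun h) v \<in> carrier V"
    and "\<And>h v. h \<in> carrier G \<Longrightarrow> v \<in> carrier V \<Longrightarrow> \<phi> (act V (unit_fun h) v) = gact U h (\<phi> v)"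
  shows "has_group_rep V U"
  unfolding has_group_rep_def group_map_def
  by (intro conjI exI[of _ \<phi>] ballI assms; assumption)

lemma has_group_rep_is_rep: "has_group_rep V U \<Longrightarrow> is_rep U"
  and has_group_rep_trivial: "has_group_rep V U \<Longrightarrow> yact_trivial U"
  by (simp_all add: has_group_rep_def)

lemma yact_trivialD: "yact_trivial U \<Longrightarrow> f \<in> fsp (idx U) \<Longrightarrow> yact U f = (\<lambda>_. 0)"
  by (simp add: yact_trivial_def)

lemma has_rep_inflate:
  assumes V: "has_group_rep V U"
  shows "has_rep (inflate G n V) U"
proof -
  from V obtain \<phi> where \<phi>: "group_map V U \<phi>" unfolding has_group_rep_def by blast
  show ?thesis
    unfolding inflate_def
  proof (rule has_rep_H_act[OF has_group_rep_is_rep[OF V] group_mapD(1)[OF \<phi>]])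
    show "act V (unit_fun h) v \<in> carrier V \<and> \<phi> (act V (unit_fun h) v) = gact U h (\<phi> v)"
      if "h \<in> carrier G" "v \<in> carrier V" for h v
      using group_mapD(2,3)[OF \<phi> that] by simp
    show "\<zero>\<^bsub>V\<^esub> \<in> carrier V \<and> \<phi> \<zero>\<^bsub>V\<^esub> = yact U (\<phi> v)" if "v \<in> carrier V" for v
      using coordD(2,7)[OF group_mapD(1)[OF \<phi>]]
        yact_trivialD[OF has_group_rep_trivial[OF V] coord_fsp[OF group_mapD(1)[OF \<phi>] that]] by simp
  qed
qed

text \<open>
  The element \<open>\<Sum> x\<^sup>k v\<^sub>k\<close> of \<open>M(V,j)\<close> corresponds to \<open>\<Sum> v\<^sub>k \<otimes> x\<^sup>k\<close>.
\<close>

lemma has_rep_M_module: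
  fixes V :: "('k, 'a \<Rightarrow> 'k, 'v) amod" and U :: "('a, 'i, 'k) crep"
  assumes V: "has_group_rep V U" and j: "j \<le> n"
  shows "has_rep (M_module G \<chi> n V j) (rtensor U (rchain j))"
proof -
  from V obtain \<phi> where map: "group_map V U \<phi>" unfolding has_group_rep_def by blast
  note \<phi> = group_mapD(1)[OF map] and U = has_group_rep_is_rep[OF V]
  note triv = yact_trivialD[OF has_group_rep_trivial[OF V]]
  note D = coordD(2,3,5)[OF \<phi>] and L = coordD(4,6,7)[OF \<phi>]
  have copies: "f \<in> carrier (copies V j) \<longleftrightarrow> (\<forall>k<j. f k \<in> carrier V) \<and> (\<forall>k\<ge>j. f k = \<zero>\<^bsub>V\<^esub>)"
    "\<zero>\<^bsub>copies V j\<^esub> = (\<lambda>_. \<zero>\<^bsub>V\<^esub>)" "f \<oplus>\<^bsub>copies V j\<^esub> f' = (\<lambda>k. f k \<oplus>\<^bsub>V\<^esub> f' k)"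
    "c \<odot>\<^bsub>copies V j\<^esub> f = (\<lambda>k. c \<odot>\<^bsub>V\<^esub> f k)" for f f' c
    by (auto simp: copies_def)
  have fk: "f k \<in> carrier V" if "f \<in> carrier (copies V j)" for f k
    using that D(1) unfolding copies by (cases "k < j") auto
  have f0: "f k = \<zero>\<^bsub>V\<^esub>" if "f \<in> carrier (copies V j)" "\<not> k < j" for f k
    using that unfolding copies by simp
  have copiesI: "f \<in> carrier (copies V j)" if "\<And>k. k < j \<Longrightarrow> f k \<in> carrier V" "\<And>k. \<not> k < j \<Longrightarrow> f k = \<zero>\<^bsub>V\<^esub>" for f
    using that unfolding copies by (simp add: not_less)
  have zero_add: "\<zero>\<^bsub>V\<^esub> \<oplus>\<^bsub>V\<^esub> \<zero>\<^bsub>V\<^esub> = \<zero>\<^bsub>V\<^esub>" by (rule coord_inj[OF \<phi>]) (simp_all add: D L)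
  have scale_zero: "c \<odot>\<^bsub>V\<^esub> \<zero>\<^bsub>V\<^esub> = \<zero>\<^bsub>V\<^esub>" for c by (rule coord_inj[OF \<phi>]) (simp_all add: D L)
  define \<theta> :: "(nat \<Rightarrow> 'v) \<Rightarrow> 'i \<times> nat \<Rightarrow> 'k" where "\<theta> f = (\<lambda>(b, k). \<phi> (f k) b)" for f
  have idx: "idx (rtensor U (rchain j)) = idx U \<times> {..<j}" by (simp add: crep_simps)
  have \<theta>: "coord (copies V j) (idx U \<times> {..<j}) \<theta>"
  proof (rule coordI)
    show "finite (idx U \<times> {..<j})" using is_repD(1)[OF U] by simp
    show "\<zero>\<^bsub>copies V j\<^esub> \<in> carrier (copies V j)" using D(1) by (simp add: copies)
    show "f \<oplus>\<^bsub>copies V j\<^esub> f' \<in> carrier (copies V j)"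
      if "f \<in> carrier (copies V j)" "f' \<in> carrier (copies V j)" for f f'
      unfolding copies(3)
      by (rule copiesI) (simp_all add: fk[OF that(1)] fk[OF that(2)] f0[OF that(1)] f0[OF that(2)] D zero_add)
    show "c \<odot>\<^bsub>copies V j\<^esub> f \<in> carrier (copies V j)" if "f \<in> carrier (copies V j)" for c f
      unfolding copies(4) by (rule copiesI) (simp_all add: fk[OF that] f0[OF that] D scale_zero)
    show "\<theta> (f \<oplus>\<^bsub>copies V j\<^esub> f') = (\<lambda>b. \<theta> f b + \<theta> f' b)"
      if "f \<in> carrier (copies V j)" "f' \<in> carrier (copies V j)" for f f'
      by (simp add: \<theta>_def copies(3) L fk[OF that(1)] fk[OF that(2)] fun_eq_iff)
    show "\<theta> (c \<odot>\<^bsub>copies V j\<^esub> f) = (\<lambda>b. c * \<theta> f b)" if "f \<in> carrier (copies V j)" for c f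
      by (simp add: \<theta>_def copies(4) L fk[OF that] fun_eq_iff)
    show "\<theta> \<zero>\<^bsub>copies V j\<^esub> = (\<lambda>_. 0)" by (simp add: \<theta>_def copies(2) L fun_eq_iff)
    show "bij_betw \<theta> (carrier (copies V j)) (fsp (idx U \<times> {..<j}))"
    proof (rule bij_betw_byWitness[of _ "\<lambda>t k. if k < j then inv_into (carrier V) \<phi> (\<lambda>b. t (b, k)) else \<zero>\<^bsub>V\<^esub>"])
      show "\<forall>f\<in>carrier (copies V j).
          (\<lambda>k. if k < j then inv_into (carrier V) \<phi> (\<lambda>b. \<theta> f (b, k)) else \<zero>\<^bsub>V\<^esub>) = f"
        by (auto simp: \<theta>_def fun_eq_iff coord_inv(3)[OF \<phi>] fk f0)
      show "\<forall>t\<in>fsp (idx U \<times> {..<j}).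
          \<theta> (\<lambda>k. if k < j then inv_into (carrier V) \<phi> (\<lambda>b. t (b, k)) else \<zero>\<^bsub>V\<^esub>) = t"
      proof (intro ballI ext)
        fix t :: "'i \<times> nat \<Rightarrow> 'k" and p assume t: "t \<in> fsp (idx U \<times> {..<j})"
        show "\<theta> (\<lambda>k. if k < j then inv_into (carrier V) \<phi> (\<lambda>b. t (b, k)) else \<zero>\<^bsub>V\<^esub>) p = t p"
          using coord_inv(2)[OF \<phi> slice1[OF t]] fspD[OF t]
          by (cases p) (auto simp: \<theta>_def L)
      qed
      show "\<theta> ` carrier (copies V j) \<subseteq> fsp (idx U \<times> {..<j})"
      proof (intro subsetI, elim imageE)
        fix t f assume t: "t = \<theta> f" and f: "f \<in> carrier (copies V j)"
        show "t \<in> fsp (idx U \<times> {..<j})"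
        proof (rule fspI)
          fix p assume "p \<notin> idx U \<times> {..<j}"
          then show "t p = 0"
            using fspD[OF coord_fsp[OF \<phi> fk[OF f]]] f0[OF f] L(3)
            by (cases p) (auto simp: t \<theta>_def)
        qed
      qed
      show "(\<lambda>t k. if k < j then inv_into (carrier V) \<phi> (\<lambda>b. t (b, k)) else \<zero>\<^bsub>V\<^esub>) ` fsp (idx U \<times> {..<j})
          \<subseteq> carrier (copies V j)"
      proof (intro subsetI, elim imageE)
        fix f and t :: "'i \<times> nat \<Rightarrow> 'k" assume "t \<in> fsp (idx U \<times> {..<j})"
          and f: "f = (\<lambda>k. if k < j then inv_into (carrier V) \<phi> (\<lambda>b. t (b, k)) else \<zero>\<^bsub>V\<^esub>)"
        then show "f \<in> carrier (copies V j)"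
          unfolding f by (intro copiesI) (simp_all add: coord_inv(1)[OF \<phi> slice1])
      qed
    qed
  qed
  show ?thesis
    unfolding M_module_def
  proof (rule has_rep_H_act[OF is_rep_rtensor[OF U is_rep_rchain[OF j]]])
    show "coord (copies V j) (idx (rtensor U (rchain j))) \<theta>" using \<theta> unfolding idx .
    show "(\<lambda>k. inverse (\<chi> h) ^ k \<odot>\<^bsub>V\<^esub> act V (unit_fun h) (f k)) \<in> carrier (copies V j) \<and>
      \<theta> (\<lambda>k. inverse (\<chi> h) ^ k \<odot>\<^bsub>V\<^esub> act V (unit_fun h) (f k)) = gact (rtensor U (rchain j)) h (\<theta> f)"
      if h: "h \<in> carrier G" and f: "f \<in> carrier (copies V j)" for h f
    proof
      have "\<phi> (act V (unit_fun h) \<zero>\<^bsub>V\<^esub>) = (\<lambda>_. 0)"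
        using group_mapD(3)[OF map h D(1)] lin_on_zero[OF is_repD(2)[OF U h]] L(3) by simp
      then have "act V (unit_fun h) \<zero>\<^bsub>V\<^esub> = \<zero>\<^bsub>V\<^esub>"
        by (intro coord_inj[OF \<phi>]) (simp_all add: D L group_mapD(2)[OF map h])
      then show "(\<lambda>k. inverse (\<chi> h) ^ k \<odot>\<^bsub>V\<^esub> act V (unit_fun h) (f k)) \<in> carrier (copies V j)"
        by (intro copiesI) (simp_all add: D(3) group_mapD(2)[OF map h] fk[OF f] f0[OF f] scale_zero)
      show "\<theta> (\<lambda>k. inverse (\<chi> h) ^ k \<odot>\<^bsub>V\<^esub> act V (unit_fun h) (f k)) = gact (rtensor U (rchain j)) h (\<theta> f)"
        by (simp add: \<theta>_def fun_eq_iff crep_simps L(2) group_mapD(2,3)[OF map h] fk[OF f]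
            lin_on_scale[OF is_repD(2)[OF U h] coord_fsp[OF \<phi> fk[OF f]]])
    qed
    show "(\<lambda>k. if 0 < k \<and> k < j then f (k - 1) else \<zero>\<^bsub>V\<^esub>) \<in> carrier (copies V j) \<and>
      \<theta> (\<lambda>k. if 0 < k \<and> k < j then f (k - 1) else \<zero>\<^bsub>V\<^esub>) = yact (rtensor U (rchain j)) (\<theta> f)"
      if f: "f \<in> carrier (copies V j)" for f
    proof
      show "(\<lambda>k. if 0 < k \<and> k < j then f (k - 1) else \<zero>\<^bsub>V\<^esub>) \<in> carrier (copies V j)"
        by (rule copiesI) (simp_all add: D(1) fk[OF f])
      have "yact U (\<lambda>b. c * \<phi> (f k) b) = (\<lambda>_. 0)" for c k
        by (rule triv[OF fsp_scale[OF coord_fsp[OF \<phi> fk[OF f]]]])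
      then show "\<theta> (\<lambda>k. if 0 < k \<and> k < j then f (k - 1) else \<zero>\<^bsub>V\<^esub>) = yact (rtensor U (rchain j)) (\<theta> f)"
        by (auto simp: \<theta>_def fun_eq_iff crep_simps L(3))
    qed
  qed
qed

lemma yact_trivial_rchar: "yact_trivial (rchar \<psi>)"
  by (simp add: yact_trivial_def rchar_def)

lemma has_group_rep_char_module:
  assumes "\<psi> \<one> = 1" "\<And>h k. h \<in> carrier G \<Longrightarrow> k \<in> carrier G \<Longrightarrow> \<psi> (h \<otimes> k) = \<psi> h * \<psi> k"
  shows "has_group_rep (char_module G \<psi>) (rchar \<psi>)"
proof (rule has_group_repI[OF is_rep_rchar[OF assms] yact_trivial_rchar])
  show "coord (char_module G \<psi>) (idx (rchar \<psi>)) (\<lambda>v _. v)"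
  proof (rule coordI)
    show "bij_betw (\<lambda>v _. v) (carrier (char_module G \<psi>)) (fsp (idx (rchar \<psi>)))"
      by (rule bij_betw_byWitness[of _ "\<lambda>f. f ()"]) (auto simp: char_module_def rchar_def fsp_def)
  qed (auto simp: char_module_def rchar_def)
  fix h v assume "h \<in> carrier G"
  then have "(\<Sum>k\<in>carrier G. unit_fun h k * \<psi> k) = \<psi> h" by (rule sum_unit_fun[OF finite_G])
  then show "(\<lambda>_. act (char_module G \<psi>) (unit_fun h) v) = gact (rchar \<psi>) h (\<lambda>_. v)"
    by (simp add: char_module_def rchar_def)
  have "carrier (char_module G \<psi>) = UNIV" by (simp add: char_module_def)
  then show "act (char_module G \<psi>) (unit_fun h) v \<in> carrier (char_module G \<psi>)" by simp
qed

lemma group_algebra_unit_closed: "h \<in> carrier G \<Longrightarrow> unit_fun h \<in> carrier (group_algebra G)"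
  by (auto simp: group_algebra_def basis_algebra_def unit_fun_def)

lemma amodule_has_group_rep:
  fixes V :: "('k, 'a \<Rightarrow> 'k, 'v) amod"
  assumes V: "amodule (group_algebra G) V"
  shows "\<exists>U :: ('a, 'v, 'k) crep. has_group_rep V U"
proof -
  obtain B :: "'v set" and \<phi> where \<phi>: "coord V B \<phi>"
    using coord_exists[OF amoduleD(1,2)[OF V]] by blast
  define \<psi> where "\<psi> = inv_into (carrier V) \<phi>"
  have \<psi>: "\<psi> f \<in> carrier V" "\<phi> (\<psi> f) = f" if "f \<in> fsp B" for f
    using coord_inv(1,2)[OF \<phi> that] by (simp_all add: \<psi>_def)
  have \<psi>\<phi>: "\<psi> (\<phi> v) = v" if "v \<in> carrier V" for v
    using coord_inv(3)[OF \<phi> that] by (simp add: \<psi>_def)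
  have \<psi>_add: "\<psi> (\<lambda>b. f b + f' b) = \<psi> f \<oplus>\<^bsub>V\<^esub> \<psi> f'" if "f \<in> fsp B" "f' \<in> fsp B" for f f'
    using \<psi>\<phi>[of "\<psi> f \<oplus>\<^bsub>V\<^esub> \<psi> f'"] \<psi> that coordD(3,4)[OF \<phi>] by simp
  have \<psi>_scale: "\<psi> (\<lambda>b. c * f b) = c \<odot>\<^bsub>V\<^esub> \<psi> f" if "f \<in> fsp B" for c f
    using \<psi>\<phi>[of "c \<odot>\<^bsub>V\<^esub> \<psi> f"] \<psi> that coordD(5,6)[OF \<phi>] by simp
  define U where "U = \<lparr>idx = B, gact = (\<lambda>h f. \<phi> (act V (unit_fun h) (\<psi> f))), yact = (\<lambda>_ _. 0 :: 'k)\<rparr>"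
  have ac: "act V (unit_fun h) v \<in> carrier V" if "h \<in> carrier G" "v \<in> carrier V" for h v
    by (rule amoduleD(3)[OF V group_algebra_unit_closed[OF that(1)] that(2)])
  have yn: "((\<lambda>_ _. 0) ^^ n) f = (\<lambda>_ :: 'v. 0 :: 'k)" for f :: "'v \<Rightarrow> 'k"
    using n_ge_2 by (cases n) auto
  have U: "is_rep U"
    unfolding is_rep_def
  proof (intro conjI ballI)
    show "finite (idx U)" using coordD(1)[OF \<phi>] by (simp add: U_def)
    show "lin_on (idx U) (idx U) (yact U)" by (simp add: U_def lin_on_null)
    show "lin_on (idx U) (idx U) (gact U h)" if h: "h \<in> carrier G" for h
    proof (rule lin_onI)
      note x = group_algebra_unit_closed[OF h]
      fix f :: "'v \<Rightarrow> 'k" assume "f \<in> fsp (idx U)"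
      then have f: "f \<in> fsp B" by (simp add: U_def)
      show "gact U h f \<in> fsp (idx U)"
        using coord_fsp[OF \<phi> ac[OF h \<psi>(1)[OF f]]] by (simp add: U_def)
      show "gact U h (\<lambda>b. c * f b) = (\<lambda>b. c * gact U h f b)" for c
        using coordD(6)[OF \<phi> ac[OF h \<psi>(1)[OF f]]]
        by (simp add: U_def \<psi>_scale[OF f] amoduleD(5)[OF V x \<psi>(1)[OF f]])
      fix f' :: "'v \<Rightarrow> 'k" assume "f' \<in> fsp (idx U)"
      then have f': "f' \<in> fsp B" by (simp add: U_def)
      show "gact U h (\<lambda>b. f b + f' b) = (\<lambda>b. gact U h f b + gact U h f' b)"
        using coordD(4)[OF \<phi> ac[OF h \<psi>(1)[OF f]] ac[OF h \<psi>(1)[OF f']]]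
        by (simp add: U_def \<psi>_add[OF f f'] amoduleD(4)[OF V x \<psi>(1)[OF f] \<psi>(1)[OF f']])
    qed
    fix f :: "'v \<Rightarrow> 'k" assume "f \<in> fsp (idx U)"
    then have f: "f \<in> fsp B" by (simp add: U_def)
    show "gact U \<one> f = f"
      using amoduleD(9)[OF V \<psi>(1)[OF f]] \<psi>(2)[OF f] by (simp add: U_def group_algebra_def basis_algebra_def)
    show "(yact U ^^ n) f = (\<lambda>_. 0)" using yn by (simp add: U_def)
    fix h assume h: "h \<in> carrier G"
    show "yact U (gact U h f) = (\<lambda>b. \<chi> h * gact U h (yact U f) b)"
    proof -
      have "\<psi> (\<lambda>_. 0) = 0 \<odot>\<^bsub>V\<^esub> \<psi> (\<lambda>_. 0)" using \<psi>_scale[of "\<lambda>_. 0" 0] by simp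
      then have "act V (unit_fun h) (\<psi> (\<lambda>_. 0)) = 0 \<odot>\<^bsub>V\<^esub> act V (unit_fun h) (\<psi> (\<lambda>_. 0))"
        using amoduleD(5)[OF V group_algebra_unit_closed[OF h] \<psi>(1)[OF fsp_zero]] by metis
      then have "\<phi> (act V (unit_fun h) (\<psi> (\<lambda>_. 0))) = (\<lambda>_. 0)"
        using coordD(6)[OF \<phi> ac[OF h \<psi>(1)[OF fsp_zero]], of 0] by simp
      then show ?thesis by (simp add: U_def)
    qed
    fix k assume k: "k \<in> carrier G"
    have "unit_fun h \<otimes>\<^bsub>group_algebra G\<^esub> unit_fun k = (unit_fun (h \<otimes> k) :: 'a \<Rightarrow> 'k)"
      unfolding group_algebra_def by (rule basis_algebra_mult[OF finite_G h k])
    then show "gact U h (gact U k f) = gact U (h \<otimes> k) f"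
      using amoduleD(8)[OF V group_algebra_unit_closed[OF h] group_algebra_unit_closed[OF k] \<psi>(1)[OF f]]
        \<psi>\<phi>[OF ac[OF k \<psi>(1)[OF f]]] by (simp add: U_def)
  qed
  have "has_group_rep V U"
  proof (rule has_group_repI[OF U])
    show "coord V (idx U) \<phi>" using \<phi> by (simp add: U_def)
    show "yact_trivial U" by (simp add: yact_trivial_def U_def)
  qed (auto simp: U_def ac \<psi>\<phi>)
  then show ?thesis by blast
qed

lemma amod_iso_has_group_rep:
  assumes N: "amodule (group_algebra G) N" and iso: "amod_iso (group_algebra G) N M"
    and M: "has_group_rep M U"
  shows "has_group_rep N U"
proof -
  from M obtain \<phi> where map: "group_map M U \<phi>" unfolding has_group_rep_def by blast
  from iso obtain f where f: "f \<in> LinearCombinations.module_hom class_ring N M"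
    "bij_betw f (carrier N) (carrier M)"
    and fact: "\<forall>x\<in>carrier (group_algebra G). \<forall>v\<in>carrier N. f (act N x v) = act M x (f v)"
    unfolding amod_iso_def by blast
  have fc: "f v \<in> carrier M" if "v \<in> carrier N" for v
    using f(1) that by (auto simp: LinearCombinations.module_hom_def)
  show ?thesis
    by (rule has_group_repI[OF has_group_rep_is_rep[OF M] has_group_rep_trivial[OF M]
          coord_amod_iso[OF f amoduleD(1)[OF N] group_mapD(1)[OF map]]])
      (simp_all add: amoduleD(3)[OF N] group_algebra_unit_closed fact fc group_mapD(3)[OF map])
qed

text \<open>
  A submodule in coordinates.
\<close>

definition stable_subspace :: "('a, 'i, 'k) crep \<Rightarrow> ('i \<Rightarrow> 'k) set \<Rightarrow> bool" where
  "stable_subspace R S \<longleftrightarrow> S \<subseteq> fsp (idx R) \<and> (\<lambda>_. 0) \<in> S \<and>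
     (\<forall>f\<in>S. \<forall>f'\<in>S. (\<lambda>b. f b + f' b) \<in> S) \<and> (\<forall>c. \<forall>f\<in>S. (\<lambda>b. c * f b) \<in> S) \<and>
     (\<forall>h\<in>carrier G. \<forall>f\<in>S. gact R h f \<in> S) \<and> (\<forall>f\<in>S. yact R f \<in> S)"

lemma stable_subspaceD:
  assumes "stable_subspace R S"
  shows "S \<subseteq> fsp (idx R)" "(\<lambda>_. 0) \<in> S"
    and "f \<in> S \<Longrightarrow> f' \<in> S \<Longrightarrow> (\<lambda>b. f b + f' b) \<in> S"
    and "f \<in> S \<Longrightarrow> (\<lambda>b. c * f b) \<in> S"
    and "h \<in> carrier G \<Longrightarrow> f \<in> S \<Longrightarrow> gact R h f \<in> S"
    and "f \<in> S \<Longrightarrow> yact R f \<in> S"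
  using assms unfolding stable_subspace_def by auto

text \<open>
  Irreducibility in coordinates is turned into simplicity of a module, so that a complete set of simple
  modules contains an isomorphic copy.
\<close>

lemma irreducible_simple_module:
  fixes U :: "('a, 'i, 'k) crep"
  assumes U: "is_rep U" and triv: "yact_trivial U" and ne: "idx U \<noteq> {}"
    and irr: "\<And>S. stable_subspace U S \<Longrightarrow> S = {\<lambda>_. 0} \<or> S = fsp (idx U)"
  shows "\<exists>W :: ('k, 'a \<Rightarrow> 'k, 'k vec) amod. simple_amodule (group_algebra G) W \<and> has_group_rep W U"
proof -
  let ?V = "module_vec TYPE('k) (card (idx U))" and ?A = "group_algebra G :: ('k, 'a \<Rightarrow> 'k) module"
  obtain \<phi> where \<phi>: "coord ?V (idx U) \<phi>"
    using vec_coord[OF is_repD(1)[OF U]] by blast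
  define ac where "ac x f = (\<lambda>b. \<Sum>h\<in>carrier G. x h * gact U h f b)" for x f
  have ac: "lin_on (idx U) (idx U) (ac x)" for x
    unfolding ac_def[abs_def] by (rule lin_on_setsum[OF is_repD(2)[OF U]])
  define W where "W = with_act ?V (\<lambda>x v. inv_into (carrier ?V) \<phi> (ac x (\<phi> v)))"
  have cW: "coord W (idx U) \<phi>" using \<phi> by (simp add: W_def)
  have carr: "carrier W = carrier ?V" by (simp add: W_def)
  have actW: "act W x v \<in> carrier W" "\<phi> (act W x v) = ac x (\<phi> v)" if "v \<in> carrier W" for x v
    using that coord_inv(1,2)[OF \<phi> lin_on_fsp[OF ac coord_fsp[OF \<phi>]]] by (simp_all add: W_def)
  have ac_unit: "ac (unit_fun h) f = gact U h f" if "h \<in> carrier G" for h f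
    unfolding ac_def using sum_unit_fun[OF finite_G that, of "\<lambda>h. gact U h f b" for b] by simp
  have W: "amodule ?A W"
    unfolding group_algebra_def
  proof (rule amodule_basis_algebraI[OF finite_G cW])
    show "lin_on (idx U) (idx U) (gact U h)" if "h \<in> carrier G" for h by (rule is_repD(2)[OF U that])
    show "gact U h (gact U k f) = (\<lambda>i. \<Sum>l\<in>carrier G. unit_fun (h \<otimes> k) l * gact U l f i)"
      if "h \<in> carrier G" "k \<in> carrier G" "f \<in> fsp (idx U)" for h k f
      using sum_unit_fun[OF finite_G, of "h \<otimes> k" "\<lambda>l. gact U l f i" for i] is_repD(5)[OF U that] that by simp
    show "(\<lambda>i. \<Sum>l\<in>carrier G. unit_fun \<one> l * gact U l f i) = f" if "f \<in> fsp (idx U)" for f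
      using sum_unit_fun[OF finite_G, of \<one> "\<lambda>l. gact U l f i" for i] is_repD(4)[OF U that] by simp
    show "act W x v \<in> carrier W \<and> \<phi> (act W x v) = (\<lambda>i. \<Sum>l\<in>carrier G. x l * gact U l (\<phi> v) i)"
      if "v \<in> carrier W" for x v
      using actW[OF that, of x] unfolding ac_def by simp
  qed (auto simp: unit_fun_def)
  have rep: "has_group_rep W U"
    by (rule has_group_repI[OF U triv cW]) (simp_all add: actW ac_unit)
  have "simple_amodule ?A W"
    unfolding simple_amodule_def
  proof (intro conjI allI impI W)
    obtain b where b: "b \<in> idx U" using ne by blast
    obtain v where v: "v \<in> carrier W" "\<phi> v = unit_fun b" using coord_surj[OF cW fsp_unit[OF b]] by blast
    then have "v \<noteq> \<zero>\<^bsub>W\<^esub>" using coordD(7)[OF cW] by (auto simp: unit_fun_def fun_eq_iff split: if_splits)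
    then show "carrier W \<noteq> {\<zero>\<^bsub>W\<^esub>}" using v(1) by blast
    fix X assume X: "VectorSpace.subspace class_ring X W \<and> (\<forall>a\<in>carrier ?A. \<forall>w\<in>X. act W a w \<in> X)"
    then have sub: "submodule class_ring X W" by (simp add: VectorSpace.subspace_def)
    note XW = submodule.subset[OF sub]
    have "stable_subspace U (\<phi> ` X)"
      unfolding stable_subspace_def
    proof (intro conjI ballI allI)
      show "\<phi> ` X \<subseteq> fsp (idx U)" using XW coord_fsp[OF cW] by blast
      show "(\<lambda>_. 0) \<in> \<phi> ` X"
        by (rule image_eqI[where f = \<phi> and x = "\<zero>\<^bsub>W\<^esub>"])
          (simp_all add: coordD(7)[OF cW] submodule.zero_closed[OF sub])
      fix f assume "f \<in> \<phi> ` X"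
      then obtain w where w: "w \<in> X" "f = \<phi> w" by blast
      have wW: "w \<in> carrier W" using w XW by blast
      show "(\<lambda>b. c * f b) \<in> \<phi> ` X" for c
        by (rule image_eqI[where f = \<phi> and x = "c \<odot>\<^bsub>W\<^esub> w"])
          (simp_all add: coordD(6)[OF cW wW] submodule.smult_closed[OF sub _ w(1)] w(2))
      show "gact U h f \<in> \<phi> ` X" if "h \<in> carrier G" for h
      proof -
        have "act W (unit_fun h) w \<in> X"
          using X w(1) group_algebra_unit_closed[OF that] by blast
        moreover have "gact U h f = \<phi> (act W (unit_fun h) w)"
          unfolding actW(2)[OF wW] ac_unit[OF that] w(2) ..
        ultimately show ?thesis
          by (intro image_eqI[where f = \<phi> and x = "act W (unit_fun h) w"])
      qed
      show "yact U f \<in> \<phi> ` X"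
        using yact_trivialD[OF triv coord_fsp[OF cW wW]] w(2) \<open>(\<lambda>_. 0) \<in> \<phi> ` X\<close> by simp
      fix f' assume "f' \<in> \<phi> ` X"
      then obtain w' where w': "w' \<in> X" "f' = \<phi> w'" by blast
      then have w'W: "w' \<in> carrier W" using XW by blast
      show "(\<lambda>b. f b + f' b) \<in> \<phi> ` X"
        by (rule image_eqI[where f = \<phi> and x = "w \<oplus>\<^bsub>W\<^esub> w'"])
          (simp_all add: coordD(4)[OF cW wW w'W] submodule.m_closed[OF sub w(1) w'(1)] w(2) w'(2))
    qed
    then consider "\<phi> ` X = {\<lambda>_. 0}" | "\<phi> ` X = fsp (idx U)" using irr by blast
    then show "X = {\<zero>\<^bsub>W\<^esub>} \<or> X = carrier W"
    proof cases
      case 1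
      have "w = \<zero>\<^bsub>W\<^esub>" if "w \<in> X" for w
      proof (rule coord_inj[OF cW])
        have "\<phi> w \<in> {\<lambda>_. 0}" using 1 that by (metis imageI)
        then show "\<phi> w = \<phi> \<zero>\<^bsub>W\<^esub>" unfolding coordD(7)[OF cW] by simp
      qed (use that XW coordD(2)[OF cW] in auto)
      then show ?thesis using submodule.zero_closed[OF sub] by blast
    next
      case 2
      have "w \<in> X" if "w \<in> carrier W" for w
      proof -
        have "\<phi> w \<in> \<phi> ` X" unfolding 2 by (rule coord_fsp[OF cW that])
        then obtain w' where "w' \<in> X" "\<phi> w = \<phi> w'" by blast
        then show ?thesis using coord_inj[OF cW that, of w'] XW by blast
      qed
      then show ?thesis using XW by blast
    qed
  qed
  with rep show ?thesis by blast
qed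

end

section \<open>Subrepresentations and direct sums\<close>

lemma sum_fun_apply: "(\<Sum>i\<in>I. F i) b = (\<Sum>i\<in>I. F i b :: 'k :: comm_monoid_add)"
  by (induction I rule: infinite_finite_induct) (simp_all add: plus_fun_def zero_fun_def)

lemma fun_vector_space: "vector_space (\<lambda>(c :: 'k :: field) (f :: 'b \<Rightarrow> 'k) b. c * f b)"
  by unfold_locales (auto simp: fun_eq_iff algebra_simps)

lemma fun_subspace_iff:
  "Modules.module.subspace (\<lambda>(c :: 'k :: field) (f :: 'b \<Rightarrow> 'k) b. c * f b) S \<longleftrightarrow>
    (\<lambda>_. 0) \<in> S \<and> (\<forall>f\<in>S. \<forall>f'\<in>S. (\<lambda>b. f b + f' b) \<in> S) \<and> (\<forall>c. \<forall>f\<in>S. (\<lambda>b. c * f b) \<in> S)"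
proof -
  interpret V: vector_space "\<lambda>(c :: 'k) (f :: 'b \<Rightarrow> 'k) b. c * f b" by (rule fun_vector_space)
  show ?thesis by (simp add: V.subspace_def plus_fun_def zero_fun_def)
qed

text \<open>
  A subspace of a coordinate space has coordinates indexed by an initial segment of the natural
  numbers, and a proper subspace needs fewer of them. The strict inequality drives the inductions on the
  dimension.
\<close>

lemma subspace_coordinates:
  fixes S :: "('b \<Rightarrow> 'k :: field) set"
  assumes B: "finite B" and SB: "S \<subseteq> fsp B"
    and sub: "(\<lambda>_. 0) \<in> S" "\<And>f f'. f \<in> S \<Longrightarrow> f' \<in> S \<Longrightarrow> (\<lambda>b. f b + f' b) \<in> S"
      "\<And>c f. f \<in> S \<Longrightarrow> (\<lambda>b. c * f b) \<in> S"
  shows "\<exists>(d :: nat) \<kappa>. d \<le> card B \<and> (S \<noteq> fsp B \<longrightarrow> d < card B) \<and>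
    lin_on {..<d} B \<kappa> \<and> bij_betw \<kappa> (fsp {..<d}) S"
proof -
  let ?sc = "\<lambda>(c :: 'k) (f :: 'b \<Rightarrow> 'k) b. c * f b"
  interpret V: vector_space ?sc by (rule fun_vector_space)
  have S: "V.subspace S" unfolding fun_subspace_iff by (intro conjI ballI allI sub; assumption)
  obtain C where C: "C \<subseteq> S" "V.independent C" "S \<subseteq> V.span C"
    by (rule V.basis_exists[of S])
  have spanC: "V.span C = S" by (rule subset_antisym[OF V.span_minimal[OF C(1) S] C(3)])
  define T where "T = (unit_fun ` B :: ('b \<Rightarrow> 'k) set)"
  have T: "finite T" "card T \<le> card B" using B card_image_le by (auto simp: T_def)
  have spanT: "fsp B \<subseteq> V.span T"
  proof
    fix f :: "'b \<Rightarrow> 'k" assume f: "f \<in> fsp B"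
    have "(\<Sum>c\<in>B. ?sc (f c) (unit_fun c)) = (\<lambda>b. \<Sum>c\<in>B. f c * unit_fun c b)"
      by (simp add: fun_eq_iff sum_fun_apply)
    also have "\<dots> = f" by (rule fsp_expand[OF B f, symmetric])
    finally have "(\<Sum>c\<in>B. ?sc (f c) (unit_fun c)) = f" .
    moreover have "(\<Sum>c\<in>B. ?sc (f c) (unit_fun c)) \<in> V.span T"
      by (rule V.span_sum, rule V.span_scale, rule V.span_base) (simp add: T_def)
    ultimately show "f \<in> V.span T" by simp
  qed
  have bound: "finite X \<and> card X \<le> card B" if "V.independent X" "X \<subseteq> fsp B" for X
    using V.independent_span_bound[OF T(1) that(1) order_trans[OF that(2) spanT]] T(2) by linarith
  have finC: "finite C" and cardC: "card C \<le> card B" using bound[OF C(2)] C(1) SB by auto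
  have strict: "card C < card B" if "S \<noteq> fsp B"
  proof -
    have "S \<subset> fsp B" using SB that by (rule psubsetI)
    from psubset_imp_ex_mem[OF this] obtain w where "w \<in> fsp B - S" by (rule exE)
    then have w: "w \<in> fsp B" "w \<notin> S" by simp_all
    have "w \<notin> C" using w(2) C(1) by (rule contra_subsetD[rotated])
    moreover have "V.independent (insert w C)"
      by (rule V.independent_insertI[OF _ C(2)]) (simp add: spanC w(2))
    moreover have "insert w C \<subseteq> fsp B" using w(1) C(1) SB by simp
    ultimately show ?thesis using bound[of "insert w C"] finC by simp
  qed
  obtain e where e: "bij_betw e {0..<card C} C" using ex_bij_betw_nat_finite[OF finC] by blast
  define d where "d = card C"
  have e: "bij_betw e {..<d} C" using e by (simp add: d_def atLeast0LessThan)
  have eB: "e i \<in> fsp B" "e i \<in> S" if "i < d" for i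
    using bij_betwE[OF e] that C(1) SB by auto
  define \<kappa> where "\<kappa> f = (\<lambda>b. \<Sum>i<d. f i * e i b)" for f :: "nat \<Rightarrow> 'k"
  have \<kappa>_sum: "\<kappa> f = (\<Sum>i<d. ?sc (f i) (e i))" for f
    by (simp add: \<kappa>_def fun_eq_iff sum_fun_apply)
  have lin: "lin_on {..<d} B \<kappa>"
  proof (rule lin_onI)
    show "\<kappa> f \<in> fsp B" for f unfolding \<kappa>_def by (rule fsp_sum) (simp add: eB)
  qed (simp_all add: \<kappa>_def fun_eq_iff distrib_right sum.distrib sum_distrib_left mult.assoc)
  have "bij_betw \<kappa> (fsp {..<d}) S"
    unfolding bij_betw_def
  proof
    have zero: "f i = 0" if "\<kappa> f = (\<lambda>_. 0)" "i < d" for f i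
    proof -
      define u where "u c = f (inv_into {..<d} e c)" for c
      have ue: "u (e i) = f i" if "i < d" for i
        using bij_betw_inv_into_left[OF e] that by (simp add: u_def)
      have "(\<Sum>c\<in>C. ?sc (u c) c) = (\<Sum>i<d. ?sc (u (e i)) (e i))"
        by (rule sum.reindex_bij_betw[OF e, symmetric])
      also have "\<dots> = \<kappa> f" unfolding \<kappa>_sum by (intro sum.cong refl) (simp add: ue)
      finally have "(\<Sum>c\<in>C. ?sc (u c) c) = 0" using that(1) by (simp add: zero_fun_def)
      then have "u (e i) = 0"
        using V.independentD[OF C(2) finC subset_refl] bij_betwE[OF e] that(2) by blast
      then show ?thesis using ue that(2) by simp
    qed
    show "inj_on \<kappa> (fsp {..<d})"
    proof (rule inj_onI)
      fix f f' :: "nat \<Rightarrow> 'k" assume f: "f \<in> fsp {..<d}" "f' \<in> fsp {..<d}" "\<kappa> f = \<kappa> f'"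
      have "\<kappa> (\<lambda>i. f i - f' i) = (\<lambda>b. \<kappa> f b - \<kappa> f' b)"
        by (simp add: \<kappa>_def left_diff_distrib sum_subtractf)
      then have "\<kappa> (\<lambda>i. f i - f' i) = (\<lambda>_. 0)" using f(3) by simp
      then have "f i - f' i = 0" if "i < d" for i using zero[of "\<lambda>i. f i - f' i" i] that by simp
      then show "f = f'" using fspD[OF f(1)] fspD[OF f(2)]
        by (intro ext) (metis lessThan_iff right_minus_eq)
    qed
    show "\<kappa> ` fsp {..<d} = S"
    proof (intro equalityI subsetI)
      fix w assume "w \<in> \<kappa> ` fsp {..<d}"
      then obtain f where f: "w = \<kappa> f" by blast
      have "\<kappa> f \<in> V.span C"
        unfolding \<kappa>_sum
        using bij_betwE[OF e] by - (rule V.span_sum, rule V.span_scale, rule V.span_base, auto)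
      then show "w \<in> S" using f spanC by simp
    next
      fix w assume "w \<in> S"
      then have "w \<in> V.span C" using spanC by simp
      then obtain u where "w = (\<Sum>c\<in>C. ?sc (u c) c)" unfolding V.span_finite[OF finC] by blast
      also have "\<dots> = (\<Sum>i<d. ?sc (u (e i)) (e i))"
        by (rule sum.reindex_bij_betw[OF e, symmetric])
      also have "\<dots> = \<kappa> (\<lambda>i. if i < d then u (e i) else 0)"
        unfolding \<kappa>_sum by (intro sum.cong) auto
      finally have w: "w = \<kappa> (\<lambda>i. if i < d then u (e i) else 0)" .
      show "w \<in> \<kappa> ` fsp {..<d}"
        unfolding w by (rule imageI) (simp add: fsp_def)
    qed
  qed
  with lin cardC strict show ?thesis
    unfolding d_def[symmetric] by (intro exI[of _ d] exI[of _ \<kappa>] conjI impI)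
qed

text \<open>
  A section of \<open>N\<close> over its image, extended to the whole space, satisfies \<open>N s N = N\<close>.
\<close>

lemma linear_partial_inverse:
  fixes N :: "('b \<Rightarrow> 'k :: field) \<Rightarrow> 'c \<Rightarrow> 'k"
  assumes N: "lin_on B C N"
  shows "\<exists>s. lin_on C B s \<and> (\<forall>f\<in>fsp B. N (s (N f)) = N f)"
proof -
  let ?sb = "\<lambda>(c :: 'k) (f :: 'b \<Rightarrow> 'k) b. c * f b" and ?sc = "\<lambda>(c :: 'k) (f :: 'c \<Rightarrow> 'k) b. c * f b"
  interpret V: vector_space_pair ?sb ?sc
    unfolding vector_space_pair_def by (intro conjI fun_vector_space)
  define r where "r f = (\<lambda>b. if b \<in> B then f b else 0)" for f :: "'b \<Rightarrow> 'k"
  have r: "r f \<in> fsp B" for f by (simp add: r_def fsp_def)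
  have r_id: "r f = f" if "f \<in> fsp B" for f using that by (auto simp: r_def fsp_def fun_eq_iff)
  define N' where "N' f = N (r f)" for f
  have "N' (f + f') = N' f + N' f'" for f f'
  proof -
    have "r (f + f') = (\<lambda>b. r f b + r f' b)" by (auto simp: r_def fun_eq_iff)
    then show ?thesis using lin_on_add[OF N r r] by (simp add: N'_def plus_fun_def)
  qed
  moreover have "N' (?sb c f) = ?sc c (N' f)" for c f
  proof -
    have "r (?sb c f) = (\<lambda>b. c * r f b)" by (auto simp: r_def fun_eq_iff)
    then show ?thesis using lin_on_scale[OF N r] by (simp add: N'_def)
  qed
  ultimately have lin: "Vector_Spaces.linear ?sb ?sc N'"
    unfolding Vector_Spaces.linear_iff by (intro conjI allI fun_vector_space)
  have sub: "V.vs1.subspace (fsp B)"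
    unfolding fun_subspace_iff by (intro conjI ballI allI fsp_zero fsp_add fsp_scale)
  obtain s where s: "range s \<subseteq> fsp B" "Vector_Spaces.linear ?sc ?sb s" "\<forall>v\<in>N' ` fsp B. N' (s v) = v"
    using V.linear_exists_right_inverse_on[OF lin sub] by auto
  have "s (f + f') = s f + s f'" "s (?sc c f) = ?sb c (s f)" for f f' c
    using s(2) unfolding Vector_Spaces.linear_iff by blast+
  then have "lin_on C B s" using s(1) by (auto simp: lin_on_def plus_fun_def)
  moreover have "N (s (N f)) = N f" if "f \<in> fsp B" for f
  proof -
    have "N' f = N f" using r_id[OF that] by (simp add: N'_def)
    moreover have "N' (s (N' f)) = N' f" using s(3) that by blast
    moreover have "N' (s g) = N (s g)" for g using r_id[of "s g"] s(1) by (simp add: N'_def image_subset_iff)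
    ultimately show ?thesis by simp
  qed
  ultimately show ?thesis by blast
qed

context nilpotent_group_datum
begin

definition rep_hom :: "('a, 'i, 'k) crep \<Rightarrow> ('a, 'j, 'k) crep \<Rightarrow> (('i \<Rightarrow> 'k) \<Rightarrow> 'j \<Rightarrow> 'k) \<Rightarrow> bool" where
  "rep_hom R R' F \<longleftrightarrow> lin_on (idx R) (idx R') F \<and>
     (\<forall>h\<in>carrier G. \<forall>f\<in>fsp (idx R). F (gact R h f) = gact R' h (F f)) \<and>
     (\<forall>f\<in>fsp (idx R). F (yact R f) = yact R' (F f))"

lemma rep_homD:
  assumes "rep_hom R R' F"
  shows "lin_on (idx R) (idx R') F"
    and "h \<in> carrier G \<Longrightarrow> f \<in> fsp (idx R) \<Longrightarrow> F (gact R h f) = gact R' h (F f)"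
    and "f \<in> fsp (idx R) \<Longrightarrow> F (yact R f) = yact R' (F f)"
  using assms by (simp_all add: rep_hom_def)

lemma subrepresentation:
  fixes R :: "('a, 'i, 'k) crep"
  assumes R: "is_rep R" and S: "stable_subspace R S"
  shows "\<exists>(R' :: ('a, nat, 'k) crep) \<kappa>. is_rep R' \<and> rep_hom R' R \<kappa> \<and> bij_betw \<kappa> (fsp (idx R')) S \<and>
    card (idx R') \<le> card (idx R) \<and> (S \<noteq> fsp (idx R) \<longrightarrow> card (idx R') < card (idx R))"
proof -
  note D = stable_subspaceD[OF S]
  have SB: "f \<in> fsp (idx R)" if "f \<in> S" for f by (rule subsetD[OF D(1) that])
  have "\<exists>(d :: nat) \<kappa>. d \<le> card (idx R) \<and> (S \<noteq> fsp (idx R) \<longrightarrow> d < card (idx R)) \<and>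
      lin_on {..<d} (idx R) \<kappa> \<and> bij_betw \<kappa> (fsp {..<d}) S"
    by (rule subspace_coordinates[OF is_repD(1)[OF R] D(1,2)]) ((rule D(3) | rule D(4)); assumption)+
  then obtain d :: nat and \<kappa> where d: "d \<le> card (idx R)" "S \<noteq> fsp (idx R) \<longrightarrow> d < card (idx R)"
    and \<kappa>: "lin_on {..<d} (idx R) \<kappa>" and bij: "bij_betw \<kappa> (fsp {..<d}) S"
    by (elim exE conjE) (rule that; assumption)
  have img: "\<kappa> ` fsp {..<d} = S" by (rule bij_betw_imp_surj_on[OF bij])
  define \<epsilon> where "\<epsilon> = inv_into (fsp {..<d}) \<kappa>"
  have \<epsilon>: "\<epsilon> f \<in> fsp {..<d}" "\<kappa> (\<epsilon> f) = f" if "f \<in> S" for f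
    using inv_into_into[of f \<kappa> "fsp {..<d}"] f_inv_into_f[of f \<kappa> "fsp {..<d}"] that img
    by (simp_all add: \<epsilon>_def)
  have \<epsilon>\<kappa>: "\<epsilon> (\<kappa> f) = f" if "f \<in> fsp {..<d}" for f
    using bij_betw_inv_into_left[OF bij that] by (simp add: \<epsilon>_def)
  have \<kappa>S: "\<kappa> f \<in> S" if "f \<in> fsp {..<d}" for f
    using imageI[OF that, of \<kappa>] img by simp
  have inj: "f = f'" if "\<kappa> f = \<kappa> f'" "f \<in> fsp {..<d}" "f' \<in> fsp {..<d}" for f f'
  proof -
    have "f = \<epsilon> (\<kappa> f)" by (rule \<epsilon>\<kappa>[OF that(2), symmetric])
    also have "\<dots> = f'" unfolding that(1) by (rule \<epsilon>\<kappa>[OF that(3)])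
    finally show ?thesis .
  qed
  define R' where "R' = \<lparr>idx = {..<d}, gact = (\<lambda>h f. \<epsilon> (gact R h (\<kappa> f))), yact = (\<lambda>f. \<epsilon> (yact R (\<kappa> f)))\<rparr>"
  have lin: "lin_on {..<d} {..<d} (\<lambda>f. \<epsilon> (T (\<kappa> f)))"
    if T: "lin_on (idx R) (idx R) T" and TS: "\<And>f. f \<in> S \<Longrightarrow> T f \<in> S" for T
  proof (rule lin_onI)
    fix f :: "nat \<Rightarrow> 'k" assume f: "f \<in> fsp {..<d}"
    show c: "\<epsilon> (T (\<kappa> f)) \<in> fsp {..<d}" by (rule \<epsilon>(1)[OF TS[OF \<kappa>S[OF f]]])
    show "\<epsilon> (T (\<kappa> (\<lambda>b. a * f b))) = (\<lambda>b. a * \<epsilon> (T (\<kappa> f)) b)" for a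
    proof (rule inj)
      show "\<kappa> (\<epsilon> (T (\<kappa> (\<lambda>b. a * f b)))) = \<kappa> (\<lambda>b. a * \<epsilon> (T (\<kappa> f)) b)"
        using \<epsilon>(2)[OF D(4)[OF TS[OF \<kappa>S[OF f]]]] \<epsilon>(2)[OF TS[OF \<kappa>S[OF f]]]
        by (simp add: lin_on_scale[OF \<kappa> f] lin_on_scale[OF T SB[OF \<kappa>S[OF f]]] lin_on_scale[OF \<kappa> c])
    qed (rule \<epsilon>(1)[OF TS[OF \<kappa>S[OF fsp_scale[OF f]]]], rule fsp_scale[OF c])
    fix f' :: "nat \<Rightarrow> 'k" assume f': "f' \<in> fsp {..<d}"
    have c': "\<epsilon> (T (\<kappa> f')) \<in> fsp {..<d}" by (rule \<epsilon>(1)[OF TS[OF \<kappa>S[OF f']]])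
    show "\<epsilon> (T (\<kappa> (\<lambda>b. f b + f' b))) = (\<lambda>b. \<epsilon> (T (\<kappa> f)) b + \<epsilon> (T (\<kappa> f')) b)"
    proof (rule inj)
      show "\<kappa> (\<epsilon> (T (\<kappa> (\<lambda>b. f b + f' b)))) = \<kappa> (\<lambda>b. \<epsilon> (T (\<kappa> f)) b + \<epsilon> (T (\<kappa> f')) b)"
        using \<epsilon>(2)[OF D(3)[OF TS[OF \<kappa>S[OF f]] TS[OF \<kappa>S[OF f']]]]
          \<epsilon>(2)[OF TS[OF \<kappa>S[OF f]]] \<epsilon>(2)[OF TS[OF \<kappa>S[OF f']]]
        by (simp add: lin_on_add[OF \<kappa> f f'] lin_on_add[OF T SB[OF \<kappa>S[OF f]] SB[OF \<kappa>S[OF f']]]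
            lin_on_add[OF \<kappa> c c'])
    qed (rule \<epsilon>(1)[OF TS[OF \<kappa>S[OF fsp_add[OF f f']]]], rule fsp_add[OF c c'])
  qed
  have gS: "gact R h (\<kappa> f) \<in> S" if "h \<in> carrier G" "f \<in> fsp {..<d}" for h f
    by (rule D(5)[OF that(1) \<kappa>S[OF that(2)]])
  have yS: "yact R (\<kappa> f) \<in> S" if "f \<in> fsp {..<d}" for f
    by (rule D(6)[OF \<kappa>S[OF that]])
  have hom: "rep_hom R' R \<kappa>"
    unfolding rep_hom_def using \<kappa> gS yS \<epsilon>(2) by (simp add: R'_def)
  have ypow: "\<kappa> ((yact R' ^^ i) f) = (yact R ^^ i) (\<kappa> f) \<and> (yact R' ^^ i) f \<in> fsp {..<d}"
    if "f \<in> fsp {..<d}" for i f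
  proof (induction i)
    case (Suc i)
    let ?f = "(yact R' ^^ i) f"
    have f: "?f \<in> fsp {..<d}" using Suc by simp
    have "(yact R' ^^ Suc i) f = \<epsilon> (yact R (\<kappa> ?f))" by (simp add: R'_def)
    then show ?case using \<epsilon>[OF yS[OF f]] Suc by simp
  qed (use that in simp)
  have "is_rep R'"
    unfolding is_rep_def
  proof (intro conjI ballI)
    show "finite (idx R')" by (simp add: R'_def)
    show "lin_on (idx R') (idx R') (gact R' h)" if "h \<in> carrier G" for h
      using lin[OF is_repD(2)[OF R that] D(5)[OF that]] by (simp add: R'_def)
    show "lin_on (idx R') (idx R') (yact R')"
      using lin[OF is_repD(3)[OF R] D(6)] by (simp add: R'_def)
    fix f :: "nat \<Rightarrow> 'k" assume "f \<in> fsp (idx R')"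
    then have f: "f \<in> fsp {..<d}" by (simp add: R'_def)
    note fR = SB[OF \<kappa>S[OF f]]
    show "gact R' \<one> f = f" using is_repD(4)[OF R fR] \<epsilon>\<kappa>[OF f] by (simp add: R'_def)
    show "(yact R' ^^ n) f = (\<lambda>_. 0)"
      by (rule inj) (use ypow[OF f, of n] is_repD(7)[OF R fR] lin_on_zero[OF \<kappa>] in auto)
    fix h assume h: "h \<in> carrier G"
    have hf: "\<epsilon> (gact R h (\<kappa> f)) \<in> fsp {..<d}" "\<epsilon> (yact R (\<kappa> f)) \<in> fsp {..<d}"
      "\<epsilon> (gact R h (yact R (\<kappa> f))) \<in> fsp {..<d}" "\<epsilon> (yact R (gact R h (\<kappa> f))) \<in> fsp {..<d}"
      using \<epsilon>(1) gS[OF h f] yS[OF f] D(5)[OF h] D(6) by auto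
    show "yact R' (gact R' h f) = (\<lambda>b. \<chi> h * gact R' h (yact R' f) b)"
    proof (rule inj)
      have "\<kappa> (yact R' (gact R' h f)) = yact R (gact R h (\<kappa> f))"
        using \<epsilon>(2)[OF gS[OF h f]] \<epsilon>(2)[OF D(6)[OF gS[OF h f]]] by (simp add: R'_def)
      moreover have "\<kappa> (\<lambda>b. \<chi> h * gact R' h (yact R' f) b) = (\<lambda>b. \<chi> h * gact R h (yact R (\<kappa> f)) b)"
        using \<epsilon>(2)[OF yS[OF f]] \<epsilon>(2)[OF D(5)[OF h yS[OF f]]] hf
        by (simp add: R'_def lin_on_scale[OF \<kappa>])
      ultimately show "\<kappa> (yact R' (gact R' h f)) = \<kappa> (\<lambda>b. \<chi> h * gact R' h (yact R' f) b)"
        using is_repD(6)[OF R h fR] by simp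
    qed (use hf \<epsilon>(2)[OF gS[OF h f]] \<epsilon>(2)[OF yS[OF f]] in \<open>auto simp: R'_def\<close>)
    fix k assume k: "k \<in> carrier G"
    show "gact R' h (gact R' k f) = gact R' (h \<otimes> k) f"
      using \<epsilon>(2)[OF gS[OF k f]] is_repD(5)[OF R h k fR] by (simp add: R'_def)
  qed
  moreover have "bij_betw \<kappa> (fsp (idx R')) S" using bij by (simp add: R'_def)
  moreover have "card (idx R') \<le> card (idx R)" "S \<noteq> fsp (idx R) \<longrightarrow> card (idx R') < card (idx R)"
    using d by (simp_all add: R'_def)
  ultimately show ?thesis using hom by (intro exI[of _ R'] exI[of _ \<kappa>] conjI)
qed

text \<open>
  An internal direct sum decomposition, with the summands given as images of homomorphisms.
\<close>

lemma rep_iso_rsumI: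
  fixes R1 :: "('a, 'i, 'k) crep" and R2 :: "('a, 'j, 'k) crep" and R :: "('a, 'l, 'k) crep"
  assumes F1: "rep_hom R1 R F1" and F2: "rep_hom R2 R F2"
    and inj: "\<And>f1 f2. f1 \<in> fsp (idx R1) \<Longrightarrow> f2 \<in> fsp (idx R2) \<Longrightarrow>
      (\<lambda>b. F1 f1 b + F2 f2 b) = (\<lambda>_. 0) \<Longrightarrow> f1 = (\<lambda>_. 0) \<and> f2 = (\<lambda>_. 0)"
    and surj: "\<And>f. f \<in> fsp (idx R) \<Longrightarrow> \<exists>f1\<in>fsp (idx R1). \<exists>f2\<in>fsp (idx R2). f = (\<lambda>b. F1 f1 b + F2 f2 b)"
    and R: "is_rep R"
  shows "rep_iso (rsum R1 R2) R"
proof -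
  note l1 = rep_homD(1)[OF F1] and l2 = rep_homD(1)[OF F2]
  define F where "F f = (\<lambda>b. F1 (\<lambda>i. f (Inl i)) b + F2 (\<lambda>i. f (Inr i)) b)" for f
  have idx: "idx (rsum R1 R2) = idx R1 <+> idx R2" by (simp add: crep_simps)
  have sl: "(\<lambda>i. f (Inl i)) \<in> fsp (idx R1)" "(\<lambda>i. f (Inr i)) \<in> fsp (idx R2)"
    if "f \<in> fsp (idx R1 <+> idx R2)" for f using that by (simp_all add: fsp_Plus)
  have lin: "lin_on (idx R1 <+> idx R2) (idx R) F"
  proof (rule lin_onI)
    fix f :: "'i + 'j \<Rightarrow> 'k" assume f: "f \<in> fsp (idx R1 <+> idx R2)"
    show "F f \<in> fsp (idx R)"
      unfolding F_def by (rule fsp_add[OF lin_on_fsp[OF l1 sl(1)[OF f]] lin_on_fsp[OF l2 sl(2)[OF f]]])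
    show "F (\<lambda>b. a * f b) = (\<lambda>b. a * F f b)" for a
      by (simp add: F_def lin_on_scale[OF l1 sl(1)[OF f]] lin_on_scale[OF l2 sl(2)[OF f]] distrib_left)
    fix f' :: "'i + 'j \<Rightarrow> 'k" assume f': "f' \<in> fsp (idx R1 <+> idx R2)"
    show "F (\<lambda>b. f b + f' b) = (\<lambda>b. F f b + F f' b)"
      unfolding F_def lin_on_add[OF l1 sl(1)[OF f] sl(1)[OF f']] lin_on_add[OF l2 sl(2)[OF f] sl(2)[OF f']]
      by (simp add: add_ac)
  qed
  have "inj_on F (fsp (idx R1 <+> idx R2))"
  proof (rule inj_onI)
    fix f f' assume f: "f \<in> fsp (idx R1 <+> idx R2)" "f' \<in> fsp (idx R1 <+> idx R2)" "F f = F f'"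
    define u where "u = (\<lambda>b. f b + (-1) * f' b)"
    have u: "u \<in> fsp (idx R1 <+> idx R2)" unfolding u_def by (intro fsp_add fsp_scale f)
    have "F u = (\<lambda>b. F f b + (-1) * F f' b)"
      unfolding u_def using lin_on_add[OF lin f(1) fsp_scale[OF f(2)]] lin_on_scale[OF lin f(2)] by metis
    then have "F u = (\<lambda>_. 0)" using f(3) by simp
    then have z: "(\<lambda>i. u (Inl i)) = (\<lambda>_. 0)" "(\<lambda>i. u (Inr i)) = (\<lambda>_. 0)"
      using inj[OF sl[OF u]] by (simp_all add: F_def)
    have "u p = 0" for p using fun_cong[OF z(1)] fun_cong[OF z(2)] by (cases p) auto
    then show "f = f'" by (simp add: u_def fun_eq_iff)
  qed
  moreover have "F ` fsp (idx R1 <+> idx R2) = fsp (idx R)"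
  proof (intro equalityI subsetI)
    fix f :: "'l \<Rightarrow> 'k" assume "f \<in> fsp (idx R)"
    then obtain f1 f2 where f: "f1 \<in> fsp (idx R1)" "f2 \<in> fsp (idx R2)" "f = (\<lambda>b. F1 f1 b + F2 f2 b)"
      using surj by blast
    then have "f = F (case_sum f1 f2)" "case_sum f1 f2 \<in> fsp (idx R1 <+> idx R2)"
      by (simp_all add: F_def fsp_Plus)
    then show "f \<in> F ` fsp (idx R1 <+> idx R2)" by blast
  next
    fix f :: "'l \<Rightarrow> 'k" assume "f \<in> F ` fsp (idx R1 <+> idx R2)"
    then show "f \<in> fsp (idx R)" using lin_on_fsp[OF lin] by (elim imageE) simp
  qed
  ultimately have bij: "bij_betw F (fsp (idx R1 <+> idx R2)) (fsp (idx R))" by (simp add: bij_betw_def)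
  have "F (gact (rsum R1 R2) h f) = gact R h (F f)"
    if "h \<in> carrier G" "f \<in> fsp (idx R1 <+> idx R2)" for h f
    using rep_homD(2)[OF F1 that(1) sl(1)[OF that(2)]] rep_homD(2)[OF F2 that(1) sl(2)[OF that(2)]]
      lin_on_add[OF is_repD(2)[OF R that(1)] lin_on_fsp[OF l1 sl(1)[OF that(2)]] lin_on_fsp[OF l2 sl(2)[OF that(2)]]]
    by (simp add: F_def crep_simps)
  moreover have "F (yact (rsum R1 R2) f) = yact R (F f)" if "f \<in> fsp (idx R1 <+> idx R2)" for f
    using rep_homD(3)[OF F1 sl(1)[OF that]] rep_homD(3)[OF F2 sl(2)[OF that]]
      lin_on_add[OF is_repD(3)[OF R] lin_on_fsp[OF l1 sl(1)[OF that]] lin_on_fsp[OF l2 sl(2)[OF that]]]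
    by (simp add: F_def crep_simps)
  ultimately show ?thesis unfolding rep_iso_def idx using lin bij by blast
qed

end

section \<open>Averaging and splitting off chains\<close>

lemma lin_on_slice1: "lin_on (B \<times> C) B (\<lambda>f b. f (b, l))"
  by (rule lin_onI) (simp_all add: slice1)

lemma inj_on_fspD:
  assumes \<kappa>: "lin_on B C \<kappa>" and inj: "inj_on \<kappa> (fsp B)" and f: "f \<in> fsp B" "\<kappa> f = (\<lambda>_. 0)"
  shows "f = (\<lambda>_. 0)"
  by (rule inj_onD[OF inj _ f(1) fsp_zero]) (simp add: f(2) lin_on_zero[OF \<kappa>])

context nilpotent_group_datum
begin

text \<open>
  The mean over \<open>k \<in> G\<close> of \<open>\<omega>(k) k s k\<^bsup>-1\<^esup>\<close>. For \<open>\<omega> = 1\<close> this is the operator of Maschke's theorem;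
  a character \<open>\<omega>\<close> produces operators that are equivariant up to \<open>\<omega>\<close>.
\<close>

definition average ::
  "('a \<Rightarrow> 'k) \<Rightarrow> ('a, 'i, 'k) crep \<Rightarrow> (('i \<Rightarrow> 'k) \<Rightarrow> 'i \<Rightarrow> 'k) \<Rightarrow> ('i \<Rightarrow> 'k) \<Rightarrow> 'i \<Rightarrow> 'k" where
  "average \<omega> R s f = (\<lambda>b. \<Sum>k\<in>carrier G. inverse (of_nat (card (carrier G))) * \<omega> k *
     gact R k (s (gact R (inv k) f)) b)"

lemma average_summand:
  assumes R: "is_rep R" and s: "lin_on (idx R) (idx R) s" and k: "k \<in> carrier G"
  shows "lin_on (idx R) (idx R) (\<lambda>f. gact R k (s (gact R (inv k) f)))"
  by (rule lin_on_comp[OF lin_on_comp[OF is_repD(2)[OF R inv_closed[OF k]] s] is_repD(2)[OF R k]])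

lemma lin_on_average:
  assumes R: "is_rep R" and s: "lin_on (idx R) (idx R) s"
  shows "lin_on (idx R) (idx R) (average \<omega> R s)"
  unfolding average_def[abs_def] by (rule lin_on_setsum[OF average_summand[OF R s]])

lemma average_sum:
  fixes w :: 'k
  assumes ord: "of_nat (card (carrier G)) \<noteq> (0 :: 'k)" and w: "\<And>k. k \<in> carrier G \<Longrightarrow> \<omega> k * F k = w"
  shows "(\<Sum>k\<in>carrier G. inverse (of_nat (card (carrier G))) * \<omega> k * F k) = w"
proof -
  have "(\<Sum>k\<in>carrier G. inverse (of_nat (card (carrier G))) * \<omega> k * F k) =
      (\<Sum>k\<in>carrier G. inverse (of_nat (card (carrier G))) * w)"
    by (intro sum.cong refl) (simp add: w mult.assoc)
  also have "\<dots> = (of_nat (card (carrier G)) * inverse (of_nat (card (carrier G)))) * w"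
    by (simp only: sum_constant mult.assoc)
  also have "\<dots> = w" by (simp only: right_inverse[OF ord] mult_1)
  finally show ?thesis .
qed

text \<open>
  Substitute \<open>h k\<close> for \<open>k\<close> in the sum.
\<close>

lemma average_equivariant:
  assumes R: "is_rep R" and s: "lin_on (idx R) (idx R) s"
    and \<omega>: "\<And>h k. h \<in> carrier G \<Longrightarrow> k \<in> carrier G \<Longrightarrow> \<omega> (h \<otimes> k) = \<omega> h * \<omega> k"
    and h: "h \<in> carrier G" and f: "f \<in> fsp (idx R)"
  shows "average \<omega> R s (gact R h f) = (\<lambda>b. \<omega> h * gact R h (average \<omega> R s f) b)"
proof
  fix b
  let ?c = "inverse (of_nat (card (carrier G))) :: 'k"
  let ?F = "\<lambda>k. ?c * \<omega> k * gact R k (s (gact R (inv k) (gact R h f))) b"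
  have closed: "gact R k (s (gact R (inv k) f)) \<in> fsp (idx R)" "s (gact R (inv k) f) \<in> fsp (idx R)"
    if "k \<in> carrier G" for k
    using lin_on_fsp[OF average_summand[OF R s that] f]
      lin_on_fsp[OF s is_rep_closed(1)[OF R f inv_closed[OF that]]] by simp_all
  have bij: "bij_betw (\<lambda>k. h \<otimes> k) (carrier G) (carrier G)"
    unfolding bij_betw_def using inj_on_cmult[OF h] surj_const_mult[OF h] by simp
  have "average \<omega> R s (gact R h f) b = (\<Sum>k\<in>carrier G. ?F k)" by (simp add: average_def)
  also have "\<dots> = (\<Sum>k\<in>carrier G. ?F (h \<otimes> k))" by (rule sum.reindex_bij_betw[OF bij, symmetric])
  also have "\<dots> = (\<Sum>k\<in>carrier G. \<omega> h * (?c * \<omega> k * gact R h (gact R k (s (gact R (inv k) f))) b))"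
  proof (intro sum.cong refl)
    fix k assume k: "k \<in> carrier G"
    have "inv (h \<otimes> k) \<otimes> h = inv k" using h k by (simp add: inv_mult_group m_assoc)
    then have "gact R (inv (h \<otimes> k)) (gact R h f) = gact R (inv k) f"
      using is_repD(5)[OF R _ h f, of "inv (h \<otimes> k)"] h k by simp
    moreover have "gact R (h \<otimes> k) (s (gact R (inv k) f)) = gact R h (gact R k (s (gact R (inv k) f)))"
      by (rule is_repD(5)[OF R h k closed(2)[OF k], symmetric])
    ultimately show "?F (h \<otimes> k) = \<omega> h * (?c * \<omega> k * gact R h (gact R k (s (gact R (inv k) f))) b)"
      by (simp add: \<omega>[OF h k])
  qed
  also have "\<dots> = \<omega> h * gact R h (average \<omega> R s f) b"
    unfolding average_def
    using fun_cong[OF lin_on_sum[OF is_repD(2)[OF R h], of "carrier G"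
        "\<lambda>k. gact R k (s (gact R (inv k) f))" "\<lambda>k. ?c * \<omega> k"], of b] closed(1)
    by (simp add: sum_distrib_left)
  finally show "average \<omega> R s (gact R h f) b = \<omega> h * gact R h (average \<omega> R s f) b" .
qed

lemma stable_subspace_sum:
  assumes S: "stable_subspace R S" and F: "\<And>i. i \<in> I \<Longrightarrow> F i \<in> S"
  shows "(\<lambda>b. \<Sum>i\<in>I. a i * F i b) \<in> S"
  using F
proof (induction I rule: infinite_finite_induct)
  case (insert i I)
  have "(\<lambda>b. a i * F i b + (\<Sum>i\<in>I. a i * F i b)) \<in> S"
    by (rule stable_subspaceD(3)[OF S stable_subspaceD(4)[OF S]]) (use insert in simp_all)
  then show ?case using insert.hyps by simp
qed (simp_all add: stable_subspaceD(2)[OF S])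

lemma rep_hom_trivial:
  fixes R :: "('a, 'i, 'k) crep" and R' :: "('a, 'j, 'k) crep"
  assumes R': "is_rep R'" and \<kappa>: "rep_hom R' R \<kappa>" and inj: "inj_on \<kappa> (fsp (idx R'))"
    and triv: "yact_trivial R"
  shows "yact_trivial R'"
  unfolding yact_trivial_def
proof
  fix f :: "'j \<Rightarrow> 'k" assume f: "f \<in> fsp (idx R')"
  show "yact R' f = (\<lambda>_. 0)"
  proof (rule inj_on_fspD[OF rep_homD(1)[OF \<kappa>] inj])
    show "yact R' f \<in> fsp (idx R')" by (rule is_rep_closed(2)[OF R' f])
    show "\<kappa> (yact R' f) = (\<lambda>_. 0)"
      unfolding rep_homD(3)[OF \<kappa> f] by (rule yact_trivialD[OF triv lin_on_fsp[OF rep_homD(1)[OF \<kappa>] f]])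
  qed
qed

lemma subrepresentationE:
  assumes "is_rep R" "stable_subspace R S"
  obtains R' :: "('a, nat, 'k) crep" and \<kappa> where "is_rep R'" "rep_hom R' R \<kappa>"
    "inj_on \<kappa> (fsp (idx R'))" "\<kappa> ` fsp (idx R') = S"
    "S \<noteq> fsp (idx R) \<longrightarrow> card (idx R') < card (idx R)"
  using subrepresentation[OF assms] unfolding bij_betw_def by (elim exE conjE) (rule that; assumption)

text \<open>
  If \<open>K\<close> is a stable complement of the image of an injective homomorphism \<open>\<kappa>\<close>, then \<open>R\<close> is the direct
  sum of the source of \<open>\<kappa>\<close> and a representation on \<open>K\<close>. The hypothesis \<open>inj\<close> expresses injectivity
  and trivial intersection at once.
\<close>

lemma complement_representation:
  fixes R :: "('a, 'i, 'k) crep" and R1 :: "('a, 'j, 'k) crep"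
  assumes R: "is_rep R" and \<kappa>: "rep_hom R1 R \<kappa>" and K: "stable_subspace R K"
    and inj: "\<And>f. f \<in> fsp (idx R1) \<Longrightarrow> \<kappa> f \<in> K \<Longrightarrow> f = (\<lambda>_. 0)"
    and surj: "\<And>w. w \<in> fsp (idx R) \<Longrightarrow> \<exists>f\<in>fsp (idx R1). (\<lambda>b. w b - \<kappa> f b) \<in> K"
  shows "\<exists>R2 :: ('a, nat, 'k) crep. is_rep R2 \<and> rep_iso (rsum R1 R2) R \<and>
    (K \<noteq> fsp (idx R) \<longrightarrow> card (idx R2) < card (idx R)) \<and> (yact_trivial R \<longrightarrow> yact_trivial R2)"
proof -
  obtain R2 :: "('a, nat, 'k) crep" and \<kappa>2 where R2: "is_rep R2" and \<kappa>2: "rep_hom R2 R \<kappa>2"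
    and inj2: "inj_on \<kappa>2 (fsp (idx R2))" and im2: "\<kappa>2 ` fsp (idx R2) = K"
    and card: "K \<noteq> fsp (idx R) \<longrightarrow> card (idx R2) < card (idx R)"
    by (rule subrepresentationE[OF R K])
  have \<kappa>2K: "\<kappa>2 f \<in> K" if "f \<in> fsp (idx R2)" for f using imageI[OF that, of \<kappa>2] im2 by simp
  have "rep_iso (rsum R1 R2) R"
  proof (rule rep_iso_rsumI[OF \<kappa> \<kappa>2 _ _ R])
    fix f1 :: "'j \<Rightarrow> 'k" and f2 :: "nat \<Rightarrow> 'k" assume f1: "f1 \<in> fsp (idx R1)" and f2: "f2 \<in> fsp (idx R2)"
      and eq: "(\<lambda>b. \<kappa> f1 b + \<kappa>2 f2 b) = (\<lambda>_. 0)"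
    have "\<kappa> f1 b = (-1) * \<kappa>2 f2 b" for b
      using fun_cong[OF eq, of b] by (simp add: eq_neg_iff_add_eq_0)
    then have 1: "\<kappa> f1 = (\<lambda>b. (-1) * \<kappa>2 f2 b)" by (rule ext)
    have "\<kappa> f1 \<in> K" unfolding 1 by (rule stable_subspaceD(4)[OF K \<kappa>2K[OF f2]])
    then have z: "f1 = (\<lambda>_. 0)" by (rule inj[OF f1])
    have "\<kappa>2 f2 = (\<lambda>_. 0)"
      using eq unfolding z lin_on_zero[OF rep_homD(1)[OF \<kappa>]] by simp
    with z show "f1 = (\<lambda>_. 0) \<and> f2 = (\<lambda>_. 0)"
      using inj_on_fspD[OF rep_homD(1)[OF \<kappa>2] inj2 f2] by simp
  next
    fix w :: "'i \<Rightarrow> 'k" assume "w \<in> fsp (idx R)"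
    from surj[OF this] obtain f where f: "f \<in> fsp (idx R1)" "(\<lambda>b. w b - \<kappa> f b) \<in> K" by (rule bexE)
    have "(\<lambda>b. w b - \<kappa> f b) \<in> \<kappa>2 ` fsp (idx R2)" using f(2) im2 by simp
    then obtain f2 where f2: "f2 \<in> fsp (idx R2)" "(\<lambda>b. w b - \<kappa> f b) = \<kappa>2 f2" by (elim imageE)
    have "w = (\<lambda>b. \<kappa> f b + \<kappa>2 f2 b)" unfolding f2(2)[symmetric] by simp
    then show "\<exists>f1\<in>fsp (idx R1). \<exists>f2\<in>fsp (idx R2). w = (\<lambda>b. \<kappa> f1 b + \<kappa>2 f2 b)"
      by (intro bexI[OF bexI[OF _ f2(1)] f(1)])
  qed
  with R2 card rep_hom_trivial[OF R2 \<kappa>2 inj2] show ?thesis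
    by (intro exI[of _ R2] conjI impI) simp_all
qed

text \<open>
  Averaging a linear projection onto \<open>S\<close> over \<open>G\<close> gives a \<open>G\<close>-linear projection, whose kernel is a
  stable complement.
\<close>

lemma maschke:
  fixes U :: "('a, 'i, 'k) crep"
  assumes U: "is_rep U" and triv: "yact_trivial U" and S: "stable_subspace U S"
    and ord: "of_nat (card (carrier G)) \<noteq> (0 :: 'k)" and ne: "S \<noteq> {\<lambda>_. 0}" "S \<noteq> fsp (idx U)"
  shows "\<exists>(U1 :: ('a, nat, 'k) crep) (U2 :: ('a, nat, 'k) crep).
    is_rep U1 \<and> yact_trivial U1 \<and> card (idx U1) < card (idx U) \<and>
    is_rep U2 \<and> yact_trivial U2 \<and> card (idx U2) < card (idx U) \<and> rep_iso (rsum U1 U2) U"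
proof -
  obtain U1 :: "('a, nat, 'k) crep" and \<kappa> where U1: "is_rep U1" and \<kappa>: "rep_hom U1 U \<kappa>"
    and inj: "inj_on \<kappa> (fsp (idx U1))" and im: "\<kappa> ` fsp (idx U1) = S"
    and card: "S \<noteq> fsp (idx U) \<longrightarrow> card (idx U1) < card (idx U)"
    by (rule subrepresentationE[OF U S])
  note l\<kappa> = rep_homD(1)[OF \<kappa>] and SD = stable_subspaceD[OF S]
  have SU: "f \<in> fsp (idx U)" if "f \<in> S" for f by (rule subsetD[OF SD(1) that])
  obtain s where s: "lin_on (idx U) (idx U1) s" and \<kappa>s: "\<forall>f\<in>fsp (idx U1). \<kappa> (s (\<kappa> f)) = \<kappa> f"
    using linear_partial_inverse[OF l\<kappa>] by (elim exE conjE) (rule that; assumption)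
  \<comment> \<open>A linear projection onto \<open>S\<close>.\<close>
  define p0 where "p0 f = \<kappa> (s f)" for f
  have p0: "lin_on (idx U) (idx U) p0" unfolding p0_def by (rule lin_on_comp[OF s l\<kappa>])
  have p0S: "p0 f \<in> S" if "f \<in> fsp (idx U)" for f
    using imageI[OF lin_on_fsp[OF s that], of \<kappa>] unfolding im p0_def .
  have p0id: "p0 f = f" if "f \<in> S" for f
  proof -
    have "f \<in> \<kappa> ` fsp (idx U1)" using that im by simp
    then obtain f' where "f = \<kappa> f'" "f' \<in> fsp (idx U1)" by (rule imageE)
    then show ?thesis using \<kappa>s by (simp add: p0_def)
  qed
  define p where "p = average (\<lambda>_. 1) U p0"
  have p: "lin_on (idx U) (idx U) p" unfolding p_def by (rule lin_on_average[OF U p0])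
  have pS: "p f \<in> S" if "f \<in> fsp (idx U)" for f
    unfolding p_def average_def
    by (rule stable_subspace_sum[OF S]) (intro SD(5) p0S is_rep_closed(1)[OF U that] inv_closed; assumption)
  have pid: "p f = f" if f: "f \<in> S" for f
    unfolding p_def average_def
  proof (rule ext, rule average_sum[OF ord])
    fix b k assume k: "k \<in> carrier G"
    have "gact U k (p0 (gact U (inv k) f)) = gact U k (gact U (inv k) f)"
      using p0id[OF SD(5)[OF inv_closed[OF k] f]] by simp
    also have "\<dots> = f"
      using is_repD(5)[OF U k inv_closed[OF k] SU[OF f]] is_repD(4)[OF U SU[OF f]] k by simp
    finally show "1 * gact U k (p0 (gact U (inv k) f)) b = f b" by simp
  qed
  have pg: "p (gact U h f) = gact U h (p f)" if "h \<in> carrier G" "f \<in> fsp (idx U)" for h f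
    unfolding p_def using average_equivariant[OF U p0 _ that, of "\<lambda>_. 1"] by simp
  define K where "K = {f \<in> fsp (idx U). p f = (\<lambda>_. 0)}"
  have K: "stable_subspace U K"
    unfolding stable_subspace_def
  proof (intro conjI ballI allI)
    show "K \<subseteq> fsp (idx U)" by (simp add: K_def)
    show "(\<lambda>_. 0) \<in> K" by (simp add: K_def lin_on_zero[OF p])
    fix f assume "f \<in> K"
    then have f: "f \<in> fsp (idx U)" "p f = (\<lambda>_. 0)" by (simp_all add: K_def)
    show "(\<lambda>b. c * f b) \<in> K" for c
      using fsp_scale[OF f(1)] by (simp add: K_def lin_on_scale[OF p f(1)] f(2))
    show "gact U h f \<in> K" if "h \<in> carrier G" for h
      using is_rep_closed(1)[OF U f(1) that] lin_on_zero[OF is_repD(2)[OF U that]]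
      by (simp add: K_def pg[OF that f(1)] f(2))
    show "yact U f \<in> K" by (simp add: yact_trivialD[OF triv f(1)] K_def lin_on_zero[OF p])
    fix f' assume "f' \<in> K"
    then have f': "f' \<in> fsp (idx U)" "p f' = (\<lambda>_. 0)" by (simp_all add: K_def)
    show "(\<lambda>b. f b + f' b) \<in> K"
      using fsp_add[OF f(1) f'(1)] by (simp add: K_def lin_on_add[OF p f(1) f'(1)] f(2) f'(2))
  qed
  have "\<exists>U2 :: ('a, nat, 'k) crep. is_rep U2 \<and> rep_iso (rsum U1 U2) U \<and>
    (K \<noteq> fsp (idx U) \<longrightarrow> card (idx U2) < card (idx U)) \<and> (yact_trivial U \<longrightarrow> yact_trivial U2)"
  proof (rule complement_representation[OF U \<kappa> K])
    fix f :: "nat \<Rightarrow> 'k" assume f: "f \<in> fsp (idx U1)" "\<kappa> f \<in> K"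
    have "\<kappa> f \<in> S" using imageI[OF f(1), of \<kappa>] im by simp
    then have "p (\<kappa> f) = \<kappa> f" by (rule pid)
    moreover have "p (\<kappa> f) = (\<lambda>_. 0)" using f(2) unfolding K_def by (elim CollectE conjE)
    ultimately have "\<kappa> f = (\<lambda>_. 0)" by simp
    then show "f = (\<lambda>_. 0)" by (rule inj_on_fspD[OF l\<kappa> inj f(1)])
  next
    fix w :: "'i \<Rightarrow> 'k" assume w: "w \<in> fsp (idx U)"
    have "p w \<in> \<kappa> ` fsp (idx U1)" using pS[OF w] im by simp
    then obtain f where f: "p w = \<kappa> f" "f \<in> fsp (idx U1)" by (rule imageE)
    have pw: "p w \<in> fsp (idx U)" by (rule SU[OF pS[OF w]])
    have "(\<lambda>b. w b + (-1) * p w b) \<in> fsp (idx U)" by (rule fsp_add[OF w fsp_scale[OF pw]])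
    moreover have "p (\<lambda>b. w b + (-1) * p w b) = (\<lambda>_. 0)"
      unfolding lin_on_add[OF p w fsp_scale[OF pw]] lin_on_scale[OF p pw] pid[OF pS[OF w]] by simp
    ultimately have "(\<lambda>b. w b + (-1) * p w b) \<in> K" by (simp only: K_def mem_Collect_eq simp_thms)
    then have "(\<lambda>b. w b - \<kappa> f b) \<in> K" unfolding f(1) by simp
    then show "\<exists>f\<in>fsp (idx U1). (\<lambda>b. w b - \<kappa> f b) \<in> K" using f(2) by (rule bexI)
  qed
  then obtain U2 :: "('a, nat, 'k) crep" where U2: "is_rep U2" "rep_iso (rsum U1 U2) U"
    "K \<noteq> fsp (idx U) \<longrightarrow> card (idx U2) < card (idx U)" "yact_trivial U \<longrightarrow> yact_trivial U2"
    by (elim exE conjE) (rule that; assumption)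
  have "K \<noteq> fsp (idx U)"
  proof
    assume "K = fsp (idx U)"
    have "f = (\<lambda>_. 0)" if "f \<in> S" for f
    proof -
      have "f \<in> K" using SU[OF that] \<open>K = fsp (idx U)\<close> by simp
      then have "p f = (\<lambda>_. 0)" unfolding K_def by (elim CollectE conjE)
      then show ?thesis using pid[OF that] by simp
    qed
    then show False using ne(1) SD(2) by blast
  qed
  with U1 U2 card ne triv rep_hom_trivial[OF U1 \<kappa> inj triv] show ?thesis
    by (intro exI[of _ U1] exI[of _ U2] conjI) simp_all
qed

text \<open>
  Let \<open>j\<close> be minimal with \<open>y\<^sup>j = 0\<close> on \<open>R\<close>, let \<open>m = j - 1\<close> and \<open>N = y\<^sup>m \<noteq> 0\<close>. Choose \<open>s\<close> with
  \<open>N s N = N\<close> and \<open>s N s = s\<close> that is \<open>G\<close>-equivariant up to the character \<open>\<omega> = \<chi>\<^bsup>-m\<^esup>\<close>; this is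
  possible by averaging, as \<open>N h = \<chi>(h)\<^sup>m h N\<close>. The image \<open>S\<close> of \<open>s\<close> is then a \<open>G\<close>-stable complement
  of the kernel of \<open>N\<close>, and the spaces \<open>S, y S, \<dots>, y\<^sup>m S\<close> span a submodule that is isomorphic to
  \<open>S \<otimes> C(j)\<close>.

  Its complement is \<open>K = {w. s y\<^sup>k w = 0 for all k < j}\<close>. The operators \<open>\<tau>\<^sub>k = s y\<^sup>k\<close> vanish for
  \<open>k \<ge> j\<close>, and \<open>\<tau>\<^sub>m\<close> is the identity on \<open>S\<close>. Hence the \<open>\<tau>\<^bsub>m-l\<^esub>\<close>, for \<open>l = 0, \<dots>, m\<close>, form a
  triangular system with identities on the diagonal with respect to the decomposition \<open>\<Oplus> y\<^sup>l S\<close>: it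
  determines the components of a vector one by one, which gives both trivial intersection and
  spanning.
\<close>

lemma split_off_chain:
  fixes R :: "('a, 'i, 'k) crep"
  assumes R: "is_rep R" and ne: "idx R \<noteq> {}" and ord: "of_nat (card (carrier G)) \<noteq> (0 :: 'k)"
  shows "\<exists>(U :: ('a, nat, 'k) crep) j (R' :: ('a, nat, 'k) crep).
    is_rep U \<and> yact_trivial U \<and> j \<le> n \<and> is_rep R' \<and> card (idx R') < card (idx R) \<and>
    rep_iso (rsum (rtensor U (rchain j)) R') R"
proof -
  let ?B = "idx R" and ?Y = "yact R"
  note ly = is_repD(3)[OF R] and Yc = is_rep_closed(3)[OF R]
  define P where "P j \<longleftrightarrow> (\<forall>f\<in>fsp ?B. (?Y ^^ j) f = (\<lambda>_. 0))" for j
  define j where "j = (LEAST j. P j)"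
  have Pn: "P n" using is_repD(7)[OF R] by (simp add: P_def)
  have Pj: "P j" unfolding j_def by (rule LeastI[of P, OF Pn])
  have jn: "j \<le> n" unfolding j_def by (rule Least_le[of P, OF Pn])
  have "j \<noteq> 0"
  proof
    assume "j = 0"
    obtain b where b: "b \<in> ?B" using ne by blast
    have "(?Y ^^ 0) (unit_fun b) = (\<lambda>_. 0)"
      using Pj fsp_unit[OF b] unfolding P_def \<open>j = 0\<close> by blast
    then show False by (simp add: unit_fun_def fun_eq_iff split: if_splits)
  qed
  then obtain m where m: "j = Suc m" by (cases j) auto
  have "\<not> P m" using not_less_Least[of m P] unfolding j_def[symmetric] m by simp
  then obtain f0 where f0: "f0 \<in> fsp ?B" "(?Y ^^ m) f0 \<noteq> (\<lambda>_. 0)" unfolding P_def by blast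
  have Y0: "(?Y ^^ k) f = (\<lambda>_. 0)" if k: "j \<le> k" and f: "f \<in> fsp ?B" for k f
  proof -
    obtain i where "k = j + i" using k le_Suc_ex by blast
    then have "(?Y ^^ k) f = (?Y ^^ j) ((?Y ^^ i) f)" by (simp add: funpow_add)
    then show ?thesis using Pj Yc[OF f, of i] by (simp add: P_def)
  qed
  define N where "N = ?Y ^^ m"
  have lN: "lin_on ?B ?B N" unfolding N_def by (rule lin_on_funpow[OF ly])
  define \<omega> where "\<omega> h = inverse (\<chi> h) ^ m" for h
  have \<omega>: "\<omega> (h \<otimes> k) = \<omega> h * \<omega> k" if "h \<in> carrier G" "k \<in> carrier G" for h k
    using that by (simp add: \<omega>_def chi_mult power_mult_distrib)
  have N_g: "N (gact R h f) = (\<lambda>b. \<chi> h ^ m * gact R h (N f) b)" if "h \<in> carrier G" "f \<in> fsp ?B" for h f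
    unfolding N_def by (rule yact_pow_gact[OF R that])
  have g_N: "gact R h (N f) = (\<lambda>b. \<omega> h * N (gact R h f) b)" if "h \<in> carrier G" "f \<in> fsp ?B" for h f
    unfolding N_def \<omega>_def by (rule gact_yact_pow[OF R that])
  have \<omega>\<chi>: "\<omega> h * \<chi> h ^ m = 1" if "h \<in> carrier G" for h
    using chi_nonzero[OF that] by (simp add: \<omega>_def power_mult_distrib[symmetric])
  have \<omega>_inv: "\<omega> (inv h) = \<chi> h ^ m" if "h \<in> carrier G" for h
    using chi_inv[OF that] by (simp add: \<omega>_def)
  obtain s0 where s0: "lin_on ?B ?B s0" and Ns0: "\<forall>f\<in>fsp ?B. N (s0 (N f)) = N f"
    using linear_partial_inverse[OF lN] by (elim exE conjE) (rule that; assumption)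
  define s1 where "s1 = average \<omega> R s0"
  have s1: "lin_on ?B ?B s1" unfolding s1_def by (rule lin_on_average[OF R s0])
  have s1_g: "s1 (gact R h f) = (\<lambda>b. \<omega> h * gact R h (s1 f) b)" if "h \<in> carrier G" "f \<in> fsp ?B" for h f
    unfolding s1_def by (rule average_equivariant[OF R s0 \<omega> that])
  have Nc: "N f \<in> fsp ?B" and s1c: "s1 f \<in> fsp ?B" and s0c: "s0 f \<in> fsp ?B" if "f \<in> fsp ?B" for f
    using lin_on_fsp[OF lN that] lin_on_fsp[OF s1 that] lin_on_fsp[OF s0 that] by simp_all
  note gc = is_rep_closed(1)[OF R]
  have Ns1: "N (s1 (N f)) = N f" if f: "f \<in> fsp ?B" for f
  proof
    fix b
    let ?v = "\<lambda>k. gact R k (s0 (gact R (inv k) (N f)))"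
    have vc: "?v k \<in> fsp ?B" if "k \<in> carrier G" for k
      by (rule gc[OF s0c[OF gc[OF Nc[OF f] inv_closed[OF that]]] that])
    have "N (s1 (N f)) b = (\<Sum>k\<in>carrier G. inverse (of_nat (card (carrier G))) * \<omega> k * N (?v k) b)"
      unfolding s1_def average_def by (rule fun_cong[OF lin_on_sum[OF lN vc]])
    also have "\<dots> = N f b"
    proof (rule average_sum[OF ord])
      fix k assume k: "k \<in> carrier G"
      let ?u = "gact R (inv k) f"
      have u: "?u \<in> fsp ?B" by (rule gc[OF f inv_closed[OF k]])
      have "gact R (inv k) (N f) = (\<lambda>b. \<chi> k ^ m * N ?u b)"
        using g_N[OF inv_closed[OF k] f] \<omega>_inv[OF k] by simp
      then have "s0 (gact R (inv k) (N f)) = (\<lambda>b. \<chi> k ^ m * s0 (N ?u) b)"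
        using lin_on_scale[OF s0 Nc[OF u]] by simp
      then have "?v k = (\<lambda>b. \<chi> k ^ m * gact R k (s0 (N ?u)) b)"
        using lin_on_scale[OF is_repD(2)[OF R k] s0c[OF Nc[OF u]]] by simp
      then have "N (?v k) = (\<lambda>b. \<chi> k ^ m * N (gact R k (s0 (N ?u))) b)"
        using lin_on_scale[OF lN gc[OF s0c[OF Nc[OF u]] k]] by simp
      also have "N (gact R k (s0 (N ?u))) = (\<lambda>b. \<chi> k ^ m * gact R k (N (s0 (N ?u))) b)"
        by (rule N_g[OF k s0c[OF Nc[OF u]]])
      also have "N (s0 (N ?u)) = N ?u" using Ns0 u by blast
      also have "gact R k (N ?u) = (\<lambda>b. \<omega> k * N (gact R k ?u) b)" by (rule g_N[OF k u])
      also have "gact R k ?u = f"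
        using is_repD(5)[OF R k inv_closed[OF k] f] is_repD(4)[OF R f] k by simp
      finally have "N (?v k) b = \<chi> k ^ m * (\<chi> k ^ m * (\<omega> k * N f b))" by simp
      then have "\<omega> k * N (?v k) b = (\<omega> k * \<chi> k ^ m) * (\<omega> k * \<chi> k ^ m) * N f b" by (simp add: ac_simps)
      then show "\<omega> k * N (?v k) b = N f b" using \<omega>\<chi>[OF k] by simp
    qed
    finally show "N (s1 (N f)) b = N f b" .
  qed
  \<comment> \<open>Replacing \<open>s1\<close> by \<open>s1 N s1\<close> keeps \<open>N s N = N\<close> and enforces \<open>s N s = s\<close>. The factors
    \<open>\<omega>\<close>, \<open>\<chi>\<^sup>m\<close>, \<open>\<omega>\<close> combine to \<open>\<omega>\<close>.\<close>
  define s where "s f = s1 (N (s1 f))" for f :: "'i \<Rightarrow> 'k"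
  have s: "lin_on ?B ?B s" unfolding s_def by (rule lin_on_comp[OF lin_on_comp[OF s1 lN] s1])
  have sc: "s f \<in> fsp ?B" if "f \<in> fsp ?B" for f by (rule lin_on_fsp[OF s that])
  have NsN: "N (s (N f)) = N f" if "f \<in> fsp ?B" for f
    by (simp add: s_def Ns1 that s1c Nc)
  have sNs: "s (N (s f)) = s f" if "f \<in> fsp ?B" for f
    by (simp add: s_def Ns1 that s1c Nc)
  have s_g: "s (gact R h f) = (\<lambda>b. \<omega> h * gact R h (s f) b)" if h: "h \<in> carrier G" and f: "f \<in> fsp ?B" for h f
  proof -
    note c1 = gc[OF s1c[OF f] h] and c2 = gc[OF Nc[OF s1c[OF f]] h]
    have "s (gact R h f) = s1 (N (\<lambda>b. \<omega> h * gact R h (s1 f) b))" by (simp add: s_def s1_g[OF h f])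
    also have "\<dots> = s1 (\<lambda>b. \<omega> h * N (gact R h (s1 f)) b)" by (simp add: lin_on_scale[OF lN c1])
    also have "\<dots> = s1 (\<lambda>b. (\<omega> h * \<chi> h ^ m) * gact R h (N (s1 f)) b)"
      by (simp add: N_g[OF h s1c[OF f]] mult.assoc)
    also have "\<dots> = s1 (gact R h (N (s1 f)))" by (simp add: \<omega>\<chi>[OF h])
    also have "\<dots> = (\<lambda>b. \<omega> h * gact R h (s f) b)" by (simp add: s1_g[OF h Nc[OF s1c[OF f]]] s_def)
    finally show ?thesis .
  qed
  \<comment> \<open>The space \<open>S\<close> is stable under \<open>G\<close> but not under \<open>y\<close>; it becomes a subrepresentation once
    \<open>y\<close> is made to act by zero.\<close>
  define R0 where "R0 = R\<lparr>yact := \<lambda>_ _. 0\<rparr>"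
  have R0_sel: "idx R0 = ?B" "gact R0 = gact R" "yact R0 f = (\<lambda>_. 0)" for f
    by (simp_all add: R0_def)
  have R0: "is_rep R0"
    unfolding is_rep_def R0_sel(1,2)
  proof (intro conjI ballI)
    show "lin_on ?B ?B (yact R0)" by (simp add: R0_def lin_on_null)
    fix f :: "'i \<Rightarrow> 'k" assume f: "f \<in> fsp ?B"
    obtain n' where n': "n = Suc n'" using n_ge_2 by (cases n) auto
    show "(yact R0 ^^ n) f = (\<lambda>_. 0)" by (simp add: n' R0_sel)
    show "yact R0 (gact R h f) = (\<lambda>b. \<chi> h * gact R h (yact R0 f) b)" if "h \<in> carrier G" for h
      by (simp add: R0_sel lin_on_zero[OF is_repD(2)[OF R that]])
  qed (simp_all add: is_repD(1,2,4,5)[OF R])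
  have R0_triv: "yact_trivial R0" by (simp add: yact_trivial_def R0_sel)
  define S where "S = s ` fsp ?B"
  have S: "stable_subspace R0 S"
    unfolding stable_subspace_def R0_sel
  proof (intro conjI ballI allI)
    show "S \<subseteq> fsp ?B" using sc by (auto simp: S_def)
    show z: "(\<lambda>_. 0) \<in> S"
      unfolding S_def by (rule image_eqI[of _ s "\<lambda>_. 0"]) (simp_all add: lin_on_zero[OF s])
    then show "(\<lambda>_. 0) \<in> S" .
    fix f :: "'i \<Rightarrow> 'k" assume "f \<in> S"
    then obtain u where u: "f = s u" "u \<in> fsp ?B" unfolding S_def by (rule imageE)
    show "(\<lambda>b. c * f b) \<in> S" for c
      unfolding S_def u(1) by (rule image_eqI[of _ s "\<lambda>b. c * u b"])
        (simp_all add: lin_on_scale[OF s u(2)] fsp_scale[OF u(2)])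
    show "gact R h f \<in> S" if h: "h \<in> carrier G" for h
      unfolding S_def u(1)
    proof (rule image_eqI[of _ s "\<lambda>b. \<chi> h ^ m * gact R h u b"])
      show "gact R h (s u) = s (\<lambda>b. \<chi> h ^ m * gact R h u b)"
        unfolding lin_on_scale[OF s gc[OF u(2) h]] s_g[OF h u(2)]
        using \<omega>\<chi>[OF h] by (simp add: mult.assoc[symmetric] mult.commute[of "\<chi> h ^ m"])
    qed (rule fsp_scale[OF gc[OF u(2) h]])
    fix f' :: "'i \<Rightarrow> 'k" assume "f' \<in> S"
    then obtain u' where u': "f' = s u'" "u' \<in> fsp ?B" unfolding S_def by (rule imageE)
    show "(\<lambda>b. f b + f' b) \<in> S"
      unfolding S_def u(1) u'(1) by (rule image_eqI[of _ s "\<lambda>b. u b + u' b"])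
        (simp_all add: lin_on_add[OF s u(2) u'(2)] fsp_add[OF u(2) u'(2)])
  qed
  obtain U :: "('a, nat, 'k) crep" and \<kappa> where U: "is_rep U" and \<kappa>: "rep_hom U R0 \<kappa>"
    and inj: "inj_on \<kappa> (fsp (idx U))" and im: "\<kappa> ` fsp (idx U) = S"
    by (rule subrepresentationE[OF R0 S])
  have U_triv: "yact_trivial U" by (rule rep_hom_trivial[OF U \<kappa> inj R0_triv])
  have l\<kappa>: "lin_on (idx U) ?B \<kappa>" using rep_homD(1)[OF \<kappa>] by (simp add: R0_sel)
  have \<kappa>_g: "\<kappa> (gact U h f) = gact R h (\<kappa> f)" if "h \<in> carrier G" "f \<in> fsp (idx U)" for h f
    using rep_homD(2)[OF \<kappa> that] by (simp add: R0_sel)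
  have \<kappa>c: "\<kappa> f \<in> fsp ?B" if "f \<in> fsp (idx U)" for f by (rule lin_on_fsp[OF l\<kappa> that])
  have sN\<kappa>: "s (N (\<kappa> f)) = \<kappa> f" if "f \<in> fsp (idx U)" for f
  proof -
    have "\<kappa> f \<in> S" using imageI[OF that, of \<kappa>] im by simp
    then obtain u where u: "\<kappa> f = s u" "u \<in> fsp ?B" unfolding S_def by (rule imageE)
    show ?thesis unfolding u(1) by (rule sNs[OF u(2)])
  qed
  define T where "T = rtensor U (rchain j)"
  have T_idx: "idx T = idx U \<times> {..<j}" by (simp add: T_def crep_simps)
  have T_rep: "is_rep T" unfolding T_def by (rule is_rep_rtensor[OF U is_rep_rchain[OF jn]])
  define D where "D = idx U \<times> {..<j}"
  have sl: "(\<lambda>i. f (i, l)) \<in> fsp (idx U)" if "f \<in> fsp D" for f :: "nat \<times> nat \<Rightarrow> 'k" and l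
    using slice1 that unfolding D_def .
  define \<iota> where "\<iota> f = (\<lambda>b. \<Sum>l<j. 1 * (?Y ^^ l) (\<kappa> (\<lambda>i. f (i, l))) b)" for f :: "nat \<times> nat \<Rightarrow> 'k"
  have summand: "lin_on D ?B (\<lambda>f. (?Y ^^ l) (\<kappa> (\<lambda>i. f (i, l))))" for l
    unfolding D_def by (rule lin_on_comp[OF lin_on_comp[OF lin_on_slice1 l\<kappa>] lin_on_funpow[OF ly]])
  have l\<iota>: "lin_on D ?B \<iota>" unfolding \<iota>_def[abs_def] by (rule lin_on_setsum[OF summand])
  have hom: "rep_hom T R \<iota>"
    unfolding rep_hom_def T_idx D_def[symmetric]
  proof (intro conjI ballI l\<iota>)
    fix f :: "nat \<times> nat \<Rightarrow> 'k" assume f: "f \<in> fsp D"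
    note fl = sl[OF f]
    show "\<iota> (gact T h f) = gact R h (\<iota> f)" if h: "h \<in> carrier G" for h
    proof -
      have "(?Y ^^ l) (\<kappa> (\<lambda>i. gact T h f (i, l))) = gact R h ((?Y ^^ l) (\<kappa> (\<lambda>i. f (i, l))))" for l
      proof -
        let ?f = "\<lambda>i. f (i, l)"
        have "(\<lambda>i. gact T h f (i, l)) = (\<lambda>i. inverse (\<chi> h) ^ l * gact U h ?f i)"
          by (simp add: T_def crep_simps lin_on_scale[OF is_repD(2)[OF U h] fl])
        then have "\<kappa> (\<lambda>i. gact T h f (i, l)) = (\<lambda>b. inverse (\<chi> h) ^ l * gact R h (\<kappa> ?f) b)"
          using lin_on_scale[OF l\<kappa> is_rep_closed(1)[OF U fl h]] \<kappa>_g[OF h fl] by simp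
        then have "(?Y ^^ l) (\<kappa> (\<lambda>i. gact T h f (i, l))) =
            (\<lambda>b. inverse (\<chi> h) ^ l * (?Y ^^ l) (gact R h (\<kappa> ?f)) b)"
          using lin_on_scale[OF lin_on_funpow[OF ly] gc[OF \<kappa>c[OF fl] h]] by simp
        then show ?thesis using gact_yact_pow[OF R h \<kappa>c[OF fl], of l] by simp
      qed
      then show ?thesis
        using lin_on_sum[OF is_repD(2)[OF R h], of "{..<j}" "\<lambda>l. (?Y ^^ l) (\<kappa> (\<lambda>i. f (i, l)))" "\<lambda>_. 1"]
          Yc[OF \<kappa>c[OF fl]] by (simp add: \<iota>_def)
    qed
    show "\<iota> (yact T f) = ?Y (\<iota> f)"
    proof
      fix b
      have triv: "yact U (\<lambda>i. c * f (i, l)) = (\<lambda>_. 0)" for c l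
        by (rule yact_trivialD[OF U_triv fsp_scale[OF fl]])
      have triv1: "yact U (\<lambda>i. f (i, l)) = (\<lambda>_. 0)" for l
        by (rule yact_trivialD[OF U_triv fl])
      have sl0: "(\<lambda>i. yact T f (i, 0)) = (\<lambda>_. 0)"
        by (simp add: T_def crep_simps triv triv1)
      have slS: "(\<lambda>i. yact T f (i, Suc l)) = (\<lambda>i. f (i, l))" if "l < m" for l
        using that by (simp add: T_def crep_simps triv triv1 m)
      have "\<iota> (yact T f) b = (\<Sum>l<m. (?Y ^^ Suc l) (\<kappa> (\<lambda>i. f (i, l))) b)"
        unfolding \<iota>_def m sum.lessThan_Suc_shift
        by (simp add: sl0 slS lin_on_zero[OF l\<kappa>])
      also have "\<dots> = (\<Sum>l<j. (?Y ^^ Suc l) (\<kappa> (\<lambda>i. f (i, l))) b)"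
        using Y0[of j, OF _ \<kappa>c[OF fl]] by (simp add: m)
      also have "\<dots> = ?Y (\<iota> f) b"
        using fun_cong[OF lin_on_sum[OF ly, of "{..<j}" "\<lambda>l. (?Y ^^ l) (\<kappa> (\<lambda>i. f (i, l)))" "\<lambda>_. 1"], of b]
          Yc[OF \<kappa>c[OF fl]] by (simp add: \<iota>_def)
      finally show "\<iota> (yact T f) b = ?Y (\<iota> f) b" .
    qed
  qed
  define \<tau> where "\<tau> k w = s ((?Y ^^ k) w)" for k and w :: "'i \<Rightarrow> 'k"
  have \<tau>: "lin_on ?B ?B (\<tau> k)" for k
    unfolding \<tau>_def[abs_def] by (rule lin_on_comp[OF lin_on_funpow[OF ly] s])
  have \<tau>_high: "\<tau> k w = (\<lambda>_. 0)" if "j \<le> k" "w \<in> fsp ?B" for k w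
    by (simp add: \<tau>_def Y0[OF that] lin_on_zero[OF s])
  have \<tau>_pow: "\<tau> k ((?Y ^^ l) w) = \<tau> (k + l) w" for k l w
    by (simp add: \<tau>_def funpow_add)
  have \<tau>_m: "\<tau> m w = s (N w)" for w by (simp add: \<tau>_def N_def)
  define K where "K = {w \<in> fsp ?B. \<forall>k<j. \<tau> k w = (\<lambda>_. 0)}"
  have KI: "w \<in> K" if "w \<in> fsp ?B" "\<And>k. k < j \<Longrightarrow> \<tau> k w = (\<lambda>_. 0)" for w using that by (simp add: K_def)
  have KD: "w \<in> fsp ?B" "k < j \<Longrightarrow> \<tau> k w = (\<lambda>_. 0)" if "w \<in> K" for w k using that by (simp_all add: K_def)
  have K: "stable_subspace R K"
    unfolding stable_subspace_def
  proof (intro conjI ballI allI)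
    show "K \<subseteq> fsp ?B" by (simp add: K_def)
    show "(\<lambda>_. 0) \<in> K" by (rule KI) (simp_all add: lin_on_zero[OF \<tau>])
    fix w :: "'i \<Rightarrow> 'k" assume w: "w \<in> K"
    note wB = KD(1)[OF w] and w0 = KD(2)[OF w]
    show "(\<lambda>b. c * w b) \<in> K" for c
      by (rule KI) (simp_all add: fsp_scale[OF wB] lin_on_scale[OF \<tau> wB] w0)
    show "gact R h w \<in> K" if h: "h \<in> carrier G" for h
    proof (rule KI[OF gc[OF wB h]])
      fix k assume k: "k < j"
      have "\<tau> k (gact R h w) = (\<lambda>b. \<chi> h ^ k * s (gact R h ((?Y ^^ k) w)) b)"
        unfolding \<tau>_def yact_pow_gact[OF R h wB] by (rule lin_on_scale[OF s gc[OF Yc[OF wB] h]])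
      also have "s (gact R h ((?Y ^^ k) w)) = (\<lambda>b. \<omega> h * gact R h (\<tau> k w) b)"
        unfolding \<tau>_def by (rule s_g[OF h Yc[OF wB]])
      finally show "\<tau> k (gact R h w) = (\<lambda>_. 0)"
        by (simp add: w0[OF k] lin_on_zero[OF is_repD(2)[OF R h]])
    qed
    show "?Y w \<in> K"
    proof (rule KI[OF is_rep_closed(2)[OF R wB]])
      fix k
      have "\<tau> k (?Y w) = \<tau> (Suc k) w" using \<tau>_pow[of k 1 w] by simp
      then show "\<tau> k (?Y w) = (\<lambda>_. 0)"
        using w0[of "Suc k"] \<tau>_high[OF _ wB, of "Suc k"] by (cases "Suc k < j") simp_all
    qed
    fix w' :: "'i \<Rightarrow> 'k" assume w': "w' \<in> K"
    show "(\<lambda>b. w b + w' b) \<in> K"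
      by (rule KI) (simp_all add: fsp_add[OF wB KD(1)[OF w']] lin_on_add[OF \<tau> wB KD(1)[OF w']] w0 KD(2)[OF w'])
  qed
  have \<iota>\<tau>: "\<tau> k (\<iota> f) = (\<lambda>b. \<Sum>l<j. \<tau> (k + l) (\<kappa> (\<lambda>i. f (i, l))) b)" if "f \<in> fsp D" for k f
    unfolding \<iota>_def
    using lin_on_sum[OF \<tau>, of "{..<j}" "\<lambda>l. (?Y ^^ l) (\<kappa> (\<lambda>i. f (i, l)))" k "\<lambda>_. 1"]
      Yc[OF \<kappa>c[OF sl[OF that]]] by (simp add: \<tau>_pow)
  have K_inj: "f = (\<lambda>_. 0)" if f: "f \<in> fsp D" and fK: "\<iota> f \<in> K" for f
  proof -
    \<comment> \<open>Apply \<open>\<tau>\<^bsub>m-l\<^esub>\<close>: the components below \<open>l\<close> are zero by induction, those above \<open>l\<close> are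
      killed, and the component at \<open>l\<close> is reproduced.\<close>
    have slice0: "l < j \<longrightarrow> (\<lambda>i. f (i, l)) = (\<lambda>_. 0)" for l
    proof (induction l rule: less_induct)
      case (less l)
      show ?case
      proof
        assume l: "l < j"
        have other: "\<tau> (m - l + l') (\<kappa> (\<lambda>i. f (i, l'))) = (\<lambda>_. 0)" if "l' < j" "l' \<noteq> l" for l'
        proof (cases "l' < l")
          case True
          then have "(\<lambda>i. f (i, l')) = (\<lambda>_. 0)" using less.IH that(1) by simp
          then show ?thesis by (simp add: lin_on_zero[OF l\<kappa>] lin_on_zero[OF \<tau>])
        next
          case False
          then have "j \<le> m - l + l'" using that l m by linarith
          then show ?thesis by (rule \<tau>_high[OF _ \<kappa>c[OF sl[OF f]]])
        qed
        have "\<kappa> (\<lambda>i. f (i, l)) b = 0" for b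
        proof -
          have "(\<Sum>l'<j. \<tau> (m - l + l') (\<kappa> (\<lambda>i. f (i, l'))) b) =
              (\<Sum>l'<j. if l' = l then \<kappa> (\<lambda>i. f (i, l)) b else 0)"
          proof (intro sum.cong refl)
            fix l' assume "l' \<in> {..<j}"
            then have l': "l' < j" by simp
            have "\<tau> (m - l + l) (\<kappa> (\<lambda>i. f (i, l))) = \<kappa> (\<lambda>i. f (i, l))"
              using l m by (simp add: \<tau>_m sN\<kappa>[OF sl[OF f]])
            then show "\<tau> (m - l + l') (\<kappa> (\<lambda>i. f (i, l'))) b = (if l' = l then \<kappa> (\<lambda>i. f (i, l)) b else 0)"
              using other[OF l'] by (cases "l' = l") simp_all
          qed
          also have "\<dots> = \<kappa> (\<lambda>i. f (i, l)) b" using l by simp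
          finally show ?thesis using fun_cong[OF \<iota>\<tau>[OF f, of "m - l"], of b] KD(2)[OF fK, of "m - l"] m by simp
        qed
        then have "\<kappa> (\<lambda>i. f (i, l)) = (\<lambda>_. 0)" by (rule ext)
        then show "(\<lambda>i. f (i, l)) = (\<lambda>_. 0)" by (rule inj_on_fspD[OF l\<kappa> inj sl[OF f]])
      qed
    qed
    show ?thesis
    proof
      fix p :: "nat \<times> nat"
      obtain i l where p: "p = (i, l)" by (cases p)
      show "f p = 0"
        using fun_cong[OF slice0[of l, rule_format], of i] fspD[OF f, of p] unfolding p D_def
        by (cases "l < j") simp_all
    qed
  qed
  have K_surj: "\<exists>f\<in>fsp D. (\<lambda>b. w b - \<iota> f b) \<in> K" if w: "w \<in> fsp ?B" for w
  proof -
    \<comment> \<open>Subtracting \<open>y\<^sup>p \<tau>\<^bsub>m-p\<^esub> r\<close> from the remainder \<open>r\<close> kills \<open>\<tau>\<^bsub>m-p\<^esub> r\<close> and leaves \<open>\<tau>\<^bsub>m-l\<^esub> r\<close>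
      unchanged for \<open>l < p\<close>.\<close>
    have "\<exists>f\<in>fsp D. \<forall>l<p. \<tau> (m - l) (\<lambda>b. w b + (-1) * \<iota> f b) = (\<lambda>_. 0)" if "p \<le> j" for p
      using that
    proof (induction p)
      case 0
      show ?case by (rule bexI[OF _ fsp_zero]) simp
    next
      case (Suc p)
      then have p: "p < j" by simp
      from Suc.IH[OF Suc_leD[OF Suc.prems]] obtain f where f: "f \<in> fsp D"
        and f0: "\<forall>l<p. \<tau> (m - l) (\<lambda>b. w b + (-1) * \<iota> f b) = (\<lambda>_. 0)" by (rule bexE)
      define r where "r = (\<lambda>b. w b + (-1) * \<iota> f b)"
      have r: "r \<in> fsp ?B" unfolding r_def by (rule fsp_add[OF w fsp_scale[OF lin_on_fsp[OF l\<iota> f]]])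
      have "\<tau> (m - p) r \<in> \<kappa> ` fsp (idx U)"
        unfolding im S_def \<tau>_def by (rule imageI[OF Yc[OF r]])
      then obtain a where a: "\<tau> (m - p) r = \<kappa> a" "a \<in> fsp (idx U)" by (rule imageE)
      define \<delta> :: "nat \<times> nat \<Rightarrow> 'k" where "\<delta> = (\<lambda>(i, l). if l = p then a i else 0)"
      have \<delta>: "\<delta> \<in> fsp D"
      proof (rule fspI)
        fix q :: "nat \<times> nat" assume "q \<notin> D"
        then show "\<delta> q = 0" using p fspD[OF a(2)] by (cases q) (auto simp: D_def \<delta>_def)
      qed
      have \<iota>\<delta>: "\<iota> \<delta> = (?Y ^^ p) (\<kappa> a)"
      proof
        fix b
        have "\<iota> \<delta> b = (\<Sum>l<j. if l = p then (?Y ^^ p) (\<kappa> a) b else 0)"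
          unfolding \<iota>_def
          by (intro sum.cong refl)
            (simp add: \<delta>_def lin_on_zero[OF l\<kappa>] lin_on_zero[OF lin_on_funpow[OF ly]])
        then show "\<iota> \<delta> b = (?Y ^^ p) (\<kappa> a) b" using p by simp
      qed
      define f' where "f' = (\<lambda>q. f q + \<delta> q)"
      have f': "f' \<in> fsp D" unfolding f'_def by (rule fsp_add[OF f \<delta>])
      have eq: "(\<lambda>b. w b + (-1) * \<iota> f' b) = (\<lambda>b. r b + (-1) * (?Y ^^ p) (\<kappa> a) b)"
        unfolding f'_def lin_on_add[OF l\<iota> f \<delta>] \<iota>\<delta> r_def by (simp add: algebra_simps)
      have \<kappa>a: "\<kappa> a \<in> fsp ?B" by (rule \<kappa>c[OF a(2)])
      have expand: "\<tau> k (\<lambda>b. w b + (-1) * \<iota> f' b) = (\<lambda>b. \<tau> k r b + (-1) * \<tau> (k + p) (\<kappa> a) b)" for k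
        unfolding eq lin_on_add[OF \<tau> r fsp_scale[OF Yc[OF \<kappa>a]]] lin_on_scale[OF \<tau> Yc[OF \<kappa>a]] \<tau>_pow ..
      have "\<tau> (m - l) (\<lambda>b. w b + (-1) * \<iota> f' b) = (\<lambda>_. 0)" if l: "l < Suc p" for l
      proof (cases "l = p")
        case True
        have "m - p + p = m" using p m by simp
        then show ?thesis unfolding expand True a(1) by (simp add: \<tau>_m sN\<kappa>[OF a(2)])
      next
        case False
        then have lp: "l < p" using l by simp
        have "j \<le> m - l + p" using lp p m by linarith
        then have "\<tau> (m - l + p) (\<kappa> a) = (\<lambda>_. 0)" by (rule \<tau>_high[OF _ \<kappa>a])
        moreover have "\<tau> (m - l) r = (\<lambda>_. 0)" using f0 lp unfolding r_def by simp
        ultimately show ?thesis unfolding expand by simp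
      qed
      then show ?case by (intro bexI[OF _ f'] allI impI)
    qed
    from this[of j, OF order_refl] obtain f where f: "f \<in> fsp D"
      and f0: "\<forall>l<j. \<tau> (m - l) (\<lambda>b. w b + (-1) * \<iota> f b) = (\<lambda>_. 0)" by (rule bexE)
    have "(\<lambda>b. w b + (-1) * \<iota> f b) \<in> K"
    proof (rule KI)
      show "(\<lambda>b. w b + (-1) * \<iota> f b) \<in> fsp ?B"
        by (rule fsp_add[OF w fsp_scale[OF lin_on_fsp[OF l\<iota> f]]])
      fix k assume "k < j"
      then have "m - k < j" "m - (m - k) = k" using m by simp_all
      then show "\<tau> k (\<lambda>b. w b + (-1) * \<iota> f b) = (\<lambda>_. 0)" using f0[rule_format, of "m - k"] by simp
    qed
    then have "(\<lambda>b. w b - \<iota> f b) \<in> K" by simp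
    then show ?thesis using f by (rule bexI)
  qed
  have KB: "K \<noteq> fsp ?B"
  proof
    assume KB: "K = fsp ?B"
    have "N f0 \<in> K" unfolding KB by (rule Nc[OF f0(1)])
    have "\<tau> m f0 = (\<lambda>_. 0)" using KD(2)[of f0 m] f0(1) m unfolding KB by simp
    then have "s (N f0) = (\<lambda>_. 0)" by (simp add: \<tau>_m)
    then have "N f0 = (\<lambda>_. 0)" using NsN[OF f0(1)] by (simp add: lin_on_zero[OF lN])
    then show False using f0(2) by (simp add: N_def)
  qed
  have "\<exists>R' :: ('a, nat, 'k) crep. is_rep R' \<and> rep_iso (rsum T R') R \<and>
    (K \<noteq> fsp ?B \<longrightarrow> card (idx R') < card ?B) \<and> (yact_trivial R \<longrightarrow> yact_trivial R')"
    by (rule complement_representation[OF R hom K]) (unfold T_idx D_def[symmetric], rule K_inj K_surj; assumption)+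
  then obtain R' :: "('a, nat, 'k) crep" where "is_rep R'" "rep_iso (rsum T R') R"
    "K \<noteq> fsp ?B \<longrightarrow> card (idx R') < card ?B"
    by (elim exE conjE) (rule that; assumption)
  with U U_triv jn KB show ?thesis
    unfolding T_def by (intro exI[of _ U] exI[of _ j] exI[of _ R'] conjI) simp_all
qed

end

section \<open>The ring of formal combinations of a monoid\<close>

text \<open>
  The integral monoid ring of \<open>X\<close> with product \<open>t\<close> and unit \<open>e\<close>, in the form of the biadditive
  extension of \<open>t\<close>.
\<close>

definition frag_ring :: "'c set \<Rightarrow> ('c \<Rightarrow> 'c \<Rightarrow> 'c) \<Rightarrow> 'c \<Rightarrow> ('c \<Rightarrow>\<^sub>0 int) ring" where
  "frag_ring X t e =
     \<lparr>carrier = carrier (free_Abelian_group X),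
      mult = (\<lambda>p p'. frag_extend (\<lambda>C. frag_extend (\<lambda>D. frag_of (t C D)) p') p),
      one = frag_of e, zero = 0, add = (+)\<rparr>"

lemma frag_extend_diff_fun: "frag_extend (\<lambda>C. f C - f' C) p = frag_extend f p - frag_extend f' p"
  by (rule frag_induction[of p UNIV]) (simp_all add: frag_extend_diff)

locale class_monoid =
  fixes X :: "'c set" and t :: "'c \<Rightarrow> 'c \<Rightarrow> 'c" and e :: 'c
  assumes t_closed: "\<And>C D. C \<in> X \<Longrightarrow> D \<in> X \<Longrightarrow> t C D \<in> X"
    and t_assoc: "\<And>C D E. C \<in> X \<Longrightarrow> D \<in> X \<Longrightarrow> E \<in> X \<Longrightarrow> t (t C D) E = t C (t D E)"
    and e_closed: "e \<in> X"
    and t_unit: "\<And>C. C \<in> X \<Longrightarrow> t e C = C" "\<And>C. C \<in> X \<Longrightarrow> t C e = C"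
begin

abbreviation F :: "('c \<Rightarrow>\<^sub>0 int) ring" where "F \<equiv> frag_ring X t e"

lemma F_carrier: "p \<in> carrier F \<longleftrightarrow> Poly_Mapping.keys p \<subseteq> X"
  by (simp add: frag_ring_def free_Abelian_group_def)

lemma F_of: "C \<in> X \<Longrightarrow> frag_of C \<in> carrier F"
  by (simp add: F_carrier)

lemma F_diff: "p \<in> carrier F \<Longrightarrow> p' \<in> carrier F \<Longrightarrow> p - p' \<in> carrier F"
  unfolding F_carrier using keys_diff[of p p'] by blast

lemma F_induct [consumes 1, case_names zero basis diff]:
  assumes "p \<in> carrier F" and "P 0" and "\<And>C. C \<in> X \<Longrightarrow> P (frag_of C)"
    and "\<And>p p'. p \<in> carrier F \<Longrightarrow> p' \<in> carrier F \<Longrightarrow> P p \<Longrightarrow> P p' \<Longrightarrow> P (p - p')"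
  shows "P p"
proof -
  have "p \<in> carrier F \<and> P p"
    by (rule frag_induction[of p X]) (use assms F_of F_diff in \<open>auto simp: F_carrier\<close>)
  then show ?thesis by simp
qed

lemma F_mult_of: "frag_of C \<otimes>\<^bsub>F\<^esub> frag_of D = frag_of (t C D)"
  by (simp add: frag_ring_def)

lemma F_mult_zero: "0 \<otimes>\<^bsub>F\<^esub> p = 0" "p \<otimes>\<^bsub>F\<^esub> 0 = 0"
  by (simp_all add: frag_ring_def frag_extend_eq_0)

lemma F_mult_diff:
  "(p - p') \<otimes>\<^bsub>F\<^esub> s = p \<otimes>\<^bsub>F\<^esub> s - p' \<otimes>\<^bsub>F\<^esub> s" "s \<otimes>\<^bsub>F\<^esub> (p - p') = s \<otimes>\<^bsub>F\<^esub> p - s \<otimes>\<^bsub>F\<^esub> p'"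
  by (simp_all add: frag_ring_def frag_extend_diff frag_extend_diff_fun)

lemma F_mult_add:
  "(p + p') \<otimes>\<^bsub>F\<^esub> s = p \<otimes>\<^bsub>F\<^esub> s + p' \<otimes>\<^bsub>F\<^esub> s" "s \<otimes>\<^bsub>F\<^esub> (p + p') = s \<otimes>\<^bsub>F\<^esub> p + s \<otimes>\<^bsub>F\<^esub> p'"
  using F_mult_diff(1)[of "p + p'" p' s] F_mult_diff(2)[of s "p + p'" p'] by simp_all

lemma F_mult_closed: "p \<in> carrier F \<Longrightarrow> p' \<in> carrier F \<Longrightarrow> p \<otimes>\<^bsub>F\<^esub> p' \<in> carrier F"
proof (induction p rule: F_induct)
  case (basis C)
  from basis.prems show ?case
  proof (induction p' rule: F_induct)
    case (basis D)
    show ?case unfolding F_mult_of by (rule F_of[OF t_closed[OF \<open>C \<in> X\<close> \<open>D \<in> X\<close>]])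
  next
    case (diff p p')
    then show ?case by (simp add: F_mult_diff F_diff)
  qed (simp add: F_mult_zero F_carrier)
next
  case (diff p1 p2)
  then show ?case by (simp add: F_mult_diff F_diff)
qed (simp add: F_mult_zero F_carrier)

lemma F_mult_assoc:
  assumes "p \<in> carrier F" "p' \<in> carrier F" "s \<in> carrier F"
  shows "(p \<otimes>\<^bsub>F\<^esub> p') \<otimes>\<^bsub>F\<^esub> s = p \<otimes>\<^bsub>F\<^esub> (p' \<otimes>\<^bsub>F\<^esub> s)"
  using assms(1)
proof (induction p rule: F_induct)
  case (basis C)
  from assms(2) show ?case
  proof (induction p' rule: F_induct)
    case (basis D)
    from assms(3) show ?case
    proof (induction s rule: F_induct)
      case (basis E)
      show ?case unfolding F_mult_of t_assoc[OF \<open>C \<in> X\<close> \<open>D \<in> X\<close> \<open>E \<in> X\<close>] ..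
    qed (simp_all add: F_mult_zero F_mult_diff)
  qed (simp_all add: F_mult_zero F_mult_diff)
qed (simp_all add: F_mult_zero F_mult_diff)

lemma F_unit:
  assumes "p \<in> carrier F"
  shows "\<one>\<^bsub>F\<^esub> \<otimes>\<^bsub>F\<^esub> p = p" "p \<otimes>\<^bsub>F\<^esub> \<one>\<^bsub>F\<^esub> = p"
proof -
  have one: "\<one>\<^bsub>F\<^esub> = frag_of e" by (simp add: frag_ring_def)
  from assms show "\<one>\<^bsub>F\<^esub> \<otimes>\<^bsub>F\<^esub> p = p" unfolding one
    by (induction p rule: F_induct) (simp_all add: F_mult_zero F_mult_diff F_mult_of t_unit)
  from assms show "p \<otimes>\<^bsub>F\<^esub> \<one>\<^bsub>F\<^esub> = p" unfolding one
    by (induction p rule: F_induct) (simp_all add: F_mult_zero F_mult_diff F_mult_of t_unit)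
qed

lemma F_add_monoid: "add_monoid F = free_Abelian_group X"
  by (simp add: frag_ring_def free_Abelian_group_def)

lemma F_simps: "p \<oplus>\<^bsub>F\<^esub> p' = p + p'" "\<zero>\<^bsub>F\<^esub> = 0" "\<one>\<^bsub>F\<^esub> = frag_of e"
  by (simp_all add: frag_ring_def)

lemma F_ring: "ring F"
proof (rule ringI)
  show "abelian_group F"
    by (rule comm_group_abelian_groupI) (simp only: F_add_monoid abelian_free_Abelian_group)
  show "Group.monoid F"
    by (rule monoidI) (simp_all add: F_mult_closed F_mult_assoc F_unit F_simps(3) F_of e_closed
        F_unit[unfolded F_simps(3)])
qed (simp_all add: F_simps(1) F_mult_add)

lemma F_minus: "p \<in> carrier F \<Longrightarrow> p' \<in> carrier F \<Longrightarrow> p \<ominus>\<^bsub>F\<^esub> p' = p - p'"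
proof -
  assume p: "p \<in> carrier F" "p' \<in> carrier F"
  interpret F: ring F by (rule F_ring)
  have "p - p' \<oplus>\<^bsub>F\<^esub> p' = p" by (simp add: F_simps)
  then show ?thesis using p F_diff[OF p] by (metis F.add.m_assoc F.a_inv_closed F.minus_eq F.r_neg F.r_zero)
qed

text \<open>
  An additive subgroup is an ideal if products of its generators with basis elements stay in it.
\<close>

lemma F_ideal:
  assumes K: "K \<subseteq> carrier F"
    and l: "\<And>k D. k \<in> K \<Longrightarrow> D \<in> X \<Longrightarrow> frag_of D \<otimes>\<^bsub>F\<^esub> k \<in> generate (free_Abelian_group X) K"
    and r: "\<And>k D. k \<in> K \<Longrightarrow> D \<in> X \<Longrightarrow> k \<otimes>\<^bsub>F\<^esub> frag_of D \<in> generate (free_Abelian_group X) K"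
  shows "ideal (generate (free_Abelian_group X) K) F"
proof -
  let ?A = "free_Abelian_group X" let ?I = "generate ?A K"
  interpret A: group ?A by simp
  have KA: "K \<subseteq> carrier ?A" using K by (simp add: frag_ring_def)
  have sub: "subgroup ?I ?A" by (rule A.generate_is_subgroup[OF KA])
  have carr: "x \<in> carrier F" if "x \<in> ?I" for x
    using subgroup.mem_carrier[OF sub that] by (simp add: frag_ring_def)
  have zero: "0 \<in> ?I" using subgroup.one_closed[OF sub] by simp
  have add: "x + x' \<in> ?I" if "x \<in> ?I" "x' \<in> ?I" for x x'
    using subgroup.m_closed[OF sub that] by simp
  have neg: "- x \<in> ?I" if "x \<in> ?I" for x
    using subgroup.m_inv_closed[OF sub that] carr[OF that] by (simp add: F_carrier)
  have diff: "x - x' \<in> ?I" if "x \<in> ?I" "x' \<in> ?I" for x x'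
    using add[OF that(1) neg[OF that(2)]] by simp
  have invK: "inv\<^bsub>?A\<^esub> k = 0 - k" if "k \<in> K" for k
    using subsetD[OF K that] by (simp add: F_carrier)
  have l': "frag_of D \<otimes>\<^bsub>F\<^esub> x \<in> ?I" and r': "x \<otimes>\<^bsub>F\<^esub> frag_of D \<in> ?I" if "D \<in> X" "x \<in> ?I" for D x
  proof -
    from that(2) have "frag_of D \<otimes>\<^bsub>F\<^esub> x \<in> ?I \<and> x \<otimes>\<^bsub>F\<^esub> frag_of D \<in> ?I"
    proof (induction x rule: generate.induct)
      case one
      show ?case by (simp add: F_mult_zero zero)
    next
      case (incl k)
      show ?case using l[OF incl that(1)] r[OF incl that(1)] by simp
    next
      case (inv k)
      show ?case using diff[OF zero l[OF inv that(1)]] diff[OF zero r[OF inv that(1)]]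
        unfolding invK[OF inv] F_mult_diff F_mult_zero by simp
    next
      case (eng x x')
      then show ?case by (simp add: F_mult_add add)
    qed
    then show "frag_of D \<otimes>\<^bsub>F\<^esub> x \<in> ?I" "x \<otimes>\<^bsub>F\<^esub> frag_of D \<in> ?I" by simp_all
  qed
  show ?thesis
  proof (rule idealI[OF F_ring])
    show "subgroup ?I (add_monoid F)" unfolding F_add_monoid by (rule sub)
    fix x p assume x: "x \<in> ?I" and p: "p \<in> carrier F"
    from p show "p \<otimes>\<^bsub>F\<^esub> x \<in> ?I"
      by (induction p rule: F_induct) (simp_all add: F_mult_zero F_mult_diff zero diff l'[OF _ x])
    from p show "x \<otimes>\<^bsub>F\<^esub> p \<in> ?I"
      by (induction p rule: F_induct) (simp_all add: F_mult_zero F_mult_diff zero diff r'[OF _ x])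
  qed
qed

end

section \<open>The monoid of isomorphism classes\<close>

context nilpotent_group_datum
begin

text \<open>
  Index sets of natural numbers suffice, so an induction on the dimension may stay within a single type
  of representations.
\<close>

lemma nat_indexed_rep:
  fixes R :: "('a, 'i, 'k) crep"
  assumes R: "is_rep R"
  shows "\<exists>R' :: ('a, nat, 'k) crep. is_rep R' \<and> rep_iso R' R \<and> (yact_trivial R \<longrightarrow> yact_trivial R')"
proof -
  have S: "stable_subspace R (fsp (idx R))"
    unfolding stable_subspace_def
    by (intro conjI ballI allI subset_refl fsp_zero fsp_add fsp_scale is_rep_closed(1,2)[OF R]; assumption)
  obtain R' :: "('a, nat, 'k) crep" and \<kappa> where R': "is_rep R'" and \<kappa>: "rep_hom R' R \<kappa>"
    and inj: "inj_on \<kappa> (fsp (idx R'))" and im: "\<kappa> ` fsp (idx R') = fsp (idx R)"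
    by (rule subrepresentationE[OF R S])
  have "rep_iso R' R"
    unfolding rep_iso_def
    by (intro exI[of _ \<kappa>] conjI ballI rep_homD[OF \<kappa>] bij_betw_imageI[OF inj im]; assumption)
  with R' rep_hom_trivial[OF R' \<kappa> inj] show ?thesis by (intro exI[of _ R']) simp
qed

lemma rep_class_in_iso_classes:
  assumes "is_rep R" shows "rep_class R \<in> iso_classes H"
proof -
  obtain N where "N \<in> rep_class R" using rep_class_nonempty[OF assms] by (rule exE)
  then have N: "has_rep N R" by (simp add: rep_class_def)
  show ?thesis
    unfolding iso_classes_def iso_class_has_rep[OF N, symmetric] using has_rep_amodule[OF N] by simp
qed

lemma iso_classesE:
  assumes "C \<in> iso_classes H"
  obtains R :: "('a, nat, 'k) crep" where "is_rep R" "C = rep_class R"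
proof -
  obtain M :: "('k, nat \<times> 'a \<Rightarrow> 'k, 'k vec) amod" where M: "amodule H M" "C = iso_class H M"
    using assms unfolding iso_classes_def by (elim imageE CollectE)
  obtain R0 :: "('a, 'k vec, 'k) crep" where R0: "has_rep M R0" using amodule_has_rep[OF M(1)] by (rule exE)
  obtain R :: "('a, nat, 'k) crep" where R: "is_rep R" "rep_iso R R0"
    using nat_indexed_rep[OF has_rep_is_rep[OF R0]] by (elim exE conjE)
  have "C = rep_class R"
    unfolding M(2) iso_class_has_rep[OF R0] by (rule rep_class_iso[OF R(1) has_rep_is_rep[OF R0] R(2), symmetric])
  with R(1) show thesis by (rule that)
qed

text \<open>
  The union that defines the product of classes runs over nonempty sets, and all its members are
  equal.
\<close>

lemma class_tensor_rep_class:
  assumes R: "is_rep R" and R': "is_rep R'"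
  shows "class_tensor G \<chi> g n (rep_class R) (rep_class R') = rep_class (rtensor R R')"
proof -
  have c: "iso_class H (H_tensor G \<chi> g n M N) = rep_class (rtensor R R')"
    if "M \<in> rep_class R" "N \<in> rep_class R'" for M N
    using that by (intro iso_class_has_rep[OF has_rep_H_tensor]) (simp_all add: rep_class_def)
  obtain M N where "M \<in> rep_class R" "N \<in> rep_class R'"
    using rep_class_nonempty[OF R] rep_class_nonempty[OF R'] by (elim exE)
  then show ?thesis unfolding class_tensor_def using c by auto
qed

abbreviation runit :: "('a, unit, 'k) crep" where "runit \<equiv> rchar (\<lambda>_. 1)"

lemma iso_classes_monoid: "class_monoid (iso_classes H) (class_tensor G \<chi> g n) (rep_class runit)"
proof
  show "rep_class runit \<in> iso_classes H" by (rule rep_class_in_iso_classes[OF is_rep_runit])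
  fix C assume "C \<in> iso_classes H"
  then obtain R :: "('a, nat, 'k) crep" where R: "is_rep R" "C = rep_class R" by (rule iso_classesE)
  show "class_tensor G \<chi> g n (rep_class runit) C = C"
    unfolding R(2) class_tensor_rep_class[OF is_rep_runit R(1)]
    by (rule rep_class_iso[OF is_rep_rtensor[OF is_rep_runit R(1)] R(1) rtensor_unit_left])
  show "class_tensor G \<chi> g n C (rep_class runit) = C"
    unfolding R(2) class_tensor_rep_class[OF R(1) is_rep_runit]
    by (rule rep_class_iso[OF is_rep_rtensor[OF R(1) is_rep_runit] R(1) rtensor_unit_right])
  fix D assume "D \<in> iso_classes H"
  then obtain R' :: "('a, nat, 'k) crep" where R': "is_rep R'" "D = rep_class R'" by (rule iso_classesE)
  note RR' = is_rep_rtensor[OF R(1) R'(1)]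
  show "class_tensor G \<chi> g n C D \<in> iso_classes H"
    unfolding R(2) R'(2) class_tensor_rep_class[OF R(1) R'(1)] by (rule rep_class_in_iso_classes[OF RR'])
  fix E assume "E \<in> iso_classes H"
  then obtain R'' :: "('a, nat, 'k) crep" where R'': "is_rep R''" "E = rep_class R''" by (rule iso_classesE)
  note R'R'' = is_rep_rtensor[OF R'(1) R''(1)]
  show "class_tensor G \<chi> g n (class_tensor G \<chi> g n C D) E = class_tensor G \<chi> g n C (class_tensor G \<chi> g n D E)"
    unfolding R(2) R'(2) R''(2) class_tensor_rep_class[OF R(1) R'(1)] class_tensor_rep_class[OF R'(1) R''(1)]
      class_tensor_rep_class[OF RR' R''(1)] class_tensor_rep_class[OF R(1) R'R'']
    by (rule rep_class_iso[OF is_rep_rtensor[OF RR' R''(1)] is_rep_rtensor[OF R(1) R'R'']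
          rtensor_assoc])
qed

lemma green_free_eq: "green_free G \<chi> g n = frag_ring (iso_classes H) (class_tensor G \<chi> g n) (rep_class runit)"
proof -
  have "has_rep (inflate G n (char_module G (\<lambda>_. 1))) runit"
    by (rule has_rep_inflate[OF has_group_rep_char_module]) simp_all
  then show ?thesis unfolding green_free_def frag_ring_def by (simp only: iso_class_has_rep)
qed

end

section \<open>The Green ring\<close>

text \<open>
  Centralisers are subrings: what commutes with the generators commutes with the generated ring. This
  is used once for a generator and once for an arbitrary element.
\<close>

lemma (in ring) generate_ring_commute:
  assumes K: "K \<subseteq> carrier R" and comm: "\<And>x y. x \<in> K \<Longrightarrow> y \<in> K \<Longrightarrow> x \<otimes> y = y \<otimes> x"
    and x: "x \<in> generate_ring R K" and y: "y \<in> generate_ring R K"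
  shows "x \<otimes> y = y \<otimes> x"
proof -
  note carr = generate_ring_in_carrier[OF K]
  have step: "u \<otimes> z = z \<otimes> u" if u: "u \<in> carrier R" and uK: "\<And>k. k \<in> K \<Longrightarrow> u \<otimes> k = k \<otimes> u"
    and z: "z \<in> generate_ring R K" for u z
    using z
  proof (induction z rule: generate_ring.induct)
    case one
    show ?case using u by simp
  next
    case (incl k)
    show ?case by (rule uK[OF incl])
  next
    case (a_inv z)
    then show ?case using u carr[OF a_inv.hyps] by (simp add: r_minus l_minus)
  next
    case (eng_add z1 z2)
    then show ?case using u carr[OF eng_add.hyps(1)] carr[OF eng_add.hyps(2)] by (simp add: r_distr l_distr)
  next
    case (eng_mult z1 z2)
    have z: "z1 \<in> carrier R" "z2 \<in> carrier R" using carr eng_mult.hyps by simp_all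
    have "u \<otimes> (z1 \<otimes> z2) = (z1 \<otimes> u) \<otimes> z2" using u z eng_mult.IH(1) by (simp add: m_assoc[symmetric])
    also have "\<dots> = (z1 \<otimes> z2) \<otimes> u" using u z eng_mult.IH(2) by (simp add: m_assoc)
    finally show ?case .
  qed
  have "k \<otimes> x = x \<otimes> k" if "k \<in> K" for k
    by (rule step[OF subsetD[OF K that] comm[OF that] x])
  then show ?thesis using step[OF carr[OF x] _ y] by simp
qed

lemma (in ring) eq_minus_of_add:
  assumes "z = x \<oplus> y" "x \<in> carrier R" "y \<in> carrier R"
  shows "x = z \<ominus> y"
  using assms by (simp add: a_minus_def a_assoc r_neg)

context nilpotent_group_datum
begin

lemma rsum_relation:
  assumes R: "is_rep R" and R': "is_rep R'"
  shows "frag_of (rep_class (rsum R R')) - frag_of (rep_class R) - frag_of (rep_class R') \<in>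
    {frag_of (iso_class H (amod_sum M N)) - frag_of (iso_class H M) - frag_of (iso_class H N)
       | (M :: ('k, nat \<times> 'a \<Rightarrow> 'k, 'k vec) amod) (N :: ('k, nat \<times> 'a \<Rightarrow> 'k, 'k vec) amod).
       amodule H M \<and> amodule H N}"
proof -
  obtain M N where "M \<in> rep_class R" "N \<in> rep_class R'"
    using rep_class_nonempty[OF R] rep_class_nonempty[OF R'] by (elim exE)
  then have M: "has_rep M R" and N: "has_rep N R'" by (simp_all add: rep_class_def)
  have "frag_of (rep_class (rsum R R')) - frag_of (rep_class R) - frag_of (rep_class R') =
      frag_of (iso_class H (amod_sum M N)) - frag_of (iso_class H M) - frag_of (iso_class H N)"
    by (simp only: iso_class_has_rep[OF M] iso_class_has_rep[OF N] iso_class_has_rep[OF has_rep_amod_sum[OF M N]])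
  with has_rep_amodule[OF M] has_rep_amodule[OF N] show ?thesis
    by (intro CollectI exI[of _ M] exI[of _ N] conjI)
qed

text \<open>
  Distributivity of the tensor product over direct sums turns the product of a relation with a class
  into another relation.
\<close>

lemma green_relations_ideal: "ideal (green_relations H) (green_free G \<chi> g n)"
  and rsum_green_relation: "\<lbrakk>is_rep R; is_rep R'\<rbrakk> \<Longrightarrow>
    frag_of (rep_class (rsum R R')) - frag_of (rep_class R) - frag_of (rep_class R') \<in> green_relations H"
proof -
  interpret C: class_monoid "iso_classes H" "class_tensor G \<chi> g n" "rep_class runit"
    by (rule iso_classes_monoid)
  define K where "K = {frag_of (iso_class H (amod_sum M N)) - frag_of (iso_class H M) - frag_of (iso_class H N)
       | (M :: ('k, nat \<times> 'a \<Rightarrow> 'k, 'k vec) amod) (N :: ('k, nat \<times> 'a \<Rightarrow> 'k, 'k vec) amod).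
       amodule H M \<and> amodule H N}"
  have I: "green_relations H = generate (free_Abelian_group (iso_classes H)) K"
    by (simp only: green_relations_def K_def)
  have rel: "frag_of (rep_class (rsum R R')) - frag_of (rep_class R) - frag_of (rep_class R') \<in> green_relations H"
    if "is_rep R" "is_rep R'" for R :: "('a, 'p, 'k) crep" and R' :: "('a, 'q, 'k) crep"
    unfolding I by (rule generate.incl) (unfold K_def, rule rsum_relation[OF that])
  show "\<lbrakk>is_rep R; is_rep R'\<rbrakk> \<Longrightarrow>
    frag_of (rep_class (rsum R R')) - frag_of (rep_class R) - frag_of (rep_class R') \<in> green_relations H"
    by (rule rel)
  have K: "\<exists>(R :: ('a, 'k vec, 'k) crep) (R' :: ('a, 'k vec, 'k) crep). is_rep R \<and> is_rep R' \<and>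
      k = frag_of (rep_class (rsum R R')) - frag_of (rep_class R) - frag_of (rep_class R')" if k: "k \<in> K" for k
  proof -
    obtain M N :: "('k, nat \<times> 'a \<Rightarrow> 'k, 'k vec) amod" where MN: "amodule H M" "amodule H N"
      "k = frag_of (iso_class H (amod_sum M N)) - frag_of (iso_class H M) - frag_of (iso_class H N)"
      using k unfolding K_def by (elim CollectE exE conjE)
    obtain R R' :: "('a, 'k vec, 'k) crep" where R: "has_rep M R" and R': "has_rep N R'"
      using amodule_has_rep[OF MN(1)] amodule_has_rep[OF MN(2)] by (elim exE)
    show ?thesis
      unfolding MN(3) iso_class_has_rep[OF R] iso_class_has_rep[OF R'] iso_class_has_rep[OF has_rep_amod_sum[OF R R']]
      by (intro exI[of _ R] exI[of _ R'] conjI refl has_rep_is_rep[OF R] has_rep_is_rep[OF R'])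
  qed
  show "ideal (green_relations H) (green_free G \<chi> g n)"
    unfolding I green_free_eq
  proof (rule C.F_ideal)
    show "K \<subseteq> carrier C.F"
    proof
      fix k assume "k \<in> K"
      from K[OF this] obtain R R' :: "('a, 'k vec, 'k) crep" where R: "is_rep R" "is_rep R'"
        "k = frag_of (rep_class (rsum R R')) - frag_of (rep_class R) - frag_of (rep_class R')" by (elim exE conjE)
      show "k \<in> carrier C.F"
        unfolding R(3) by (intro C.F_diff C.F_of rep_class_in_iso_classes is_rep_rsum R(1,2))
    qed
    fix k D assume "k \<in> K" and "D \<in> iso_classes H"
    from K[OF this(1)] obtain R R' :: "('a, 'k vec, 'k) crep" where R: "is_rep R" "is_rep R'"
      and k: "k = frag_of (rep_class (rsum R R')) - frag_of (rep_class R) - frag_of (rep_class R')" by (elim exE conjE)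
    from \<open>D \<in> iso_classes H\<close> obtain Q :: "('a, nat, 'k) crep" where Q: "is_rep Q" "D = rep_class Q"
      by (rule iso_classesE)
    note T = is_rep_rtensor[OF R(1) Q(1)] is_rep_rtensor[OF R(2) Q(1)]
      is_rep_rtensor[OF Q(1) R(1)] is_rep_rtensor[OF Q(1) R(2)]
    note RR = is_rep_rsum[OF R]
    have "rep_class (rtensor (rsum R R') Q) = rep_class (rsum (rtensor R Q) (rtensor R' Q))"
      by (rule rep_class_iso[OF is_rep_rtensor[OF RR Q(1)] is_rep_rsum[OF T(1,2)] rtensor_rsum_distrib_right])
    then show "k \<otimes>\<^bsub>C.F\<^esub> frag_of D \<in> generate (free_Abelian_group (iso_classes H)) K"
      unfolding I[symmetric] k Q(2) C.F_mult_diff C.F_mult_of class_tensor_rep_class[OF RR Q(1)]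
        class_tensor_rep_class[OF R(1) Q(1)] class_tensor_rep_class[OF R(2) Q(1)]
      using rel[OF T(1,2)] by simp
    have "rep_class (rtensor Q (rsum R R')) = rep_class (rsum (rtensor Q R) (rtensor Q R'))"
      by (rule rep_class_iso[OF is_rep_rtensor[OF Q(1) RR] is_rep_rsum[OF T(3,4)] rtensor_rsum_distrib_left])
    then show "frag_of D \<otimes>\<^bsub>C.F\<^esub> k \<in> generate (free_Abelian_group (iso_classes H)) K"
      unfolding I[symmetric] k Q(2) C.F_mult_diff C.F_mult_of class_tensor_rep_class[OF Q(1) RR]
        class_tensor_rep_class[OF Q(1) R(1)] class_tensor_rep_class[OF Q(1) R(2)]
      using rel[OF T(3,4)] by simp
  qed
qed

abbreviation GR :: "(('k, nat \<times> 'a \<Rightarrow> 'k, 'k vec) amod set \<Rightarrow>\<^sub>0 int) set ring" where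
  "GR \<equiv> green_ring G \<chi> g n"

definition rep_green :: "('a, 'i, 'k) crep \<Rightarrow> (('k, nat \<times> 'a \<Rightarrow> 'k, 'k vec) amod set \<Rightarrow>\<^sub>0 int) set" where
  "rep_green R = green_relations H +>\<^bsub>green_free G \<chi> g n\<^esub> frag_of (rep_class R)"

lemma green_ring_ring: "ring GR"
  unfolding green_ring_def by (rule ideal.quotient_is_ring[OF green_relations_ideal])

lemma green_class_has_rep: "has_rep M R \<Longrightarrow> green_class G \<chi> g n M = rep_green R"
  by (simp only: green_class_def rep_green_def iso_class_has_rep)

lemma rep_green_iso: "is_rep R \<Longrightarrow> is_rep R' \<Longrightarrow> rep_iso R R' \<Longrightarrow> rep_green R = rep_green R'"
  by (simp only: rep_green_def rep_class_iso[of R R'])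

lemma green_hom: "a_r_coset (green_free G \<chi> g n) (green_relations H) \<in> Ring.ring_hom (green_free G \<chi> g n) GR"
  unfolding green_ring_def by (rule ideal.rcos_ring_hom[OF green_relations_ideal])

lemma rep_class_in_green_free: "is_rep R \<Longrightarrow> frag_of (rep_class R) \<in> carrier (green_free G \<chi> g n)"
  unfolding green_free_eq by (rule class_monoid.F_of[OF iso_classes_monoid rep_class_in_iso_classes])

lemma rep_green_closed: "is_rep R \<Longrightarrow> rep_green R \<in> carrier GR"
  unfolding rep_green_def by (rule ring_hom_closed[OF green_hom rep_class_in_green_free])

lemma rep_green_unit: "rep_green runit = \<one>\<^bsub>GR\<^esub>"
  using ring_hom_one[OF green_hom] unfolding rep_green_def green_free_eq
    class_monoid.F_simps(3)[OF iso_classes_monoid] .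

lemma rep_green_tensor:
  assumes R: "is_rep R" and R': "is_rep R'"
  shows "rep_green (rtensor R R') = rep_green R \<otimes>\<^bsub>GR\<^esub> rep_green R'"
proof -
  have "frag_of (rep_class (rtensor R R')) = frag_of (rep_class R) \<otimes>\<^bsub>green_free G \<chi> g n\<^esub> frag_of (rep_class R')"
    unfolding green_free_eq class_monoid.F_mult_of[OF iso_classes_monoid] class_tensor_rep_class[OF R R'] ..
  then show ?thesis unfolding rep_green_def
    by (simp only: ring_hom_mult[OF green_hom rep_class_in_green_free[OF R] rep_class_in_green_free[OF R']])
qed

lemma rep_green_sum:
  assumes R: "is_rep R" and R': "is_rep R'"
  shows "rep_green (rsum R R') = rep_green R \<oplus>\<^bsub>GR\<^esub> rep_green R'"
proof -
  let ?F = "green_free G \<chi> g n"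
  interpret I: ideal "green_relations H" ?F by (rule green_relations_ideal)
  let ?s = "frag_of (rep_class (rsum R R'))" and ?x = "frag_of (rep_class R)" and ?x' = "frag_of (rep_class R')"
  have carr: "?x \<in> carrier ?F" "?x' \<in> carrier ?F" "?s \<in> carrier ?F"
    by (rule rep_class_in_green_free R R' is_rep_rsum)+
  have plus: "?x \<oplus>\<^bsub>?F\<^esub> ?x' = ?x + ?x'" unfolding green_free_eq by (rule class_monoid.F_simps(1)[OF iso_classes_monoid])
  have "?s \<ominus>\<^bsub>?F\<^esub> (?x \<oplus>\<^bsub>?F\<^esub> ?x') = ?s - (?x + ?x')"
    using carr I.add.m_closed[OF carr(1,2)] unfolding plus unfolding green_free_eq
    by (intro class_monoid.F_minus[OF iso_classes_monoid])
  also have "\<dots> \<in> green_relations H" using rsum_green_relation[OF R R'] by (simp add: diff_diff_eq)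
  finally have "green_relations H +>\<^bsub>?F\<^esub> ?s = green_relations H +>\<^bsub>?F\<^esub> (?x \<oplus>\<^bsub>?F\<^esub> ?x')"
    using I.quotient_eq_iff_same_a_r_cos[OF I.is_ideal carr(3) I.add.m_closed[OF carr(1,2)]] by simp
  then show ?thesis unfolding rep_green_def ring_hom_add[OF green_hom carr(1,2)] .
qed

lemma fsp_empty: "f \<in> fsp {} \<Longrightarrow> (\<lambda>_. 0) = f"
  by (rule ext) (simp add: fspD)

text \<open>
  For the zero representation \<open>R \<oplus> R \<cong> R\<close>, so its class is idempotent under addition.
\<close>

lemma rep_green_zero:
  fixes R :: "('a, 'i, 'k) crep"
  assumes R: "is_rep R" and e: "idx R = {}"
  shows "rep_green R = \<zero>\<^bsub>GR\<^esub>"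
proof -
  interpret GR: ring GR by (rule green_ring_ring)
  have e': "idx (rsum R R) = {}" by (simp add: rsum_simps e)
  have "rep_iso (rsum R R) R"
  proof (rule rep_isoI[where F = "\<lambda>_ _. 0" and E = "\<lambda>_ _. 0"])
    show "lin_on (idx (rsum R R)) (idx R) (\<lambda>_ _. 0)" by (rule lin_on_null)
    show "(\<lambda>_. 0) \<in> fsp (idx (rsum R R))" by (rule fsp_zero)
    show "(\<lambda>_. 0) = f" if "f \<in> fsp (idx (rsum R R))" for f using that unfolding e' by (rule fsp_empty)
    show "(\<lambda>_. 0) = f" if "f \<in> fsp (idx R)" for f using that unfolding e by (rule fsp_empty)
    show "(\<lambda>_. 0) = gact R h (\<lambda>_. 0)" if "h \<in> carrier G" for h using lin_on_zero[OF is_repD(2)[OF R that]] by simp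
    show "(\<lambda>_. 0) = yact R (\<lambda>_. 0)" using lin_on_zero[OF is_repD(3)[OF R]] by simp
  qed
  then have "rep_green R \<oplus>\<^bsub>GR\<^esub> rep_green R = rep_green R"
    using rep_green_sum[OF R R] rep_green_iso[OF is_rep_rsum[OF R R] R] by simp
  then show ?thesis using GR.add.r_cancel_one'[OF rep_green_closed[OF R] rep_green_closed[OF R]] by simp
qed

lemma green_ring_generated_by_reps:
  assumes T: "subring T GR" and gen: "\<And>R :: ('a, nat, 'k) crep. is_rep R \<Longrightarrow> rep_green R \<in> T"
  shows "carrier GR \<subseteq> T"
proof
  let ?F = "green_free G \<chi> g n" and ?\<pi> = "a_r_coset (green_free G \<chi> g n) (green_relations H)"
  interpret I: ideal "green_relations H" ?F by (rule green_relations_ideal)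
  interpret GR: ring GR by (rule green_ring_ring)
  fix x assume "x \<in> carrier GR"
  then obtain p where p: "p \<in> carrier ?F" "x = ?\<pi> p"
    unfolding green_ring_def FactRing_simps by (auto simp: FactRing_def A_RCOSETS_def')
  have z0: "?\<pi> 0 = \<zero>\<^bsub>GR\<^esub>"
    using ring_hom_zero[OF green_hom I.ring_axioms green_ring_ring]
    unfolding green_free_eq class_monoid.F_simps(2)[OF iso_classes_monoid] .
  from p(1) have "?\<pi> p \<in> T"
    unfolding green_free_eq
  proof (induction p rule: class_monoid.F_induct[OF iso_classes_monoid, consumes 1, case_names zero basis diff])
    case zero
    show ?case using z0[unfolded green_free_eq] subringE(2)[OF T] by simp
  next
    case (basis C)
    then obtain R :: "('a, nat, 'k) crep" where R: "is_rep R" "C = rep_class R" by (rule iso_classesE)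
    show ?case using gen[OF R(1)] unfolding rep_green_def R(2) green_free_eq .
  next
    case (diff p p')
    have c: "p \<in> carrier ?F" "p' \<in> carrier ?F" using diff(1,2) unfolding green_free_eq by simp_all
    have d: "p - p' \<in> carrier ?F"
      using class_monoid.F_diff[OF iso_classes_monoid diff(1,2)] unfolding green_free_eq .
    have "p - p' \<oplus>\<^bsub>?F\<^esub> p' = p"
      unfolding green_free_eq class_monoid.F_simps(1)[OF iso_classes_monoid] by simp
    then have "?\<pi> p = ?\<pi> (p - p') \<oplus>\<^bsub>GR\<^esub> ?\<pi> p'"
      using ring_hom_add[OF green_hom d c(2)] by simp
    note eq = GR.eq_minus_of_add[OF this ring_hom_closed[OF green_hom d] ring_hom_closed[OF green_hom c(2)],
        unfolded green_free_eq]
    show ?case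
      unfolding eq using diff(3,4) subringE(7)[OF T _ subringE(5)[OF T]] unfolding a_minus_def by simp
  qed
  then show "x \<in> T" unfolding p(2) .
qed

end

section \<open>Relations and generators of the Green ring\<close>

context nilpotent_group_datum
begin

text \<open>
  Applied to the trivial character, this shows that the trivial module occurs among the simple modules.
\<close>

lemma one_dim_irreducible:
  assumes "stable_subspace (rchar \<psi>) S"
  shows "S = {\<lambda>_. 0} \<or> S = fsp (idx (rchar \<psi>))"
proof (rule disjCI)
  assume "S \<noteq> fsp (idx (rchar \<psi>))"
  show "S = {\<lambda>_. 0}"
  proof (rule ccontr)
    assume "S \<noteq> {\<lambda>_. 0}"
    then obtain f :: "unit \<Rightarrow> 'k" where f: "f \<in> S" "f \<noteq> (\<lambda>_. 0)" using stable_subspaceD(2)[OF assms] by blast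
    have f0: "f () \<noteq> 0" using f(2) by (auto simp: fun_eq_iff)
    have "f' \<in> S" for f' :: "unit \<Rightarrow> 'k"
    proof -
      have "f' = (\<lambda>b. (f' () / f ()) * f b)" using f0 by (simp add: fun_eq_iff)
      with stable_subspaceD(4)[OF assms f(1), of "f' () / f ()"] show ?thesis by simp
    qed
    then show False using \<open>S \<noteq> fsp (idx (rchar \<psi>))\<close> stable_subspaceD(1)[OF assms] by blast
  qed
qed

lemma rep_green_chain_product:
  assumes j: "0 < j" "j < n"
  shows "rep_green (rchain 2) \<otimes>\<^bsub>GR\<^esub> rep_green (rchain j) =
    rep_green (rchain (Suc j)) \<oplus>\<^bsub>GR\<^esub> rep_green rchi_inv \<otimes>\<^bsub>GR\<^esub> rep_green (rchain (j - 1))"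
proof -
  have reps: "is_rep (rchain 2)" "is_rep (rchain j)" "is_rep (rchain (Suc j))" "is_rep (rchain (j - 1))"
    using j n_ge_2 by (simp_all add: is_rep_rchain)
  note T = is_rep_rtensor[OF is_rep_rchi_inv reps(4)]
  show ?thesis
    unfolding rep_green_tensor[OF reps(1,2), symmetric] rep_green_tensor[OF is_rep_rchi_inv reps(4), symmetric]
      rep_green_sum[OF reps(3) T, symmetric]
    by (rule rep_green_iso[OF is_rep_rsum[OF reps(3) T] is_rep_rtensor[OF reps(1,2)] chain_product[OF j], symmetric])
qed

lemma rep_green_top_product:
  "rep_green (rchain 2) \<otimes>\<^bsub>GR\<^esub> rep_green (rchain n) =
    (\<one>\<^bsub>GR\<^esub> \<oplus>\<^bsub>GR\<^esub> rep_green rchi_inv) \<otimes>\<^bsub>GR\<^esub> rep_green (rchain n)"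
proof -
  interpret GR: ring GR by (rule green_ring_ring)
  have reps: "is_rep (rchain 2)" "is_rep (rchain n)" using n_ge_2 by (simp_all add: is_rep_rchain)
  note T = is_rep_rtensor[OF is_rep_rchi_inv reps(2)]
  have "rep_green (rchain 2) \<otimes>\<^bsub>GR\<^esub> rep_green (rchain n) =
      rep_green (rchain n) \<oplus>\<^bsub>GR\<^esub> rep_green rchi_inv \<otimes>\<^bsub>GR\<^esub> rep_green (rchain n)"
    unfolding rep_green_tensor[OF reps, symmetric] rep_green_tensor[OF is_rep_rchi_inv reps(2), symmetric]
      rep_green_sum[OF reps(2) T, symmetric]
    by (rule rep_green_iso[OF is_rep_rsum[OF reps(2) T] is_rep_rtensor[OF reps] top_chain_product, symmetric])
  then show ?thesis
    using rep_green_closed[OF reps(2)] rep_green_closed[OF is_rep_rchi_inv] by (simp add: GR.l_distr)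
qed

text \<open>
  For the rest of the block, \<open>T\<close> is a subring that contains the classes of the irreducible
  representations of \<open>G\<close> and of the chain of length \<open>2\<close>; it turns out to contain all classes.
\<close>

context
  fixes T
  assumes T: "subring T GR" and ord: "of_nat (card (carrier G)) \<noteq> (0 :: 'k)"
    and irr_T: "\<And>U :: ('a, nat, 'k) crep. \<lbrakk>is_rep U; yact_trivial U; idx U \<noteq> {};
      \<And>S. stable_subspace U S \<Longrightarrow> S = {\<lambda>_. 0} \<or> S = fsp (idx U)\<rbrakk> \<Longrightarrow> rep_green U \<in> T"
    and two_T: "rep_green (rchain 2) \<in> T"
begin

text \<open>
  Induction on the dimension: a reducible representation splits into two smaller ones.
\<close>

lemma group_rep_in_subring:
  fixes U :: "('a, nat, 'k) crep"
  assumes "is_rep U" "yact_trivial U"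
  shows "rep_green U \<in> T"
  using assms
proof (induction "card (idx U)" arbitrary: U rule: less_induct)
  case less
  note U = less.prems
  show ?case
  proof (cases "idx U = {}")
    case True
    show ?thesis unfolding rep_green_zero[OF U(1) True] by (rule subringE(2)[OF T])
  next
    case ne: False
    show ?thesis
    proof (cases "\<forall>S. stable_subspace U S \<longrightarrow> S = {\<lambda>_. 0} \<or> S = fsp (idx U)")
      case True
      show ?thesis by (rule irr_T[OF U ne True[rule_format]])
    next
      case False
      then obtain S where S: "stable_subspace U S" "S \<noteq> {\<lambda>_. 0}" "S \<noteq> fsp (idx U)" by blast
      obtain U1 U2 :: "('a, nat, 'k) crep" where U1: "is_rep U1" "yact_trivial U1" "card (idx U1) < card (idx U)"
        and U2: "is_rep U2" "yact_trivial U2" "card (idx U2) < card (idx U)" and iso: "rep_iso (rsum U1 U2) U"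
        using maschke[OF U S(1) ord S(2,3)] by (elim exE conjE)
      have "rep_green U = rep_green U1 \<oplus>\<^bsub>GR\<^esub> rep_green U2"
        unfolding rep_green_sum[OF U1(1) U2(1), symmetric]
        by (rule rep_green_iso[OF is_rep_rsum[OF U1(1) U2(1)] U(1) iso, symmetric])
      then show ?thesis
        using subringE(7)[OF T less.hyps[OF U1(3,1,2)] less.hyps[OF U2(3,1,2)]] by simp
    qed
  qed
qed

lemma chi_inv_in_subring: "rep_green rchi_inv \<in> T"
proof -
  obtain U :: "('a, nat, 'k) crep" where U: "is_rep U" "rep_iso U rchi_inv"
    "yact_trivial rchi_inv \<longrightarrow> yact_trivial U"
    using nat_indexed_rep[OF is_rep_rchi_inv] by (elim exE conjE)
  show ?thesis
    using group_rep_in_subring[OF U(1) U(3)[rule_format, OF yact_trivial_rchar]]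
      rep_green_iso[OF U(1) is_rep_rchi_inv U(2)] by simp
qed

text \<open>
  The product formula for \<open>C(2) \<otimes> C(k)\<close> with \<open>k < n\<close> is solved for the class of \<open>C(k+1)\<close>.
\<close>

lemma chain_in_subring: "j \<le> n \<Longrightarrow> rep_green (rchain j) \<in> T"
proof (induction j rule: less_induct)
  case (less j)
  interpret GR: ring GR by (rule green_ring_ring)
  consider "j = 0" | "j = 1" | k where "j = Suc k" "0 < k" by (cases j) auto
  then show ?case
  proof cases
    case 1
    have "idx (rchain j) = {}" using 1 by (simp add: crep_simps)
    then show ?thesis
      using rep_green_zero[OF is_rep_rchain[OF less.prems]] subringE(2)[OF T] by simp
  next
    case 2
    show ?thesis
      unfolding 2 rep_green_iso[OF is_rep_rchain[OF less.prems[unfolded 2]] is_rep_runit rchain_1] rep_green_unit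
      by (rule subringE(3)[OF T])
  next
    case (3 k)
    let ?a = "rep_green rchi_inv \<otimes>\<^bsub>GR\<^esub> rep_green (rchain (k - 1))"
    have kn: "k < n" using less.prems 3 by simp
    have IH: "rep_green (rchain k) \<in> T" "rep_green (rchain (k - 1)) \<in> T" using less 3 by simp_all
    have a: "?a \<in> T" by (rule subringE(6)[OF T chi_inv_in_subring IH(2)])
    have "rep_green (rchain (Suc k)) = rep_green (rchain 2) \<otimes>\<^bsub>GR\<^esub> rep_green (rchain k) \<ominus>\<^bsub>GR\<^esub> ?a"
      by (rule GR.eq_minus_of_add[OF rep_green_chain_product[OF 3(2) kn]
            rep_green_closed[OF is_rep_rchain[OF less.prems[unfolded 3(1)]]] subsetD[OF subringE(1)[OF T] a]])
    then show ?thesis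
      unfolding 3(1) a_minus_def
      using subringE(7)[OF T subringE(6)[OF T two_T IH(1)] subringE(5)[OF T a]] by simp
  qed
qed

text \<open>
  Induction on the dimension, splitting off one summand \<open>U \<otimes> C(j)\<close> at a time.
\<close>

lemma rep_in_subring:
  fixes R :: "('a, nat, 'k) crep"
  assumes "is_rep R"
  shows "rep_green R \<in> T"
  using assms
proof (induction "card (idx R)" arbitrary: R rule: less_induct)
  case less
  note R = less.prems
  show ?case
  proof (cases "idx R = {}")
    case True
    show ?thesis unfolding rep_green_zero[OF R True] by (rule subringE(2)[OF T])
  next
    case False
    obtain U :: "('a, nat, 'k) crep" and j and R' :: "('a, nat, 'k) crep" where
      U: "is_rep U" "yact_trivial U" and j: "j \<le> n" and R': "is_rep R'" "card (idx R') < card (idx R)"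
      and iso: "rep_iso (rsum (rtensor U (rchain j)) R') R"
      using split_off_chain[OF R False ord] by (elim exE conjE)
    note C = is_rep_rchain[OF j]
    note Uj = is_rep_rtensor[OF U(1) C]
    have "rep_green R = rep_green U \<otimes>\<^bsub>GR\<^esub> rep_green (rchain j) \<oplus>\<^bsub>GR\<^esub> rep_green R'"
      unfolding rep_green_tensor[OF U(1) C, symmetric] rep_green_sum[OF Uj R'(1), symmetric]
      by (rule rep_green_iso[OF is_rep_rsum[OF Uj R'(1)] R iso, symmetric])
    then show ?thesis
      using subringE(7)[OF T subringE(6)[OF T group_rep_in_subring[OF U] chain_in_subring[OF j]]
          less.hyps[OF R'(2,1)]] by simp
  qed
qed

end

lemma rep_green_commute_trivial:
  assumes "is_rep U" "yact_trivial U" "is_rep U'" "yact_trivial U'"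
  shows "rep_green U \<otimes>\<^bsub>GR\<^esub> rep_green U' = rep_green U' \<otimes>\<^bsub>GR\<^esub> rep_green U"
  unfolding rep_green_tensor[OF assms(1,3), symmetric] rep_green_tensor[OF assms(3,1), symmetric]
  by (rule rep_green_iso[OF is_rep_rtensor[OF assms(1,3)] is_rep_rtensor[OF assms(3,1)]
        rtensor_commute_trivial[OF assms]])

lemma rep_green_commute_chain:
  assumes "is_rep U" "yact_trivial U" "j \<le> n"
  shows "rep_green U \<otimes>\<^bsub>GR\<^esub> rep_green (rchain j) = rep_green (rchain j) \<otimes>\<^bsub>GR\<^esub> rep_green U"
proof -
  note C = is_rep_rchain[OF assms(3)]
  show ?thesis
    unfolding rep_green_tensor[OF assms(1) C, symmetric] rep_green_tensor[OF C assms(1), symmetric]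
    by (rule rep_green_iso[OF is_rep_rtensor[OF assms(1) C] is_rep_rtensor[OF C assms(1)]
          rtensor_chain_commute[OF assms(1,2)]])
qed

end

theorem proposition4p1:
  fixes G :: "('g, 'x) monoid_scheme"
    and \<chi> :: "'g \<Rightarrow> 'k :: {alg_closed_field, field_char_0}"
    and g :: 'g
    and n m :: nat
    and V :: "nat \<Rightarrow> ('k, 'g \<Rightarrow> 'k, 'v) amod"
    and r :: "(('k, nat \<times> 'g \<Rightarrow> 'k, 'k vec) amod set \<Rightarrow>\<^sub>0 int) set ring"
  assumes datum: "nilpotent_group_datum G \<chi> g n"
    and simples: "complete_simples (group_algebra G) m V"
    and trivial: "amod_iso (group_algebra G) (V 1) (char_module G (\<lambda>_. 1))"
    and r: "r = green_ring G \<chi> g n"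
    and M: "M = (\<lambda>i j. green_class G \<chi> g n (M_module G \<chi> n (V i) j))"
    and S: "S = (\<lambda>i. green_class G \<chi> g n (inflate G n (V i)))"
    and a: "a = green_class G \<chi> g n (inflate G n (char_module G (\<lambda>h. inverse (\<chi> h))))"
  shows "(\<forall>i\<in>{1..m}. \<forall>j\<in>{1..n}.
            M i j = S i \<otimes>\<^bsub>r\<^esub> M 1 j \<and> M i j = M 1 j \<otimes>\<^bsub>r\<^esub> S i)
       \<and> (\<forall>j\<in>{2..n - 1}.
            M 1 2 \<otimes>\<^bsub>r\<^esub> M 1 j = M 1 (j + 1) \<oplus>\<^bsub>r\<^esub> a \<otimes>\<^bsub>r\<^esub> M 1 (j - 1) \<and>
            M 1 j \<otimes>\<^bsub>r\<^esub> M 1 2 = M 1 (j + 1) \<oplus>\<^bsub>r\<^esub> a \<otimes>\<^bsub>r\<^esub> M 1 (j - 1))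
       \<and> (M 1 2 \<otimes>\<^bsub>r\<^esub> M 1 n = (\<one>\<^bsub>r\<^esub> \<oplus>\<^bsub>r\<^esub> a) \<otimes>\<^bsub>r\<^esub> M 1 n \<and>
          M 1 n \<otimes>\<^bsub>r\<^esub> M 1 2 = (\<one>\<^bsub>r\<^esub> \<oplus>\<^bsub>r\<^esub> a) \<otimes>\<^bsub>r\<^esub> M 1 n)
       \<and> cring r
       \<and> generate_ring r (S ` {1..m} \<union> {M 1 2}) = carrier r"
proof -
  interpret D: nilpotent_group_datum G \<chi> g n by (rule datum)
  interpret R: ring r unfolding r by (rule D.green_ring_ring)
  let ?A = "group_algebra G :: ('k, 'g \<Rightarrow> 'k) module" and ?gc = "\<lambda>j. D.rep_green (D.rchain j)"
  have ord: "of_nat (card (carrier G)) \<noteq> (0 :: 'k)"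
    using D.finite_G D.one_closed by (auto simp: card_eq_0_iff)
  have modV: "amodule ?A (V i)" if "i \<in> {1..m}" for i
    using simples that unfolding complete_simples_def simple_amodule_def by blast
  have ex: "\<exists>i\<in>{1..m}. D.has_group_rep (V i) U"
    if U: "D.is_rep U" "D.yact_trivial U" "idx U \<noteq> {}"
      and irr: "\<And>S. D.stable_subspace U S \<Longrightarrow> S = {\<lambda>_. 0} \<or> S = fsp (idx U)" for U :: "('g, 'i, 'k) crep"
  proof -
    have "\<exists>W :: ('k, 'g \<Rightarrow> 'k, 'k vec) amod. simple_amodule ?A W \<and> D.has_group_rep W U"
      by (rule D.irreducible_simple_module[OF U]) (rule irr)
    then obtain W :: "('k, 'g \<Rightarrow> 'k, 'k vec) amod" where W: "simple_amodule ?A W" "D.has_group_rep W U"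
      by (elim exE conjE)
    obtain i where i: "i \<in> {1..m}" "amod_iso ?A (V i) W"
      using simples W(1) unfolding complete_simples_def by blast
    show ?thesis using D.amod_iso_has_group_rep[OF modV[OF i(1)] i(2) W(2)] i(1) by (intro bexI[of _ i])
  qed
  \<comment> \<open>The list of simple modules is nonempty, so \<open>V 1\<close> is one of its members.\<close>
  have "\<exists>i\<in>{1..m}. D.has_group_rep (V i) D.runit"
    by (rule ex[OF D.is_rep_runit D.yact_trivial_rchar])
      (simp add: D.crep_simps, rule D.one_dim_irreducible)
  then have one_m: "1 \<in> {1..m}" by auto
  have V1: "D.has_group_rep (V 1) D.runit"
    by (rule D.amod_iso_has_group_rep[OF modV[OF one_m] trivial D.has_group_rep_char_module]) simp_all
  have SU: "S i = D.rep_green U" if "D.has_group_rep (V i) U" for i and U :: "('g, 'i, 'k) crep"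
    unfolding S by (rule D.green_class_has_rep[OF D.has_rep_inflate[OF that]])
  have MU: "M i j = S i \<otimes>\<^bsub>r\<^esub> ?gc j" if U: "D.has_group_rep (V i) U" and j: "j \<le> n" for i j and U :: "('g, 'i, 'k) crep"
    unfolding SU[OF U] r D.rep_green_tensor[OF D.has_group_rep_is_rep[OF U] D.is_rep_rchain[OF j], symmetric]
    unfolding M by (rule D.green_class_has_rep[OF D.has_rep_M_module[OF U j]])
  have gc: "?gc j \<in> carrier r" if "j \<le> n" for j
    unfolding r by (rule D.rep_green_closed[OF D.is_rep_rchain[OF that]])
  have S1: "S 1 = \<one>\<^bsub>r\<^esub>" unfolding SU[OF V1] r by (rule D.rep_green_unit)
  have M1: "M 1 j = ?gc j" if "j \<le> n" for j
    unfolding MU[OF V1 that] S1 using gc[OF that] by simp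
  have a_rep: "a = D.rep_green D.rchi_inv"
    unfolding a by (rule D.green_class_has_rep[OF D.has_rep_inflate[OF D.has_group_rep_char_module]])
      (simp_all add: D.chi_one D.chi_mult)
  have reps: "\<exists>U :: ('g, 'v, 'k) crep. D.has_group_rep (V i) U" if "i \<in> {1..m}" for i
    by (rule D.amodule_has_group_rep[OF modV[OF that]])
  define X where "X = S ` {1..m} \<union> {M 1 2}"
  \<comment> \<open>The generators are classes of inflated representations of \<open>G\<close>, and the class of the chain of
    length \<open>2\<close>.\<close>
  have X_cases: "(\<exists>U :: ('g, 'v, 'k) crep. D.is_rep U \<and> D.yact_trivial U \<and> x = D.rep_green U) \<or> x = ?gc 2"
    if "x \<in> X" for x
    using that unfolding X_def
  proof (elim UnE imageE singletonE)
    fix i assume i: "x = S i" "i \<in> {1..m}"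
    obtain U :: "('g, 'v, 'k) crep" where U: "D.has_group_rep (V i) U" using reps[OF i(2)] by (rule exE)
    show ?thesis
      unfolding i(1) SU[OF U] using D.has_group_rep_is_rep[OF U] D.has_group_rep_trivial[OF U] by blast
  next
    assume "x = M 1 2"
    then show ?thesis using M1[OF D.n_ge_2] by simp
  qed
  have X: "X \<subseteq> carrier r"
  proof
    fix x assume "x \<in> X"
    from X_cases[OF this] show "x \<in> carrier r"
      using gc[OF D.n_ge_2] D.rep_green_closed unfolding r by auto
  qed
  define T where "T = generate_ring r X"
  have T: "subring T r" unfolding T_def by (rule R.generate_ring_is_subring[OF X])
  have irr_T: "D.rep_green U \<in> T" if "D.is_rep U" "D.yact_trivial U" "idx U \<noteq> {}"
      "\<And>S. D.stable_subspace U S \<Longrightarrow> S = {\<lambda>_. 0} \<or> S = fsp (idx U)" for U :: "('g, nat, 'k) crep"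
  proof -
    have "\<exists>i\<in>{1..m}. D.has_group_rep (V i) U" by (rule ex[OF that(1-3)]) (rule that(4))
    then obtain i where i: "i \<in> {1..m}" "D.has_group_rep (V i) U" by (rule bexE)
    show ?thesis unfolding T_def SU[OF i(2), symmetric] by (rule generate_ring.incl) (use i(1) in \<open>simp add: X_def\<close>)
  qed
  have two_T: "?gc 2 \<in> T"
    unfolding T_def M1[OF D.n_ge_2, symmetric] by (rule generate_ring.incl) (simp add: X_def)
  have T_all: "T = carrier r"
  proof
    show "T \<subseteq> carrier r" by (rule subringE(1)[OF T])
    show "carrier r \<subseteq> T"
      unfolding r
    proof (rule D.green_ring_generated_by_reps[OF T[unfolded r]])
      fix R :: "('g, nat, 'k) crep" assume R: "D.is_rep R"
      show "D.rep_green R \<in> T"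
      proof (rule D.rep_in_subring[OF T[unfolded r] ord _ two_T R])
        fix U :: "('g, nat, 'k) crep" assume U: "D.is_rep U" "D.yact_trivial U" "idx U \<noteq> {}"
          and irr: "\<And>S. D.stable_subspace U S \<Longrightarrow> S = {\<lambda>_. 0} \<or> S = fsp (idx U)"
        show "D.rep_green U \<in> T" by (rule irr_T[OF U]) (rule irr)
      qed
    qed
  qed
  have X_comm: "x \<otimes>\<^bsub>r\<^esub> y = y \<otimes>\<^bsub>r\<^esub> x" if "x \<in> X" "y \<in> X" for x y
    using X_cases[OF that(1)] X_cases[OF that(2)] unfolding r
  proof (elim disjE exE conjE)
    fix U U' :: "('g, 'v, 'k) crep"
    assume U: "D.is_rep U" "D.yact_trivial U" and U': "D.is_rep U'" "D.yact_trivial U'"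
      and xy: "x = D.rep_green U" "y = D.rep_green U'"
    show "x \<otimes>\<^bsub>D.GR\<^esub> y = y \<otimes>\<^bsub>D.GR\<^esub> x" unfolding xy by (rule D.rep_green_commute_trivial[OF U U'])
  next
    fix U :: "('g, 'v, 'k) crep"
    assume U: "D.is_rep U" "D.yact_trivial U" and xy: "x = D.rep_green U" "y = ?gc 2"
    show "x \<otimes>\<^bsub>D.GR\<^esub> y = y \<otimes>\<^bsub>D.GR\<^esub> x" unfolding xy by (rule D.rep_green_commute_chain[OF U D.n_ge_2])
  next
    fix U :: "('g, 'v, 'k) crep"
    assume U: "D.is_rep U" "D.yact_trivial U" and xy: "y = D.rep_green U" "x = ?gc 2"
    show "x \<otimes>\<^bsub>D.GR\<^esub> y = y \<otimes>\<^bsub>D.GR\<^esub> x" unfolding xy by (rule D.rep_green_commute_chain[OF U D.n_ge_2, symmetric])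
  next
    assume xy: "x = ?gc 2" "y = ?gc 2"
    show "x \<otimes>\<^bsub>D.GR\<^esub> y = y \<otimes>\<^bsub>D.GR\<^esub> x" unfolding xy ..
  qed
  have comm: "x \<otimes>\<^bsub>r\<^esub> y = y \<otimes>\<^bsub>r\<^esub> x" if "x \<in> carrier r" "y \<in> carrier r" for x y
    by (rule R.generate_ring_commute[OF X X_comm that[folded T_all, unfolded T_def]])
  have cring: "cring r"
    by (intro cring.intro R.ring_axioms comm_monoid.intro R.monoid_axioms comm_monoid_axioms.intro comm)
  have 1: "\<forall>i\<in>{1..m}. \<forall>j\<in>{1..n}. M i j = S i \<otimes>\<^bsub>r\<^esub> M 1 j \<and> M i j = M 1 j \<otimes>\<^bsub>r\<^esub> S i"
  proof (intro ballI)
    fix i j assume i: "i \<in> {1..m}" and "j \<in> {1..n}"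
    then have j: "j \<le> n" by simp
    obtain U :: "('g, 'v, 'k) crep" where U: "D.has_group_rep (V i) U" using reps[OF i] by (rule exE)
    have Si: "S i \<in> carrier r" unfolding SU[OF U] r by (rule D.rep_green_closed[OF D.has_group_rep_is_rep[OF U]])
    show "M i j = S i \<otimes>\<^bsub>r\<^esub> M 1 j \<and> M i j = M 1 j \<otimes>\<^bsub>r\<^esub> S i"
      unfolding MU[OF U j] M1[OF j] by (intro conjI refl comm[OF Si gc[OF j]])
  qed
  have 2: "M 1 2 \<otimes>\<^bsub>r\<^esub> M 1 j = M 1 (j + 1) \<oplus>\<^bsub>r\<^esub> a \<otimes>\<^bsub>r\<^esub> M 1 (j - 1)" if "j \<in> {2..n - 1}" for j
  proof -
    have j: "0 < j" "j < n" "2 \<le> n" "j \<le> n" "j + 1 \<le> n" "j - 1 \<le> n" using that by auto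
    show ?thesis
      unfolding M1[OF j(3)] M1[OF j(4)] M1[OF j(5)] M1[OF j(6)] a_rep
      using D.rep_green_chain_product[OF j(1,2)] by (simp add: r)
  qed
  have 3: "M 1 2 \<otimes>\<^bsub>r\<^esub> M 1 n = (\<one>\<^bsub>r\<^esub> \<oplus>\<^bsub>r\<^esub> a) \<otimes>\<^bsub>r\<^esub> M 1 n"
    unfolding M1[OF D.n_ge_2] M1[OF order_refl] a_rep r by (rule D.rep_green_top_product)
  have flip: "M 1 j \<otimes>\<^bsub>r\<^esub> M 1 2 = M 1 2 \<otimes>\<^bsub>r\<^esub> M 1 j" if "j \<le> n" for j
    unfolding M1[OF that] M1[OF D.n_ge_2] by (rule comm[OF gc[OF that] gc[OF D.n_ge_2]])
  show ?thesis
  proof (intro conjI ballI 3 cring)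
    fix j assume j: "j \<in> {2..n - 1}"
    then have "j \<le> n" by auto
    from flip[OF this] 2[OF j]
    show "M 1 j \<otimes>\<^bsub>r\<^esub> M 1 2 = M 1 (j + 1) \<oplus>\<^bsub>r\<^esub> a \<otimes>\<^bsub>r\<^esub> M 1 (j - 1)" by (rule trans)
  next
    show "M 1 n \<otimes>\<^bsub>r\<^esub> M 1 2 = (\<one>\<^bsub>r\<^esub> \<oplus>\<^bsub>r\<^esub> a) \<otimes>\<^bsub>r\<^esub> M 1 n" by (rule trans[OF flip[OF order_refl] 3])
    show "generate_ring r (S ` {1..m} \<union> {M 1 2}) = carrier r" by (rule T_all[unfolded T_def X_def])
  qed (rule 1[rule_format, THEN conjunct1] 1[rule_format, THEN conjunct2] 2; assumption)+
qed

end
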